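(* Let $M^n$ be a compact smooth manifold without boundary, and let $X: M\times[0,T)\to\mathbb{R}^{n+1}$ be a smooth family of embeddings satisfying $$\frac{\partial X}{\partial t}=-F\nu,$$ where $\nu$ is the outward unit normal and the speed $F(x,t)=f(\kappa_1(x,t),\dots,\kappa_n(x,t))$ is given by a smooth, symmetric, homogeneous degree one, monotone increasing function $f$ of the principal curvatures, defined on a convex cone $\Gamma\subset\mathbb{R}^n$ containing the positive ray (the principal curvatures of the solution lying in $\Gamma$). (i) If $f$ is convex, then the exterior sphere curvature $\underline{Z}$ is a viscosity supersolution of the linearized flow $$\frac{\partial u}{\partial t}=\dot F^{kl}\nabla_k\nabla_l u+\dot F^{kl}{h_k}^{p}h_{pl}\,u .$$ (ii) If $f$ is concave, then the interior sphere curvature $\overline{Z}$ is a viscosity subsolution of the same equation.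
   Context: Orientation: $\nu(x,t)$ is the unit normal pointing out of the compact region $\Omega_t\subset\mathbb{R}^{n+1}$ with $\partial\Omega_t=X(M,t)$. The second fundamental form is $h_{ij}=-\langle \partial_i\partial_j X,\nu\rangle$ (so round spheres have positive principal curvatures). Indices are raised and lowered with the metric $g(t)$ induced by $X(\cdot,t)$, and $\nabla$ is the (time-dependent) Levi-Civita connection of $g(t)$. The principal curvatures $\kappa_1,\dots,\kappa_n$ are the eigenvalues of $h$ with respect to $g(t)$. Speed: $\Gamma$ is an open convex cone, invariant under permutations of coordinates, containing the ray $\{(s,\dots,s): s>0\}$; $f:\Gamma\to\mathbb{R}$ is smooth, symmetric, homogeneous of degree one and monotone increasing in each variable. $F$ is also viewed as the function of symmetric matrices $A$ with eigenvalues in $\Gamma$, $F(A)=f(\text{eigenvalues of }A)$, evaluated on the components of $h$ in an orthonormal frame. $\dot F^{kl}$ is the derivative of $F$ with respect to the components $h_{kl}$: $\dot F^{kl}|_A B_{kl}=\frac{d}{ds}F(A+sB)|_{s=0}$ for symmetric $B$; in the equation it is evaluated at $h$ at the point $(x,t)$. For $x\neq y$ in $M$ and $t\in[0,T)$ define $$Z(x,y,t)=\frac{2\langle X(x,t)-X(y,t),\nu(x,t)\rangle}{\|X(x,t)-X(y,t)\|^2}.$$ The interior sphere curvature is $\overline{Z}(x,t)=\sup\{Z(x,y,t): y\in M,\ y\ne x\}$ and the exterior sphere curvature is $\underline{Z}(x,t)=\inf\{Z(x,y,t): y\in M,\ y\ne x\}$. Viscosity solutions: a continuous function $v:M\times[0,T)\to\mathbb{R}$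 is a viscosity subsolution of $\frac{\partial u}{\partial t}=G(x,t,u,\nabla u,\nabla^2u)$ if for every $(x_0,t_0)\in M\times(0,T)$ and every $C^2$ function $\phi$ on $M\times[0,T)$ such that $\phi(x_0,t_0)=v(x_0,t_0)$ and $\phi\ge v$ for $x$ in a neighbourhood of $x_0$ and $t\le t_0$ sufficiently close to $t_0$, one has $\frac{\partial\phi}{\partial t}\le G(x,t,\phi,\nabla\phi,\nabla^2\phi)$ at $(x_0,t_0)$. It is a viscosity supersolution if the same holds with both inequalities for $\phi$ reversed. *)

theory Defs
  imports "HOL-Analysis.Analysis"
begin

section \<open>Differentiability of higher order\<close>

text \<open>
  The derivatives are taken within \<open>S\<close>. This is meant for sets \<open>S\<close> on which they are unique:
  open sets, and products of an open set with a half-open time interval, where the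
  time derivative at the initial time is one-sided.
\<close>

primrec Ck_on :: "nat \<Rightarrow> ('a::real_normed_vector \<Rightarrow> 'b::real_normed_vector) \<Rightarrow> 'a set \<Rightarrow> bool" where
  "Ck_on 0 f S \<longleftrightarrow> continuous_on S f"
| "Ck_on (Suc k) f S \<longleftrightarrow>
     (\<exists>f'. (\<forall>x\<in>S. (f has_derivative f' x) (at x within S)) \<and> (\<forall>v. Ck_on k (\<lambda>x. f' x v) S))"

definition smooth_on :: "('a::real_normed_vector \<Rightarrow> 'b::real_normed_vector) \<Rightarrow> 'a set \<Rightarrow> bool" where
  "smooth_on f S \<longleftrightarrow> (\<forall>k. Ck_on k f S)"

definition pd :: "'n::finite \<Rightarrow> (real^'n \<Rightarrow> 'b::real_normed_vector) \<Rightarrow> real^'n \<Rightarrow> 'b" where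
  "pd i f z = frechet_derivative f (at z) (axis i 1)"


section \<open>Smooth manifolds without boundary\<close>

type_synonym ('p, 'n) chart = "'p set \<times> ('p \<Rightarrow> real^'n)"

definition chart_inv :: "('p, 'n::finite) chart \<Rightarrow> real^'n \<Rightarrow> 'p" where
  "chart_inv C = inv_into (fst C) (snd C)"

definition smooth_atlas :: "('p::topological_space, 'n::finite) chart set \<Rightarrow> bool" where
  "smooth_atlas \<A> \<longleftrightarrow>
     (\<Union>C\<in>\<A>. fst C) = UNIV \<and>
     (\<forall>C\<in>\<A>. open (fst C) \<and> open (snd C ` fst C) \<and>
        homeomorphism (fst C) (snd C ` fst C) (snd C) (chart_inv C)) \<and>
     (\<forall>C\<in>\<A>. \<forall>D\<in>\<A>. smooth_on (snd D \<circ> chart_inv C) (snd C ` (fst C \<inter> fst D)))"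

text \<open>Regularity of a time-dependent map on \<open>M \<times> [0,T)\<close>, jointly in space and time.\<close>

definition Ck_family ::
  "nat \<Rightarrow> ('p, 'n::finite) chart set \<Rightarrow> real \<Rightarrow> ('p \<Rightarrow> real \<Rightarrow> 'b::real_normed_vector) \<Rightarrow> bool" where
  "Ck_family k \<A> T u \<longleftrightarrow>
     (\<forall>C\<in>\<A>. Ck_on k (\<lambda>(z, t). u (chart_inv C z) t) ((snd C ` fst C) \<times> {0..<T}))"

definition smooth_family ::
  "('p, 'n::finite) chart set \<Rightarrow> real \<Rightarrow> ('p \<Rightarrow> real \<Rightarrow> 'b::real_normed_vector) \<Rightarrow> bool" where
  "smooth_family \<A> T u \<longleftrightarrow> (\<forall>k. Ck_family k \<A> T u)"

definition immersion :: "('p, 'n::finite) chart set \<Rightarrow> ('p \<Rightarrow> 'b::real_normed_vector) \<Rightarrow> bool" where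
  "immersion \<A> Y \<longleftrightarrow>
     (\<forall>C\<in>\<A>. \<forall>z\<in>snd C ` fst C. inj (frechet_derivative (Y \<circ> chart_inv C) (at z)))"

definition smooth_family_of_embeddings ::
  "('p::topological_space, 'n::finite) chart set \<Rightarrow> real \<Rightarrow> ('p \<Rightarrow> real \<Rightarrow> 'b::real_normed_vector) \<Rightarrow> bool" where
  "smooth_family_of_embeddings \<A> T X \<longleftrightarrow>
     smooth_family \<A> T X \<and>
     (\<forall>t\<in>{0..<T}. immersion \<A> (\<lambda>x. X x t) \<and>
        (\<exists>Y. homeomorphism UNIV (range (\<lambda>x. X x t)) (\<lambda>x. X x t) Y))"


section \<open>Geometry of a family of hypersurfaces in local coordinates\<close>

text \<open>All tensors are given by their components at the point with coordinates \<open>z\<close> in the chart \<open>C\<close>.\<close>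

definition metric ::
  "('p \<Rightarrow> real \<Rightarrow> real^'m) \<Rightarrow> ('p, 'n::finite) chart \<Rightarrow> real \<Rightarrow> real^'n \<Rightarrow> real^'n^'n" where
  "metric X C t z =
     (let Y = (\<lambda>w. X (chart_inv C w) t) in \<chi> i j. pd i Y z \<bullet> pd j Y z)"

definition second_fundamental_form ::
  "('p \<Rightarrow> real \<Rightarrow> real^'m) \<Rightarrow> ('p \<Rightarrow> real \<Rightarrow> real^'m) \<Rightarrow>
     ('p, 'n::finite) chart \<Rightarrow> real \<Rightarrow> real^'n \<Rightarrow> real^'n^'n" where
  "second_fundamental_form X \<nu> C t z =
     (let Y = (\<lambda>w. X (chart_inv C w) t) in \<chi> i j. - (pd i (pd j Y) z \<bullet> \<nu> (chart_inv C z) t))"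

text \<open>\<open>christoffel X C t z m i j\<close> is the symbol with upper index \<open>m\<close> and lower indices \<open>i\<close>, \<open>j\<close>.\<close>

definition christoffel ::
  "('p \<Rightarrow> real \<Rightarrow> real^'m) \<Rightarrow> ('p, 'n::finite) chart \<Rightarrow> real \<Rightarrow> real^'n \<Rightarrow> 'n \<Rightarrow> 'n \<Rightarrow> 'n \<Rightarrow> real" where
  "christoffel X C t z m i j =
     (let g = metric X C t in
      1/2 * (\<Sum>l\<in>UNIV. matrix_inv (g z) $ m $ l *
        (pd i (\<lambda>w. g w $ j $ l) z + pd j (\<lambda>w. g w $ i $ l) z - pd l (\<lambda>w. g w $ i $ j) z)))"

definition gradient ::
  "('p, 'n::finite) chart \<Rightarrow> ('p \<Rightarrow> real) \<Rightarrow> real^'n \<Rightarrow> real^'n" where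
  "gradient C u z = (\<chi> i. pd i (u \<circ> chart_inv C) z)"

definition hessian ::
  "('p \<Rightarrow> real \<Rightarrow> real^'m) \<Rightarrow> ('p, 'n::finite) chart \<Rightarrow> real \<Rightarrow> ('p \<Rightarrow> real) \<Rightarrow> real^'n \<Rightarrow> real^'n^'n" where
  "hessian X C t u z =
     (let w = u \<circ> chart_inv C in
      \<chi> i j. pd i (pd j w) z - (\<Sum>m\<in>UNIV. christoffel X C t z m i j * pd m w z))"

text \<open>
  A frame at a point is given by the matrix \<open>E\<close> whose columns are the coordinates of
  the frame vectors.
\<close>

definition orthonormal_frame :: "real^'n^'n \<Rightarrow> real^'n^'n \<Rightarrow> bool" where
  "orthonormal_frame g E \<longleftrightarrow> transpose E ** g ** E = mat 1"

definition in_frame :: "real^'n^'n \<Rightarrow> real^'n^'n \<Rightarrow> real^'n^'n" where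
  "in_frame E B = transpose E ** B ** E"

text \<open>
  The regularity condition on \<open>\<Omega>\<close> excludes lower-dimensional parts and makes the
  region bounded by a given compact embedded hypersurface unique.
\<close>

definition bounds_region :: "(real^'m) set \<Rightarrow> (real^'m) set \<Rightarrow> bool" where
  "bounds_region S \<Omega> \<longleftrightarrow> compact \<Omega> \<and> closure (interior \<Omega>) = \<Omega> \<and> frontier \<Omega> = S"

definition outward_unit_normal ::
  "('p, 'n::finite) chart set \<Rightarrow> ('p \<Rightarrow> real^'m) \<Rightarrow> (real^'m) set \<Rightarrow> ('p \<Rightarrow> real^'m) \<Rightarrow> bool" where
  "outward_unit_normal \<A> Y \<Omega> N \<longleftrightarrow>
     (\<forall>x. norm (N x) = 1 \<and>
        (\<forall>C\<in>\<A>. x \<in> fst C \<longrightarrow> (\<forall>i. pd i (Y \<circ> chart_inv C) (snd C x) \<bullet> N x = 0)) \<and>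
        (\<forall>\<^sub>F s in at_right 0. Y x + s *\<^sub>R N x \<notin> \<Omega> \<and> Y x - s *\<^sub>R N x \<in> \<Omega>))"

text \<open>\<open>k\<close> lists the eigenvalues of \<open>B\<close> with respect to \<open>g\<close>, with multiplicities.\<close>

definition eigenvalues_wrt :: "real^'n^'n \<Rightarrow> real^'n^'n \<Rightarrow> real^'n \<Rightarrow> bool" where
  "eigenvalues_wrt g B k \<longleftrightarrow> (\<forall>r. det (B - r *\<^sub>R g) = det g * (\<Prod>i\<in>UNIV. (k $ i - r)))"

definition principal_curvatures ::
  "('p, 'n::finite) chart set \<Rightarrow> ('p \<Rightarrow> real \<Rightarrow> real^'m) \<Rightarrow> ('p \<Rightarrow> real \<Rightarrow> real^'m) \<Rightarrow>
     'p \<Rightarrow> real \<Rightarrow> real^'n \<Rightarrow> bool" where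
  "principal_curvatures \<A> X \<nu> x t k \<longleftrightarrow>
     (\<forall>C\<in>\<A>. x \<in> fst C \<longrightarrow>
        eigenvalues_wrt (metric X C t (snd C x)) (second_fundamental_form X \<nu> C t (snd C x)) k)"


section \<open>The speed\<close>

text \<open>
  The library's predicate \<open>cone\<close> is not used since it forces the origin to belong to the cone.
\<close>

definition symmetric_cone :: "(real^'n) set \<Rightarrow> bool" where
  "symmetric_cone \<Gamma> \<longleftrightarrow>
     open \<Gamma> \<and> convex \<Gamma> \<and>
     (\<forall>k\<in>\<Gamma>. \<forall>c>0. c *\<^sub>R k \<in> \<Gamma>) \<and>
     (\<forall>k\<in>\<Gamma>. \<forall>p. bij p \<longrightarrow> (\<chi> i. k $ p i) \<in> \<Gamma>) \<and>
     (\<forall>s>0. (\<chi> i. s) \<in> \<Gamma>)"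

definition speed_function :: "(real^'n) set \<Rightarrow> (real^'n \<Rightarrow> real) \<Rightarrow> bool" where
  "speed_function \<Gamma> f \<longleftrightarrow>
     smooth_on f \<Gamma> \<and>
     (\<forall>k\<in>\<Gamma>. \<forall>p. bij p \<longrightarrow> f (\<chi> i. k $ p i) = f k) \<and>
     (\<forall>k\<in>\<Gamma>. \<forall>c>0. f (c *\<^sub>R k) = c * f k) \<and>
     (\<forall>k\<in>\<Gamma>. \<forall>i. \<forall>s\<ge>0. k + s *\<^sub>R axis i 1 \<in> \<Gamma> \<longrightarrow> f k \<le> f (k + s *\<^sub>R axis i 1))"

text \<open>
  \<open>f\<close> as a function of symmetric matrices with eigenvalues in \<open>\<Gamma>\<close>; the choice of the
  ordering of the eigenvalues is immaterial for symmetric \<open>f\<close>.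
\<close>

definition matrix_fun :: "(real^'n \<Rightarrow> real) \<Rightarrow> real^'n^'n \<Rightarrow> real" where
  "matrix_fun f A = f (SOME k. eigenvalues_wrt (mat 1) A k)"

definition matrix_fun_deriv :: "(real^'n \<Rightarrow> real) \<Rightarrow> real^'n^'n \<Rightarrow> real^'n^'n" where
  "matrix_fun_deriv f A =
     (THE P. transpose P = P \<and>
        (\<forall>B. transpose B = B \<longrightarrow>
           ((\<lambda>s. matrix_fun f (A + s *\<^sub>R B)) has_real_derivative
              (\<Sum>k\<in>UNIV. \<Sum>l\<in>UNIV. P $ k $ l * B $ k $ l)) (at 0)))"


section \<open>Sphere curvatures\<close>

definition Z :: "('p \<Rightarrow> real \<Rightarrow> real^'m) \<Rightarrow> ('p \<Rightarrow> real \<Rightarrow> real^'m) \<Rightarrow> 'p \<Rightarrow> 'p \<Rightarrow> real \<Rightarrow> real" where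
  "Z X \<nu> x y t = 2 * ((X x t - X y t) \<bullet> \<nu> x t) / (norm (X x t - X y t))\<^sup>2"

definition interior_sphere_curvature ::
  "('p \<Rightarrow> real \<Rightarrow> real^'m) \<Rightarrow> ('p \<Rightarrow> real \<Rightarrow> real^'m) \<Rightarrow> 'p \<Rightarrow> real \<Rightarrow> real" where
  "interior_sphere_curvature X \<nu> x t = (SUP y\<in>{y. y \<noteq> x}. Z X \<nu> x y t)"

definition exterior_sphere_curvature ::
  "('p \<Rightarrow> real \<Rightarrow> real^'m) \<Rightarrow> ('p \<Rightarrow> real \<Rightarrow> real^'m) \<Rightarrow> 'p \<Rightarrow> real \<Rightarrow> real" where
  "exterior_sphere_curvature X \<nu> x t = (INF y\<in>{y. y \<noteq> x}. Z X \<nu> x y t)"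


section \<open>Viscosity solutions\<close>

text \<open>
  A second-order operator \<open>G C E x t r q H\<close> is a function of the point, the time, the value \<open>r\<close>, and
  the components \<open>q\<close> of the gradient and \<open>H\<close> of the Hessian in the \<open>g(t)\<close>-orthonormal frame \<open>E\<close>,
  itself given in the coordinates of the chart \<open>C\<close>. The differential inequalities are required in
  every chart and every orthonormal frame; for invariant operators the choice does not matter.
\<close>

type_synonym ('p, 'n) operator2 =
  "('p, 'n) chart \<Rightarrow> real^'n^'n \<Rightarrow> 'p \<Rightarrow> real \<Rightarrow> real \<Rightarrow> real^'n \<Rightarrow> real^'n^'n \<Rightarrow> real"

definition apply_operator ::
  "('p, 'n::finite) operator2 \<Rightarrow> ('p \<Rightarrow> real \<Rightarrow> real^'m) \<Rightarrow> ('p, 'n) chart \<Rightarrow> real^'n^'n \<Rightarrow>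
     ('p \<Rightarrow> real \<Rightarrow> real) \<Rightarrow> 'p \<Rightarrow> real \<Rightarrow> real" where
  "apply_operator G X C E \<phi> x t =
     G C E x t (\<phi> x t)
       (transpose E *v gradient C (\<lambda>y. \<phi> y t) (snd C x))
       (in_frame E (hessian X C t (\<lambda>y. \<phi> y t) (snd C x)))"

definition touches_from_above ::
  "real \<Rightarrow> ('p::topological_space \<Rightarrow> real \<Rightarrow> real) \<Rightarrow> ('p \<Rightarrow> real \<Rightarrow> real) \<Rightarrow> 'p \<Rightarrow> real \<Rightarrow> bool" where
  "touches_from_above T \<phi> v x\<^sub>0 t\<^sub>0 \<longleftrightarrow>
     \<phi> x\<^sub>0 t\<^sub>0 = v x\<^sub>0 t\<^sub>0 \<and>
     (\<exists>N \<delta>. open N \<and> x\<^sub>0 \<in> N \<and> \<delta> > 0 \<and>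
        (\<forall>x\<in>N. \<forall>t\<in>{0..<T}. t\<^sub>0 - \<delta> < t \<and> t \<le> t\<^sub>0 \<longrightarrow> v x t \<le> \<phi> x t))"

definition viscosity_subsolution ::
  "('p::topological_space, 'n::finite) chart set \<Rightarrow> real \<Rightarrow> ('p \<Rightarrow> real \<Rightarrow> real^'m) \<Rightarrow>
     ('p, 'n) operator2 \<Rightarrow> ('p \<Rightarrow> real \<Rightarrow> real) \<Rightarrow> bool" where
  "viscosity_subsolution \<A> T X G v \<longleftrightarrow>
     continuous_on (UNIV \<times> {0..<T}) (\<lambda>(x, t). v x t) \<and>
     (\<forall>x\<^sub>0. \<forall>t\<^sub>0\<in>{0<..<T}. \<forall>\<phi>. Ck_family 2 \<A> T \<phi> \<and> touches_from_above T \<phi> v x\<^sub>0 t\<^sub>0 \<longrightarrow>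
        (\<forall>C\<in>\<A>. \<forall>E. x\<^sub>0 \<in> fst C \<and> orthonormal_frame (metric X C t\<^sub>0 (snd C x\<^sub>0)) E \<longrightarrow>
           deriv (\<lambda>t. \<phi> x\<^sub>0 t) t\<^sub>0 \<le> apply_operator G X C E \<phi> x\<^sub>0 t\<^sub>0))"

definition viscosity_supersolution ::
  "('p::topological_space, 'n::finite) chart set \<Rightarrow> real \<Rightarrow> ('p \<Rightarrow> real \<Rightarrow> real^'m) \<Rightarrow>
     ('p, 'n) operator2 \<Rightarrow> ('p \<Rightarrow> real \<Rightarrow> real) \<Rightarrow> bool" where
  "viscosity_supersolution \<A> T X G v \<longleftrightarrow>
     continuous_on (UNIV \<times> {0..<T}) (\<lambda>(x, t). v x t) \<and>
     (\<forall>x\<^sub>0. \<forall>t\<^sub>0\<in>{0<..<T}. \<forall>\<phi>. Ck_family 2 \<A> T \<phi> \<and> touches_from_above T v \<phi> x\<^sub>0 t\<^sub>0 \<longrightarrow>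
        (\<forall>C\<in>\<A>. \<forall>E. x\<^sub>0 \<in> fst C \<and> orthonormal_frame (metric X C t\<^sub>0 (snd C x\<^sub>0)) E \<longrightarrow>
           deriv (\<lambda>t. \<phi> x\<^sub>0 t) t\<^sub>0 \<ge> apply_operator G X C E \<phi> x\<^sub>0 t\<^sub>0))"

text \<open>
  In an orthonormal frame, raising and lowering indices does not change components,
  so the mixed components of the second fundamental form are those of \<open>A\<close>.
\<close>

definition linearized_flow ::
  "('p \<Rightarrow> real \<Rightarrow> real^'m) \<Rightarrow> ('p \<Rightarrow> real \<Rightarrow> real^'m) \<Rightarrow> (real^'n \<Rightarrow> real) \<Rightarrow>
     ('p, 'n::finite) operator2" where
  "linearized_flow X \<nu> f C E x t r q H =
     (let A = in_frame E (second_fundamental_form X \<nu> C t (snd C x));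
          P = matrix_fun_deriv f A
      in (\<Sum>k\<in>UNIV. \<Sum>l\<in>UNIV. P $ k $ l * H $ k $ l) +
         (\<Sum>k\<in>UNIV. \<Sum>l\<in>UNIV. P $ k $ l * (\<Sum>p\<in>UNIV. A $ k $ p * A $ p $ l)) * r)"

end

theory Submission
  imports Defs
begin

text \<open>
  Let \<open>f\<close> be concave and let \<open>\<phi>\<close> touch the interior sphere curvature from above at \<open>(x, t)\<close>. The supremum
  defining it is either attained at some \<open>y \<noteq> x\<close> or equals the largest principal curvature at \<open>x\<close>.

  In the first case, the sphere of curvature \<open>\<phi>\<close> touching at \<open>x\<close> also touches at \<open>y\<close>, so the tangent planes at
  both points are exchanged by the reflection in the bisecting hyperplane. Since
  \<open>\<phi> |X x - X y|\<^sup>2 - 2 \<langle>X x - X y, \<nu> x\<rangle>\<close> is nonnegative for nearby points and earlier times and vanishes at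
  \<open>(x, y, t)\<close>, its time derivative there is nonpositive while its Hessian is nonnegative in the directions
  \<open>(e\<^sub>i, e\<^sub>i')\<close>, where \<open>e\<^sub>i\<close> diagonalizes the second fundamental form at \<open>x\<close> and \<open>e\<^sub>i'\<close> is its reflection.
  Summing these with the weights \<open>c\<^sub>i = \<partial>f/\<partial>\<kappa>\<^sub>i\<close> at \<open>x\<close> gives the differential inequality; the speed at \<open>y\<close>
  enters only through the bound \<open>F \<le> \<Sum>c\<^sub>i h\<^sub>i\<^sub>i\<close>, valid at every point and in every orthonormal frame
  by concavity and homogeneity. In the second case, the infinitesimal version of the same argument
  applies to \<open>\<phi> |e\<^sub>j|\<^sup>2 - h(e\<^sub>j, e\<^sub>j)\<close>.

  The statement for convex \<open>f\<close> follows by replacing \<open>\<nu>\<close> by \<open>-\<nu>\<close> and \<open>f\<close> by \<open>\<kappa> \<mapsto> -f(-\<kappa>)\<close>.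
\<close>

section \<open>Calculus of $C^k$ maps\<close>

text \<open>Three obstacles shape the proof. (1) The speed is bounded by a linear function of the
  second fundamental form only in orthonormal frames, while derivatives are taken in coordinates.
  Near the centre of normal coordinates the coordinate frame is corrected to an orthonormal one with
  an error that is cubic along coordinate lines; a second derivative test that tolerates such an
  error turns the bound, sharp at the centre, into the exact gradient and an upper bound for the
  Hessian of the speed. (2) The outward normal is given separately at each time, so its sign might
  jump as \<open>t\<close> varies. It is compared with a smooth unit normal of a chart, and a jump
  is excluded by following the side on which points of the ambient space lie; only then is \<nu>
  smooth and the sphere curvature continuous. (3) Reflected frames make the two-point Hessian
  computable: the derivatives of the chord in these directions are multiples of the chord, and what
  is left over is a square with the factor \<open>a $ i - \<phi>\<close>, nonpositive because \<phi>
  dominates every principal curvature.\<close>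

lemma Ck_on_cong:
  assumes "\<And>x. x \<in> S \<Longrightarrow> f x = g x" "Ck_on k f S"
  shows "Ck_on k g S"
proof (cases k)
  case 0
  then show ?thesis using assms continuous_on_cong[of S S f g] by auto
next
  case (Suc k')
  then obtain f' where f': "\<forall>x\<in>S. (f has_derivative f' x) (at x within S)"
      "\<forall>v. Ck_on k' (\<lambda>x. f' x v) S" using assms by auto
  have "\<forall>x\<in>S. (g has_derivative f' x) (at x within S)"
    using f'(1) assms(1) by (metis has_derivative_transform)
  then show ?thesis using f' Suc by auto
qed

lemma Ck_on_subset: "Ck_on k f S \<Longrightarrow> T \<subseteq> S \<Longrightarrow> Ck_on k f T"
proof (induction k arbitrary: f)
  case 0
  then show ?case by (auto intro: continuous_on_subset)
next
  case (Suc k)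
  then obtain f' where f': "\<forall>x\<in>S. (f has_derivative f' x) (at x within S)"
      "\<forall>v. Ck_on k (\<lambda>x. f' x v) S" by auto
  have "\<forall>x\<in>T. (f has_derivative f' x) (at x within T)"
    using f'(1) Suc.prems(2) by (meson has_derivative_subset subsetD)
  then show ?case using f'(2) Suc by auto
qed

lemma Ck_on_SucD: "Ck_on (Suc k) f S \<Longrightarrow> Ck_on k f S"
proof (induction k arbitrary: f)
  case 0
  then show ?case
    by (auto simp: continuous_on_eq_continuous_within intro: has_derivative_continuous)
next
  case (Suc k)
  then obtain f' where f': "\<forall>x\<in>S. (f has_derivative f' x) (at x within S)"
      "\<forall>v. Ck_on (Suc k) (\<lambda>x. f' x v) S" by (metis Ck_on.simps(2))
  then show ?case using Suc.IH by auto
qed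

lemma Ck_on_le: "Ck_on k f S \<Longrightarrow> j \<le> k \<Longrightarrow> Ck_on j f S"
proof (induction "k - j" arbitrary: j)
  case 0 then show ?case by simp
next
  case (Suc d)
  then have "Ck_on (Suc j) f S" by (metis Suc_diff_Suc Suc_leI diff_Suc_1 zero_less_Suc zero_less_diff)
  then show ?case by (rule Ck_on_SucD)
qed

lemma Ck_on_imp_continuous_on: "Ck_on k f S \<Longrightarrow> continuous_on S f"
  using Ck_on_le[of k f S 0] by simp

lemma Ck_on_const [simp]: "Ck_on k (\<lambda>x. c) S"
proof (induction k arbitrary: c)
  case (Suc k)
  show ?case unfolding Ck_on.simps by (rule exI[of _ "\<lambda>x v. 0"]) (use Suc in auto)
qed auto

lemma Ck_on_bounded_linear:
  assumes "bounded_linear f" shows "Ck_on k f S"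
proof (cases k)
  case 0 then show ?thesis using assms by (simp add: linear_continuous_on)
next
  case (Suc k')
  show ?thesis unfolding Suc Ck_on.simps
    by (rule exI[of _ "\<lambda>x. f"]) (use assms in \<open>auto intro: bounded_linear_imp_has_derivative\<close>)
qed

lemma Ck_on_add: "Ck_on k f S \<Longrightarrow> Ck_on k g S \<Longrightarrow> Ck_on k (\<lambda>x. f x + g x) S"
proof (induction k arbitrary: f g)
  case 0 then show ?case by (auto intro: continuous_intros)
next
  case (Suc k)
  then obtain f' g' where f': "\<forall>x\<in>S. (f has_derivative f' x) (at x within S)"
      "\<forall>v. Ck_on k (\<lambda>x. f' x v) S" "\<forall>x\<in>S. (g has_derivative g' x) (at x within S)"
      "\<forall>v. Ck_on k (\<lambda>x. g' x v) S" by auto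
  show ?case unfolding Ck_on.simps
    by (rule exI[of _ "\<lambda>x v. f' x v + g' x v"]) (use f' Suc.IH in \<open>auto intro: has_derivative_add\<close>)
qed

lemma Ck_on_bilinear:
  assumes "bounded_bilinear B"
  shows "Ck_on k f S \<Longrightarrow> Ck_on k g S \<Longrightarrow> Ck_on k (\<lambda>x. B (f x) (g x)) S"
proof (induction k arbitrary: f g)
  case 0 then show ?case using bounded_bilinear.continuous_on[OF assms] by auto
next
  case (Suc k)
  then obtain f' g' where f': "\<forall>x\<in>S. (f has_derivative f' x) (at x within S)"
      "\<forall>v. Ck_on k (\<lambda>x. f' x v) S" "\<forall>x\<in>S. (g has_derivative g' x) (at x within S)"
      "\<forall>v. Ck_on k (\<lambda>x. g' x v) S" by auto
  have "Ck_on k f S" "Ck_on k g S" using Suc.prems Ck_on_SucD by blast+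
  then show ?case unfolding Ck_on.simps
    by (intro exI[of _ "\<lambda>x v. B (f x) (g' x v) + B (f' x v) (g x)"])
       (use f' Suc.IH in \<open>auto intro!: Ck_on_add bounded_bilinear.FDERIV[OF assms]\<close>)
qed

lemmas Ck_on_mult = Ck_on_bilinear[OF bounded_bilinear_mult]
lemmas Ck_on_scaleR = Ck_on_bilinear[OF bounded_bilinear_scaleR]
lemmas Ck_on_inner = Ck_on_bilinear[OF bounded_bilinear_inner]

lemma Ck_on_uminus: "Ck_on k f S \<Longrightarrow> Ck_on k (\<lambda>x. - f x) S"
  using Ck_on_scaleR[where f="\<lambda>x. -1" and g=f and k=k and S=S] by (simp del: Ck_on.simps)

lemma Ck_on_diff: "Ck_on k f S \<Longrightarrow> Ck_on k g S \<Longrightarrow> Ck_on k (\<lambda>x. f x - g x) S"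
  using Ck_on_add[of k f S "\<lambda>x. - g x"] Ck_on_uminus[of k g S] by (simp del: Ck_on.simps)

lemma Ck_on_sum: "(\<And>i. i \<in> I \<Longrightarrow> Ck_on k (f i) S) \<Longrightarrow> Ck_on k (\<lambda>x. \<Sum>i\<in>I. f i x) S"
  by (induction I rule: infinite_finite_induct) (auto intro: Ck_on_add)

lemma Ck_on_prod:
  fixes f :: "'i \<Rightarrow> 'a::real_normed_vector \<Rightarrow> real"
  shows "(\<And>i. i \<in> I \<Longrightarrow> Ck_on k (f i) S) \<Longrightarrow> Ck_on k (\<lambda>x. \<Prod>i\<in>I. f i x) S"
  by (induction I rule: infinite_finite_induct) (auto intro: Ck_on_mult)

lemma Ck_on_compose:
  fixes f :: "'a::real_normed_vector \<Rightarrow> 'b::euclidean_space" and g :: "'b \<Rightarrow> 'c::real_normed_vector"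
  shows "Ck_on k f S \<Longrightarrow> Ck_on k g T \<Longrightarrow> f ` S \<subseteq> T \<Longrightarrow> Ck_on k (\<lambda>x. g (f x)) S"
proof (induction k arbitrary: f g)
  case 0 then show ?case by (auto intro: continuous_on_compose2)
next
  case (Suc k)
  obtain f' where f': "\<forall>x\<in>S. (f has_derivative f' x) (at x within S)"
      "\<forall>v. Ck_on k (\<lambda>x. f' x v) S" using Suc.prems(1) by auto
  obtain g' where g': "\<forall>x\<in>T. (g has_derivative g' x) (at x within T)"
      "\<forall>v. Ck_on k (\<lambda>x. g' x v) T" using Suc.prems(2) by auto
  have fk: "Ck_on k f S" using Suc.prems(1) Ck_on_SucD by blast
  have der: "((\<lambda>x. g (f x)) has_derivative (\<lambda>v. g' (f x) (f' x v))) (at x within S)" if "x \<in> S" for x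
  proof -
    have "(g has_derivative g' (f x)) (at (f x) within f ` S)"
      using g'(1) that Suc.prems(3) by (meson has_derivative_subset image_subset_iff)
    then show ?thesis using f'(1) that
      by (metis has_derivative_in_compose)
  qed
  have ck: "Ck_on k (\<lambda>x. g' (f x) (f' x v)) S" for v
  proof -
    \<comment> \<open>In \<open>g' (f x) (f' x v)\<close> the direction itself depends on
      \<open>x\<close>, whereas the induction hypothesis speaks of fixed directions; expanding in a
      basis leaves fixed directions \<open>b\<close> with coefficients of class C^k.\<close>
    have "Ck_on k (\<lambda>x. \<Sum>b\<in>Basis. (f' x v \<bullet> b) *\<^sub>R g' (f x) b) S"
      by (intro Ck_on_sum Ck_on_scaleR Ck_on_inner Ck_on_const Suc.IH f'(2)[rule_format]
          g'(2)[rule_format] Suc.prems(3) fk)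
    moreover have "(\<Sum>b\<in>Basis. (f' x v \<bullet> b) *\<^sub>R g' (f x) b) = g' (f x) (f' x v)" if "x \<in> S" for x
    proof -
      have "f x \<in> T" using that Suc.prems(3) by auto
      then have "linear (g' (f x))" using g'(1) has_derivative_linear by blast
      then have "g' (f x) (\<Sum>b\<in>Basis. (f' x v \<bullet> b) *\<^sub>R b) = (\<Sum>b\<in>Basis. (f' x v \<bullet> b) *\<^sub>R g' (f x) b)"
        by (simp add: linear_sum linear_scale)
      then show ?thesis by (simp add: euclidean_representation)
    qed
    ultimately show ?thesis by (rule Ck_on_cong[rotated])
  qed
  show ?case unfolding Ck_on.simps
    by (rule exI[of _ "\<lambda>x v. g' (f x) (f' x v)"]) (use der ck in auto)
qed

lemma Ck_on_vec:
  fixes f :: "'i::finite \<Rightarrow> 'a::real_normed_vector \<Rightarrow> real"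
  assumes "\<And>i. Ck_on k (f i) S"
  shows "Ck_on k (\<lambda>x. \<chi> i. f i x) S"
proof -
  have "Ck_on k (\<lambda>x. \<Sum>i\<in>UNIV. f i x *\<^sub>R axis i (1::real)) S"
    by (intro Ck_on_sum Ck_on_scaleR Ck_on_const assms)
  moreover have "(\<Sum>i\<in>UNIV. f i x *\<^sub>R axis i (1::real)) = (\<chi> i. f i x)" for x
    by (simp add: vec_eq_iff axis_def if_distrib cong: if_cong)
  ultimately show ?thesis by simp
qed

lemma Ck_on_pair: "Ck_on k f S \<Longrightarrow> Ck_on k g S \<Longrightarrow> Ck_on k (\<lambda>x. (f x, g x)) S"
proof (induction k arbitrary: f g)
  case 0 then show ?case by (auto intro: continuous_intros)
next
  case (Suc k)
  then obtain f' g' where f': "\<forall>x\<in>S. (f has_derivative f' x) (at x within S)"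
      "\<forall>v. Ck_on k (\<lambda>x. f' x v) S" "\<forall>x\<in>S. (g has_derivative g' x) (at x within S)"
      "\<forall>v. Ck_on k (\<lambda>x. g' x v) S" by auto
  show ?case unfolding Ck_on.simps
    by (rule exI[of _ "\<lambda>x v. (f' x v, g' x v)"]) (use f' Suc.IH in \<open>auto intro: has_derivative_Pair\<close>)
qed

text \<open>The derivative of a power is a multiple of another power, so the induction runs over all
  exponents at once. The exponent -1/2 serves to normalize a normal vector.\<close>

lemma Ck_on_powr: "Ck_on k (\<lambda>x::real. x powr a) {0<..}"
proof (induction k arbitrary: a)
  case 0 show ?case by (auto intro!: continuous_intros)
next
  case (Suc k)
  have "((\<lambda>x::real. x powr a) has_derivative (\<lambda>v. (a * x powr (a - 1)) * v)) (at x within {0<..})"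
    if "x > 0" for x
    using has_real_derivative_powr[OF that, of a]
    by (simp add: has_field_derivative_def has_derivative_at_withinI)
  moreover have "Ck_on k (\<lambda>x. (a * x powr (a - 1)) * v) {0<..}" for v
    by (intro Ck_on_mult Ck_on_const Suc.IH)
  ultimately show ?case unfolding Ck_on.simps
    by (intro exI[of _ "\<lambda>x v. (a * x powr (a - 1)) * v"]) auto
qed

section \<open>Directional derivatives and the symmetry of second derivatives\<close>

definition D :: "'a::real_normed_vector \<Rightarrow> ('a \<Rightarrow> 'b::real_normed_vector) \<Rightarrow> 'a \<Rightarrow> 'b" where
  "D v f x = frechet_derivative f (at x) v"

lemma has_derivative_D: "f differentiable (at x) \<Longrightarrow> (f has_derivative (\<lambda>v. D v f x)) (at x)"
  unfolding D_def by (simp add: frechet_derivative_works eta_contract_eq)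

lemma D_eq: "(f has_derivative f') (at x) \<Longrightarrow> D v f x = f' v"
  unfolding D_def by (metis frechet_derivative_at)

text \<open>Derivatives on an open set are unique, so the existential witness in
  \<open>Ck_on\<close> must be the total derivative and can be replaced by \<open>D\<close>.\<close>

lemma Ck_on_Suc_open:
  assumes "open S"
  shows "Ck_on (Suc k) f S \<longleftrightarrow> (\<forall>x\<in>S. f differentiable (at x)) \<and> (\<forall>v. Ck_on k (D v f) S)"
proof
  assume "Ck_on (Suc k) f S"
  then obtain f' where f': "\<forall>x\<in>S. (f has_derivative f' x) (at x within S)"
      "\<forall>v. Ck_on k (\<lambda>x. f' x v) S" by auto
  then have d: "(f has_derivative f' x) (at x)" if "x \<in> S" for x
    using assms that by (metis at_within_open)
  have "Ck_on k (D v f) S" for v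
    by (rule Ck_on_cong[of _ "\<lambda>x. f' x v"]) (use f' D_eq[OF d] in auto)
  then show "(\<forall>x\<in>S. f differentiable (at x)) \<and> (\<forall>v. Ck_on k (D v f) S)"
    using d differentiable_def by blast
next
  assume r: "(\<forall>x\<in>S. f differentiable (at x)) \<and> (\<forall>v. Ck_on k (D v f) S)"
  show "Ck_on (Suc k) f S" unfolding Ck_on.simps
    by (rule exI[of _ "\<lambda>x v. D v f x"]) (use r in \<open>auto intro: has_derivative_at_withinI has_derivative_D\<close>)
qed

lemma Ck_on_D: "open S \<Longrightarrow> Ck_on (Suc k) f S \<Longrightarrow> Ck_on k (D v f) S"
  using Ck_on_Suc_open by blast

lemma Ck_on_differentiable: "open S \<Longrightarrow> Ck_on (Suc k) f S \<Longrightarrow> x \<in> S \<Longrightarrow> f differentiable (at x)"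
  using Ck_on_Suc_open by blast

text \<open>Near \<open>x\<close> both functions have the same derivatives, if any, so the choice
  inside \<open>frechet_derivative\<close> picks the same map for both.\<close>

lemma D_cong:
  assumes "open S" "x \<in> S" "\<And>y. y \<in> S \<Longrightarrow> f y = g y"
  shows "D v f x = D v g x"
proof -
  have "(f has_derivative f') (at x) = (g has_derivative f') (at x)" for f'
    using assms by (metis has_derivative_transform_within_open)
  then show ?thesis unfolding D_def frechet_derivative_def by simp
qed

lemma D_linear: assumes "f differentiable (at x)"
  shows "D (v + w) f x = D v f x + D w f x" "D (r *\<^sub>R v) f x = r *\<^sub>R D v f x"
    "D (\<Sum>i\<in>I. h i) f x = (\<Sum>i\<in>I. D (h i) f x)" "D 0 f x = 0"
proof -
  have l: "linear (\<lambda>v. D v f x)" using has_derivative_D[OF assms] has_derivative_linear by blast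
  show "D (v + w) f x = D v f x + D w f x" "D (r *\<^sub>R v) f x = r *\<^sub>R D v f x"
    "D (\<Sum>i\<in>I. h i) f x = (\<Sum>i\<in>I. D (h i) f x)"  "D 0 f x = 0"
    using linear_add[OF l] linear_scale[OF l] linear_sum[OF l] linear_0[OF l] by auto
qed

lemma D_const [simp]: "D v (\<lambda>x. c) = (\<lambda>x. 0)"
  by (rule ext, rule D_eq, rule has_derivative_const)

lemma D_add: "f differentiable (at x) \<Longrightarrow> g differentiable (at x) \<Longrightarrow>
    D v (\<lambda>x. f x + g x) x = D v f x + D v g x"
  by (intro D_eq has_derivative_add has_derivative_D)

lemma D_diff: "f differentiable (at x) \<Longrightarrow> g differentiable (at x) \<Longrightarrow>
    D v (\<lambda>x. f x - g x) x = D v f x - D v g x"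
  by (intro D_eq has_derivative_diff has_derivative_D)

lemma D_uminus: "f differentiable (at x) \<Longrightarrow> D v (\<lambda>x. - f x) x = - D v f x"
  by (intro D_eq has_derivative_minus has_derivative_D)

lemma D_sum: "(\<And>i. i \<in> I \<Longrightarrow> f i differentiable (at x)) \<Longrightarrow>
    D v (\<lambda>x. \<Sum>i\<in>I. f i x) x = (\<Sum>i\<in>I. D v (f i) x)"
  by (rule D_eq, rule has_derivative_sum, rule has_derivative_D)

lemma D_bilinear: "bounded_bilinear B \<Longrightarrow> f differentiable (at x) \<Longrightarrow> g differentiable (at x) \<Longrightarrow>
    D v (\<lambda>x. B (f x) (g x)) x = B (f x) (D v g x) + B (D v f x) (g x)"
  by (rule D_eq, rule bounded_bilinear.FDERIV; (rule has_derivative_D)?)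

lemmas D_inner = D_bilinear[OF bounded_bilinear_inner]
lemmas D_mult = D_bilinear[OF bounded_bilinear_mult]
lemmas D_scaleR = D_bilinear[OF bounded_bilinear_scaleR]

lemma differentiable_bilinear:
  assumes "bounded_bilinear B" "f differentiable (at x)" "g differentiable (at x)"
  shows "(\<lambda>x. B (f x) (g x)) differentiable (at x)"
  using bounded_bilinear.FDERIV[OF assms(1)] assms(2,3) unfolding differentiable_def by blast

lemma D_along_line:
  assumes "f differentiable (at (x + s *\<^sub>R v))"
  shows "((\<lambda>s. f (x + s *\<^sub>R v)) has_vector_derivative D v f (x + s *\<^sub>R v)) (at s)"
proof -
  have "((\<lambda>s. x + s *\<^sub>R v) has_derivative (\<lambda>r. r *\<^sub>R v)) (at s)"
    by (auto intro!: derivative_eq_intros)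
  from diff_chain_at[OF this has_derivative_D[OF assms]]
  have "((\<lambda>s. f (x + s *\<^sub>R v)) has_derivative (\<lambda>r. D (r *\<^sub>R v) f (x + s *\<^sub>R v))) (at s)"
    by (simp add: o_def)
  then show ?thesis unfolding has_vector_derivative_def by (simp add: D_linear[OF assms])
qed

lemma D_compose_bilinear2:
  assumes B: "bounded_bilinear B" and S: "open S" "x \<in> S" and f: "Ck_on 2 f S" and g: "Ck_on 2 g S"
  shows "D v (D w (\<lambda>x. B (f x) (g x))) x =
    B (f x) (D v (D w g) x) + B (D v f x) (D w g x) + B (D w f x) (D v g x) + B (D v (D w f) x) (g x)"
proof -
  have 1: "Ck_on (Suc 0) f S" "Ck_on (Suc 0) g S" "Ck_on (Suc 0) (D w f) S" "Ck_on (Suc 0) (D w g) S"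
    using Ck_on_D[OF S(1), of "Suc 0" f w] Ck_on_D[OF S(1), of "Suc 0" g w] f g
    by (auto simp: numeral_2_eq_2 dest: Ck_on_SucD simp del: Ck_on.simps)
  note d = 1[THEN Ck_on_differentiable[OF S(1)]]
  have "D v (D w (\<lambda>x. B (f x) (g x))) x = D v (\<lambda>x. B (f x) (D w g x) + B (D w f x) (g x)) x"
    by (rule D_cong[OF S]) (use D_bilinear[OF B d(1,2)] in auto)
  also have "\<dots> = D v (\<lambda>x. B (f x) (D w g x)) x + D v (\<lambda>x. B (D w f x) (g x)) x"
    by (rule D_add; rule differentiable_bilinear[OF B]; rule d[OF S(2)])
  also have "\<dots> = B (f x) (D v (D w g) x) + B (D v f x) (D w g x) + B (D w f x) (D v g x) + B (D v (D w f) x) (g x)"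
    using d[OF S(2)] by (simp add: D_bilinear[OF B])
  finally show ?thesis .
qed

lemmas D2_inner = D_compose_bilinear2[OF bounded_bilinear_inner]
lemmas D2_mult = D_compose_bilinear2[OF bounded_bilinear_mult]
lemmas D2_scaleR = D_compose_bilinear2[OF bounded_bilinear_scaleR]

text \<open>The mean value theorem is applied twice: along \<open>v\<close> to the increment in
  direction \<open>w\<close>, then along \<open>w\<close> to \<open>D v g\<close>. The bound on
  \<open>h\<close> keeps the whole parallelogram inside the ball.\<close>

lemma second_difference:
  fixes g :: "'a::real_normed_vector \<Rightarrow> real"
  assumes S: "open S" "ball x \<delta> \<subseteq> S" and g: "Ck_on 2 g S" and h: "0 < h" "h * (norm v + norm w) < \<delta>"
  shows "\<exists>\<sigma> \<tau>. 0 < \<sigma> \<and> \<sigma> < h \<and> 0 < \<tau> \<and> \<tau> < h \<and>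
    g (x + h *\<^sub>R v + h *\<^sub>R w) - g (x + h *\<^sub>R v) - g (x + h *\<^sub>R w) + g x
      = h\<^sup>2 * D w (D v g) (x + \<sigma> *\<^sub>R v + \<tau> *\<^sub>R w)"
proof -
  have inS: "x + s *\<^sub>R v + r *\<^sub>R w \<in> S" if "0 \<le> s" "s \<le> h" "0 \<le> r" "r \<le> h" for s r
  proof -
    have "norm (s *\<^sub>R v + r *\<^sub>R w) \<le> s * norm v + r * norm w"
      using norm_triangle_ineq[of "s *\<^sub>R v" "r *\<^sub>R w"] that by simp
    also have "\<dots> \<le> h * norm v + h * norm w" using that by (intro add_mono mult_right_mono) auto
    finally have "norm (s *\<^sub>R v + r *\<^sub>R w) < \<delta>" using h by (simp add: algebra_simps)
    then have "x + (s *\<^sub>R v + r *\<^sub>R w) \<in> ball x \<delta>"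
      by (metis add_diff_cancel_left' dist_norm mem_ball norm_minus_commute)
    then show ?thesis using S(2) by (auto simp: add.assoc)
  qed
  have 1: "Ck_on (Suc 0) g S" "Ck_on (Suc 0) (D v g) S"
    using Ck_on_D[OF S(1), of "Suc 0" g v] g
    by (auto simp: numeral_2_eq_2 dest: Ck_on_SucD simp del: Ck_on.simps)
  note d = 1[THEN Ck_on_differentiable[OF S(1)]]
  have der: "((\<lambda>s. u (y + s *\<^sub>R e)) has_real_derivative D e u (y + s *\<^sub>R e)) (at s)"
    if "u differentiable (at (y + s *\<^sub>R e))" for u :: "'a \<Rightarrow> real" and y e s
    using D_along_line[OF that] by (simp add: has_real_derivative_iff_has_vector_derivative)
  define \<phi> where "\<phi> s = g (x + h *\<^sub>R w + s *\<^sub>R v) - g (x + s *\<^sub>R v)" for s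
  have "(\<phi> has_real_derivative (D v g (x + h *\<^sub>R w + s *\<^sub>R v) - D v g (x + s *\<^sub>R v))) (at s)"
    if "0 \<le> s" "s \<le> h" for s
    unfolding \<phi>_def
    by (intro DERIV_diff der d) (use inS[of s h] inS[of s 0] that h in \<open>auto simp: ac_simps\<close>)
  from MVT2[OF h(1) this] obtain \<sigma> where \<sigma>: "0 < \<sigma>" "\<sigma> < h"
    "\<phi> h - \<phi> 0 = h * (D v g (x + h *\<^sub>R w + \<sigma> *\<^sub>R v) - D v g (x + \<sigma> *\<^sub>R v))" by auto
  have "((\<lambda>r. D v g (x + \<sigma> *\<^sub>R v + r *\<^sub>R w)) has_real_derivative D w (D v g) (x + \<sigma> *\<^sub>R v + r *\<^sub>R w)) (at r)"
    if "0 \<le> r" "r \<le> h" for r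
    by (intro der d inS) (use that \<sigma> in auto)
  from MVT2[OF h(1) this] obtain \<tau> where \<tau>: "0 < \<tau>" "\<tau> < h"
    "D v g (x + \<sigma> *\<^sub>R v + h *\<^sub>R w) - D v g (x + \<sigma> *\<^sub>R v) = h * D w (D v g) (x + \<sigma> *\<^sub>R v + \<tau> *\<^sub>R w)"
    by auto
  have e: "x + h *\<^sub>R w + \<sigma> *\<^sub>R v = x + \<sigma> *\<^sub>R v + h *\<^sub>R w" by (simp add: ac_simps)
  have "\<phi> h - \<phi> 0 = h * (h * D w (D v g) (x + \<sigma> *\<^sub>R v + \<tau> *\<^sub>R w))"
    using \<sigma>(3) unfolding e \<tau>(3) .
  then have "g (x + h *\<^sub>R v + h *\<^sub>R w) - g (x + h *\<^sub>R v) - g (x + h *\<^sub>R w) + g x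
      = h\<^sup>2 * D w (D v g) (x + \<sigma> *\<^sub>R v + \<tau> *\<^sub>R w)"
    unfolding \<phi>_def by (simp add: power2_eq_square algebra_simps)
  with \<sigma> \<tau> show ?thesis by blast
qed

text \<open>The second difference is symmetric in \<open>v\<close> and \<open>w\<close>, so the two
  mixed derivatives take a common value at points arbitrarily close to \<open>x\<close>. If they
  differed at \<open>x\<close>, continuity would keep them apart nearby.\<close>

lemma D_commute_real:
  fixes g :: "'a::real_normed_vector \<Rightarrow> real"
  assumes S: "open S" "x \<in> S" and g: "Ck_on 2 g S"
  shows "D v (D w g) x = D w (D v g) x"
proof (rule ccontr)
  assume ne: "D v (D w g) x \<noteq> D w (D v g) x"
  define \<epsilon> where "\<epsilon> = \<bar>D v (D w g) x - D w (D v g) x\<bar> / 2"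
  have "\<epsilon> > 0" using ne by (simp add: \<epsilon>_def)
  have c: "continuous_on S (D v (D w g))" "continuous_on S (D w (D v g))"
    using Ck_on_D[OF S(1) Ck_on_D[OF S(1)], of 0] g by (auto simp: numeral_2_eq_2 simp del: Ck_on.simps(2))
  obtain \<delta>0 where \<delta>0: "\<delta>0 > 0" "ball x \<delta>0 \<subseteq> S" using S open_contains_ball by blast
  obtain \<delta>1 where \<delta>1: "\<delta>1 > 0" "\<And>y. y \<in> S \<Longrightarrow> dist y x < \<delta>1 \<Longrightarrow> dist (D v (D w g) y) (D v (D w g) x) < \<epsilon>"
    using c(1) S(2) \<open>\<epsilon> > 0\<close> unfolding continuous_on_iff by metis
  obtain \<delta>2 where \<delta>2: "\<delta>2 > 0" "\<And>y. y \<in> S \<Longrightarrow> dist y x < \<delta>2 \<Longrightarrow> dist (D w (D v g) y) (D w (D v g) x) < \<epsilon>"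
    using c(2) S(2) \<open>\<epsilon> > 0\<close> unfolding continuous_on_iff by metis
  define \<delta> where "\<delta> = min \<delta>0 (min \<delta>1 \<delta>2)"
  have \<delta>: "\<delta> > 0" "\<delta> \<le> \<delta>0" "\<delta> \<le> \<delta>1" "\<delta> \<le> \<delta>2" using \<delta>0 \<delta>1 \<delta>2 by (auto simp: \<delta>_def)
  \<comment> \<open>With this choice \<open>h * (norm v + norm w)\<close> is at most \<delta> / 2;
    the summand 1 covers \<open>v = w = 0\<close>.\<close>
  define h where "h = \<delta> / (2 * (norm v + norm w + 1))"
  have nn: "norm v + norm w + 1 > 0" by (simp add: add_nonneg_pos)
  have h: "h > 0" "h * (norm v + norm w) < \<delta>"
  proof -
    show "h > 0" using \<delta> nn by (simp add: h_def)
    have "h * (norm v + norm w) \<le> h * (norm v + norm w + 1)" using \<open>h > 0\<close> by simp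
    also have "\<dots> = \<delta> / 2" using nn unfolding h_def by (simp add: field_simps)
    finally show "h * (norm v + norm w) < \<delta>" using \<delta>(1) by linarith
  qed
  have near: "dist (x + s *\<^sub>R v + r *\<^sub>R w) x < \<delta>" if "0 < s" "s < h" "0 < r" "r < h" for s r
  proof -
    have "norm (s *\<^sub>R v + r *\<^sub>R w) \<le> s * norm v + r * norm w"
      using norm_triangle_ineq[of "s *\<^sub>R v" "r *\<^sub>R w"] that by simp
    also have "\<dots> \<le> h * norm v + h * norm w" using that by (intro add_mono mult_right_mono) auto
    finally show ?thesis using h by (simp add: dist_norm algebra_simps)
  qed
  have \<delta>S: "ball x \<delta> \<subseteq> S" using \<delta>0 \<delta> by (meson subset_ball subset_trans)
  obtain s r where 1: "0 < s" "s < h" "0 < r" "r < h"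
    "g (x + h *\<^sub>R v + h *\<^sub>R w) - g (x + h *\<^sub>R v) - g (x + h *\<^sub>R w) + g x
      = h\<^sup>2 * D w (D v g) (x + s *\<^sub>R v + r *\<^sub>R w)"
    using second_difference[OF S(1) \<delta>S g h] by blast
  have h': "h * (norm w + norm v) < \<delta>" using h by (simp add: add.commute)
  obtain r' s' where 2: "0 < s'" "s' < h" "0 < r'" "r' < h"
    "g (x + h *\<^sub>R w + h *\<^sub>R v) - g (x + h *\<^sub>R w) - g (x + h *\<^sub>R v) + g x
      = h\<^sup>2 * D v (D w g) (x + r' *\<^sub>R w + s' *\<^sub>R v)"
    using second_difference[OF S(1) \<delta>S g h(1) h'] by blast
  have e: "x + h *\<^sub>R w + h *\<^sub>R v = x + h *\<^sub>R v + h *\<^sub>R w" "x + r' *\<^sub>R w + s' *\<^sub>R v = x + s' *\<^sub>R v + r' *\<^sub>R w"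
    by (simp_all add: ac_simps)
  have "h\<^sup>2 * D v (D w g) (x + s' *\<^sub>R v + r' *\<^sub>R w) = h\<^sup>2 * D w (D v g) (x + s *\<^sub>R v + r *\<^sub>R w)"
    using 1(5) 2(5) unfolding e by linarith
  then have eq: "D v (D w g) (x + s' *\<^sub>R v + r' *\<^sub>R w) = D w (D v g) (x + s *\<^sub>R v + r *\<^sub>R w)"
    using h(1) by simp
  have "dist (D v (D w g) (x + s' *\<^sub>R v + r' *\<^sub>R w)) (D v (D w g) x) < \<epsilon>"
    using near[OF 2(1-4)] \<delta> \<delta>S by (intro \<delta>1) (auto simp: dist_commute subset_iff)
  moreover have "dist (D w (D v g) (x + s *\<^sub>R v + r *\<^sub>R w)) (D w (D v g) x) < \<epsilon>"
    using near[OF 1(1-4)] \<delta> \<delta>S by (intro \<delta>2) (auto simp: dist_commute subset_iff)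
  ultimately have "\<bar>D v (D w g) x - D w (D v g) x\<bar> < 2 * \<epsilon>" unfolding eq dist_real_def by linarith
  then show False by (simp add: \<epsilon>_def)
qed

lemma D_commute:
  fixes f :: "'a::real_normed_vector \<Rightarrow> 'b::real_inner"
  assumes S: "open S" "x \<in> S" and f: "Ck_on 2 f S"
  shows "D v (D w f) x = D w (D v f) x"
proof -
  have "D v (D w f) x \<bullet> c = D w (D v f) x \<bullet> c" for c
  proof -
    have "Ck_on 2 (\<lambda>x. f x \<bullet> c) S" by (intro Ck_on_inner f Ck_on_const)
    from D_commute_real[OF S this, of v w] show ?thesis
      by (simp add: D2_inner[OF S f Ck_on_const] D_inner)
  qed
  then show ?thesis by (metis inner_commute vector_eq_ldot)
qed

text \<open>Only the space variable is differentiated, so that this also makes sense at the initial time.\<close>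

definition sd :: "'a::real_normed_vector \<Rightarrow> ('a \<times> real \<Rightarrow> 'b::real_normed_vector) \<Rightarrow> 'a \<times> real \<Rightarrow> 'b" where
  "sd v f p = D v (\<lambda>w. f (w, snd p)) (fst p)"

lemma sd_aux:
  assumes "open U" "z \<in> U" "t \<in> I" "(f has_derivative f') (at (z, t) within U \<times> I)"
  shows "((\<lambda>w. f (w, t)) has_derivative (\<lambda>v. f' (v, 0))) (at z)"
proof -
  have "((\<lambda>w. (w, t)) has_derivative (\<lambda>v. (v, 0))) (at z within U)"
    by (auto intro!: derivative_eq_intros)
  moreover have "(f has_derivative f') (at (z, t) within (\<lambda>w. (w, t)) ` U)"
    by (rule has_derivative_subset[OF assms(4)]) (use assms in auto)
  ultimately have "((\<lambda>w. f (w, t)) has_derivative (\<lambda>v. f' (v, 0))) (at z within U)"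
    by (rule has_derivative_in_compose[where f="\<lambda>w. (w, t)" and g=f and s=U and f'="\<lambda>v. (v, 0)" and g'=f'])
  then show ?thesis using at_within_open[OF assms(2,1)] by (simp only:)
qed

lemma sd_has_derivative:
  assumes "open U" "Ck_on (Suc k) f (U \<times> I)" "z \<in> U" "t \<in> I"
  shows "((\<lambda>w. f (w, t)) has_derivative (\<lambda>v. sd v f (z, t))) (at z)"
proof -
  obtain f' where "\<forall>x\<in>U \<times> I. (f has_derivative f' x) (at x within U \<times> I)" using assms(2) by auto
  then have "(f has_derivative f' (z, t)) (at (z, t) within U \<times> I)" using assms(3,4) by blast
  note d = sd_aux[OF assms(1,3,4) this]
  show ?thesis using d D_eq[OF d] by (simp add: sd_def)
qed

text \<open>The spatial derivative is the value at \<open>(v, 0)\<close> of the derivative within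
  \<open>U \<times> I\<close>, and this value is one of the functions that \<open>Ck_on\<close>
  controls. The argument includes the initial time, where the time derivative is one-sided.\<close>

lemma Ck_on_sd:
  assumes "open U" "Ck_on (Suc k) f (U \<times> I)"
  shows "Ck_on k (sd v f) (U \<times> I)"
proof -
  obtain f' where f': "\<forall>x\<in>U \<times> I. (f has_derivative f' x) (at x within U \<times> I)"
      "\<forall>v. Ck_on k (\<lambda>x. f' x v) (U \<times> I)" using assms by auto
  show ?thesis
  proof (rule Ck_on_cong[of _ "\<lambda>x. f' x (v, 0)"])
    fix x assume "x \<in> U \<times> I"
    then show "f' x (v, 0) = sd v f x"
      using D_eq[OF sd_aux[OF assms(1) _ _ f'(1)[rule_format]]] by (auto simp: sd_def)
  qed (use f' in auto)
qed

lemma sd_eq_D: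
  assumes "f differentiable (at (z, t))"
  shows "sd v f (z, t) = D (v, 0) f (z, t)"
proof -
  have "((\<lambda>w. (w, t)) has_derivative (\<lambda>v. (v, 0))) (at z)"
    by (auto intro!: derivative_eq_intros)
  from diff_chain_at[OF this has_derivative_D[OF assms]]
  show ?thesis unfolding sd_def by (intro D_eq) (simp add: o_def)
qed

section \<open>Symmetric matrices\<close>

text \<open>This single fact is the source of the distributive laws, the norm estimates and the
  limit rules for matrix products.\<close>

lemma bounded_bilinear_matrix_mult:
  "bounded_bilinear ((**) :: real^'n^'m \<Rightarrow> real^'p^'n \<Rightarrow> real^'p^'m)"
proof -
  have "bilinear ((**) :: real^'n^'m \<Rightarrow> real^'p^'n \<Rightarrow> real^'p^'m)"
    unfolding bilinear_def
    by (auto intro!: linearI simp: matrix_add_ldistrib vec_eq_iff matrix_matrix_mult_def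
        sum.distrib algebra_simps sum_distrib_left)
  then show ?thesis by (simp add: bilinear_conv_bounded_bilinear)
qed

lemmas matrix_mult_diff_left = bounded_bilinear.diff_left[OF bounded_bilinear_matrix_mult]
  and matrix_mult_diff_right = bounded_bilinear.diff_right[OF bounded_bilinear_matrix_mult]
  and matrix_mult_add_left = bounded_bilinear.add_left[OF bounded_bilinear_matrix_mult]
  and matrix_mult_add_right = bounded_bilinear.add_right[OF bounded_bilinear_matrix_mult]
  and matrix_mult_scaleR_left = bounded_bilinear.scaleR_left[OF bounded_bilinear_matrix_mult]
  and matrix_mult_scaleR_right = bounded_bilinear.scaleR_right[OF bounded_bilinear_matrix_mult]
  and matrix_mult_uminus_left = bounded_bilinear.minus_left[OF bounded_bilinear_matrix_mult]
  and matrix_mult_uminus_right = bounded_bilinear.minus_right[OF bounded_bilinear_matrix_mult]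

lemma transpose_add: "transpose (A + B) = transpose A + transpose (B::'a::plus^'n^'m)"
  by (simp add: transpose_def vec_eq_iff)

lemma transpose_diff: "transpose (A - B) = transpose A - transpose (B::'a::minus^'n^'m)"
  by (simp add: transpose_def vec_eq_iff)

lemma transpose_uminus: "transpose (- A) = - transpose (A::'a::uminus^'n^'m)"
  by (simp add: transpose_def vec_eq_iff)

lemma linear_coeff_zero:
  fixes b c :: real
  assumes "\<And>s. 0 \<le> s * b + s\<^sup>2 * c"
  shows "b = 0"
proof (rule ccontr)
  assume "b \<noteq> 0"
  \<comment> \<open>The positive number \<open>m\<close> dominates \<open>c\<close>, and the
    \<open>s\<close> chosen next minimizes \<open>s * b + s\<^sup>2 * m\<close>; the minimum is
    negative unless \<open>b = 0\<close>.\<close>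
  define m where "m = \<bar>c\<bar> + 1"
  have m: "m > 0" "c \<le> m" by (auto simp: m_def)
  define s where "s = - b / (2 * m)"
  have "s * b + s\<^sup>2 * c \<le> s * b + s\<^sup>2 * m" using m by (intro add_left_mono mult_left_mono) auto
  also have "\<dots> = - b\<^sup>2 / (4 * m)"
    using m unfolding s_def by (simp add: power2_eq_square field_simps)
  also have "\<dots> < 0" using \<open>b \<noteq> 0\<close> m by (simp add: divide_neg_pos)
  finally show False using assms[of s] by linarith
qed

text \<open>Along the line \<open>x + s *\<^sub>R y\<close> the form is a nonnegative quadratic
  polynomial in \<open>s\<close> without constant term, so its linear coefficient vanishes.\<close>

lemma psd_kernel:
  fixes A :: "real^'n^'n"
  assumes sym: "transpose A = A" and V: "subspace V" "x \<in> V" "y \<in> V"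
    and psd: "\<And>v. v \<in> V \<Longrightarrow> 0 \<le> v \<bullet> (A *v v)" and "x \<bullet> (A *v x) = 0"
  shows "(A *v x) \<bullet> y = 0"
proof -
  have s: "y \<bullet> (A *v x) = x \<bullet> (A *v y)" by (metis dot_lmul_matrix inner_commute sym vector_transpose_matrix)
  have "0 \<le> s * (2 * (x \<bullet> (A *v y))) + s\<^sup>2 * (y \<bullet> (A *v y))" for s
  proof -
    have "x + s *\<^sub>R y \<in> V" using V by (simp add: subspace_add subspace_scale)
    from psd[OF this] have "0 \<le> (x + s *\<^sub>R y) \<bullet> (A *v x + s *\<^sub>R (A *v y))"
      by (simp add: matrix_vector_right_distrib scaleR_matrix_vector_assoc matrix_scaleR_vector_ac)
    then show ?thesis using assms(6) s by (simp add: inner_add inner_simps power2_eq_square algebra_simps)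
  qed
  from linear_coeff_zero[OF this] show ?thesis using s by (simp add: inner_commute)
qed

text \<open>Let \<open>x\<close> maximize the Rayleigh quotient on the unit sphere of
  \<open>V\<close>, with value \<open>l\<close>. Then \<open>l I - A\<close> is nonnegative on
  \<open>V\<close> and vanishes at \<open>x\<close>, hence sends \<open>x\<close> to a vector
  orthogonal to \<open>V\<close>; by invariance this vector lies in \<open>V\<close>, so it is
  zero.\<close>

lemma symmetric_eigenvector:
  fixes A :: "real^'n^'n"
  assumes sym: "transpose A = A" and V: "subspace V" "V \<noteq> {0}" and inv: "\<And>v. v \<in> V \<Longrightarrow> A *v v \<in> V"
  shows "\<exists>x l. x \<in> V \<and> norm x = 1 \<and> A *v x = l *\<^sub>R x"
proof -
  let ?S = "sphere 0 1 \<inter> V"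
  have "compact ?S" using closed_subspace[OF V(1)] by (simp add: compact_Int_closed)
  moreover obtain v where v: "v \<in> V" "v \<noteq> 0" using V subspace_0 by blast
  then have "(1 / norm v) *\<^sub>R v \<in> ?S" using V(1) by (simp add: subspace_scale)
  then have "?S \<noteq> {}" by blast
  moreover have "continuous_on ?S (\<lambda>v. v \<bullet> (A *v v))"
    by (intro continuous_intros linear_continuous_on_compose[OF _ matrix_vector_mul_linear])
  ultimately obtain x where x: "x \<in> ?S" "\<And>y. y \<in> ?S \<Longrightarrow> y \<bullet> (A *v y) \<le> x \<bullet> (A *v x)"
    using continuous_attains_sup[of ?S "\<lambda>v. v \<bullet> (A *v v)"] by blast
  define l where "l = x \<bullet> (A *v x)"
  define B where "B = l *\<^sub>R mat 1 - A"
  have Bv: "B *v v = l *\<^sub>R v - A *v v" for v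
    unfolding B_def by (simp add: matrix_vector_mult_diff_rdistrib flip: scaleR_matrix_vector_assoc)
  have psd: "0 \<le> v \<bullet> (B *v v)" if "v \<in> V" for v
  proof (cases "v = 0")
    case False
    define u where "u = (1 / norm v) *\<^sub>R v"
    have "u \<in> ?S" using that V(1) False by (simp add: u_def subspace_scale)
    then have "u \<bullet> (A *v u) \<le> l" using x(2) l_def by simp
    moreover have "v \<bullet> (A *v v) = (norm v)\<^sup>2 * (u \<bullet> (A *v u))"
      using False unfolding u_def by (simp add: matrix_scaleR_vector_ac power2_eq_square flip: scaleR_matrix_vector_assoc)
    ultimately have "v \<bullet> (A *v v) \<le> (norm v)\<^sup>2 * l" by (simp add: mult_left_mono)
    then show ?thesis unfolding Bv by (simp add: inner_diff_right power2_norm_eq_inner mult.commute)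
  qed simp
  have x1: "x \<in> V" "norm x = 1" using x(1) by auto
  have "x \<bullet> x = 1" using x1(2) by (simp add: norm_eq_1)
  then have "x \<bullet> (B *v x) = 0"
    unfolding Bv by (simp add: inner_diff_right l_def)
  moreover have "transpose B = B" unfolding B_def by (simp add: transpose_diff transpose_scalar sym)
  moreover have "B *v x \<in> V" unfolding Bv using x1 V inv by (simp add: subspace_diff subspace_scale)
  ultimately have "(B *v x) \<bullet> (B *v x) = 0" using psd_kernel[of B V x] psd V x1 by blast
  then have "A *v x = l *\<^sub>R x" by (simp add: Bv)
  then show ?thesis using x1 by blast
qed

text \<open>Induction on the dimension: split off one eigenvector. Its orthogonal complement in
  \<open>V\<close> is again invariant, because \<open>A\<close> is symmetric.\<close>

lemma symmetric_eigenbasis: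
  fixes A :: "real^'n^'n"
  assumes sym: "transpose A = A"
  shows "subspace V \<Longrightarrow> (\<And>v. v \<in> V \<Longrightarrow> A *v v \<in> V) \<Longrightarrow>
    \<exists>B. finite B \<and> card B = dim V \<and> B \<subseteq> V \<and> pairwise orthogonal B \<and>
      (\<forall>x\<in>B. norm x = 1 \<and> (\<exists>l. A *v x = l *\<^sub>R x))"
proof (induction "dim V" arbitrary: V rule: less_induct)
  case less
  show ?case
  proof (cases "V = {0}")
    case True
    then show ?thesis by (intro exI[of _ "{}"]) auto
  next
    case False
    obtain x l where x: "x \<in> V" "norm x = 1" "A *v x = l *\<^sub>R x"
      using symmetric_eigenvector[OF sym less(2) False less(3)] by blast
    define W where "W = {y \<in> V. orthogonal x y}"
    have "W = V \<inter> {y. orthogonal x y}" by (auto simp: W_def)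
    then have W: "subspace W" using subspace_inter[OF less(2) subspace_orthogonal_to_vector[of x]] by simp
    have "x \<notin> W" using x by (auto simp: W_def orthogonal_def)
    have inv: "A *v w \<in> W" if "w \<in> W" for w
    proof -
      have "x \<bullet> (A *v w) = (A *v x) \<bullet> w" by (metis dot_lmul_matrix inner_commute sym vector_transpose_matrix)
      then show ?thesis using that less(3) x by (auto simp: W_def orthogonal_def)
    qed
    have "W \<subset> V" using x \<open>x \<notin> W\<close> by (auto simp: W_def)
    have Vs: "V \<subseteq> span (insert x W)"
    proof
      fix v assume v: "v \<in> V"
      have "v - (x \<bullet> v) *\<^sub>R x \<in> W"
        using v x less(2) by (auto simp: W_def orthogonal_def inner_diff_right subspace_diff subspace_scale norm_eq_1)
      then have "v - (x \<bullet> v) *\<^sub>R x + (x \<bullet> v) *\<^sub>R x \<in> span (insert x W)"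
        by (intro span_add span_scale) (auto intro: span_base)
      then show "v \<in> span (insert x W)" by simp
    qed
    have "dim V = Suc (dim W)"
    proof -
      have "dim V = dim (insert x W)"
      proof (rule antisym)
        show "dim V \<le> dim (insert x W)" using Vs dim_subset dim_span by metis
        show "dim (insert x W) \<le> dim V" using \<open>W \<subset> V\<close> x by (intro dim_subset) auto
      qed
      also have "\<dots> = Suc (dim W)" using \<open>x \<notin> W\<close> W by (simp add: dim_insert span_eq_iff[THEN iffD2])
      finally show ?thesis .
    qed
    then obtain B where B: "finite B" "card B = dim W" "B \<subseteq> W" "pairwise orthogonal B"
      "\<forall>x\<in>B. norm x = 1 \<and> (\<exists>l. A *v x = l *\<^sub>R x)"
      using less(1)[OF _ W inv] by auto
    have "pairwise orthogonal (insert x B)"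
      using B(3,4) by (auto simp: pairwise_insert W_def orthogonal_commute)
    moreover have "x \<notin> B" using B(3) \<open>x \<notin> W\<close> by blast
    ultimately show ?thesis using B x \<open>dim V = Suc (dim W)\<close> \<open>W \<subset> V\<close>
      by (intro exI[of _ "insert x B"]) auto
  qed
qed

definition diagm :: "real^'n \<Rightarrow> real^'n^'n" where
  "diagm a = (\<chi> i j. if i = j then a $ i else 0)"

lemma transpose_diagm [simp]: "transpose (diagm a) = diagm a"
  by (auto simp: transpose_def diagm_def vec_eq_iff)

lemma diagm_entry: "diagm a $ i $ j = (if i = j then a $ i else 0)"
  by (simp add: diagm_def)

lemma conj_diagm_entry:
  "(U ** diagm a ** transpose U) $ i $ j = (\<Sum>k\<in>UNIV. a $ k * U $ i $ k * U $ j $ k)"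
  by (auto simp: matrix_matrix_mult_def diagm_entry transpose_def if_distrib cong: if_cong intro!: sum.cong)

lemma symmetric_diagonalization:
  fixes A :: "real^'n^'n"
  assumes sym: "transpose A = A"
  obtains U a where "orthogonal_matrix U" "A = U ** diagm a ** transpose U"
proof -
  obtain B where B: "finite B" "card B = dim (UNIV :: (real^'n) set)" "pairwise orthogonal B"
    "\<forall>x\<in>B. norm x = 1 \<and> (\<exists>l. A *v x = l *\<^sub>R x)"
    using symmetric_eigenbasis[OF sym, of UNIV] by auto
  have "card B = card (UNIV :: 'n set)" using B(2) by simp
  then obtain b where b: "bij_betw b (UNIV :: 'n set) B"
    using B(1) by (metis finite_class.finite_UNIV finite_same_card_bij)
  have "\<forall>i. \<exists>l. A *v b i = l *\<^sub>R b i" using b B(4) bij_betwE by blast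
  then obtain a where a: "\<And>i. A *v b i = a i *\<^sub>R b i" by metis
  define U :: "real^'n^'n" where "U = (\<chi> i j. b j $ i)"
  have col: "column j U = b j" for j by (simp add: column_def U_def vec_eq_iff)
  have bb: "b i \<bullet> b j = (if i = j then 1 else 0)" for i j
  proof (cases "i = j")
    case False
    then have "b i \<noteq> b j" using b by (metis UNIV_I bij_betw_def inj_on_def)
    then show ?thesis using False B(3) b by (simp add: pairwise_def orthogonal_def bij_betwE)
  qed (use B(4) b in \<open>simp add: bij_betwE norm_eq_1\<close>)
  have U: "orthogonal_matrix U"
    by (simp add: orthogonal_matrix matrix_mult_transpose_dot_column col bb vec_eq_iff mat_def)
  have "A ** U = U ** diagm (\<chi> i. a i)"
  proof -
    have "(A ** U) $ i $ j = (A *v b j) $ i" for i j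
      by (simp add: matrix_matrix_mult_def matrix_vector_mult_def U_def)
    then show ?thesis
      by (simp add: vec_eq_iff a matrix_matrix_mult_def diagm_entry U_def if_distrib cong: if_cong)
  qed
  then have "A ** (U ** transpose U) = U ** diagm (\<chi> i. a i) ** transpose U"
    by (simp add: matrix_mul_assoc)
  moreover have "U ** transpose U = mat 1" using U by (simp add: orthogonal_matrix_def)
  ultimately show ?thesis using U that by simp
qed

lemma eigenvalues_wrt_conj_diagm:
  fixes U :: "real^'n^'n"
  assumes "orthogonal_matrix U"
  shows "eigenvalues_wrt (mat 1) (U ** diagm a ** transpose U) a"
proof -
  have U: "U ** transpose U = mat 1" using assms by (simp add: orthogonal_matrix_def)
  show ?thesis unfolding eigenvalues_wrt_def
  proof
    fix r :: real
    have "U ** diagm a ** transpose U - r *\<^sub>R mat 1 = U ** (diagm a - r *\<^sub>R mat 1) ** transpose U"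
      by (simp add: matrix_mult_diff_left matrix_mult_diff_right matrix_mult_scaleR_left matrix_mult_scaleR_right U)
    then have "det (U ** diagm a ** transpose U - r *\<^sub>R mat 1) = det (U ** transpose U) * det (diagm a - r *\<^sub>R mat 1)"
      by (simp add: det_mul)
    also have "\<dots> = det (diagm a - r *\<^sub>R mat 1)" by (simp add: U)
    also have "\<dots> = (\<Prod>i\<in>UNIV. a $ i - r)"
      by (subst det_diagonal) (auto simp: diagm_entry mat_def)
    finally show "det (U ** diagm a ** transpose U - r *\<^sub>R mat 1) = det (mat 1 :: real^'n^'n) * (\<Prod>i\<in>UNIV. a $ i - r)" by simp
  qed
qed

text \<open>Both lists are the roots, with multiplicity, of the same monic polynomial, so they form
  the same multiset; two enumerations of one multiset differ by a permutation of the
  indices.\<close>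

lemma eigenvalues_wrt_unique:
  fixes k k' :: "real^'n"
  assumes "eigenvalues_wrt g B k" "eigenvalues_wrt g B k'" "det g \<noteq> 0"
  obtains p where "bij p" "k' = (\<chi> i. k $ p i)"
proof -
  define P where "P k = (\<Prod>i\<in>UNIV. [:- (k $ i), 1:])" for k :: "real^'n"
  have "(\<Prod>i\<in>UNIV. k $ i - r) = (\<Prod>i\<in>UNIV. k' $ i - r)" for r
    using assms unfolding eigenvalues_wrt_def by (metis mult_cancel_left)
  then have "(-1)^CARD('n) * (\<Prod>i\<in>UNIV. k $ i - r) = (-1)^CARD('n) * (\<Prod>i\<in>UNIV. k' $ i - r)" for r by simp
  moreover have "poly (P k) r = (-1)^CARD('n) * (\<Prod>i\<in>UNIV. k $ i - r)" for k r
    unfolding P_def poly_prod by (simp flip: prod_constant prod.distrib)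
  ultimately have "poly (P k) r = poly (P k') r" for r by simp
  then have "P k = P k'" by (simp add: poly_eq_poly_eq_iff ext flip: poly_eq_poly_eq_iff)
  moreover have "proots (P k) = image_mset (($) k) (mset_set UNIV)" for k
    unfolding P_def by (subst proots_prod) (auto simp: sum_unfold_sum_mset)
  ultimately have "image_mset (($) k') (mset_set UNIV) = image_mset (($) k) (mset_set UNIV)" by metis
  from image_mset_eq_implies_permutes[OF _ this] obtain p where "p permutes UNIV" "\<forall>x. k' $ x = k $ p x" by auto
  then show ?thesis using that[of p] by (simp add: vec_eq_iff permutes_bij)
qed

text \<open>
  Move all mass of row \<open>i\<close> and column \<open>j\<close> to the entry \<open>(i, j)\<close>,
  where \<open>c i\<close> is maximal and \<open>b j\<close> minimal, redistributing the rest proportionally; this decreases the sum.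
\<close>

lemma doubly_stochastic_rearrangement:
  fixes c :: "'a \<Rightarrow> real" and b :: "'b \<Rightarrow> real"
  assumes "finite I" "finite J" "card I = card J"
    and "\<And>i j. i \<in> I \<Longrightarrow> j \<in> J \<Longrightarrow> 0 \<le> S i j"
    and "\<And>i. i \<in> I \<Longrightarrow> (\<Sum>j\<in>J. S i j) = 1" and "\<And>j. j \<in> J \<Longrightarrow> (\<Sum>i\<in>I. S i j) = 1"
  shows "\<exists>\<pi>. bij_betw \<pi> I J \<and> (\<Sum>i\<in>I. c i * b (\<pi> i)) \<le> (\<Sum>i\<in>I. \<Sum>j\<in>J. c i * S i j * b j)"
  using assms
proof (induction "card I" arbitrary: I J S)
  case 0
  then show ?case by (auto simp: bij_betw_def)
next
  case (Suc n)
  note fin = \<open>finite I\<close> \<open>finite J\<close>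
  have ne: "I \<noteq> {}" "J \<noteq> {}" using Suc.hyps(2) Suc.prems by auto
  obtain i where i: "i \<in> I" "\<And>k. k \<in> I \<Longrightarrow> c k \<le> c i"
    using ne fin Max_in[of "c ` I"] Max_ge[of "c ` I"] by fastforce
  obtain j where j: "j \<in> J" "\<And>k. k \<in> J \<Longrightarrow> b j \<le> b k"
    using ne fin Min_in[of "b ` J"] Min_le[of "b ` J"] by fastforce
  define I' J' s where "I' = I - {i}" and "J' = J - {j}" and "s = S i j"
  have fin': "finite I'" "finite J'" using fin by (auto simp: I'_def J'_def)
  have sumI: "(\<Sum>k\<in>I. u k) = u i + (\<Sum>k\<in>I'. u k)" for u :: "'a \<Rightarrow> real"
    unfolding I'_def using fin i by (simp add: sum.remove)
  have sumJ: "(\<Sum>k\<in>J. u k) = u j + (\<Sum>k\<in>J'. u k)" for u :: "'b \<Rightarrow> real"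
    unfolding J'_def using fin j by (simp add: sum.remove)
  have S0: "0 \<le> S k l" if "k \<in> I" "l \<in> J" for k l using Suc.prems(4) that .
  have row: "(\<Sum>l\<in>J'. S k l) = 1 - S k j" if "k \<in> I" for k
    using Suc.prems(5)[OF that] sumJ[of "S k"] by simp
  have col: "(\<Sum>k\<in>I'. S k l) = 1 - S i l" if "l \<in> J" for l
    using Suc.prems(6)[OF that] sumI[of "\<lambda>k. S k l"] by simp
  have IJ: "\<And>k. k \<in> I' \<Longrightarrow> k \<in> I" "\<And>l. l \<in> J' \<Longrightarrow> l \<in> J" by (auto simp: I'_def J'_def)
  have s1: "s \<le> 1"
    using row[OF i(1)] sum_nonneg[of J' "S i"] S0 i IJ by (simp add: s_def)
  \<comment> \<open>If \<open>s = 1\<close>, the entry \<open>(i, j)\<close> exhausts its row and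
    column, so the other entries there vanish and the convention \<open>x / 0 = 0\<close> gives the
    right value.\<close>
  have cancel_col: "S k j * (1 - s) / (1 - s) = S k j" if k: "k \<in> I'" for k
  proof (cases "s = 1")
    case True
    then have "(\<Sum>k\<in>I'. S k j) = 0" using col[OF j(1)] by (simp add: s_def)
    then have "S k j = 0" using sum_nonneg_0[OF fin'(1), of "\<lambda>k. S k j" k] S0 IJ j k by simp
    then show ?thesis by simp
  qed simp
  have cancel_row: "S i l * (1 - s) / (1 - s) = S i l" if l: "l \<in> J'" for l
  proof (cases "s = 1")
    case True
    then have "(\<Sum>l\<in>J'. S i l) = 0" using row[OF i(1)] by (simp add: s_def)
    then have "S i l = 0" using sum_nonneg_0[OF fin'(2), of "S i" l] S0 IJ i l by simp
    then show ?thesis by simp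
  qed simp
  \<comment> \<open>A rank one array whose row sums are the entries of column \<open>j\<close> and
    whose column sums are those of row \<open>i\<close>: exactly the mass that the remaining block
    lacks to be doubly stochastic.\<close>
  define w where "w k l = S k j * S i l / (1 - s)" for k l
  have w0: "0 \<le> w k l" if "k \<in> I'" "l \<in> J'" for k l
    unfolding w_def using S0 IJ that i j s1 by (intro divide_nonneg_nonneg mult_nonneg_nonneg) auto
  have wrow: "(\<Sum>l\<in>J'. w k l) = S k j" if "k \<in> I'" for k
  proof -
    have "(\<Sum>l\<in>J'. w k l) = S k j * (\<Sum>l\<in>J'. S i l) / (1 - s)"
      unfolding w_def by (simp add: sum_distrib_left sum_divide_distrib)
    then show ?thesis using row[OF i(1)] cancel_col[OF that] by (simp add: s_def)
  qed
  have wcol: "(\<Sum>k\<in>I'. w k l) = S i l" if "l \<in> J'" for l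
  proof -
    have "(\<Sum>k\<in>I'. w k l) = (\<Sum>k\<in>I'. S k j) * S i l / (1 - s)"
      unfolding w_def by (simp add: sum_distrib_right sum_divide_distrib)
    then show ?thesis using col[OF j(1)] cancel_row[OF that] by (simp add: s_def mult.commute)
  qed
  define S' where "S' k l = S k l + w k l" for k l
  have "\<exists>\<pi>. bij_betw \<pi> I' J' \<and> (\<Sum>k\<in>I'. c k * b (\<pi> k)) \<le> (\<Sum>k\<in>I'. \<Sum>l\<in>J'. c k * S' k l * b l)"
  proof (rule Suc.hyps(1))
    show "n = card I'" "card I' = card J'" using Suc.hyps(2) Suc.prems i j by (auto simp: I'_def J'_def)
    show "0 \<le> S' k l" if "k \<in> I'" "l \<in> J'" for k l
      using S0 w0 IJ that by (simp add: S'_def)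
    show "(\<Sum>l\<in>J'. S' k l) = 1" if "k \<in> I'" for k
      using row[of k] wrow[of k] IJ that by (simp add: S'_def sum.distrib)
    show "(\<Sum>k\<in>I'. S' k l) = 1" if "l \<in> J'" for l
      using col[of l] wcol[of l] IJ that by (simp add: S'_def sum.distrib)
  qed (use fin' in auto)
  then obtain \<pi> where \<pi>: "bij_betw \<pi> I' J'" "(\<Sum>k\<in>I'. c k * b (\<pi> k)) \<le> (\<Sum>k\<in>I'. \<Sum>l\<in>J'. c k * S' k l * b l)" by blast
  have bij: "bij_betw (\<pi>(i := j)) I J"
  proof -
    have "bij_betw (\<pi>(i := j)) I' J'" using \<pi>(1) by (rule bij_betw_cong[THEN iffD1, rotated]) (auto simp: I'_def)
    then have "bij_betw (\<pi>(i := j)) (I' \<union> {i}) (J' \<union> {j})"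
      by (rule bij_betw_combine) (auto simp: J'_def)
    moreover have "I' \<union> {i} = I" "J' \<union> {j} = J" using i j by (auto simp: I'_def J'_def)
    ultimately show ?thesis by simp
  qed
  have "(\<Sum>k\<in>I. c k * b ((\<pi>(i := j)) k)) = c i * b j + (\<Sum>k\<in>I'. c k * b (\<pi> k))"
    unfolding sumI by (auto simp: I'_def intro!: sum.cong)
  also have "\<dots> \<le> c i * b j + (\<Sum>k\<in>I'. \<Sum>l\<in>J'. c k * S' k l * b l)" using \<pi>(2) by simp
  also have "\<dots> \<le> (\<Sum>k\<in>I. \<Sum>l\<in>J. c k * S k l * b l)"
  proof -
    \<comment> \<open>Each unit of mass moved around the rectangle \<open>i, k\<close> by
      \<open>j, l\<close> lowers the sum by \<open>(c i - c k) * (b l - b j)\<close>; maximality of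
      \<open>c i\<close> and minimality of \<open>b j\<close> make this nonnegative.\<close>
    have "0 \<le> (\<Sum>k\<in>I'. \<Sum>l\<in>J'. w k l * ((c i - c k) * (b l - b j)))"
      using w0 i(2) j(2) IJ by (intro sum_nonneg mult_nonneg_nonneg) auto
    also have "\<dots> = (\<Sum>k\<in>I'. \<Sum>l\<in>J'. c i * (w k l * b l)) - (\<Sum>k\<in>I'. \<Sum>l\<in>J'. c i * b j * w k l)
        - (\<Sum>k\<in>I'. \<Sum>l\<in>J'. c k * w k l * b l) + (\<Sum>k\<in>I'. \<Sum>l\<in>J'. c k * b j * w k l)"
      unfolding sum_subtractf[symmetric] sum.distrib[symmetric]
      by (intro sum.cong refl) (simp add: algebra_simps)
    also have "(\<Sum>k\<in>I'. \<Sum>l\<in>J'. c i * (w k l * b l)) = (\<Sum>l\<in>J'. c i * S i l * b l)"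
      by (subst sum.swap) (simp add: wcol mult.assoc flip: sum_distrib_left sum_distrib_right)
    also have "(\<Sum>k\<in>I'. \<Sum>l\<in>J'. c i * b j * w k l) = c i * b j * (1 - s)"
      using wrow col[OF j(1)] by (simp add: s_def flip: sum_distrib_left)
    also have "(\<Sum>k\<in>I'. \<Sum>l\<in>J'. c k * b j * w k l) = (\<Sum>k\<in>I'. c k * S k j * b j)"
      using wrow by (simp add: ac_simps flip: sum_distrib_left)
    finally have "c i * b j * (1 - s) + (\<Sum>k\<in>I'. \<Sum>l\<in>J'. c k * w k l * b l)
        \<le> (\<Sum>l\<in>J'. c i * S i l * b l) + (\<Sum>k\<in>I'. c k * S k j * b j)" by simp
    moreover have "(\<Sum>k\<in>I'. \<Sum>l\<in>J'. c k * S' k l * b l) =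
        (\<Sum>k\<in>I'. \<Sum>l\<in>J'. c k * S k l * b l) + (\<Sum>k\<in>I'. \<Sum>l\<in>J'. c k * w k l * b l)"
      by (simp add: S'_def algebra_simps sum.distrib)
    moreover have "(\<Sum>k\<in>I. \<Sum>l\<in>J. c k * S k l * b l) = c i * s * b j + (\<Sum>l\<in>J'. c i * S i l * b l) +
        ((\<Sum>k\<in>I'. c k * S k j * b j) + (\<Sum>k\<in>I'. \<Sum>l\<in>J'. c k * S k l * b l))"
      unfolding sumI sumJ by (simp add: s_def sum.distrib)
    ultimately show ?thesis by (simp add: algebra_simps)
  qed
  finally show ?case using bij by blast
qed

section \<open>Concave symmetric functions of the eigenvalues\<close>

definition grad :: "(real^'n \<Rightarrow> real) \<Rightarrow> real^'n \<Rightarrow> real^'n" where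
  "grad f a = (\<chi> i. D (axis i 1) f a)"

lemma D_eq_grad:
  assumes "f differentiable (at a)"
  shows "D v f a = grad f a \<bullet> v"
proof -
  have "D (\<Sum>i\<in>UNIV. v $ i *\<^sub>R axis i 1) f a = (\<Sum>i\<in>UNIV. v $ i * D (axis i 1) f a)"
    by (simp add: D_linear[OF assms])
  moreover have "(\<Sum>i\<in>UNIV. v $ i *\<^sub>R axis i 1) = v"
    by (simp add: vec_eq_iff axis_def if_distrib cong: if_cong)
  ultimately show ?thesis by (simp add: grad_def inner_vec_def mult.commute)
qed

text \<open>Contracting with a matrix that is diagonal in the frame \<open>U\<close> only sees
  diagonal entries in that frame. This links the weights of the maximum principle with the
  derivative of F in the differential equation.\<close>

lemma inner_conj_diagm:
  "(U ** diagm c ** transpose U) \<bullet> B = (\<Sum>i\<in>UNIV. c $ i * (transpose U ** B ** U) $ i $ i)"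
proof -
  have "(U ** diagm c ** transpose U) \<bullet> B = (\<Sum>k\<in>UNIV. \<Sum>l\<in>UNIV. \<Sum>i\<in>UNIV. c $ i * (U $ k $ i * B $ k $ l * U $ l $ i))"
    by (simp add: inner_vec_def conj_diagm_entry sum_distrib_right sum_distrib_left ac_simps)
  also have "\<dots> = (\<Sum>k\<in>UNIV. \<Sum>i\<in>UNIV. \<Sum>l\<in>UNIV. c $ i * (U $ k $ i * B $ k $ l * U $ l $ i))"
    by (rule sum.cong[OF refl], rule sum.swap)
  also have "\<dots> = (\<Sum>i\<in>UNIV. \<Sum>k\<in>UNIV. \<Sum>l\<in>UNIV. c $ i * (U $ k $ i * B $ k $ l * U $ l $ i))"
    by (rule sum.swap)
  also have "\<dots> = (\<Sum>i\<in>UNIV. \<Sum>l\<in>UNIV. \<Sum>k\<in>UNIV. c $ i * (U $ k $ i * B $ k $ l * U $ l $ i))"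
    by (rule sum.cong[OF refl], rule sum.swap)
  also have "\<dots> = (\<Sum>i\<in>UNIV. c $ i * (transpose U ** B ** U) $ i $ i)"
    by (simp add: matrix_matrix_mult_def transpose_def sum_distrib_left sum_distrib_right ac_simps)
  finally show ?thesis .
qed

text \<open>Stated so as to have two instances: a concave speed on its cone, and for a convex speed
  the function \<open>- f (- k)\<close> on the reflected cone, which contains the negative ray in
  place of the positive one.\<close>

locale concave_symmetric =
  fixes \<Gamma> :: "(real^'n) set" and f :: "real^'n \<Rightarrow> real"
  assumes open_\<Gamma>: "open \<Gamma>" and concave_f: "concave_on \<Gamma> f"
    and scale_\<Gamma>: "\<And>k c. k \<in> \<Gamma> \<Longrightarrow> c > 0 \<Longrightarrow> c *\<^sub>R k \<in> \<Gamma>"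
    and perm_\<Gamma>: "\<And>k p. k \<in> \<Gamma> \<Longrightarrow> bij p \<Longrightarrow> (\<chi> i. k $ p i) \<in> \<Gamma>"
    and perm_f: "\<And>k p. k \<in> \<Gamma> \<Longrightarrow> bij p \<Longrightarrow> f (\<chi> i. k $ p i) = f k"
    and scale_f: "\<And>k c. k \<in> \<Gamma> \<Longrightarrow> c > 0 \<Longrightarrow> f (c *\<^sub>R k) = c * f k"
    and diff_f: "\<And>k. k \<in> \<Gamma> \<Longrightarrow> f differentiable (at k)"
    and cont_grad: "continuous_on \<Gamma> (grad f)"
begin

text \<open>Differentiate \<open>f ((1 + s) *\<^sub>R a) = (1 + s) * f a\<close> at
  \<open>s = 0\<close>.\<close>

lemma euler: assumes "a \<in> \<Gamma>" shows "grad f a \<bullet> a = f a"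
proof -
  have "((\<lambda>s. f (a + s *\<^sub>R a)) has_vector_derivative D a f a) (at 0)"
    using D_along_line[of f a 0 a] diff_f[OF assms] by simp
  moreover have "((\<lambda>s. f (a + s *\<^sub>R a)) has_vector_derivative f a) (at 0)"
  proof -
    have "((\<lambda>s. (1 + s) * f a) has_vector_derivative f a) (at 0)"
      by (auto intro!: derivative_eq_intros)
    then show ?thesis
    proof (rule has_vector_derivative_transform_within_open[where S="{-1<..<1}"])
      show "(1 + s) * f a = f (a + s *\<^sub>R a)" if "s \<in> {-1<..<1}" for s
        using scale_f[OF assms, of "1 + s"] that by (simp add: algebra_simps)
    qed auto
  qed
  ultimately have "D a f a = f a" by (rule vector_derivative_unique_at)
  then show ?thesis using D_eq_grad[OF diff_f[OF assms]] by simp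
qed

text \<open>Concavity places \<open>f\<close> below its tangent plane at \<open>a\<close>, and by
  Euler's identity the affine function describing that plane is linear.\<close>

lemma tangent_bound:
  assumes a: "a \<in> \<Gamma>" and b: "b \<in> \<Gamma>"
  shows "f b \<le> grad f a \<bullet> b"
proof -
  define g where "g s = f (a + s *\<^sub>R (b - a))" for s
  have "(g has_vector_derivative D (b - a) f a) (at 0)"
    using D_along_line[of f a 0 "b - a"] diff_f[OF a] by (simp add: g_def[abs_def])
  then have "(g has_real_derivative D (b - a) f a) (at 0)"
    by (simp add: has_real_derivative_iff_has_vector_derivative)
  then have "((\<lambda>s. (g s - g 0) / s) \<longlongrightarrow> D (b - a) f a) (at 0)"
    by (simp add: has_field_derivative_iff)
  then have lim: "((\<lambda>s. (g s - g 0) / s) \<longlongrightarrow> D (b - a) f a) (at_right 0)"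
    by (rule filterlim_mono[OF _ order_refl at_le]) auto
  have "\<forall>\<^sub>F s in at_right 0. f b - f a \<le> (g s - g 0) / s"
  proof -
    have "f b - f a \<le> (g s - g 0) / s" if "0 < s" "s < 1" for s
    proof -
      have "g s = f ((1 - s) *\<^sub>R a + s *\<^sub>R b)" by (simp add: g_def algebra_simps)
      also have "\<dots> \<ge> (1 - s) * f a + s * f b"
        using concave_f a b that by (auto simp: concave_on_iff)
      finally show ?thesis using that by (simp add: g_def field_simps)
    qed
    then show ?thesis by (auto simp: eventually_at_right_field intro!: exI[of _ 1])
  qed
  from tendsto_lowerbound[OF lim this] have "f b - f a \<le> grad f a \<bullet> (b - a)"
    using D_eq_grad[OF diff_f[OF a]] by simp
  then show ?thesis using euler[OF a] by (simp add: inner_diff_right)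
qed

text \<open>The diagonal of \<open>B\<close> in the frame \<open>U\<close> averages the eigenvalues
  with the doubly stochastic weights \<open>(Q $ i $ k)\<^sup>2\<close>. By the rearrangement lemma
  some ordering of the eigenvalues pairs with the gradient to at most the given sum; since
  \<open>f\<close> is symmetric, the tangent bound for that ordering still bounds
  \<open>f b\<close>.\<close>

lemma support_bound:
  assumes a: "a \<in> \<Gamma>" and b: "b \<in> \<Gamma>" and U: "orthogonal_matrix U"
    and B: "transpose B = B" "eigenvalues_wrt (mat 1) B b"
  shows "f b \<le> (\<Sum>i\<in>UNIV. grad f a $ i * (transpose U ** B ** U) $ i $ i)"
proof -
  obtain V b' where V: "orthogonal_matrix V" "B = V ** diagm b' ** transpose V"
    using symmetric_diagonalization[OF B(1)] .
  obtain p where p: "bij p" "b' = (\<chi> i. b $ p i)"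
    using eigenvalues_wrt_unique[OF B(2)] eigenvalues_wrt_conj_diagm[OF V(1), of b'] V(2) by auto
  define Q where "Q = transpose U ** V"
  have Q: "orthogonal_matrix Q" unfolding Q_def using U V by (simp add: orthogonal_matrix_mul)
  have "transpose U ** B ** U = Q ** diagm b' ** transpose Q"
    unfolding V(2) Q_def matrix_transpose_mul by (simp add: matrix_mul_assoc)
  then have entry: "(transpose U ** B ** U) $ i $ i = (\<Sum>k\<in>UNIV. (Q $ i $ k)\<^sup>2 * b' $ k)" for i
    by (simp add: conj_diagm_entry power2_eq_square ac_simps)
  have row: "(\<Sum>k\<in>UNIV. (Q $ i $ k)\<^sup>2) = 1" for i
  proof -
    have "(Q ** transpose Q) $ i $ i = 1" using Q by (simp add: orthogonal_matrix_def mat_def)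
    then show ?thesis by (simp add: matrix_matrix_mult_def transpose_def power2_eq_square)
  qed
  have col: "(\<Sum>i\<in>UNIV. (Q $ i $ k)\<^sup>2) = 1" for k
  proof -
    have "(transpose Q ** Q) $ k $ k = 1" using Q by (simp add: orthogonal_matrix_def mat_def)
    then show ?thesis by (simp add: matrix_matrix_mult_def transpose_def power2_eq_square)
  qed
  obtain \<pi> where \<pi>: "bij \<pi>" "(\<Sum>i\<in>UNIV. grad f a $ i * b' $ \<pi> i) \<le>
      (\<Sum>i\<in>UNIV. \<Sum>j\<in>UNIV. grad f a $ i * (Q $ i $ j)\<^sup>2 * b' $ j)"
    using doubly_stochastic_rearrangement[of UNIV UNIV "\<lambda>i j. (Q $ i $ j)\<^sup>2" "($) (grad f a)" "($) b'"] row col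
    by auto
  have "bij (p \<circ> \<pi>)" using p(1) \<pi>(1) by (simp add: bij_comp)
  define b'' where "b'' = (\<chi> i. b $ (p \<circ> \<pi>) i)"
  have b'': "b'' \<in> \<Gamma>" "f b'' = f b" unfolding b''_def using b \<open>bij (p \<circ> \<pi>)\<close> perm_\<Gamma> perm_f by blast+
  have "f b \<le> grad f a \<bullet> b''" using tangent_bound[OF a b''(1)] b''(2) by simp
  also have "\<dots> = (\<Sum>i\<in>UNIV. grad f a $ i * b' $ \<pi> i)" by (simp add: inner_vec_def b''_def p(2))
  also have "\<dots> \<le> (\<Sum>i\<in>UNIV. grad f a $ i * (transpose U ** B ** U) $ i $ i)"
    using \<pi>(2) by (simp add: entry sum_distrib_left mult.assoc)
  finally show ?thesis .
qed

lemma grad_perm: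
  assumes a: "a \<in> \<Gamma>" and p: "bij p"
  shows "grad f (\<chi> i. a $ p i) $ j = grad f a $ p j"
proof -
  let ?P = "\<lambda>k::real^'n. \<chi> i. k $ p i"
  have lin: "bounded_linear ?P"
    by (rule linear_conv_bounded_linear[THEN iffD1]) (auto intro!: linearI simp: vec_eq_iff)
  have "((\<lambda>k. f (?P k)) has_derivative (\<lambda>v. D (?P v) f (?P a))) (at a)"
    using diff_chain_at[OF bounded_linear_imp_has_derivative[OF lin] has_derivative_D[OF diff_f[OF perm_\<Gamma>[OF a p]]]]
    by (simp add: o_def)
  then have "D (axis (p j) 1) (\<lambda>k. f (?P k)) a = D (?P (axis (p j) 1)) f (?P a)" by (rule D_eq)
  moreover have "D (axis (p j) 1) (\<lambda>k. f (?P k)) a = D (axis (p j) 1) f a"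
    using perm_f p by (intro D_cong[OF open_\<Gamma> a]) auto
  moreover have "?P (axis (p j) 1) = axis j 1"
    using p by (auto simp: vec_eq_iff axis_def bij_def inj_def)
  ultimately show ?thesis by (simp add: grad_def)
qed

text \<open>The transposition of \<open>i\<close> and \<open>j\<close> fixes \<open>a\<close>, so
  \<open>grad_perm\<close> identifies the two partial derivatives. Repeated eigenvalues therefore
  cause no ambiguity when the gradient is turned into a matrix.\<close>

lemma grad_eq:
  assumes a: "a \<in> \<Gamma>" and "a $ i = a $ j"
  shows "grad f a $ i = grad f a $ j"
proof -
  have "(\<chi> k. a $ (Transposition.transpose i j) k) = a"
    using assms(2) by (auto simp: vec_eq_iff Transposition.transpose_def)
  then show ?thesis using grad_perm[OF a, of "Transposition.transpose i j" j] by simp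
qed

text \<open>The change of basis \<open>Q\<close> intertwines the two diagonal matrices, so
  \<open>Q $ i $ j\<close> can be nonzero only if the eigenvalues \<open>a $ i\<close> and
  \<open>a' $ j\<close> agree. Then the corresponding gradient entries agree too, and
  \<open>Q\<close> also intertwines the gradients.\<close>

lemma conj_grad_unique:
  assumes a: "a \<in> \<Gamma>" and U: "orthogonal_matrix U" and V: "orthogonal_matrix V"
    and eq: "U ** diagm a ** transpose U = V ** diagm a' ** transpose V"
  shows "a' \<in> \<Gamma>" "U ** diagm (grad f a) ** transpose U = V ** diagm (grad f a') ** transpose V"
proof -
  obtain p where p: "bij p" "a' = (\<chi> i. a $ p i)"
    using eigenvalues_wrt_unique[of "mat 1" "U ** diagm a ** transpose U" a a']
      eigenvalues_wrt_conj_diagm[OF U, of a] eigenvalues_wrt_conj_diagm[OF V, of a'] eq by auto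
  show "a' \<in> \<Gamma>" using p perm_\<Gamma>[OF a] by simp
  define Q where "Q = transpose U ** V"
  have UU: "U ** transpose U = mat 1" "transpose U ** U = mat 1" using U by (simp_all add: orthogonal_matrix_def)
  have VV: "V ** transpose V = mat 1" "transpose V ** V = mat 1" using V by (simp_all add: orthogonal_matrix_def)
  have UQ: "U ** Q = V" unfolding Q_def by (simp add: matrix_mul_assoc UU)
  have "transpose U ** (U ** diagm a ** transpose U) ** V = transpose U ** (V ** diagm a' ** transpose V) ** V"
    using eq by simp
  then have "(transpose U ** U) ** diagm a ** Q = Q ** diagm a' ** (transpose V ** V)"
    unfolding Q_def by (simp only: matrix_mul_assoc)
  then have "diagm a ** Q = Q ** diagm a'" by (simp add: UU VV)
  then have c: "a $ i * Q $ i $ j = Q $ i $ j * a' $ j" for i j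
    by (simp add: vec_eq_iff matrix_matrix_mult_def diagm_entry if_distrib if_distribR cong: if_cong)
  have "grad f a $ i * Q $ i $ j = Q $ i $ j * grad f a' $ j" for i j
  proof (cases "Q $ i $ j = 0")
    case False
    then have "a $ i = a $ p j" using c[of i j] p(2) by simp
    then have "grad f a $ i = grad f a' $ j" using grad_eq[OF a] grad_perm[OF a p(1), of j] p(2) by metis
    then show ?thesis by simp
  qed simp
  then have "diagm (grad f a) ** Q = Q ** diagm (grad f a')"
    by (simp add: vec_eq_iff matrix_matrix_mult_def diagm_entry if_distrib if_distribR cong: if_cong)
  then have "U ** (diagm (grad f a) ** Q) ** transpose V = U ** (Q ** diagm (grad f a')) ** transpose V" by simp
  moreover have "U ** (diagm (grad f a) ** Q) ** transpose V = U ** diagm (grad f a) ** transpose U ** (V ** transpose V)"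
    unfolding Q_def by (simp only: matrix_mul_assoc)
  moreover have "U ** (Q ** diagm (grad f a')) ** transpose V = V ** diagm (grad f a') ** transpose V"
    by (simp add: matrix_mul_assoc UQ)
  ultimately show "U ** diagm (grad f a) ** transpose U = V ** diagm (grad f a') ** transpose V" by (simp add: VV)
qed

end

section \<open>The derivative of a symmetric function of the eigenvalues\<close>

lemma bounded_linear_transpose: "bounded_linear (transpose :: real^'n^'m \<Rightarrow> real^'m^'n)"
  by (rule linear_conv_bounded_linear[THEN iffD1]) (auto intro!: linearI simp: transpose_def vec_eq_iff)

lemma bounded_linear_diagm: "bounded_linear (diagm :: real^'n \<Rightarrow> real^'n^'n)"
  by (rule linear_conv_bounded_linear[THEN iffD1]) (auto intro!: linearI simp: diagm_def vec_eq_iff)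

lemma norm_orthogonal_matrix_le:
  fixes V :: "real^'n^'n"
  assumes "orthogonal_matrix V"
  shows "norm V \<le> real CARD('n)"
proof -
  have "norm (V $ i) = 1" for i
  proof -
    have "V $ i \<bullet> V $ i = (V ** transpose V) $ i $ i"
      by (simp add: inner_vec_def matrix_matrix_mult_def transpose_def)
    then show ?thesis using assms by (simp add: orthogonal_matrix_def mat_def norm_eq_1)
  qed
  then have "norm V \<le> (\<Sum>i\<in>(UNIV::'n set). 1)"
    unfolding norm_vec_def by (intro order_trans[OF L2_set_le_sum]) auto
  then show ?thesis by simp
qed

lemma compact_orthogonal_matrices: "compact {V :: real^'n^'n. orthogonal_matrix V}"
proof (rule compact_eq_bounded_closed[THEN iffD2], rule conjI)
  show "bounded {V :: real^'n^'n. orthogonal_matrix V}"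
    using norm_orthogonal_matrix_le by (auto simp: bounded_iff)
  have "continuous_on UNIV (\<lambda>V :: real^'n^'n. transpose V ** V)"
    by (intro bounded_bilinear.continuous_on[OF bounded_bilinear_matrix_mult]
        linear_continuous_on[OF bounded_linear_transpose] continuous_on_id)
  from closed_Collect_eq[OF this continuous_on_const[of UNIV "mat 1"]]
  show "closed {V :: real^'n^'n. orthogonal_matrix V}" by (simp add: orthogonal_matrix)
qed

lemma transpose_conj_diagm [simp]:
  "transpose (U ** diagm c ** transpose U) = U ** diagm c ** transpose (U :: real^'n^'n)"
  by (simp add: matrix_transpose_mul matrix_mul_assoc)

lemma orthogonal_conj_conj:
  assumes "orthogonal_matrix U"
  shows "transpose U ** (U ** M ** transpose U) ** U = M"
proof -
  have "transpose U ** (U ** M ** transpose U) ** U = (transpose U ** U) ** M ** (transpose U ** U)"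
    by (simp only: matrix_mul_assoc)
  then show ?thesis using assms by (simp add: orthogonal_matrix_def)
qed

lemma matrix_fun_eq:
  assumes "eigenvalues_wrt (mat 1) A a" and "\<And>p. bij p \<Longrightarrow> f (\<chi> i. a $ p i) = f a"
  shows "matrix_fun f A = f a"
proof -
  have "eigenvalues_wrt (mat 1) A (SOME k. eigenvalues_wrt (mat 1) A k)" using assms(1) by (rule someI)
  then obtain p where "bij p" "(SOME k. eigenvalues_wrt (mat 1) A k) = (\<chi> i. a $ p i)"
    using eigenvalues_wrt_unique[OF assms(1)] by auto
  then show ?thesis unfolding matrix_fun_def using assms(2) by metis
qed

lemma matrix_fun_deriv_eqI:
  assumes P: "transpose P = P"
    and der: "\<And>B. transpose B = B \<Longrightarrow> ((\<lambda>s. matrix_fun f (A + s *\<^sub>R B)) has_real_derivative P \<bullet> B) (at 0)"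
  shows "matrix_fun_deriv f A = P"
proof -
  have ip: "(\<Sum>k\<in>UNIV. \<Sum>l\<in>UNIV. Q $ k $ l * B $ k $ l) = Q \<bullet> B" for Q B :: "real^'a^'a"
    by (simp add: inner_vec_def)
  show ?thesis unfolding matrix_fun_deriv_def ip
  proof (rule the_equality)
    show "transpose P = P \<and> (\<forall>B. transpose B = B \<longrightarrow> ((\<lambda>s. matrix_fun f (A + s *\<^sub>R B)) has_real_derivative P \<bullet> B) (at 0))"
      using P der by blast
    fix Q assume Q: "transpose Q = Q \<and> (\<forall>B. transpose B = B \<longrightarrow> ((\<lambda>s. matrix_fun f (A + s *\<^sub>R B)) has_real_derivative Q \<bullet> B) (at 0))"
    \<comment> \<open>Two candidates are separated by testing them on their own difference, which is
      an admissible symmetric direction.\<close>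
    have "transpose (Q - P) = Q - P" using P Q by (simp add: transpose_diff)
    then have "Q \<bullet> (Q - P) = P \<bullet> (Q - P)" using Q der DERIV_unique by blast
    then have "(Q - P) \<bullet> (Q - P) = 0" by (simp add: inner_diff_left)
    then show "Q = P" by simp
  qed
qed

context concave_symmetric
begin

text \<open>Eigenvectors may be discontinuous in \<open>s\<close>, so compactness of the orthogonal
  group is used instead: along a sequence of bad diagonalizations with \<open>s\<close> tending to
  0, a subsequence converges to some diagonalization of \<open>A\<close>. By
  \<open>conj_grad_unique\<close> its eigenvalues lie in the open cone and its gradient matrix is
  the given one, a contradiction.\<close>

lemma eigenvalues_stable:
  assumes a: "a \<in> \<Gamma>" and U: "orthogonal_matrix U" and A: "A = U ** diagm a ** transpose U" and "\<epsilon> > 0"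
  shows "\<exists>\<delta>>0. \<forall>s V b. \<bar>s\<bar> < \<delta> \<and> orthogonal_matrix V \<and> A + s *\<^sub>R B = V ** diagm b ** transpose V \<longrightarrow>
    b \<in> \<Gamma> \<and> \<bar>(V ** diagm (grad f b) ** transpose V) \<bullet> B - (U ** diagm (grad f a) ** transpose U) \<bullet> B\<bar> < \<epsilon>"
proof (rule ccontr)
  let ?good = "\<lambda>V b. b \<in> \<Gamma> \<and> \<bar>(V ** diagm (grad f b) ** transpose V) \<bullet> B - (U ** diagm (grad f a) ** transpose U) \<bullet> B\<bar> < \<epsilon>"
  assume no: "\<not> ?thesis"
  have "\<exists>s V b. \<bar>s\<bar> < inverse (real (Suc n)) \<and> orthogonal_matrix V \<and> A + s *\<^sub>R B = V ** diagm b ** transpose V \<and> \<not> ?good V b" for n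
  proof -
    have "inverse (real (Suc n)) > 0" by simp
    then show ?thesis using no by blast
  qed
  then obtain s V b where sVb: "\<And>n. \<bar>s n\<bar> < inverse (real (Suc n))" "\<And>n. orthogonal_matrix (V n)"
    "\<And>n. A + s n *\<^sub>R B = V n ** diagm (b n) ** transpose (V n)" "\<And>n. \<not> ?good (V n) (b n)" by metis
  have s0: "s \<longlonglongrightarrow> 0"
    by (rule Lim_null_comparison[OF _ LIMSEQ_inverse_real_of_nat]) (use sVb(1) in \<open>auto intro!: always_eventually less_imp_le\<close>)
  obtain W r where W: "orthogonal_matrix W" "strict_mono r" "(V \<circ> r) \<longlonglongrightarrow> W"
    using compact_orthogonal_matrices[unfolded compact_def, rule_format, of V] sVb(2) by auto
  have Wl: "(\<lambda>n. V (r n)) \<longlonglongrightarrow> W" using W(3) by (simp add: o_def)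
  have WTl: "(\<lambda>n. transpose (V (r n))) \<longlonglongrightarrow> transpose W"
    by (rule bounded_linear.tendsto[OF bounded_linear_transpose Wl])
  have sl: "(\<lambda>n. s (r n)) \<longlonglongrightarrow> 0" using LIMSEQ_subseq_LIMSEQ[OF s0 W(2)] by (simp add: o_def)
  have "(\<lambda>n. A + s (r n) *\<^sub>R B) \<longlonglongrightarrow> A + 0 *\<^sub>R B" by (intro tendsto_intros sl)
  then have "(\<lambda>n. transpose (V (r n)) ** (A + s (r n) *\<^sub>R B) ** V (r n)) \<longlonglongrightarrow> transpose W ** (A + 0 *\<^sub>R B) ** W"
    by (intro bounded_bilinear.tendsto[OF bounded_bilinear_matrix_mult] WTl Wl)
  then have lim: "(\<lambda>n. diagm (b (r n))) \<longlonglongrightarrow> transpose W ** A ** W"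
    unfolding sVb(3) orthogonal_conj_conj[OF sVb(2)] by simp
  define b' where "b' = (\<chi> i. (transpose W ** A ** W) $ i $ i)"
  have bl: "(\<lambda>n. b (r n)) \<longlonglongrightarrow> b'"
  proof (rule vec_tendstoI)
    fix i show "(\<lambda>n. b (r n) $ i) \<longlonglongrightarrow> b' $ i"
      using tendsto_vec_nth[OF tendsto_vec_nth[OF lim, of i], of i] by (simp add: b'_def diagm_entry)
  qed
  have "(\<lambda>n. diagm (b (r n))) \<longlonglongrightarrow> diagm b'" by (rule bounded_linear.tendsto[OF bounded_linear_diagm bl])
  then have db': "transpose W ** A ** W = diagm b'" using lim LIMSEQ_unique by blast
  have "W ** diagm b' ** transpose W = (W ** transpose W) ** A ** (W ** transpose W)"
    unfolding db'[symmetric] by (simp only: matrix_mul_assoc)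
  then have "A = W ** diagm b' ** transpose W" using W(1) by (simp add: orthogonal_matrix_def)
  then have b': "b' \<in> \<Gamma>" and P: "U ** diagm (grad f a) ** transpose U = W ** diagm (grad f b') ** transpose W"
    using conj_grad_unique[OF a U W(1)] A by auto
  have ev: "\<forall>\<^sub>F n in sequentially. b (r n) \<in> \<Gamma>" using topological_tendstoD[OF bl open_\<Gamma> b'] .
  have "isCont (grad f) b'" using cont_grad b' open_\<Gamma> by (simp add: continuous_on_eq_continuous_at)
  from isCont_tendsto_compose[OF this bl]
  have "(\<lambda>n. diagm (grad f (b (r n)))) \<longlonglongrightarrow> diagm (grad f b')"
    by (rule bounded_linear.tendsto[OF bounded_linear_diagm])
  then have "(\<lambda>n. (V (r n) ** diagm (grad f (b (r n))) ** transpose (V (r n))) \<bullet> B) \<longlonglongrightarrow> (W ** diagm (grad f b') ** transpose W) \<bullet> B"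
    by (intro tendsto_inner tendsto_const bounded_bilinear.tendsto[OF bounded_bilinear_matrix_mult] WTl Wl)
  from tendstoD[OF this \<open>\<epsilon> > 0\<close>]
  have "\<forall>\<^sub>F n in sequentially. \<bar>(V (r n) ** diagm (grad f (b (r n))) ** transpose (V (r n))) \<bullet> B - (U ** diagm (grad f a) ** transpose U) \<bullet> B\<bar> < \<epsilon>"
    unfolding P by (simp add: dist_real_def)
  with ev have "\<forall>\<^sub>F n in sequentially. ?good (V (r n)) (b (r n))" by (rule eventually_conj)
  then show False using sVb(4) by (simp add: eventually_sequentially)
qed

text \<open>The support bound is used both ways, with contact at \<open>A\<close> and with contact
  at \<open>A + s *\<^sub>R B\<close>. This squeezes the difference quotient between two pairings
  with \<open>B\<close>, one based at \<open>A\<close> and one at the perturbed matrix, and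
  \<open>eigenvalues_stable\<close> makes them merge.\<close>

lemma matrix_fun_has_derivative:
  assumes a: "a \<in> \<Gamma>" and U: "orthogonal_matrix U" and A: "A = U ** diagm a ** transpose U"
    and B: "transpose B = B"
  shows "((\<lambda>s. matrix_fun f (A + s *\<^sub>R B)) has_real_derivative (U ** diagm (grad f a) ** transpose U) \<bullet> B) (at 0)"
proof -
  let ?P = "\<lambda>U a. U ** diagm (grad f a) ** transpose U"
  have At: "transpose A = A" unfolding A by simp
  have self: "?P V b \<bullet> (V ** diagm b ** transpose V) = f b" if "orthogonal_matrix V" "b \<in> \<Gamma>" for V b
    unfolding inner_conj_diagm orthogonal_conj_conj[OF that(1)]
    using euler[OF that(2)] by (simp add: diagm_entry inner_vec_def)
  have fa: "matrix_fun f A = f a"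
    by (rule matrix_fun_eq) (use eigenvalues_wrt_conj_diagm[OF U] A perm_f a in auto)
  have "((\<lambda>s. (matrix_fun f (A + s *\<^sub>R B) - matrix_fun f A) / s) \<longlongrightarrow> ?P U a \<bullet> B) (at 0)"
  proof (rule LIM_I)
    fix \<epsilon> :: real assume "\<epsilon> > 0"
    from eigenvalues_stable[OF a U A this, of B] obtain \<delta> where \<delta>: "\<delta> > 0"
      "\<And>s V b. \<bar>s\<bar> < \<delta> \<Longrightarrow> orthogonal_matrix V \<Longrightarrow> A + s *\<^sub>R B = V ** diagm b ** transpose V \<Longrightarrow>
        b \<in> \<Gamma> \<and> \<bar>?P V b \<bullet> B - ?P U a \<bullet> B\<bar> < \<epsilon>" by blast
    show "\<exists>\<delta>>0. \<forall>s. s \<noteq> 0 \<and> norm (s - 0) < \<delta> \<longrightarrow> norm ((matrix_fun f (A + s *\<^sub>R B) - matrix_fun f A) / s - ?P U a \<bullet> B) < \<epsilon>"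
    proof (intro exI[of _ \<delta>] conjI allI impI \<delta>(1))
      fix s :: real assume s: "s \<noteq> 0 \<and> norm (s - 0) < \<delta>"
      have sym: "transpose (A + s *\<^sub>R B) = A + s *\<^sub>R B" by (simp add: transpose_add transpose_scalar At B)
      obtain V b where V: "orthogonal_matrix V" "A + s *\<^sub>R B = V ** diagm b ** transpose V"
        using symmetric_diagonalization[OF sym] .
      have b: "b \<in> \<Gamma>" "\<bar>?P V b \<bullet> B - ?P U a \<bullet> B\<bar> < \<epsilon>" using \<delta>(2)[OF _ V] s by auto
      have eb: "eigenvalues_wrt (mat 1) (A + s *\<^sub>R B) b" using eigenvalues_wrt_conj_diagm[OF V(1)] V(2) by simp
      have ea: "eigenvalues_wrt (mat 1) A a" using eigenvalues_wrt_conj_diagm[OF U] A by simp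
      have fb: "matrix_fun f (A + s *\<^sub>R B) = f b"
        by (rule matrix_fun_eq[OF eb]) (use perm_f b in auto)
      have "f b \<le> ?P U a \<bullet> (A + s *\<^sub>R B)"
        using support_bound[OF a b(1) U sym eb] by (simp add: inner_conj_diagm)
      also have "\<dots> = f a + s * (?P U a \<bullet> B)" using self[OF U a] A by (simp add: inner_add_right)
      finally have up: "f b - f a \<le> s * (?P U a \<bullet> B)" by simp
      have "f a \<le> ?P V b \<bullet> A" using support_bound[OF b(1) a V(1) At ea] by (simp add: inner_conj_diagm)
      also have "\<dots> = ?P V b \<bullet> (A + s *\<^sub>R B) - s * (?P V b \<bullet> B)" by (simp add: inner_add_right)
      also have "\<dots> = f b - s * (?P V b \<bullet> B)" using self[OF V(1) b(1)] V(2) by simp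
      finally have low: "s * (?P V b \<bullet> B) \<le> f b - f a" by simp
      \<comment> \<open>Division by \<open>s\<close> reverses \<open>up\<close> and
        \<open>low\<close> when \<open>s\<close> is negative, but in both cases the quotient lies
        between the two pairings.\<close>
      have "\<bar>(f b - f a) / s - ?P U a \<bullet> B\<bar> \<le> \<bar>?P V b \<bullet> B - ?P U a \<bullet> B\<bar>"
      proof (cases "s > 0")
        case True
        then have "?P V b \<bullet> B \<le> (f b - f a) / s" "(f b - f a) / s \<le> ?P U a \<bullet> B"
          using up low by (simp_all add: field_simps)
        then show ?thesis by linarith
      next
        case False
        then have "s < 0" using s by simp
        then have "(f b - f a) / s \<le> ?P V b \<bullet> B" "?P U a \<bullet> B \<le> (f b - f a) / s"
          using up low by (simp_all add: field_simps)
        then show ?thesis by linarith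
      qed
      then show "norm ((matrix_fun f (A + s *\<^sub>R B) - matrix_fun f A) / s - ?P U a \<bullet> B) < \<epsilon>"
        using b(2) by (simp add: fa fb)
    qed
  qed
  then show ?thesis by (simp add: has_field_derivative_iff)
qed

lemma matrix_fun_deriv_eq:
  assumes "a \<in> \<Gamma>" "orthogonal_matrix U"
  shows "matrix_fun_deriv f (U ** diagm a ** transpose U) = U ** diagm (grad f a) ** transpose U"
  by (rule matrix_fun_deriv_eqI) (use matrix_fun_has_derivative[OF assms refl] in auto)

end

text \<open>With \<open>g k = - f (- k)\<close> one has F(A) = - G(-A) for the associated matrix
  functions, and the two signs cancel in the derivative. The identity is used near
  \<open>s = 0\<close> only, where \<open>eigenvalues_stable\<close> keeps the eigenvalues of the
  perturbed matrix in the reflected cone.\<close>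

lemma matrix_fun_deriv_eq_reflected:
  fixes f :: "real^'n \<Rightarrow> real"
  assumes cs: "concave_symmetric (uminus ` \<Gamma>) (\<lambda>k. - f (- k))" and a: "a \<in> \<Gamma>" and U: "orthogonal_matrix U"
  shows "matrix_fun_deriv f (U ** diagm a ** transpose U) = U ** diagm (grad f a) ** transpose U"
    and "grad (\<lambda>k. - f (- k)) (- a) = grad f a"
proof -
  interpret concave_symmetric "uminus ` \<Gamma>" "\<lambda>k. - f (- k)" by (rule cs)
  let ?g = "\<lambda>k. - f (- k)"
  have a': "- a \<in> uminus ` \<Gamma>" using a by simp
  have neg: "bounded_linear (uminus :: real^'n \<Rightarrow> _)" by (rule bounded_linear_minus[OF bounded_linear_ident])
  have df: "f differentiable (at a)"
  proof -
    have "((\<lambda>k. ?g (- k)) has_derivative (\<lambda>v. D (- v) ?g (- a))) (at a)"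
      using diff_chain_at[OF bounded_linear_imp_has_derivative[OF neg] has_derivative_D[OF diff_f[OF a']]]
      by (simp add: o_def)
    from has_derivative_minus[OF this] show ?thesis by (auto simp: differentiable_def)
  qed
  have "((\<lambda>k. f (- k)) has_derivative (\<lambda>v. D (- v) f (- (- a)))) (at (- a))"
    using diff_chain_at[OF bounded_linear_imp_has_derivative[OF neg], of f "\<lambda>v. D v f a" "- a"] has_derivative_D[OF df]
    by (simp add: o_def)
  from D_eq[OF has_derivative_minus[OF this]]
  show gr: "grad ?g (- a) = grad f a"
    using D_linear(2)[OF df, of "-1"] by (simp add: grad_def)
  show "matrix_fun_deriv f (U ** diagm a ** transpose U) = U ** diagm (grad f a) ** transpose U"
  proof (rule matrix_fun_deriv_eqI)
    fix B :: "real^'n^'n" assume B: "transpose B = B"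
    let ?A = "U ** diagm a ** transpose U"
    have dneg: "diagm (- c) = - diagm c" for c :: "real^'n" by (simp add: diagm_def vec_eq_iff)
    have A': "- ?A = U ** diagm (- a) ** transpose U"
      by (simp add: dneg matrix_mult_uminus_left matrix_mult_uminus_right)
    have B': "transpose (- B) = - B" using B by (simp add: transpose_uminus)
    obtain \<delta> where \<delta>: "\<delta> > 0"
      "\<And>s V b. \<bar>s\<bar> < \<delta> \<Longrightarrow> orthogonal_matrix V \<Longrightarrow> - ?A + s *\<^sub>R - B = V ** diagm b ** transpose V \<Longrightarrow> b \<in> uminus ` \<Gamma>"
      using eigenvalues_stable[OF a' U A', of 1 "- B"] by auto
    have eq: "- matrix_fun ?g (- ?A + s *\<^sub>R - B) = matrix_fun f (?A + s *\<^sub>R B)" if s: "s \<in> ball 0 \<delta>" for s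
    proof -
      have sym: "transpose (- ?A + s *\<^sub>R - B) = - ?A + s *\<^sub>R - B"
        using B' by (simp add: transpose_add transpose_scalar transpose_uminus transpose_diff B)
      obtain V b where V: "orthogonal_matrix V" "- ?A + s *\<^sub>R - B = V ** diagm b ** transpose V"
        using symmetric_diagonalization[OF sym] .
      have b: "b \<in> uminus ` \<Gamma>" using \<delta>(2)[OF _ V] s by simp
      have eb: "eigenvalues_wrt (mat 1) (- ?A + s *\<^sub>R - B) b" using eigenvalues_wrt_conj_diagm[OF V(1)] V(2) by simp
      have "?A + s *\<^sub>R B = - (- ?A + s *\<^sub>R - B)" by simp
      also have "\<dots> = V ** diagm (- b) ** transpose V"
        unfolding V(2) by (simp add: dneg matrix_mult_uminus_left matrix_mult_uminus_right)
      finally have eb': "eigenvalues_wrt (mat 1) (?A + s *\<^sub>R B) (- b)" using eigenvalues_wrt_conj_diagm[OF V(1)] by simp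
      have neg_perm: "- (\<chi> i. b $ p i) = (\<chi> i. (- b) $ p i)" for p by (simp add: vec_eq_iff)
      have pf: "f (\<chi> i. (- b) $ p i) = f (- b)" if "bij p" for p
        using perm_f[OF b that] unfolding neg_perm by simp
      have "matrix_fun ?g (- ?A + s *\<^sub>R - B) = ?g b" by (rule matrix_fun_eq[OF eb perm_f[OF b]])
      moreover have "matrix_fun f (?A + s *\<^sub>R B) = f (- b)" by (rule matrix_fun_eq[OF eb' pf])
      ultimately show ?thesis by simp
    qed
    have "((\<lambda>s. - matrix_fun ?g (- ?A + s *\<^sub>R - B)) has_real_derivative - ((U ** diagm (grad f a) ** transpose U) \<bullet> (- B))) (at 0)"
      using DERIV_minus[OF matrix_fun_has_derivative[OF a' U A' B']] unfolding gr .
    then have "((\<lambda>s. - matrix_fun ?g (- ?A + s *\<^sub>R - B)) has_real_derivative (U ** diagm (grad f a) ** transpose U) \<bullet> B) (at 0)"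
      by simp
    then show "((\<lambda>s. matrix_fun f (?A + s *\<^sub>R B)) has_real_derivative (U ** diagm (grad f a) ** transpose U) \<bullet> B) (at 0)"
      by (rule has_field_derivative_transform_within_open[where S="ball 0 \<delta>"]) (use eq \<open>\<delta> > 0\<close> in auto)
  qed simp
qed

section \<open>Frames that are almost orthonormal\<close>

lemma norm_diagm_le: "\<exists>L>0. \<forall>d :: real^'n. norm (diagm d) \<le> L * norm d"
  using bounded_linear.pos_bounded[OF bounded_linear_diagm] by (metis mult.commute)

lemma norm_conj_orthogonal_le:
  "\<exists>L>0. \<forall>(V::real^'n^'n) M. orthogonal_matrix V \<longrightarrow> norm (V ** M ** transpose V) \<le> L * norm M"
proof -
  obtain K where K: "K > 0" "\<And>(A :: real^'n^'n) (B :: real^'n^'n). norm (A ** B) \<le> norm A * norm B * K"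
    using bounded_bilinear.pos_bounded[OF bounded_bilinear_matrix_mult] by metis
  let ?n = "real CARD('n)"
  have "norm (V ** M ** transpose V) \<le> (?n * ?n * K * K) * norm M" if V: "orthogonal_matrix V" for V M :: "real^'n^'n"
  proof -
    have t: "norm (transpose V) \<le> ?n" using norm_orthogonal_matrix_le[of "transpose V"] V by simp
    have v: "norm V \<le> ?n" by (rule norm_orthogonal_matrix_le[OF V])
    have "norm (V ** M ** transpose V) \<le> norm (V ** M) * norm (transpose V) * K" by (rule K)
    also have "\<dots> \<le> (norm V * norm M * K) * norm (transpose V) * K"
      using K by (intro mult_right_mono) auto
    also have "\<dots> \<le> (?n * norm M * K) * ?n * K"
      using K v t by (intro mult_mono mult_nonneg_nonneg) auto
    finally show ?thesis by (simp add: ac_simps)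
  qed
  moreover have "?n * ?n * K * K > 0" using K by simp
  ultimately show ?thesis by blast
qed

text \<open>With \<open>q = sqrt (1 + \<sigma>)\<close> the identity
  \<open>(1 / q - 1) * (q + q\<^sup>2) = 1 - q\<^sup>2 = - \<sigma>\<close> holds, and the second
  factor is at least 1 in the given range.\<close>

lemma inverse_sqrt_estimate:
  fixes \<sigma> :: real
  assumes "\<bar>\<sigma>\<bar> \<le> 1/2"
  shows "\<bar>1 / sqrt (1 + \<sigma>) - 1\<bar> \<le> \<bar>\<sigma>\<bar>"
proof -
  define q where "q = sqrt (1 + \<sigma>)"
  have q: "q > 0" "q\<^sup>2 = 1 + \<sigma>" using assms by (auto simp: q_def)
  have one: "1 \<le> q + q\<^sup>2"
  proof (cases "q \<ge> 1")
    case False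
    then have "q\<^sup>2 \<le> q" using q(1) by (simp add: power2_eq_square mult_left_le)
    moreover have "1/2 \<le> q\<^sup>2" using q(2) assms by linarith
    ultimately show ?thesis by linarith
  next
    case True
    then show ?thesis using zero_le_power2[of q] by linarith
  qed
  have "\<bar>1 / q - 1\<bar> * (q + q\<^sup>2) = \<bar>\<sigma>\<bar>"
  proof -
    have "(1 / q - 1) * (q + q\<^sup>2) = 1 - q\<^sup>2" using q(1) by (simp add: field_simps power2_eq_square)
    then have "\<bar>(1 / q - 1) * (q + q\<^sup>2)\<bar> = \<bar>\<sigma>\<bar>" using q(2) by simp
    then show ?thesis using one by (simp add: abs_mult)
  qed
  moreover have "\<bar>1 / q - 1\<bar> * 1 \<le> \<bar>1 / q - 1\<bar> * (q + q\<^sup>2)" using one by (intro mult_left_mono) auto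
  ultimately show ?thesis by (simp add: q_def)
qed

text \<open>\<open>R\<close> is the inverse square root of \<open>1 + S\<close>, formed eigenvalue
  by eigenvalue in a diagonalization of \<open>S\<close>.\<close>

lemma orthonormal_correction:
  "\<exists>C>0. \<exists>\<epsilon>>0. \<forall>S :: real^'n^'n. transpose S = S \<and> norm S \<le> \<epsilon> \<longrightarrow>
     (\<exists>R. transpose R = R \<and> R ** (mat 1 + S) ** R = mat 1 \<and> norm (R - mat 1) \<le> C * norm S)"
proof -
  obtain L where L: "L > 0" "\<And>(V::real^'n^'n) M. orthogonal_matrix V \<Longrightarrow> norm (V ** M ** transpose V) \<le> L * norm M"
    using norm_conj_orthogonal_le by blast
  obtain L' where L': "L' > 0" "\<And>d :: real^'n. norm (diagm d) \<le> L' * norm d" using norm_diagm_le by blast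
  have "\<exists>R. transpose R = R \<and> R ** (mat 1 + S) ** R = mat 1 \<and> norm (R - mat 1) \<le> (L * L' * real CARD('n) * L) * norm S"
    if S: "transpose S = S" "norm S \<le> 1 / (2 * L)" for S :: "real^'n^'n"
  proof -
    obtain V \<sigma> where V: "orthogonal_matrix V" "S = V ** diagm \<sigma> ** transpose V"
      using symmetric_diagonalization[OF S(1)] .
    have VV: "V ** transpose V = mat 1" "transpose V ** V = mat 1" using V(1) by (simp_all add: orthogonal_matrix_def)
    have "transpose V ** S ** transpose (transpose V) = diagm \<sigma>"
      using orthogonal_conj_conj[OF V(1), of "diagm \<sigma>"] unfolding V(2) by simp
    then have "norm (diagm \<sigma>) \<le> L * norm S"
      using L(2)[of "transpose V" S] V(1) by (simp add: orthogonal_matrix_transpose)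
    moreover have "\<bar>\<sigma> $ i\<bar> \<le> norm (diagm \<sigma>)" for i
      using component_le_norm_cart[of "diagm \<sigma> $ i" i] Finite_Cartesian_Product.norm_nth_le[of "diagm \<sigma>" i] by (simp add: diagm_entry)
    ultimately have \<sigma>: "\<bar>\<sigma> $ i\<bar> \<le> L * norm S" for i by (meson order_trans)
    have "L * norm S \<le> L * (1 / (2 * L))" using S(2) L(1) by (intro mult_left_mono) auto
    then have half: "\<bar>\<sigma> $ i\<bar> \<le> 1/2" for i using \<sigma>[of i] L(1) by simp
    define \<rho> where "\<rho> = (\<chi> i. 1 / sqrt (1 + \<sigma> $ i))"
    define R where "R = V ** diagm \<rho> ** transpose V"
    have one: "diagm \<rho> ** (mat 1 + diagm \<sigma>) ** diagm \<rho> = mat 1"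
    proof -
      have e: "mat 1 + diagm \<sigma> = diagm (\<chi> i. 1 + \<sigma> $ i)" by (simp add: diagm_def mat_def vec_eq_iff)
      have dd: "diagm x ** diagm y = diagm (\<chi> i. x $ i * y $ i)" for x y :: "real^'n"
      proof -
        have "(\<Sum>k\<in>UNIV. diagm x $ i $ k * diagm y $ k $ j) = (\<Sum>k\<in>UNIV. if k = i then x $ i * diagm y $ i $ j else 0)" for i j
          by (intro sum.cong) (auto simp: diagm_entry)
        then show ?thesis by (simp add: matrix_matrix_mult_def vec_eq_iff diagm_entry)
      qed
      have r: "\<rho> $ i * (1 + \<sigma> $ i) * \<rho> $ i = 1" for i
      proof -
        have "1 + \<sigma> $ i > 0" using half[of i] by linarith
        then show ?thesis by (simp add: \<rho>_def field_simps)
      qed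
      show ?thesis unfolding e dd using r by (simp add: diagm_def mat_def vec_eq_iff)
    qed
    have "R ** (mat 1 + S) ** R = V ** diagm \<rho> ** (transpose V ** (mat 1 + S) ** V) ** diagm \<rho> ** transpose V"
      unfolding R_def by (simp only: matrix_mul_assoc)
    also have "transpose V ** (mat 1 + S) ** V = mat 1 + diagm \<sigma>"
      unfolding V(2) by (simp add: matrix_mult_add_left matrix_mult_add_right VV orthogonal_conj_conj[OF V(1)])
    also have "V ** diagm \<rho> ** (mat 1 + diagm \<sigma>) ** diagm \<rho> ** transpose V = V ** (diagm \<rho> ** (mat 1 + diagm \<sigma>) ** diagm \<rho>) ** transpose V"
      by (simp only: matrix_mul_assoc)
    also have "\<dots> = mat 1" by (simp add: one VV)
    finally have R1: "R ** (mat 1 + S) ** R = mat 1" .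
    have "diagm \<rho> - mat 1 = diagm (\<rho> - (\<chi> i. 1))" by (simp add: diagm_def mat_def vec_eq_iff)
    then have "R - mat 1 = V ** diagm (\<rho> - (\<chi> i. 1)) ** transpose V"
      unfolding R_def by (metis VV(1) matrix_mul_rid matrix_mult_diff_left matrix_mult_diff_right)
    then have "norm (R - mat 1) \<le> L * norm (diagm (\<rho> - (\<chi> i. 1)))"
      using L(2)[OF V(1), of "diagm (\<rho> - (\<chi> i. 1))"] by simp
    also have "\<dots> \<le> L * (L' * norm (\<rho> - (\<chi> i. 1)))" using L(1) L'(2) by (intro mult_left_mono) auto
    finally have 1: "norm (R - mat 1) \<le> L * (L' * norm (\<rho> - (\<chi> i. 1)))" .
    have "norm (\<rho> - (\<chi> i. 1)) \<le> (\<Sum>i\<in>UNIV. \<bar>(\<rho> - (\<chi> i. 1)) $ i\<bar>)" by (rule norm_le_l1_cart)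
    also have "\<dots> \<le> (\<Sum>i\<in>(UNIV::'n set). L * norm S)"
      using inverse_sqrt_estimate[OF half] \<sigma> by (intro sum_mono) (auto simp: \<rho>_def intro: order_trans)
    finally have 2: "norm (\<rho> - (\<chi> i. 1)) \<le> real CARD('n) * (L * norm S)" by simp
    have "L * (L' * norm (\<rho> - (\<chi> i. 1))) \<le> L * (L' * (real CARD('n) * (L * norm S)))"
      using 2 L(1) L'(1) by (intro mult_left_mono) auto
    with 1 have "norm (R - mat 1) \<le> (L * L' * real CARD('n) * L) * norm S"
      by (simp add: ac_simps)
    moreover have "transpose R = R" by (simp add: R_def)
    ultimately show ?thesis using R1 by blast
  qed
  moreover have "L * L' * real CARD('n) * L > 0" "1 / (2 * L) > 0" using L(1) L'(1) by auto
  ultimately show ?thesis by blast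
qed

text \<open>To first order the frame \<open>J = 1 - \<eta> / 2\<close> is already orthonormal for
  \<open>1 + \<eta>\<close>; its defect is quadratic in \<eta> and is removed by
  \<open>orthonormal_correction\<close>. Expanding \<open>J ** h ** J\<close> gives the first order
  change of the components of \<open>h\<close>.\<close>

lemma near_orthonormal_frame:
  "\<exists>C>0. \<exists>\<epsilon>>0. \<forall>\<eta> h :: real^'n^'n. transpose \<eta> = \<eta> \<and> norm \<eta> \<le> \<epsilon> \<longrightarrow>
     (\<exists>E. transpose E ** (mat 1 + \<eta>) ** E = mat 1 \<and>
       norm (transpose E ** h ** E - (h - (1/2) *\<^sub>R (\<eta> ** h + h ** \<eta>))) \<le> C * norm h * (norm \<eta>)\<^sup>2)"
proof -
  obtain K where K0: "K > 0" and K: "\<And>(A :: real^'n^'n) (B :: real^'n^'n). norm (A ** B) \<le> norm A * norm B * K"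
    using bounded_bilinear.pos_bounded[OF bounded_bilinear_matrix_mult] by metis
  obtain C \<delta> where C: "C > 0" "\<delta> > 0" "\<And>S :: real^'n^'n. transpose S = S \<Longrightarrow> norm S \<le> \<delta> \<Longrightarrow>
     \<exists>R. transpose R = R \<and> R ** (mat 1 + S) ** R = mat 1 \<and> norm (R - mat 1) \<le> C * norm S"
    using orthonormal_correction by blast
  define c where "c = K + K * K"
  have c: "c > 0" using K0 by (simp add: c_def add_pos_pos)
  \<comment> \<open>The bound \<open>\<delta> / c\<close> makes the defect \<open>S\<close> small
    enough for the correction, and \<open>1 / (C * c)\<close> makes \<open>P = R - 1\<close> have
    norm at most 1, so that terms quadratic in \<open>P\<close> are controlled by linear
    ones.\<close>
  define \<epsilon> where "\<epsilon> = min 1 (min (\<delta> / c) (1 / (C * c)))"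
  have \<epsilon>: "\<epsilon> > 0" "\<epsilon> \<le> 1" "\<epsilon> \<le> \<delta> / c" "\<epsilon> \<le> 1 / (C * c)" using C c by (auto simp: \<epsilon>_def)
  define m where "m = 1 + K + K * K"
  define C' where "C' = K * K + C * c * m * K * (K + 2)"
  have m: "m > 0" using K0 by (simp add: m_def add_pos_pos)
  have C': "C' > 0" using K0 C c m by (simp add: C'_def add_pos_pos)
  have Kle: "norm (A ** B) \<le> a * b * K" if "norm A \<le> a" "norm B \<le> b" for A B :: "real^'n^'n" and a b
    using K[of A B] K0 that by (meson mult_mono mult_right_mono norm_ge_zero order_trans less_imp_le)
  have frac: "norm (r *\<^sub>R A) \<le> b" if "norm A \<le> b" "0 \<le> r" "r \<le> 1" for A :: "real^'n^'n" and b r :: real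
    using that mult_left_le_one_le[of "norm A" r] by simp
  have "\<exists>E. transpose E ** (mat 1 + \<eta>) ** E = mat 1 \<and>
       norm (transpose E ** h ** E - (h - (1/2) *\<^sub>R (\<eta> ** h + h ** \<eta>))) \<le> C' * norm h * (norm \<eta>)\<^sup>2"
    if \<eta>: "transpose \<eta> = \<eta>" "norm \<eta> \<le> \<epsilon>" for \<eta> h :: "real^'n^'n"
  proof -
    define x where "x = norm \<eta>"
    have x: "0 \<le> x" "x \<le> 1" "x \<le> \<epsilon>" using \<eta>(2) \<epsilon> by (auto simp: x_def)
    have xx: "x\<^sup>2 \<le> x" using x by (simp add: power2_eq_square mult_left_le)
    define J where "J = mat 1 - (1/2) *\<^sub>R \<eta>"
    have Jt: "transpose J = J" using \<eta>(1) by (simp add: J_def transpose_diff transpose_scalar)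
    define S where "S = J ** (mat 1 + \<eta>) ** J - mat 1"
    have St: "transpose S = S"
      by (simp add: S_def transpose_diff matrix_transpose_mul Jt \<eta>(1) transpose_add matrix_mul_assoc)
    \<comment> \<open>The linear terms cancel: (1 - x/2)^2 (1 + x) = 1 - 3 x^2 / 4 + x^3 /
      4.\<close>
    have S: "S = (1/4) *\<^sub>R (\<eta> ** \<eta> ** \<eta>) - (3/4) *\<^sub>R (\<eta> ** \<eta>)"
      unfolding S_def J_def
      by (simp add: matrix_mult_diff_left matrix_mult_diff_right matrix_mult_add_left matrix_mult_add_right
          matrix_mult_scaleR_left matrix_mult_scaleR_right)
         (simp add: vec_eq_iff algebra_simps)
    have n2: "norm (\<eta> ** \<eta>) \<le> K * x\<^sup>2" using K[of \<eta> \<eta>] by (simp add: x_def power2_eq_square ac_simps)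
    have n3: "norm (\<eta> ** \<eta> ** \<eta>) \<le> K * K * x\<^sup>2"
    proof -
      have "norm (\<eta> ** \<eta> ** \<eta>) \<le> (K * x\<^sup>2) * 1 * K" using x by (intro Kle n2) (simp add: x_def)
      then show ?thesis by (simp add: ac_simps)
    qed
    have "norm S \<le> norm ((1/4) *\<^sub>R (\<eta> ** \<eta> ** \<eta>)) + norm ((3/4) *\<^sub>R (\<eta> ** \<eta>))"
      unfolding S by (rule norm_triangle_ineq4)
    also have "\<dots> \<le> K * K * x\<^sup>2 + K * x\<^sup>2"
    proof (rule add_mono)
      show "norm ((1/4) *\<^sub>R (\<eta> ** \<eta> ** \<eta>)) \<le> K * K * x\<^sup>2" by (rule frac[OF n3]) auto
      show "norm ((3/4) *\<^sub>R (\<eta> ** \<eta>)) \<le> K * x\<^sup>2" by (rule frac[OF n2]) auto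
    qed
    also have "\<dots> = c * x\<^sup>2" by (simp add: c_def algebra_simps)
    finally have nS: "norm S \<le> c * x\<^sup>2" .
    have "c * x\<^sup>2 \<le> c * \<epsilon>" using c xx x by (intro mult_left_mono) auto
    also have "\<dots> \<le> \<delta>" using \<epsilon>(3) c by (simp add: field_simps)
    finally have "norm S \<le> \<delta>" using nS by simp
    then obtain R where R: "transpose R = R" "R ** (mat 1 + S) ** R = mat 1" "norm (R - mat 1) \<le> C * norm S"
      using C(3)[OF St] by blast
    define P where "P = R - mat 1"
    have "C * norm S \<le> C * (c * x\<^sup>2)" using nS C(1) by (intro mult_left_mono) auto
    then have nP: "norm P \<le> C * c * x\<^sup>2" using R(3) by (simp add: P_def)
    have "C * c * x\<^sup>2 \<le> C * c * \<epsilon>" using C c xx x by (intro mult_left_mono) auto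
    also have "\<dots> \<le> 1" using \<epsilon>(4) C c by (simp add: field_simps)
    finally have nP1: "norm P \<le> 1" using nP by simp
    define M where "M = J ** h ** J"
    have M: "M = h - (1/2) *\<^sub>R (\<eta> ** h + h ** \<eta>) + (1/4) *\<^sub>R (\<eta> ** h ** \<eta>)"
      unfolding M_def J_def
      by (simp add: matrix_mult_diff_left matrix_mult_diff_right matrix_mult_scaleR_left matrix_mult_scaleR_right)
         (simp add: vec_eq_iff algebra_simps)
    have h1: "norm (\<eta> ** h) \<le> 1 * norm h * K" "norm (h ** \<eta>) \<le> norm h * 1 * K"
      using x by (intro Kle; simp add: x_def)+
    have h2: "norm (\<eta> ** h ** \<eta>) \<le> (x * norm h * K) * x * K"
      by (intro Kle) (simp_all add: x_def)
    then have h2': "norm (\<eta> ** h ** \<eta>) \<le> K * K * norm h * x\<^sup>2" by (simp add: power2_eq_square ac_simps)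
    have "K * K * norm h * x\<^sup>2 \<le> K * K * norm h * 1" using xx x K0 by (intro mult_left_mono) auto
    then have h2'': "norm (\<eta> ** h ** \<eta>) \<le> K * K * norm h" using h2' by simp
    have nM: "norm M \<le> m * norm h"
    proof -
      have "norm M \<le> norm (h - (1/2) *\<^sub>R (\<eta> ** h + h ** \<eta>)) + norm ((1/4) *\<^sub>R (\<eta> ** h ** \<eta>))"
        unfolding M by (rule norm_triangle_ineq)
      also have "norm (h - (1/2) *\<^sub>R (\<eta> ** h + h ** \<eta>)) \<le> norm h + norm ((1/2) *\<^sub>R (\<eta> ** h + h ** \<eta>))"
        by (rule norm_triangle_ineq4)
      also have "norm ((1/2) *\<^sub>R (\<eta> ** h + h ** \<eta>)) \<le> 1/2 * (norm (\<eta> ** h) + norm (h ** \<eta>))"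
        using norm_triangle_ineq[of "\<eta> ** h" "h ** \<eta>"] by simp
      also have "\<dots> \<le> norm h * K" using h1 by simp
      also have "norm ((1/4) *\<^sub>R (\<eta> ** h ** \<eta>)) \<le> K * K * norm h"
        by (rule frac[OF h2'']) auto
      finally show ?thesis by (simp add: m_def algebra_simps)
    qed
    define E where "E = J ** R"
    have Et: "transpose E = R ** J" by (simp add: E_def matrix_transpose_mul R(1) Jt)
    have "transpose E ** (mat 1 + \<eta>) ** E = R ** (J ** (mat 1 + \<eta>) ** J) ** R"
      by (simp only: Et) (simp only: E_def matrix_mul_assoc)
    also have "J ** (mat 1 + \<eta>) ** J = mat 1 + S" by (simp add: S_def)
    finally have E1: "transpose E ** (mat 1 + \<eta>) ** E = mat 1" using R(2) by simp
    have R': "R = mat 1 + P" by (simp add: P_def)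
    have "transpose E ** h ** E = R ** M ** R" by (simp only: Et) (simp only: E_def M_def matrix_mul_assoc)
    then have "transpose E ** h ** E - M = P ** M ** P + (P ** M + M ** P)"
      unfolding R' by (simp add: matrix_mult_add_left matrix_mult_add_right)
    then have "transpose E ** h ** E - (h - (1/2) *\<^sub>R (\<eta> ** h + h ** \<eta>)) = P ** M ** P + (P ** M + M ** P) + (1/4) *\<^sub>R (\<eta> ** h ** \<eta>)"
      unfolding M by (simp add: algebra_simps)
    then have "norm (transpose E ** h ** E - (h - (1/2) *\<^sub>R (\<eta> ** h + h ** \<eta>)))
        \<le> norm (P ** M ** P) + (norm (P ** M) + norm (M ** P)) + norm ((1/4) *\<^sub>R (\<eta> ** h ** \<eta>))"
      using norm_triangle_ineq[of "P ** M ** P + (P ** M + M ** P)" "(1/4) *\<^sub>R (\<eta> ** h ** \<eta>)"]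
        norm_triangle_ineq[of "P ** M ** P" "P ** M + M ** P"] norm_triangle_ineq[of "P ** M" "M ** P"] by simp
    also have "\<dots> \<le> (C * c * x\<^sup>2 * (m * norm h) * K) * 1 * K
        + (C * c * x\<^sup>2 * (m * norm h) * K + m * norm h * (C * c * x\<^sup>2) * K) + K * K * norm h * x\<^sup>2"
    proof (intro add_mono)
      show "norm (P ** M ** P) \<le> (C * c * x\<^sup>2 * (m * norm h) * K) * 1 * K" by (intro Kle nP nP1 nM)
      show "norm (P ** M) \<le> C * c * x\<^sup>2 * (m * norm h) * K" by (intro Kle nP nM)
      show "norm (M ** P) \<le> m * norm h * (C * c * x\<^sup>2) * K" by (intro Kle nP nM)
      show "norm ((1/4) *\<^sub>R (\<eta> ** h ** \<eta>)) \<le> K * K * norm h * x\<^sup>2"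
        by (rule frac[OF h2']) auto
    qed
    also have "\<dots> = C' * norm h * x\<^sup>2" by (simp add: C'_def algebra_simps)
    finally show ?thesis using E1 unfolding x_def by blast
  qed
  then show ?thesis using C' \<epsilon>(1) by blast
qed

section \<open>Second order conditions\<close>

text \<open>A cubic error is invisible to a second derivative. If \<open>L\<close> were negative,
  integrating \<phi>' would give a quadratic upper bound with negative coefficient, which falls
  below the cubic lower bound for small \<open>s\<close>.\<close>

lemma second_derivative_test_real:
  fixes \<phi> \<phi>' :: "real \<Rightarrow> real"
  assumes "\<delta> > 0" and lower: "\<And>s. \<bar>s\<bar> < \<delta> \<Longrightarrow> - C * \<bar>s\<bar>^3 \<le> \<phi> s" and "\<phi> 0 = 0"
    and der: "\<And>s. \<bar>s\<bar> < \<delta> \<Longrightarrow> (\<phi> has_real_derivative \<phi>' s) (at s)"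
    and der2: "(\<phi>' has_real_derivative L) (at 0)"
  shows "\<phi>' 0 = 0" "0 \<le> L"
proof -
  have lim: "((\<lambda>s. \<phi> s / s) \<longlongrightarrow> \<phi>' 0) (at 0)"
    using der[of 0] assms(1,3) by (simp add: has_field_derivative_iff)
  have cube: "((\<lambda>s::real. C * s^2) \<longlongrightarrow> 0) (at_right 0)" "((\<lambda>s::real. C * s^2) \<longlongrightarrow> 0) (at_left 0)"
    by (auto intro!: tendsto_eq_intros)
  have "0 \<le> \<phi>' 0"
  proof (rule tendsto_le[OF _ _ tendsto_minus[OF cube(1), simplified]])
    show "((\<lambda>s. \<phi> s / s) \<longlongrightarrow> \<phi>' 0) (at_right 0)"
      by (rule filterlim_mono[OF lim order_refl at_le]) auto
    have "- (C * s\<^sup>2) \<le> \<phi> s / s" if "0 < s" "s < \<delta>" for s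
      using lower[of s] that by (simp add: field_simps power2_eq_square power3_eq_cube)
    then show "\<forall>\<^sub>F s in at_right 0. - (C * s\<^sup>2) \<le> \<phi> s / s"
      using \<open>\<delta> > 0\<close> unfolding eventually_at_right_field by (intro exI[of _ \<delta>]) auto
  qed auto
  moreover have "\<phi>' 0 \<le> 0"
  proof (rule tendsto_le[OF _ cube(2)])
    show "((\<lambda>s. \<phi> s / s) \<longlongrightarrow> \<phi>' 0) (at_left 0)"
      by (rule filterlim_mono[OF lim order_refl at_le]) auto
    have "\<phi> s / s \<le> C * s\<^sup>2" if "s < 0" "- \<delta> < s" for s
    proof -
      have "C * s ^ 3 \<le> \<phi> s" using lower[of s] that by (simp add: power3_eq_cube)
      then show ?thesis using that by (simp add: field_simps power2_eq_square power3_eq_cube)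
    qed
    then show "\<forall>\<^sub>F s in at_left 0. \<phi> s / s \<le> C * s\<^sup>2"
      using \<open>\<delta> > 0\<close> unfolding eventually_at_left_field by (intro exI[of _ "-\<delta>"]) auto
  qed auto
  ultimately show p0: "\<phi>' 0 = 0" by simp
  show "0 \<le> L"
  proof (rule ccontr)
    assume "\<not> 0 \<le> L"
    define m where "m = - L / 2"
    have m: "m > 0" using \<open>\<not> 0 \<le> L\<close> by (simp add: m_def)
    have "((\<lambda>s. \<phi>' s / s) \<longlongrightarrow> L) (at 0)" using der2 p0 by (simp add: has_field_derivative_iff)
    moreover have "L < - m" using m by (simp add: m_def)
    ultimately have "\<forall>\<^sub>F s in at 0. \<phi>' s / s < - m" by (rule order_tendstoD(2))
    then obtain d where d: "d > 0" "\<And>s. s \<noteq> 0 \<Longrightarrow> \<bar>s\<bar> < d \<Longrightarrow> \<phi>' s / s < - m"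
      by (auto simp: eventually_at dist_real_def)
    \<comment> \<open>Chosen so that \<open>2 * (\<bar>C\<bar> + 1) * q = m\<close>: below
      \<open>q\<close> the quadratic term beats the cubic one. The summand 1 keeps the denominator
      positive.\<close>
    define q where "q = m / (2 * (\<bar>C\<bar> + 1))"
    have "q > 0" using m by (simp add: q_def)
    define s where "s = min (min d \<delta>) q / 2"
    have s: "s > 0" "s < d" "s < \<delta>" "s < q" using d \<open>\<delta> > 0\<close> \<open>q > 0\<close> by (auto simp: s_def min_def)
    have "\<phi> s + m * s\<^sup>2 / 2 \<le> \<phi> 0 + m * 0\<^sup>2 / 2"
    proof (rule DERIV_nonpos_imp_nonincreasing[where f="\<lambda>s. \<phi> s + m * s\<^sup>2 / 2"])
      show "0 \<le> s" using s by simp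
      fix x assume x: "0 \<le> x" "x \<le> s"
      have "((\<lambda>s. \<phi> s + m * s\<^sup>2 / 2) has_real_derivative \<phi>' x + m * x) (at x)"
        using der[of x] x s by (auto intro!: derivative_eq_intros)
      moreover have "\<phi>' x + m * x \<le> 0"
      proof (cases "x = 0")
        case False
        then have "\<phi>' x / x < - m" using d(2)[of x] x s by auto
        then show ?thesis using x False by (simp add: field_simps)
      qed (simp add: p0)
      ultimately show "\<exists>y. ((\<lambda>s. \<phi> s + m * s\<^sup>2 / 2) has_real_derivative y) (at x) \<and> y \<le> 0" by blast
    qed
    then have "m * s\<^sup>2 / 2 \<le> C * s ^ 3" using lower[of s] s \<open>\<phi> 0 = 0\<close> by simp
    then have "m * s\<^sup>2 \<le> (2 * C * s) * s\<^sup>2" by (simp add: power2_eq_square power3_eq_cube)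
    then have "m \<le> 2 * C * s" using s(1) by (simp add: mult_le_cancel_right)
    also have "\<dots> \<le> 2 * (\<bar>C\<bar> + 1) * s" using s(1) by (intro mult_right_mono) auto
    also have "\<dots> < 2 * (\<bar>C\<bar> + 1) * q" using s(4) by (intro mult_strict_left_mono) auto
    also have "\<dots> = m" by (simp add: q_def)
    finally show False by simp
  qed
qed

lemma eventually_on_line:
  fixes x :: "'a::real_normed_vector"
  assumes "open S" "x \<in> S"
  shows "\<exists>\<delta>>0. \<forall>s. \<bar>s\<bar> < \<delta> \<longrightarrow> x + s *\<^sub>R v \<in> S"
proof -
  have "open ((\<lambda>s. x + s *\<^sub>R v) -` S)" by (rule open_vimage[OF assms(1)]) (intro continuous_intros)
  moreover have "0 \<in> (\<lambda>s. x + s *\<^sub>R v) -` S" using assms by simp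
  ultimately obtain d where "d > 0" "ball 0 d \<subseteq> (\<lambda>s. x + s *\<^sub>R v) -` S" using open_contains_ball by blast
  then show ?thesis by (intro exI[of _ d]) (auto simp: subset_iff)
qed

lemma line_derivatives:
  fixes f :: "'a::real_normed_vector \<Rightarrow> real"
  assumes S: "open S" "x \<in> S" and f: "Ck_on 2 f S"
  obtains \<delta> where "\<delta> > 0" "\<And>s. \<bar>s\<bar> < \<delta> \<Longrightarrow> x + s *\<^sub>R v \<in> S"
    "\<And>s. \<bar>s\<bar> < \<delta> \<Longrightarrow> ((\<lambda>s. f (x + s *\<^sub>R v)) has_real_derivative D v f (x + s *\<^sub>R v)) (at s)"
    "((\<lambda>s. D v f (x + s *\<^sub>R v)) has_real_derivative D v (D v f) x) (at 0)"
proof -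
  obtain \<delta> where \<delta>: "\<delta> > 0" "\<And>s. \<bar>s\<bar> < \<delta> \<Longrightarrow> x + s *\<^sub>R v \<in> S" using eventually_on_line[OF S] by blast
  have "Ck_on (Suc 0) f S" "Ck_on (Suc 0) (D v f) S"
    using Ck_on_D[OF S(1), of "Suc 0" f v] f by (auto simp: numeral_2_eq_2 dest: Ck_on_SucD simp del: Ck_on.simps)
  note d = this[THEN Ck_on_differentiable[OF S(1)]]
  have 1: "((\<lambda>s. f (x + s *\<^sub>R v)) has_real_derivative D v f (x + s *\<^sub>R v)) (at s)" if "\<bar>s\<bar> < \<delta>" for s
    using D_along_line[OF d(1)[OF \<delta>(2)[OF that]]] by (simp add: has_real_derivative_iff_has_vector_derivative)
  have 2: "((\<lambda>s. D v f (x + s *\<^sub>R v)) has_real_derivative D v (D v f) x) (at 0)"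
    using D_along_line[of "D v f" x 0 v] d(2)[OF S(2)] by (simp add: has_real_derivative_iff_has_vector_derivative)
  show ?thesis by (rule that[OF \<delta> 1 2])
qed

lemma second_derivative_test:
  fixes f :: "'a::real_normed_vector \<Rightarrow> real"
  assumes S: "open S" "x \<in> S" and f: "Ck_on 2 f S" "f x = 0"
    and lower: "\<rho> > 0" "\<And>s. \<bar>s\<bar> < \<rho> \<Longrightarrow> - C * \<bar>s\<bar>^3 \<le> f (x + s *\<^sub>R v)"
  shows "D v f x = 0" "0 \<le> D v (D v f) x"
proof -
  obtain \<delta> where \<delta>: "\<delta> > 0"
    "\<And>s. \<bar>s\<bar> < \<delta> \<Longrightarrow> ((\<lambda>s. f (x + s *\<^sub>R v)) has_real_derivative D v f (x + s *\<^sub>R v)) (at s)"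
    "((\<lambda>s. D v f (x + s *\<^sub>R v)) has_real_derivative D v (D v f) x) (at 0)"
    using line_derivatives[OF S f(1), of v] by metis
  have "min \<delta> \<rho> > 0" using \<delta> lower by simp
  note * = second_derivative_test_real[OF this, of C "\<lambda>s. f (x + s *\<^sub>R v)" "\<lambda>s. D v f (x + s *\<^sub>R v)", OF _ _ _ \<delta>(3)]
  show "D v f x = 0" "0 \<le> D v (D v f) x" using * lower \<delta> f(2) by auto
qed

text \<open>The contact condition compares with earlier times only, so the sign is read off
  difference quotients from the left, and just an inequality results.\<close>

lemma first_derivative_test_backwards:
  fixes f :: "'a::real_normed_vector \<Rightarrow> real"
  assumes f: "f differentiable (at x)" "f x = 0"
    and lower: "\<rho> > 0" "\<And>s. - \<rho> < s \<Longrightarrow> s \<le> 0 \<Longrightarrow> 0 \<le> f (x + s *\<^sub>R v)"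
  shows "D v f x \<le> 0"
proof -
  have "((\<lambda>s. f (x + s *\<^sub>R v)) has_real_derivative D v f x) (at 0)"
    using D_along_line[of f x 0 v] f(1) by (simp add: has_real_derivative_iff_has_vector_derivative)
  then have "((\<lambda>s. f (x + s *\<^sub>R v) / s) \<longlongrightarrow> D v f x) (at 0)" using f(2) by (simp add: has_field_derivative_iff)
  then have lim: "((\<lambda>s. f (x + s *\<^sub>R v) / s) \<longlongrightarrow> D v f x) (at_left 0)"
    by (rule filterlim_mono[OF _ order_refl at_le]) auto
  have "f (x + s *\<^sub>R v) / s \<le> 0" if "s < 0" "- \<rho> < s" for s
    using lower(2)[of s] that by (simp add: divide_nonneg_neg)
  then have "\<forall>\<^sub>F s in at_left 0. f (x + s *\<^sub>R v) / s \<le> 0"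
    using lower(1) unfolding eventually_at_left_field by (intro exI[of _ "-\<rho>"]) auto
  from tendsto_upperbound[OF lim this] show ?thesis by simp
qed

lemma quadratic_bound:
  fixes f :: "'a::real_normed_vector \<Rightarrow> real"
  assumes S: "open S" "x \<in> S" and f: "Ck_on 2 f S" "f x = 0" "D v f x = 0"
  shows "\<exists>C \<delta>. \<delta> > 0 \<and> (\<forall>s. \<bar>s\<bar> < \<delta> \<longrightarrow> \<bar>f (x + s *\<^sub>R v)\<bar> \<le> C * s\<^sup>2)"
proof -
  obtain \<delta> where \<delta>: "\<delta> > 0"
    "\<And>s. \<bar>s\<bar> < \<delta> \<Longrightarrow> ((\<lambda>s. f (x + s *\<^sub>R v)) has_real_derivative D v f (x + s *\<^sub>R v)) (at s)"
    "((\<lambda>s. D v f (x + s *\<^sub>R v)) has_real_derivative D v (D v f) x) (at 0)"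
    using line_derivatives[OF S f(1), of v] by metis
  define L where "L = \<bar>D v (D v f) x\<bar> + 1"
  have "((\<lambda>s. D v f (x + s *\<^sub>R v) / s) \<longlongrightarrow> D v (D v f) x) (at 0)"
    using \<delta>(3) f(3) by (simp add: has_field_derivative_iff)
  then have "((\<lambda>s. \<bar>D v f (x + s *\<^sub>R v) / s\<bar>) \<longlongrightarrow> \<bar>D v (D v f) x\<bar>) (at 0)" by (rule tendsto_rabs)
  then have "\<forall>\<^sub>F s in at 0. \<bar>D v f (x + s *\<^sub>R v) / s\<bar> < L" by (rule order_tendstoD(2)) (simp add: L_def)
  then obtain d where d: "d > 0" "\<And>s. s \<noteq> 0 \<Longrightarrow> \<bar>s\<bar> < d \<Longrightarrow> \<bar>D v f (x + s *\<^sub>R v) / s\<bar> < L"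
    by (auto simp: eventually_at dist_real_def)
  have slope: "\<bar>D v f (x + s *\<^sub>R v)\<bar> \<le> L * \<bar>s\<bar>" if "\<bar>s\<bar> < d" for s
  proof (cases "s = 0")
    case False
    then show ?thesis using d(2)[OF False that] by (simp add: abs_divide field_simps)
  qed (simp add: f(3))
  have "\<bar>f (x + s *\<^sub>R v)\<bar> \<le> L * s\<^sup>2" if s: "\<bar>s\<bar> < min d \<delta>" for s
  proof -
    have "norm (f (x + s *\<^sub>R v) - f (x + 0 *\<^sub>R v)) \<le> (L * \<bar>s\<bar>) * norm (s - 0)"
    proof (rule field_differentiable_bound[where S="{-\<bar>s\<bar>..\<bar>s\<bar>}" and f'="\<lambda>s. D v f (x + s *\<^sub>R v)"])
      fix r assume r: "r \<in> {-\<bar>s\<bar>..\<bar>s\<bar>}"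
      show "((\<lambda>s. f (x + s *\<^sub>R v)) has_real_derivative D v f (x + r *\<^sub>R v)) (at r within {-\<bar>s\<bar>..\<bar>s\<bar>})"
        using \<delta>(2)[of r] r s by (auto intro: has_field_derivative_at_within)
      have "\<bar>D v f (x + r *\<^sub>R v)\<bar> \<le> L * \<bar>r\<bar>" using slope[of r] r s by auto
      also have "\<dots> \<le> L * \<bar>s\<bar>" using r by (intro mult_left_mono) (auto simp: L_def)
      finally show "norm (D v f (x + r *\<^sub>R v)) \<le> L * \<bar>s\<bar>" by simp
    qed auto
    then show ?thesis using f(2) by (simp add: power2_eq_square ac_simps)
  qed
  moreover have "min d \<delta> > 0" using d \<delta> by simp
  ultimately show ?thesis by blast
qed

lemma linear_bound:
  fixes f :: "'a::real_normed_vector \<Rightarrow> real"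
  assumes f: "f differentiable (at x)"
  shows "\<exists>C \<delta>. \<delta> > 0 \<and> (\<forall>s. \<bar>s\<bar> < \<delta> \<longrightarrow> \<bar>f (x + s *\<^sub>R v) - f x\<bar> \<le> C * \<bar>s\<bar>)"
proof -
  define L where "L = \<bar>D v f x\<bar> + 1"
  have "((\<lambda>s. f (x + s *\<^sub>R v)) has_real_derivative D v f x) (at 0)"
    using D_along_line[of f x 0 v] f(1) by (simp add: has_real_derivative_iff_has_vector_derivative)
  then have "((\<lambda>s. (f (x + s *\<^sub>R v) - f x) / s) \<longlongrightarrow> D v f x) (at 0)" by (simp add: has_field_derivative_iff)
  then have "((\<lambda>s. \<bar>(f (x + s *\<^sub>R v) - f x) / s\<bar>) \<longlongrightarrow> \<bar>D v f x\<bar>) (at 0)" by (rule tendsto_rabs)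
  then have "\<forall>\<^sub>F s in at 0. \<bar>(f (x + s *\<^sub>R v) - f x) / s\<bar> < L" by (rule order_tendstoD(2)) (simp add: L_def)
  then obtain d where d: "d > 0" "\<And>s. s \<noteq> 0 \<Longrightarrow> \<bar>s\<bar> < d \<Longrightarrow> \<bar>(f (x + s *\<^sub>R v) - f x) / s\<bar> < L"
    by (auto simp: eventually_at dist_real_def)
  have "\<bar>f (x + s *\<^sub>R v) - f x\<bar> \<le> L * \<bar>s\<bar>" if "\<bar>s\<bar> < d" for s
  proof (cases "s = 0")
    case False
    then show ?thesis using d(2)[OF False that] by (simp add: abs_divide field_simps)
  qed simp
  then show ?thesis using d(1) by blast
qed

text \<open>In codimension one the frame and the normal together have as many orthonormal vectors as
  the ambient dimension, so they span and a vector is determined by its products with them.\<close>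

lemma orthonormal_basis_expansion:
  fixes u :: "'n::finite \<Rightarrow> real^'m::finite" and N :: "real^'m"
  assumes card: "CARD('m) = CARD('n) + 1" and u: "\<And>i j. u i \<bullet> u j = (if i = j then 1 else 0)"
    and N: "N \<bullet> N = 1" "\<And>i. u i \<bullet> N = 0"
    and eq: "\<And>i. x \<bullet> u i = y \<bullet> u i" "x \<bullet> N = y \<bullet> N"
  shows "x = y"
proof -
  have inj: "inj u"
  proof (rule injI, rule ccontr)
    fix i j assume "u i = u j" "i \<noteq> j"
    then show False using u[of i j] u[of i i] by simp
  qed
  have notin: "N \<notin> range u" using N by auto
  let ?B = "insert N (range u)"
  have "pairwise orthogonal ?B"
    unfolding pairwise_insert
    using N u by (auto simp: pairwise_def orthogonal_def inner_commute inj_def split: if_splits)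
  moreover have "0 \<notin> ?B" using N(1) u by auto (metis inner_zero_left zero_neq_one)
  ultimately have "independent ?B" by (rule pairwise_orthogonal_independent)
  moreover have "card ?B = DIM(real^'m)" using notin inj card by (simp add: card_image)
  ultimately have "span ?B = UNIV"
    using card_ge_dim_independent[of ?B UNIV] by auto
  then have "x - y \<in> span ?B" by simp
  moreover have "orthogonal (x - y) b" if "b \<in> ?B" for b
    using that eq by (auto simp: orthogonal_def inner_diff_left)
  ultimately have "orthogonal (x - y) (x - y)" by (metis orthogonal_to_span)
  then show ?thesis by (simp add: orthogonal_self)
qed

lemma D2_congs:
  fixes f g :: "'a::real_normed_vector \<Rightarrow> 'b::real_normed_vector"
  assumes S: "open S" "x \<in> S" and f: "Ck_on 2 f S" and g: "Ck_on 2 g S"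
  shows D2_add: "D v (D w (\<lambda>x. f x + g x)) x = D v (D w f) x + D v (D w g) x"
    and D2_diff: "D v (D w (\<lambda>x. f x - g x)) x = D v (D w f) x - D v (D w g) x"
proof -
  have 1: "Ck_on (Suc 0) f S" "Ck_on (Suc 0) g S" "Ck_on (Suc 0) (D w f) S" "Ck_on (Suc 0) (D w g) S"
    using Ck_on_D[OF S(1), of "Suc 0" f w] Ck_on_D[OF S(1), of "Suc 0" g w] f g
    by (auto simp: numeral_2_eq_2 dest: Ck_on_SucD simp del: Ck_on.simps)
  note d = 1[THEN Ck_on_differentiable[OF S(1)]]
  have "D v (D w (\<lambda>x. f x + g x)) x = D v (\<lambda>x. D w f x + D w g x) x"
    by (rule D_cong[OF S]) (use D_add[OF d(1,2)] in auto)
  then show "D v (D w (\<lambda>x. f x + g x)) x = D v (D w f) x + D v (D w g) x"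
    using D_add[OF d(3,4)[OF S(2) ]] S(2) by simp
  have "D v (D w (\<lambda>x. f x - g x)) x = D v (\<lambda>x. D w f x - D w g x) x"
    by (rule D_cong[OF S]) (use D_diff[OF d(1,2)] in auto)
  then show "D v (D w (\<lambda>x. f x - g x)) x = D v (D w f) x - D v (D w g) x"
    using D_diff[OF d(3,4)[OF S(2)]] S(2) by simp
qed

lemma D2_sum:
  fixes f :: "'i \<Rightarrow> 'a::real_normed_vector \<Rightarrow> 'b::real_normed_vector"
  assumes S: "open S" "x \<in> S" and f: "\<And>i. i \<in> I \<Longrightarrow> Ck_on 2 (f i) S"
  shows "D v (D w (\<lambda>x. \<Sum>i\<in>I. f i x)) x = (\<Sum>i\<in>I. D v (D w (f i)) x)"
  using f
proof (induction I rule: infinite_finite_induct)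
  case (insert i I)
  then show ?case
    using D2_add[OF S, of "f i" "\<lambda>x. \<Sum>i\<in>I. f i x" v w] by (simp add: Ck_on_sum)
qed auto

lemma D2_cmult:
  fixes f :: "'a::real_normed_vector \<Rightarrow> real"
  assumes S: "open S" "x \<in> S" and f: "Ck_on 2 f S"
  shows "D v (D w (\<lambda>x. c * f x)) x = c * D v (D w f) x"
  using D2_mult[OF S Ck_on_const f, of v w c] by simp

text \<open>
  A patch of the flow in coordinates \<open>(\<xi>, t)\<close> around the point \<open>(0, t0)\<close>, with normal coordinates at
  this point: \<open>g = I\<close> and the Christoffel symbols vanish, so second derivatives of \<open>p\<close> are normal.
\<close>

abbreviation \<xi>dir :: "'n::finite \<Rightarrow> (real^'n) \<times> real" where "\<xi>dir i \<equiv> (axis i 1, 0)"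
abbreviation tdir :: "(real^'n) \<times> real" where "tdir \<equiv> (0, 1)"

definition first_form :: "((real^'n) \<times> real \<Rightarrow> real^'m) \<Rightarrow> (real^'n) \<times> real \<Rightarrow> real^'n^'n" where
  "first_form p x = (\<chi> i j. D (\<xi>dir i) p x \<bullet> D (\<xi>dir j) p x)"

definition second_form :: "((real^'n) \<times> real \<Rightarrow> real^'m) \<Rightarrow> ((real^'n) \<times> real \<Rightarrow> real^'m) \<Rightarrow> (real^'n) \<times> real \<Rightarrow> real^'n^'n" where
  "second_form p N x = (\<chi> i j. - (D (\<xi>dir i) (D (\<xi>dir j) p) x \<bullet> N x))"

locale flow_patch =
  fixes S :: "((real^'n) \<times> real) set" and t0 :: real and p N :: "(real^'n) \<times> real \<Rightarrow> real^'m"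
    and F :: "(real^'n) \<times> real \<Rightarrow> real" and H :: "real^'n^'n"
  assumes card_m: "CARD('m) = CARD('n) + 1"
    and S: "open S" "(0, t0) \<in> S"
    and smooth_p: "\<And>k. Ck_on k p S" and smooth_N: "\<And>k. Ck_on k N S"
    and unit: "\<And>x. x \<in> S \<Longrightarrow> N x \<bullet> N x = 1"
    and normal: "\<And>x i. x \<in> S \<Longrightarrow> N x \<bullet> D (\<xi>dir i) p x = 0"
    and flow: "\<And>x. x \<in> S \<Longrightarrow> D tdir p x = - (F x *\<^sub>R N x)"
    and orthonormal: "\<And>i j. D (\<xi>dir i) p (0, t0) \<bullet> D (\<xi>dir j) p (0, t0) = (if i = j then 1 else 0)"
    and hess_p: "\<And>i j. D (\<xi>dir i) (D (\<xi>dir j) p) (0, t0) = - (H $ i $ j *\<^sub>R N (0, t0))"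
begin

abbreviation "pt \<equiv> (0 :: real^'n, t0)"

lemma diffI: "(\<And>k. Ck_on k f S) \<Longrightarrow> x \<in> S \<Longrightarrow> f differentiable (at x)"
  using Ck_on_differentiable[OF S(1), of 0 f] by blast

lemma smooth_D: "(\<And>k. Ck_on k f S) \<Longrightarrow> Ck_on k (D v f) S"
  using Ck_on_D[OF S(1), of k f] by blast

lemma smooth_F: "Ck_on k F S"
proof (rule Ck_on_cong)
  show "Ck_on k (\<lambda>x. - (D tdir p x \<bullet> N x)) S"
    by (intro Ck_on_uminus Ck_on_inner smooth_D smooth_p smooth_N)
  show "- (D tdir p x \<bullet> N x) = F x" if "x \<in> S" for x using flow[OF that] unit[OF that] by simp
qed

lemma commute:
  fixes f :: "(real^'n) \<times> real \<Rightarrow> 'c::real_inner"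
  shows "(\<And>k. Ck_on k f S) \<Longrightarrow> x \<in> S \<Longrightarrow> D v (D w f) x = D w (D v f) x"
  using D_commute[OF S(1)] by blast

lemma commute2:
  fixes f :: "(real^'n) \<times> real \<Rightarrow> 'c::real_inner"
  shows "(\<And>k. Ck_on k f S) \<Longrightarrow> x \<in> S \<Longrightarrow> D u (D v (D w f)) x = D u (D w (D v f)) x"
  by (rule D_cong[OF S(1)]) (auto intro: commute)

lemma N_DN: "x \<in> S \<Longrightarrow> N x \<bullet> D v N x = 0"
proof -
  assume x: "x \<in> S"
  have "D v (\<lambda>x. N x \<bullet> N x) x = D v (\<lambda>x. 1) x" by (rule D_cong[OF S(1) x]) (rule unit)
  then show ?thesis using x by (simp add: D_inner diffI smooth_N inner_commute)
qed

lemma N_DN': "x \<in> S \<Longrightarrow> D v N x \<bullet> N x = 0"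
  using N_DN by (simp add: inner_commute)

lemma normal': "x \<in> S \<Longrightarrow> D (\<xi>dir i) p x \<bullet> N x = 0"
  using normal by (simp add: inner_commute)

lemma N_DDN: "x \<in> S \<Longrightarrow> D v (D v N) x \<bullet> N x = - (D v N x \<bullet> D v N x)"
proof -
  assume x: "x \<in> S"
  have "D v (\<lambda>x. N x \<bullet> D v N x) x = D v (\<lambda>x. 0) x" by (rule D_cong[OF S(1) x]) (rule N_DN)
  then show ?thesis using x by (simp add: D_inner diffI smooth_N smooth_D inner_commute)
qed

lemma DN_Dp: "x \<in> S \<Longrightarrow> D v N x \<bullet> D (\<xi>dir i) p x = - (N x \<bullet> D v (D (\<xi>dir i) p) x)"
proof -
  assume x: "x \<in> S"
  have "D v (\<lambda>x. N x \<bullet> D (\<xi>dir i) p x) x = D v (\<lambda>x. 0) x" by (rule D_cong[OF S(1) x]) (rule normal)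
  then show ?thesis using x by (simp add: D_inner diffI smooth_N smooth_p smooth_D inner_commute)
qed

lemma DDN_Dp: "x \<in> S \<Longrightarrow> D v (D v N) x \<bullet> D (\<xi>dir i) p x =
   - (N x \<bullet> D v (D v (D (\<xi>dir i) p)) x) - 2 * (D v N x \<bullet> D v (D (\<xi>dir i) p) x)"
proof -
  assume x: "x \<in> S"
  have "D v (\<lambda>x. D v N x \<bullet> D (\<xi>dir i) p x) x = D v (\<lambda>x. - (N x \<bullet> D v (D (\<xi>dir i) p) x)) x"
    by (rule D_cong[OF S(1) x]) (rule DN_Dp)
  moreover have "(\<lambda>x. N x \<bullet> D v (D (\<xi>dir i) p) x) differentiable (at x)"
    by (intro diffI x Ck_on_inner smooth_N smooth_D smooth_p)
  ultimately show ?thesis using x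
    by (simp add: D_inner D_uminus diffI smooth_N smooth_p smooth_D inner_commute)
qed

lemma frame_eqI:
  assumes "\<And>i. x \<bullet> D (\<xi>dir i) p pt = y \<bullet> D (\<xi>dir i) p pt" "x \<bullet> N pt = y \<bullet> N pt"
  shows "x = y"
proof (rule orthonormal_basis_expansion[OF card_m orthonormal unit[OF S(2)] _ assms])
  show "D (\<xi>dir i) p pt \<bullet> N pt = 0" for i using normal[OF S(2)] by (simp add: inner_commute)
qed

end

section \<open>Derivatives of the speed, and the two inequalities at a contact point\<close>

lemma uniform_finite_bound:
  fixes P :: "'i::finite \<Rightarrow> real \<Rightarrow> real"
  assumes "\<And>i. \<exists>C \<delta>. \<delta> > 0 \<and> (\<forall>s. \<bar>s\<bar> < \<delta> \<longrightarrow> P i s \<le> C * r s)" and "\<And>s. 0 \<le> r s"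
  shows "\<exists>C \<delta>. 0 \<le> C \<and> \<delta> > 0 \<and> (\<forall>i s. \<bar>s\<bar> < \<delta> \<longrightarrow> P i s \<le> C * r s)"
proof -
  obtain C \<delta> where C: "\<And>i. \<delta> i > 0" "\<And>i s. \<bar>s\<bar> < \<delta> i \<Longrightarrow> P i s \<le> C i * r s"
    using assms(1) by metis
  let ?C = "\<Sum>i\<in>UNIV. \<bar>C i\<bar>" and ?\<delta> = "Min (range \<delta>)"
  have "P i s \<le> ?C * r s" if "\<bar>s\<bar> < ?\<delta>" for i s
  proof -
    have "P i s \<le> C i * r s" using that C(2)[of s i] by simp
    also have "\<dots> \<le> ?C * r s"
      using member_le_sum[of i UNIV "\<lambda>i. \<bar>C i\<bar>"] assms(2) by (intro mult_right_mono) auto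
    finally show ?thesis .
  qed
  moreover have "?\<delta> > 0" using C(1) by simp
  ultimately show ?thesis by (intro exI[of _ ?C] exI[of _ ?\<delta>]) (auto intro: sum_nonneg)
qed

lemma norm_matrix_le_sum: "norm (A :: real^'n^'m) \<le> (\<Sum>i\<in>UNIV. \<Sum>j\<in>UNIV. \<bar>A $ i $ j\<bar>)"
proof -
  have "norm A \<le> (\<Sum>i\<in>UNIV. norm (A $ i))" unfolding norm_vec_def[of A] by (rule L2_set_le_sum) simp
  also have "\<dots> \<le> (\<Sum>i\<in>UNIV. \<Sum>j\<in>UNIV. \<bar>A $ i $ j\<bar>)" by (intro sum_mono norm_le_l1_cart)
  finally show ?thesis .
qed

text \<open>In the application \<open>a\<close> lists the principal curvatures at the centre and
  \<open>c\<close> is the gradient of \<open>f\<close> there. All information on the speed is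
  contained in a bound linear in the second form, \<open>F_le\<close>, and in its sharpness at the
  centre, \<open>F_pt\<close>.\<close>

locale eigen_flow_patch = flow_patch +
  fixes a c :: "real^'n"
  assumes diag: "H = diagm a"
    and c_nonneg: "\<And>i. 0 \<le> c $ i"
    and F_pt: "F (0, t0) = (\<Sum>i\<in>UNIV. c $ i * a $ i)"
    and F_le: "\<And>x E. x \<in> S \<Longrightarrow> transpose E ** first_form p x ** E = mat 1 \<Longrightarrow>
      F x \<le> (\<Sum>i\<in>UNIV. c $ i * (transpose E ** second_form p N x ** E) $ i $ i)"
begin

lemma p_ij: "D (\<xi>dir i) (D (\<xi>dir j) p) pt = (if i = j then - (a $ i *\<^sub>R N pt) else 0)"
  by (simp add: hess_p diag diagm_entry)

lemma N_i: "D (\<xi>dir i) N pt = a $ i *\<^sub>R D (\<xi>dir i) p pt"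
proof (rule frame_eqI)
  show "D (\<xi>dir i) N pt \<bullet> D (\<xi>dir j) p pt = (a $ i *\<^sub>R D (\<xi>dir i) p pt) \<bullet> D (\<xi>dir j) p pt" for j
    using DN_Dp[OF S(2), of "\<xi>dir i" j] unit[OF S(2)] by (simp add: p_ij orthonormal)
  show "D (\<xi>dir i) N pt \<bullet> N pt = (a $ i *\<^sub>R D (\<xi>dir i) p pt) \<bullet> N pt"
    using N_DN[OF S(2), of "\<xi>dir i"] normal[OF S(2), of i] by (simp add: inner_commute)
qed

text \<open>The tangential part of the time derivative of the normal is the gradient of the speed:
  the time derivative is moved past the tangent vector by commuting derivatives, and the flow
  equation is inserted.\<close>

lemma N_t: "D tdir N pt \<bullet> D (\<xi>dir j) p pt = D (\<xi>dir j) F pt"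
proof -
  have "D tdir (D (\<xi>dir j) p) pt = D (\<xi>dir j) (D tdir p) pt" by (rule commute[OF smooth_p S(2)])
  also have "\<dots> = D (\<xi>dir j) (\<lambda>x. - (F x *\<^sub>R N x)) pt" by (rule D_cong[OF S]) (rule flow)
  also have "\<dots> = - (F pt *\<^sub>R D (\<xi>dir j) N pt + D (\<xi>dir j) F pt *\<^sub>R N pt)"
    by (subst D_uminus) (auto simp: D_scaleR diffI smooth_F smooth_N S intro!: diffI Ck_on_scaleR)
  finally show ?thesis using DN_Dp[OF S(2), of tdir j] N_DN[OF S(2), of "\<xi>dir j"] unit[OF S(2)]
    by (simp add: inner_add_right inner_diff_right)
qed

text \<open>\<open>F_le\<close> asks for an orthonormal frame, and the coordinate frame is one only
  at the centre. Along a coordinate line of normal coordinates the metric error \<eta> is quadratic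
  and the second form is within a linear error of \<open>diagm a\<close>. Hence
  \<open>near_orthonormal_frame\<close> changes the diagonal entries by
  \<open>a $ i * \<eta> s $ i $ i\<close> up to a cubic error.\<close>

lemma F_upper_line:
  "\<exists>C \<delta>. \<delta> > 0 \<and> (\<forall>s. \<bar>s\<bar> < \<delta> \<longrightarrow> F (pt + s *\<^sub>R \<xi>dir j) \<le>
     (\<Sum>i\<in>UNIV. c $ i * (second_form p N (pt + s *\<^sub>R \<xi>dir j) $ i $ i
        - a $ i * (first_form p (pt + s *\<^sub>R \<xi>dir j) $ i $ i - 1))) + C * \<bar>s\<bar>^3)"
proof -
  let ?x = "\<lambda>s. pt + s *\<^sub>R \<xi>dir j"
  let ?n = "real CARD('n)"
  obtain C0 \<epsilon> where C0: "C0 > 0" "\<epsilon> > 0" "\<And>\<eta> h :: real^'n^'n. transpose \<eta> = \<eta> \<Longrightarrow> norm \<eta> \<le> \<epsilon> \<Longrightarrow>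
     \<exists>E. transpose E ** (mat 1 + \<eta>) ** E = mat 1 \<and>
       norm (transpose E ** h ** E - (h - (1/2) *\<^sub>R (\<eta> ** h + h ** \<eta>))) \<le> C0 * norm h * (norm \<eta>)\<^sup>2"
    using near_orthonormal_frame by blast
  define \<eta> where "\<eta> s = first_form p (?x s) - mat 1" for s
  define h where "h s = second_form p N (?x s)" for s
  have "\<exists>C \<delta>. \<delta> > 0 \<and> (\<forall>s. \<bar>s\<bar> < \<delta> \<longrightarrow> \<bar>\<eta> s $ fst ik $ snd ik\<bar> \<le> C * s\<^sup>2)" for ik
  proof -
    obtain i k where ik: "ik = (i, k)" by (cases ik)
    let ?f = "\<lambda>x. D (\<xi>dir i) p x \<bullet> D (\<xi>dir k) p x - (if i = k then 1 else 0)"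
    have "D (\<xi>dir j) ?f pt = 0"
      by (subst D_diff) (auto simp: D_inner diffI smooth_D smooth_p S p_ij normal normal'
          intro!: diffI Ck_on_inner)
    moreover have "?f pt = 0" by (simp add: orthonormal)
    moreover have "Ck_on 2 ?f S" by (intro Ck_on_diff Ck_on_inner Ck_on_const smooth_D smooth_p)
    ultimately show ?thesis using quadratic_bound[OF S, of ?f "\<xi>dir j"]
      by (simp add: \<eta>_def first_form_def mat_def ik)
  qed
  from uniform_finite_bound[where P="\<lambda>ik s. \<bar>\<eta> s $ fst ik $ snd ik\<bar>" and r="\<lambda>s. s\<^sup>2", OF this]
  obtain C1 \<delta>1 where C1: "0 \<le> C1" "\<delta>1 > 0"
    "\<And>i k s. \<bar>s\<bar> < \<delta>1 \<Longrightarrow> \<bar>\<eta> s $ i $ k\<bar> \<le> C1 * s\<^sup>2" by auto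
  have h0: "second_form p N pt = diagm a"
    using unit[OF S(2)] by (simp add: second_form_def vec_eq_iff p_ij diagm_entry)
  have "\<exists>C \<delta>. \<delta> > 0 \<and> (\<forall>s. \<bar>s\<bar> < \<delta> \<longrightarrow> \<bar>h s $ fst ik $ snd ik - diagm a $ fst ik $ snd ik\<bar> \<le> C * \<bar>s\<bar>)" for ik
  proof -
    obtain i k where ik: "ik = (i, k)" by (cases ik)
    have "(\<lambda>x. - (D (\<xi>dir i) (D (\<xi>dir k) p) x \<bullet> N x)) differentiable (at pt)"
      by (intro diffI S Ck_on_uminus Ck_on_inner smooth_D smooth_p smooth_N)
    from linear_bound[OF this, of "\<xi>dir j"] show ?thesis
      unfolding h0[symmetric] by (simp add: h_def second_form_def ik)
  qed
  from uniform_finite_bound[where P="\<lambda>ik s. \<bar>h s $ fst ik $ snd ik - diagm a $ fst ik $ snd ik\<bar>" and r="\<lambda>s. \<bar>s\<bar>", OF this]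
  obtain C2 \<delta>2 where C2: "0 \<le> C2" "\<delta>2 > 0"
    "\<And>i k s. \<bar>s\<bar> < \<delta>2 \<Longrightarrow> \<bar>h s $ i $ k - diagm a $ i $ k\<bar> \<le> C2 * \<bar>s\<bar>" by auto
  obtain \<delta>3 where \<delta>3: "\<delta>3 > 0" "\<And>s. \<bar>s\<bar> < \<delta>3 \<Longrightarrow> ?x s \<in> S" using eventually_on_line[OF S] by blast
  define K where "K = ?n * ?n * C1"
  have K: "0 \<le> K" using C1 by (simp add: K_def)
  define B where "B = norm (diagm a) + ?n * ?n * C2"
  have B: "0 \<le> B" using C2 by (simp add: B_def)
  \<comment> \<open>The bound 1 lets higher powers of \<open>\<bar>s\<bar>\<close> be estimated by
    lower ones; \<open>\<epsilon> / (K + 1)\<close> brings the metric error into the range of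
    \<open>near_orthonormal_frame\<close>.\<close>
  define \<delta> where "\<delta> = min (min 1 (\<epsilon> / (K + 1))) (min \<delta>1 (min \<delta>2 \<delta>3))"
  have \<delta>: "\<delta> > 0" "\<delta> \<le> 1" "\<delta> \<le> \<epsilon> / (K + 1)" "\<delta> \<le> \<delta>1" "\<delta> \<le> \<delta>2" "\<delta> \<le> \<delta>3"
    using C0 C1 C2 \<delta>3 K by (auto simp: \<delta>_def)
  \<comment> \<open>The first summand comes from the frame error, quadratic in \<eta> and thus of
    fourth order in \<open>s\<close>; the second from replacing the second form by
    \<open>diagm a\<close> in its product with \<eta>.\<close>
  define L where "L = C0 * B * K\<^sup>2 + ?n * C1 * C2"
  define C where "C = (\<Sum>i\<in>UNIV. c $ i * L)"
  have "F (?x s) \<le> (\<Sum>i\<in>UNIV. c $ i * (second_form p N (?x s) $ i $ i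
        - a $ i * (first_form p (?x s) $ i $ i - 1))) + C * \<bar>s\<bar>^3" if s: "\<bar>s\<bar> < \<delta>" for s
  proof -
    have xS: "?x s \<in> S" using \<delta>3 s \<delta> by auto
    have s1: "\<bar>s\<bar> \<le> 1" "s\<^sup>2 \<le> 1" "s\<^sup>2 \<le> \<bar>s\<bar>" "s ^ 4 \<le> \<bar>s\<bar> ^ 3"
    proof -
      show 1: "\<bar>s\<bar> \<le> 1" using s \<delta> by linarith
      show "s\<^sup>2 \<le> 1" using 1 by (simp add: abs_square_le_1)
      show "s\<^sup>2 \<le> \<bar>s\<bar>" using 1 power_decreasing[of 1 2 "\<bar>s\<bar>"] by simp
      show "s ^ 4 \<le> \<bar>s\<bar> ^ 3" using 1 power_decreasing[of 3 4 "\<bar>s\<bar>"] by simp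
    qed
    have "norm (\<eta> s) \<le> (\<Sum>i\<in>(UNIV::'n set). \<Sum>k\<in>(UNIV::'n set). C1 * s\<^sup>2)"
      using C1(3) s \<delta> by (intro order_trans[OF norm_matrix_le_sum] sum_mono) auto
    then have n\<eta>: "norm (\<eta> s) \<le> K * s\<^sup>2" by (simp add: K_def)
    also have "\<dots> \<le> K * \<bar>s\<bar>" using K s1 by (intro mult_left_mono)
    also have "\<dots> \<le> (K + 1) * \<delta>" using K s \<delta> by (intro mult_mono) auto
    also have "\<dots> \<le> \<epsilon>" using \<delta>(3) K by (simp add: field_simps)
    finally have \<eta>\<epsilon>: "norm (\<eta> s) \<le> \<epsilon>" .
    have "norm (h s - diagm a) \<le> (\<Sum>i\<in>(UNIV::'n set). \<Sum>k\<in>(UNIV::'n set). C2 * \<bar>s\<bar>)"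
      using C2(3) s \<delta> by (intro order_trans[OF norm_matrix_le_sum] sum_mono) auto
    also have "\<dots> = ?n * ?n * C2 * \<bar>s\<bar>" by simp
    also have "\<dots> \<le> ?n * ?n * C2 * 1" using C2 s1 by (intro mult_left_mono) auto
    finally have nh: "norm (h s) \<le> B" using norm_triangle_sub[of "h s" "diagm a"] by (simp add: B_def)
    have \<eta>sym: "\<eta> s $ i $ k = \<eta> s $ k $ i" for i k by (simp add: \<eta>_def first_form_def mat_def inner_commute)
    have hsym: "h s $ i $ k = h s $ k $ i" for i k
      using commute[OF smooth_p xS] by (simp add: h_def second_form_def)
    have "transpose (\<eta> s) = \<eta> s" using \<eta>sym by (simp add: transpose_def vec_eq_iff)
    from C0(3)[OF this \<eta>\<epsilon>, of "h s"] obtain E where E: "transpose E ** (mat 1 + \<eta> s) ** E = mat 1"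
      "norm (transpose E ** h s ** E - (h s - (1/2) *\<^sub>R (\<eta> s ** h s + h s ** \<eta> s))) \<le> C0 * norm (h s) * (norm (\<eta> s))\<^sup>2"
      by blast
    have "C0 * norm (h s) * (norm (\<eta> s))\<^sup>2 \<le> C0 * B * (K * s\<^sup>2)\<^sup>2"
      using C0 nh n\<eta> B by (intro mult_mono power_mono) auto
    also have "\<dots> = C0 * B * K\<^sup>2 * s ^ 4" by (simp add: power2_eq_square power4_eq_xxxx)
    also have "\<dots> \<le> C0 * B * K\<^sup>2 * \<bar>s\<bar> ^ 3" using C0 B s1 by (intro mult_left_mono) auto
    finally have err: "C0 * norm (h s) * (norm (\<eta> s))\<^sup>2 \<le> C0 * B * K\<^sup>2 * \<bar>s\<bar> ^ 3" .
    have entry: "(transpose E ** h s ** E) $ i $ i \<le> h s $ i $ i - a $ i * \<eta> s $ i $ i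
        + L * \<bar>s\<bar> ^ 3" for i
    proof -
      let ?M = "transpose E ** h s ** E - (h s - (1/2) *\<^sub>R (\<eta> s ** h s + h s ** \<eta> s))"
      have "?M $ i $ i \<le> norm ?M"
        using component_le_norm_cart[of "?M $ i" i] Finite_Cartesian_Product.norm_nth_le[of ?M i] by linarith
      then have 1: "?M $ i $ i \<le> C0 * B * K\<^sup>2 * \<bar>s\<bar> ^ 3" using E(2) err by linarith
      have 2: "((1/2) *\<^sub>R (\<eta> s ** h s + h s ** \<eta> s)) $ i $ i = (\<Sum>k\<in>UNIV. \<eta> s $ i $ k * h s $ k $ i)"
      proof -
        have "(\<eta> s ** h s) $ i $ i = (\<Sum>k\<in>UNIV. \<eta> s $ i $ k * h s $ k $ i)" by (simp add: matrix_matrix_mult_def)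
        moreover have "(h s ** \<eta> s) $ i $ i = (\<Sum>k\<in>UNIV. \<eta> s $ i $ k * h s $ k $ i)"
          unfolding matrix_matrix_mult_def using \<eta>sym[of i] hsym[of i] by (simp add: mult.commute)
        ultimately show ?thesis by simp
      qed
      have 3: "(\<Sum>k\<in>UNIV. \<eta> s $ i $ k * diagm a $ k $ i) = a $ i * \<eta> s $ i $ i"
        by (simp add: diagm_entry if_distrib cong: if_cong)
      have "\<bar>(\<Sum>k\<in>UNIV. \<eta> s $ i $ k * h s $ k $ i) - (\<Sum>k\<in>UNIV. \<eta> s $ i $ k * diagm a $ k $ i)\<bar>
          = \<bar>\<Sum>k\<in>UNIV. \<eta> s $ i $ k * (h s $ k $ i - diagm a $ k $ i)\<bar>"
        by (simp add: sum_subtractf right_diff_distrib)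
      also have "\<dots> \<le> (\<Sum>k\<in>UNIV. \<bar>\<eta> s $ i $ k * (h s $ k $ i - diagm a $ k $ i)\<bar>)" by (rule sum_abs)
      also have "\<dots> \<le> (\<Sum>k\<in>(UNIV::'n set). (C1 * s\<^sup>2) * (C2 * \<bar>s\<bar>))"
        unfolding abs_mult using C1 C2 s \<delta> by (intro sum_mono mult_mono) auto
      also have "\<dots> = ?n * C1 * C2 * \<bar>s\<bar> ^ 3" by (simp add: power2_eq_square power3_eq_cube)
      finally have "a $ i * \<eta> s $ i $ i - ?n * C1 * C2 * \<bar>s\<bar> ^ 3 \<le> (\<Sum>k\<in>UNIV. \<eta> s $ i $ k * h s $ k $ i)"
        unfolding 3 by linarith
      then show ?thesis using 1 2 by (simp add: L_def algebra_simps)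
    qed
    have "transpose E ** first_form p (?x s) ** E = mat 1" using E(1) by (simp add: \<eta>_def)
    from F_le[OF xS this] have "F (?x s) \<le> (\<Sum>i\<in>UNIV. c $ i * (transpose E ** h s ** E) $ i $ i)"
      by (simp add: h_def)
    also have "\<dots> \<le> (\<Sum>i\<in>UNIV. c $ i * (h s $ i $ i - a $ i * \<eta> s $ i $ i
        + L * \<bar>s\<bar> ^ 3))"
      by (intro sum_mono mult_left_mono entry c_nonneg)
    also have "\<dots> = (\<Sum>i\<in>UNIV. c $ i * (h s $ i $ i - a $ i * \<eta> s $ i $ i)) + C * \<bar>s\<bar> ^ 3"
      by (simp add: C_def distrib_left sum.distrib sum_distrib_right mult.assoc)
    finally show ?thesis by (simp add: h_def \<eta>_def mat_def)
  qed
  then show ?thesis using \<delta>(1) by blast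
qed

abbreviation "pp i j \<equiv> D (\<xi>dir i) (D (\<xi>dir j) p)"

text \<open>The difference \<open>G\<close> between the upper bound and the speed vanishes at the
  centre and is at least a negative cubic along each coordinate line. The second derivative test
  gives equality of gradients and an inequality for second derivatives; the first derivatives of the
  metric drop out in normal coordinates.\<close>

lemma F_derivatives:
  shows F_grad: "D (\<xi>dir j) F pt = - (\<Sum>i\<in>UNIV. c $ i * (D (\<xi>dir j) (pp i i) pt \<bullet> N pt))"
    and F_hess: "D (\<xi>dir j) (D (\<xi>dir j) F) pt \<le> (\<Sum>i\<in>UNIV. c $ i *
      (- (D (\<xi>dir j) (D (\<xi>dir j) (pp i i)) pt \<bullet> N pt) - 2 * (D (\<xi>dir j) (pp i i) pt \<bullet> D (\<xi>dir j) N pt)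
         - pp i i pt \<bullet> D (\<xi>dir j) (D (\<xi>dir j) N) pt
       - a $ i * (2 * (D (\<xi>dir j) (pp j i) pt \<bullet> D (\<xi>dir i) p pt) + 2 * (pp j i pt \<bullet> pp j i pt))))"
proof -
  define k where "k i x = pp i i x \<bullet> N x" for i x
  define g where "g i x = D (\<xi>dir i) p x \<bullet> D (\<xi>dir i) p x" for i x
  define G where "G x = (\<Sum>i\<in>UNIV. c $ i * (- k i x - a $ i * (g i x - 1))) - F x" for x
  have sk: "Ck_on m (k i) S" and sg: "Ck_on m (g i) S" for i m
    unfolding k_def[abs_def] g_def[abs_def] by (intro Ck_on_inner smooth_D smooth_p smooth_N)+
  have sG: "Ck_on m (\<lambda>x. c $ i * (- k i x - a $ i * (g i x - 1))) S" for i m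
    by (intro Ck_on_mult Ck_on_diff Ck_on_uminus Ck_on_const sk sg)
  have G2: "Ck_on 2 G S" unfolding G_def[abs_def] by (intro Ck_on_diff Ck_on_sum sG smooth_F)
  have "G pt = 0" using unit[OF S(2)] by (simp add: G_def k_def g_def p_ij orthonormal F_pt)
  obtain C \<delta> where C: "\<delta> > 0" "\<And>s. \<bar>s\<bar> < \<delta> \<Longrightarrow> F (pt + s *\<^sub>R \<xi>dir j) \<le>
     (\<Sum>i\<in>UNIV. c $ i * (second_form p N (pt + s *\<^sub>R \<xi>dir j) $ i $ i
        - a $ i * (first_form p (pt + s *\<^sub>R \<xi>dir j) $ i $ i - 1))) + C * \<bar>s\<bar>^3" using F_upper_line by blast
  have "- C * \<bar>s\<bar>^3 \<le> G (pt + s *\<^sub>R \<xi>dir j)" if "\<bar>s\<bar> < \<delta>" for s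
    using C(2)[OF that] by (simp add: G_def k_def g_def second_form_def first_form_def)
  note * = second_derivative_test[OF S G2 \<open>G pt = 0\<close> C(1) this]
  have "D (\<xi>dir j) G pt = (\<Sum>i\<in>UNIV. c $ i * (- D (\<xi>dir j) (k i) pt - a $ i * D (\<xi>dir j) (g i) pt)) - D (\<xi>dir j) F pt"
  proof -
    have "D (\<xi>dir j) (\<lambda>x. c $ i * (- k i x - a $ i * (g i x - 1))) pt = c $ i * (- D (\<xi>dir j) (k i) pt - a $ i * D (\<xi>dir j) (g i) pt)" for i
    proof -
      have "D (\<xi>dir j) (\<lambda>x. - k i x - a $ i * (g i x - 1)) pt = - D (\<xi>dir j) (k i) pt - a $ i * D (\<xi>dir j) (g i) pt"
        using diffI[OF sk S(2)] diffI[OF sg S(2)] by (simp add: D_diff D_uminus D_mult)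
      moreover have "(\<lambda>x. - k i x - a $ i * (g i x - 1)) differentiable (at pt)"
        by (intro diffI S Ck_on_mult Ck_on_diff Ck_on_uminus Ck_on_const sk sg)
      ultimately show ?thesis by (simp add: D_mult)
    qed
    moreover have "D (\<xi>dir j) G pt = D (\<xi>dir j) (\<lambda>x. \<Sum>i\<in>UNIV. c $ i * (- k i x - a $ i * (g i x - 1))) pt - D (\<xi>dir j) F pt"
      unfolding G_def[abs_def] by (intro D_diff diffI S Ck_on_sum sG smooth_F)
    moreover have "D (\<xi>dir j) (\<lambda>x. \<Sum>i\<in>UNIV. c $ i * (- k i x - a $ i * (g i x - 1))) pt
        = (\<Sum>i\<in>UNIV. D (\<xi>dir j) (\<lambda>x. c $ i * (- k i x - a $ i * (g i x - 1))) pt)"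
      by (rule D_sum) (rule diffI[OF sG S(2)])
    ultimately show ?thesis by simp
  qed
  moreover have "D (\<xi>dir j) (g i) pt = 0" for i
    unfolding g_def[abs_def] by (simp add: D_inner diffI smooth_D smooth_p S p_ij normal normal')
  moreover have "D (\<xi>dir j) (k i) pt = D (\<xi>dir j) (pp i i) pt \<bullet> N pt" for i
    unfolding k_def[abs_def]
    by (simp add: D_inner diffI smooth_D smooth_p smooth_N S p_ij[of i i] N_DN)
  ultimately show "D (\<xi>dir j) F pt = - (\<Sum>i\<in>UNIV. c $ i * (D (\<xi>dir j) (pp i i) pt \<bullet> N pt))"
    using *(1) by (simp add: sum_negf)
  have "D (\<xi>dir j) (D (\<xi>dir j) G) pt =
    (\<Sum>i\<in>UNIV. c $ i * (- D (\<xi>dir j) (D (\<xi>dir j) (k i)) pt - a $ i * D (\<xi>dir j) (D (\<xi>dir j) (g i)) pt)) - D (\<xi>dir j) (D (\<xi>dir j) F) pt"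
  proof -
    have "D (\<xi>dir j) (D (\<xi>dir j) (\<lambda>x. c $ i * (- k i x - a $ i * (g i x - 1)))) pt =
       c $ i * (- D (\<xi>dir j) (D (\<xi>dir j) (k i)) pt - a $ i * D (\<xi>dir j) (D (\<xi>dir j) (g i)) pt)" for i
    proof -
      have "(\<lambda>x. c $ i * (- k i x - a $ i * (g i x - 1))) = (\<lambda>x. (- c $ i) * k i x + (- c $ i * a $ i) * g i x + c $ i * a $ i)"
        by (simp add: algebra_simps)
      then show ?thesis
        by (simp only: D2_add[OF S Ck_on_add[OF Ck_on_mult[OF Ck_on_const sk] Ck_on_mult[OF Ck_on_const sg]] Ck_on_const]
            D2_add[OF S Ck_on_mult[OF Ck_on_const sk] Ck_on_mult[OF Ck_on_const sg]] D2_cmult[OF S sk] D2_cmult[OF S sg] D_const)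
          (simp add: algebra_simps)
    qed
    moreover have "D (\<xi>dir j) (D (\<xi>dir j) G) pt = D (\<xi>dir j) (D (\<xi>dir j) (\<lambda>x. \<Sum>i\<in>UNIV. c $ i * (- k i x - a $ i * (g i x - 1)))) pt
        - D (\<xi>dir j) (D (\<xi>dir j) F) pt"
      unfolding G_def[abs_def] by (intro D2_diff[OF S] Ck_on_sum sG smooth_F)
    moreover have "D (\<xi>dir j) (D (\<xi>dir j) (\<lambda>x. \<Sum>i\<in>UNIV. c $ i * (- k i x - a $ i * (g i x - 1)))) pt
        = (\<Sum>i\<in>UNIV. D (\<xi>dir j) (D (\<xi>dir j) (\<lambda>x. c $ i * (- k i x - a $ i * (g i x - 1)))) pt)"
      by (rule D2_sum[OF S sG])
    ultimately show ?thesis by simp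
  qed
  moreover have "D (\<xi>dir j) (D (\<xi>dir j) (g i)) pt = 2 * (D (\<xi>dir j) (pp j i) pt \<bullet> D (\<xi>dir i) p pt) + 2 * (pp j i pt \<bullet> pp j i pt)" for i
    unfolding g_def[abs_def] D2_inner[OF S smooth_D[OF smooth_p] smooth_D[OF smooth_p]] by (simp add: inner_commute)
  moreover have "D (\<xi>dir j) (D (\<xi>dir j) (k i)) pt = D (\<xi>dir j) (D (\<xi>dir j) (pp i i)) pt \<bullet> N pt
      + 2 * (D (\<xi>dir j) (pp i i) pt \<bullet> D (\<xi>dir j) N pt) + pp i i pt \<bullet> D (\<xi>dir j) (D (\<xi>dir j) N) pt" for i
    unfolding k_def[abs_def] D2_inner[OF S smooth_D[OF smooth_D[OF smooth_p]] smooth_N] by (simp add: inner_commute)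
  ultimately show "D (\<xi>dir j) (D (\<xi>dir j) F) pt \<le> (\<Sum>i\<in>UNIV. c $ i *
      (- (D (\<xi>dir j) (D (\<xi>dir j) (pp i i)) pt \<bullet> N pt) - 2 * (D (\<xi>dir j) (pp i i) pt \<bullet> D (\<xi>dir j) N pt)
         - pp i i pt \<bullet> D (\<xi>dir j) (D (\<xi>dir j) N) pt
       - a $ i * (2 * (D (\<xi>dir j) (pp j i) pt \<bullet> D (\<xi>dir i) p pt) + 2 * (pp j i pt \<bullet> pp j i pt))))"
    using *(2) by (simp add: diff_diff_eq)
qed

text \<open>Both sides are compared on the frame at the centre. Tangentially this is
  \<open>N_t\<close> combined with \<open>F_grad\<close> and the symmetry of third derivatives of
  \<open>p\<close>, a form of the Codazzi equation; in the normal direction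
  \<open>D (\<xi>dir i) (D (\<xi>dir i) N)\<close> contributes \<open>- (a $ i)\<^sup>2\<close>,
  which the last term compensates.\<close>

lemma normal_evolution:
  "D tdir N pt = (\<Sum>i\<in>UNIV. c $ i *\<^sub>R D (\<xi>dir i) (D (\<xi>dir i) N) pt) + (\<Sum>i\<in>UNIV. c $ i * (a $ i)\<^sup>2) *\<^sub>R N pt"
proof (rule frame_eqI)
  fix j
  have "D (\<xi>dir i) (D (\<xi>dir i) N) pt \<bullet> D (\<xi>dir j) p pt = - (D (\<xi>dir j) (pp i i) pt \<bullet> N pt)" for i
  proof -
    have "D (\<xi>dir i) (pp i j) pt = D (\<xi>dir i) (pp j i) pt" by (rule commute2[OF smooth_p S(2)])
    also have "\<dots> = D (\<xi>dir j) (pp i i) pt" by (rule commute[OF smooth_D[OF smooth_p] S(2)])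
    finally have "D (\<xi>dir i) (pp i j) pt = D (\<xi>dir j) (pp i i) pt" .
    moreover have "D (\<xi>dir i) N pt \<bullet> pp i j pt = 0"
      using normal'[OF S(2)] by (simp add: N_i p_ij)
    ultimately show ?thesis using DDN_Dp[OF S(2), of "\<xi>dir i" j] by (simp add: inner_commute)
  qed
  then show "D tdir N pt \<bullet> D (\<xi>dir j) p pt = ((\<Sum>i\<in>UNIV. c $ i *\<^sub>R D (\<xi>dir i) (D (\<xi>dir i) N) pt) + (\<Sum>i\<in>UNIV. c $ i * (a $ i)\<^sup>2) *\<^sub>R N pt) \<bullet> D (\<xi>dir j) p pt"
    using normal[OF S(2)] by (simp add: N_t F_grad inner_add_left inner_sum_left sum_negf)
next
  have "D (\<xi>dir i) (D (\<xi>dir i) N) pt \<bullet> N pt = - (a $ i)\<^sup>2" for i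
    using N_DDN[OF S(2), of "\<xi>dir i"] by (simp add: N_i orthonormal power2_eq_square)
  then show "D tdir N pt \<bullet> N pt = ((\<Sum>i\<in>UNIV. c $ i *\<^sub>R D (\<xi>dir i) (D (\<xi>dir i) N) pt) + (\<Sum>i\<in>UNIV. c $ i * (a $ i)\<^sup>2) *\<^sub>R N pt) \<bullet> N pt"
    using N_DN'[OF S(2), of tdir] unit[OF S(2)] by (simp add: inner_add_left inner_sum_left sum_negf)
qed

lemma p_ij_N [simp]: "pp i j pt \<bullet> N pt = (if i = j then - a $ i else 0)"
  using unit[OF S(2)] by (simp add: p_ij)

lemma differentiable_of_C2: "Ck_on 2 \<phi> S \<Longrightarrow> x \<in> S \<Longrightarrow> \<phi> differentiable (at x)"
  using Ck_on_differentiable[OF S(1), of 1 \<phi>] by (simp add: numeral_2_eq_2 del: Ck_on.simps)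

text \<open>The centre is a minimum among present and past points: in time only a left derivative
  can be tested, while space derivatives are tested on the slice \<open>t = t0\<close> in both
  directions.\<close>

lemma back_in_time:
  fixes u :: "(real^'n) \<times> real \<Rightarrow> real"
  assumes "\<And>\<xi> t. (\<xi>, t) \<in> S \<Longrightarrow> t \<le> t0 \<Longrightarrow> 0 \<le> u (\<xi>, t)" and u: "Ck_on 2 u S" "u pt = 0"
  shows "D tdir u pt \<le> 0" "D (\<xi>dir i) u pt = 0" "0 \<le> D (\<xi>dir i) (D (\<xi>dir i) u) pt"
proof -
  obtain d where d: "d > 0" "\<And>s. \<bar>s\<bar> < d \<Longrightarrow> pt + s *\<^sub>R tdir \<in> S" using eventually_on_line[OF S] by blast
  show "D tdir u pt \<le> 0"
    by (rule first_derivative_test_backwards[where f=u and x=pt, OF differentiable_of_C2[OF u(1) S(2)] u(2) d(1)])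
       (use d assms(1) in auto)
  obtain e where e: "e > 0" "\<And>s. \<bar>s\<bar> < e \<Longrightarrow> pt + s *\<^sub>R \<xi>dir i \<in> S" using eventually_on_line[OF S] by blast
  have "- 0 * \<bar>s\<bar> ^ 3 \<le> u (pt + s *\<^sub>R \<xi>dir i)" if "\<bar>s\<bar> < e" for s
    using e(2)[OF that] assms(1) by auto
  from second_derivative_test[OF S u e(1) this]
  show "D (\<xi>dir i) u pt = 0" "0 \<le> D (\<xi>dir i) (D (\<xi>dir i) u) pt" by auto
qed

text \<open>These are, in terms of \<open>p\<close>, the evolution equations for the diagonal
  components of the second fundamental form and of the metric at the centre.\<close>

lemma flow_second:
  "D tdir (pp j j) pt \<bullet> N pt = - D (\<xi>dir j) (D (\<xi>dir j) F) pt + F pt * (a $ j)\<^sup>2"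
  "D tdir (D (\<xi>dir j) p) pt \<bullet> D (\<xi>dir j) p pt = - F pt * a $ j"
proof -
  have "D tdir (pp j j) pt = D (\<xi>dir j) (D tdir (D (\<xi>dir j) p)) pt"
    by (rule commute[OF smooth_D[OF smooth_p] S(2)])
  also have "\<dots> = D (\<xi>dir j) (D (\<xi>dir j) (D tdir p)) pt" by (rule commute2[OF smooth_p S(2)])
  also have "\<dots> = D (\<xi>dir j) (D (\<xi>dir j) (\<lambda>x. (- F x) *\<^sub>R N x)) pt"
    by (intro D_cong[OF S] D_cong[OF S(1)]) (simp_all add: flow)
  also have "\<dots> = - F pt *\<^sub>R D (\<xi>dir j) (D (\<xi>dir j) N) pt + D (\<xi>dir j) (\<lambda>x. - F x) pt *\<^sub>R D (\<xi>dir j) N pt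
      + D (\<xi>dir j) (\<lambda>x. - F x) pt *\<^sub>R D (\<xi>dir j) N pt
      + D (\<xi>dir j) (D (\<xi>dir j) (\<lambda>x. - F x)) pt *\<^sub>R N pt"
    by (subst D2_scaleR[OF S Ck_on_uminus[OF smooth_F] smooth_N]) (rule refl)
  finally show "D tdir (pp j j) pt \<bullet> N pt = - D (\<xi>dir j) (D (\<xi>dir j) F) pt + F pt * (a $ j)\<^sup>2"
    using N_DDN[OF S(2), of "\<xi>dir j"] N_DN'[OF S(2), of "\<xi>dir j"] unit[OF S(2)] D2_cmult[OF S smooth_F, of "\<xi>dir j" "\<xi>dir j" "-1"]
    by (simp only: inner_add_left inner_scaleR_left) (simp add: N_i orthonormal power2_eq_square normal'[OF S(2)])
  have "D tdir (D (\<xi>dir j) p) pt = D (\<xi>dir j) (D tdir p) pt" by (rule commute[OF smooth_p S(2)])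
  also have "\<dots> = D (\<xi>dir j) (\<lambda>x. (- F x) *\<^sub>R N x) pt" by (rule D_cong[OF S]) (simp add: flow)
  also have "\<dots> = - F pt *\<^sub>R D (\<xi>dir j) N pt + D (\<xi>dir j) (\<lambda>x. - F x) pt *\<^sub>R N pt"
    by (rule D_scaleR[OF diffI[OF Ck_on_uminus[OF smooth_F] S(2)] diffI[OF smooth_N S(2)]])
  finally show "D tdir (D (\<xi>dir j) p) pt \<bullet> D (\<xi>dir j) p pt = - F pt * a $ j"
    using normal[OF S(2), of j] by (simp add: inner_add_left inner_diff_left N_i orthonormal)
qed

text \<open>
  The supremum is approached along the diagonal: \<open>\<phi>\<close> touches the largest principal curvature \<open>a $ j\<close>.
  The fourth order derivatives of \<open>p\<close> cancel, so Simons' identity is not needed.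
\<close>

lemma diagonal_inequality:
  assumes \<phi>: "Ck_on 2 \<phi> S" and aj: "a $ j = \<phi> pt"
    and nonneg: "\<And>\<xi> t. (\<xi>, t) \<in> S \<Longrightarrow> t \<le> t0 \<Longrightarrow>
      0 \<le> \<phi> (\<xi>, t) * (D (\<xi>dir j) p (\<xi>, t) \<bullet> D (\<xi>dir j) p (\<xi>, t)) + pp j j (\<xi>, t) \<bullet> N (\<xi>, t)"
  shows "D tdir \<phi> pt \<le> (\<Sum>k\<in>UNIV. c $ k * (D (\<xi>dir k) (D (\<xi>dir k) \<phi>) pt + (a $ k)\<^sup>2 * \<phi> pt))"
proof -
  define f where "f = \<phi> pt"
  let ?g = "\<lambda>x. D (\<xi>dir j) p x \<bullet> D (\<xi>dir j) p x" and ?k = "\<lambda>x. pp j j x \<bullet> N x"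
  have sg: "Ck_on m ?g S" and sk: "Ck_on m ?k S" for m by (intro Ck_on_inner smooth_D smooth_p smooth_N)+
  define u where "u x = \<phi> x * ?g x + ?k x" for x
  have su: "Ck_on 2 u S" unfolding u_def[abs_def] by (intro Ck_on_add Ck_on_mult \<phi> sg sk)
  have u0: "u pt = 0" by (simp add: u_def orthonormal aj)
  have "0 \<le> u (\<xi>, t)" if "(\<xi>, t) \<in> S" "t \<le> t0" for \<xi> t using nonneg[OF that] by (simp add: u_def)
  note test = back_in_time[OF this su u0]
  have d\<phi>: "\<phi> differentiable (at pt)" by (rule differentiable_of_C2[OF \<phi> S(2)])
  have "D tdir u pt = D tdir \<phi> pt + f * D tdir ?g pt + D tdir ?k pt"
    unfolding u_def[abs_def] using d\<phi> diffI[OF sg S(2)] diffI[OF sk S(2)]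
    by (subst D_add) (auto simp: D_mult orthonormal f_def intro!: differentiable_mult)
  also have "D tdir ?g pt = - 2 * F pt * f"
    using flow_second(2)[of j] by (simp add: D_inner diffI smooth_D smooth_p S inner_commute f_def aj)
  also have "D tdir ?k pt = - D (\<xi>dir j) (D (\<xi>dir j) F) pt + F pt * f\<^sup>2"
    using flow_second(1)[of j] N_DN[OF S(2), of tdir]
    by (simp add: D_inner diffI smooth_D smooth_p smooth_N S p_ij[of j j] f_def aj)
  finally have t: "D tdir \<phi> pt \<le> D (\<xi>dir j) (D (\<xi>dir j) F) pt + F pt * f\<^sup>2"
    using test(1) by (simp add: power2_eq_square algebra_simps)
  \<comment> \<open>\<open>Q\<close> stands for fourth derivatives, \<open>P\<close> and
    \<open>R\<close> for third ones. Since coordinate derivatives of the vector-valued map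
    \<open>p\<close> commute, the same three quantities occur in the Hessian of \<open>u\<close>
    and, with opposite sign, in the bound for the Hessian of the speed.\<close>
  define Q where "Q k = D (\<xi>dir j) (D (\<xi>dir j) (pp k k)) pt \<bullet> N pt" for k
  define P where "P k = D (\<xi>dir j) (pp k k) pt \<bullet> D (\<xi>dir j) p pt" for k
  define R where "R k = D (\<xi>dir k) (pp j j) pt \<bullet> D (\<xi>dir k) p pt" for k
  have comm1: "D (\<xi>dir k) (D (\<xi>dir k) (pp j j)) pt \<bullet> N pt = Q k" for k
  proof -
    have "D (\<xi>dir k) (D (\<xi>dir k) (pp j j)) pt = D (\<xi>dir k) (D (\<xi>dir j) (pp k j)) pt"
      by (rule commute2[OF smooth_D[OF smooth_p] S(2)])
    also have "\<dots> = D (\<xi>dir j) (D (\<xi>dir k) (pp k j)) pt" by (rule commute[OF smooth_D[OF smooth_D[OF smooth_p]] S(2)])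
    also have "\<dots> = D (\<xi>dir j) (D (\<xi>dir k) (pp j k)) pt"
      by (rule D_cong[OF S]) (rule commute2[OF smooth_p])
    also have "\<dots> = D (\<xi>dir j) (D (\<xi>dir j) (pp k k)) pt" by (rule commute2[OF smooth_D[OF smooth_p] S(2)])
    finally show ?thesis by (simp add: Q_def)
  qed
  have comm2: "D (\<xi>dir j) (pp j k) pt = D (\<xi>dir k) (pp j j) pt" for j k
    by (subst commute2[OF smooth_p S(2)]) (rule commute[OF smooth_D[OF smooth_p] S(2)])
  have Dg: "D (\<xi>dir k) (D (\<xi>dir k) ?g) pt = 2 * P k + 2 * (if j = k then f\<^sup>2 else 0)" for k
  proof -
    have "pp k j pt \<bullet> pp k j pt = (if j = k then f\<^sup>2 else 0)"
      using unit[OF S(2)] aj by (auto simp: p_ij f_def power2_eq_square)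
    then show ?thesis
      by (simp add: D2_inner[OF S smooth_D[OF smooth_p] smooth_D[OF smooth_p]] inner_commute P_def comm2)
  qed
  have Dk: "D (\<xi>dir k) (D (\<xi>dir k) ?k) pt = Q k + 2 * a $ k * R k + f * (a $ k)\<^sup>2" for k
  proof -
    have "pp j j pt \<bullet> D (\<xi>dir k) (D (\<xi>dir k) N) pt = f * (a $ k)\<^sup>2"
      using N_DDN[OF S(2), of "\<xi>dir k"] by (simp add: p_ij f_def aj N_i orthonormal power2_eq_square inner_commute)
    then show ?thesis
      by (simp add: D2_inner[OF S smooth_D[OF smooth_D[OF smooth_p]] smooth_N] comm1 N_i R_def)
  qed
  have D1g: "D (\<xi>dir k) ?g pt = 0" for k
    by (simp add: D_inner diffI smooth_D smooth_p S p_ij normal normal')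
  have "D (\<xi>dir k) (D (\<xi>dir k) u) pt = D (\<xi>dir k) (D (\<xi>dir k) \<phi>) pt + f * (2 * P k + 2 * (if j = k then f\<^sup>2 else 0))
      + (Q k + 2 * a $ k * R k + f * (a $ k)\<^sup>2)" for k
    unfolding u_def[abs_def] D2_add[OF S Ck_on_mult[OF \<phi> sg] sk] D2_mult[OF S \<phi> sg] Dg Dk D1g
    by (simp add: orthonormal f_def)
  then have "0 \<le> c $ k * (D (\<xi>dir k) (D (\<xi>dir k) \<phi>) pt + f * (2 * P k + 2 * (if j = k then f\<^sup>2 else 0))
      + (Q k + 2 * a $ k * R k + f * (a $ k)\<^sup>2))" for k
    using test(3)[of k] c_nonneg[of k] by simp
  then have s: "0 \<le> (\<Sum>k\<in>UNIV. c $ k * (D (\<xi>dir k) (D (\<xi>dir k) \<phi>) pt + f * (2 * P k + 2 * (if j = k then f\<^sup>2 else 0))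
      + (Q k + 2 * a $ k * R k + f * (a $ k)\<^sup>2)))" by (intro sum_nonneg) auto
  have "D (\<xi>dir j) (D (\<xi>dir j) F) pt \<le> (\<Sum>k\<in>UNIV. c $ k * (- Q k - 2 * f * P k - a $ k * f\<^sup>2
      - a $ k * (2 * R k + 2 * (if j = k then f\<^sup>2 else 0))))"
  proof (rule order_trans[OF F_hess[of j]], rule sum_mono, rule mult_left_mono[OF _ c_nonneg])
    fix k
    have 1: "pp k k pt \<bullet> D (\<xi>dir j) (D (\<xi>dir j) N) pt = a $ k * f\<^sup>2"
      using N_DDN[OF S(2), of "\<xi>dir j"] by (simp add: p_ij f_def aj N_i orthonormal power2_eq_square inner_commute)
    have 2: "pp j k pt \<bullet> pp j k pt = (if j = k then f\<^sup>2 else 0)"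
      using unit[OF S(2)] aj by (auto simp: p_ij f_def power2_eq_square)
    show "- (D (\<xi>dir j) (D (\<xi>dir j) (pp k k)) pt \<bullet> N pt) - 2 * (D (\<xi>dir j) (pp k k) pt \<bullet> D (\<xi>dir j) N pt)
         - pp k k pt \<bullet> D (\<xi>dir j) (D (\<xi>dir j) N) pt
       - a $ k * (2 * (D (\<xi>dir j) (pp j k) pt \<bullet> D (\<xi>dir k) p pt) + 2 * (pp j k pt \<bullet> pp j k pt))
      \<le> - Q k - 2 * f * P k - a $ k * f\<^sup>2 - a $ k * (2 * R k + 2 * (if j = k then f\<^sup>2 else 0))"
      unfolding 1 2 comm2[of j k] by (simp add: Q_def P_def R_def N_i f_def aj)
  qed
  \<comment> \<open>Besides the cancellation of \<open>Q\<close>, \<open>P\<close> and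
    \<open>R\<close>, the terms \<open>a $ k * f\<^sup>2\<close> are absorbed by
    \<open>F pt * f\<^sup>2\<close>, and the terms with \<open>j = k\<close> vanish because
    \<open>a $ j = f\<close>.\<close>
  moreover have "(\<Sum>k\<in>UNIV. c $ k * (- Q k - 2 * f * P k - a $ k * f\<^sup>2 - a $ k * (2 * R k + 2 * (if j = k then f\<^sup>2 else 0))))
     + F pt * f\<^sup>2 + (\<Sum>k\<in>UNIV. c $ k * (D (\<xi>dir k) (D (\<xi>dir k) \<phi>) pt + f * (2 * P k + 2 * (if j = k then f\<^sup>2 else 0))
      + (Q k + 2 * a $ k * R k + f * (a $ k)\<^sup>2))) = (\<Sum>k\<in>UNIV. c $ k * (D (\<xi>dir k) (D (\<xi>dir k) \<phi>) pt + (a $ k)\<^sup>2 * f))"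
    unfolding F_pt sum_distrib_right sum.distrib[symmetric]
    by (intro sum.cong refl) (auto simp: algebra_simps f_def aj)
  ultimately show ?thesis using t s unfolding f_def[symmetric] by linarith
qed

text \<open>Both points are moved with the same coordinate \<xi>. As the frames are mirror images,
  the first derivatives of \<open>V = p - q\<close> at the centre are multiples of \<open>v\<close>,
  so the first order condition determines the gradient of \<phi> and all squared terms combine into
  \<open>8 * (a $ i - f) * (\<alpha> i)\<^sup>2 / dd\<close>, which has a sign. \<open>M\<close> is
  the reflected normal.\<close>

lemma off_diagonal_inequality:
  assumes q: "flow_patch S t0 q M F' H'" and \<phi>: "Ck_on 2 \<phi> S"
    and nonneg: "\<And>\<xi> t. (\<xi>, t) \<in> S \<Longrightarrow> t \<le> t0 \<Longrightarrow>
      0 \<le> \<phi> (\<xi>, t) * ((p (\<xi>, t) - q (\<xi>, t)) \<bullet> (p (\<xi>, t) - q (\<xi>, t))) - 2 * ((p (\<xi>, t) - q (\<xi>, t)) \<bullet> N (\<xi>, t))"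
    and ne: "p pt \<noteq> q pt"
    and zero: "\<phi> pt * ((p pt - q pt) \<bullet> (p pt - q pt)) = 2 * ((p pt - q pt) \<bullet> N pt)"
    and M: "M pt = N pt - \<phi> pt *\<^sub>R (p pt - q pt)"
    and reflect: "\<And>i. D (\<xi>dir i) q pt = D (\<xi>dir i) p pt -
      (2 * (D (\<xi>dir i) p pt \<bullet> (p pt - q pt)) / ((p pt - q pt) \<bullet> (p pt - q pt))) *\<^sub>R (p pt - q pt)"
    and F': "F' pt \<le> (\<Sum>i\<in>UNIV. c $ i * H' $ i $ i)"
    and a_le: "\<And>i. a $ i \<le> \<phi> pt"
  shows "D tdir \<phi> pt \<le> (\<Sum>k\<in>UNIV. c $ k * (D (\<xi>dir k) (D (\<xi>dir k) \<phi>) pt + (a $ k)\<^sup>2 * \<phi> pt))"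
proof -
  interpret q: flow_patch S t0 q M F' H' by (rule q)
  define v where "v = p pt - q pt"
  define dd where "dd = v \<bullet> v"
  define f where "f = \<phi> pt"
  define \<alpha> where "\<alpha> i = D (\<xi>dir i) p pt \<bullet> v" for i
  define b where "b i = H' $ i $ i" for i
  have dd: "dd > 0" using ne by (simp add: dd_def v_def)
  have vN: "2 * (v \<bullet> N pt) = f * dd" using zero by (simp add: v_def dd_def f_def)
  have Mv: "M pt = N pt - f *\<^sub>R v" using M by (simp add: v_def f_def)
  define V where "V x = p x - q x" for x
  have sV: "Ck_on m V S" for m unfolding V_def[abs_def] by (intro Ck_on_diff smooth_p q.smooth_p)
  have V0: "V pt = v" by (simp add: V_def v_def)
  have DV: "D w V pt = D w p pt - D w q pt" for w
    unfolding V_def[abs_def] by (intro D_diff diffI smooth_p q.smooth_p S)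
  have Vi: "D (\<xi>dir i) V pt = (2 * \<alpha> i / dd) *\<^sub>R v" for i
    unfolding DV reflect by (simp add: v_def dd_def \<alpha>_def)
  have Vii: "D (\<xi>dir i) (D (\<xi>dir i) V) pt = b i *\<^sub>R M pt - a $ i *\<^sub>R N pt" for i
    unfolding V_def[abs_def] D2_diff[OF S smooth_p q.smooth_p] by (simp add: p_ij q.hess_p b_def)
  have Vt: "D tdir V pt = F' pt *\<^sub>R M pt - F pt *\<^sub>R N pt"
    unfolding DV by (simp add: flow[OF S(2)] q.flow[OF S(2)])
  have MV: "f * (v \<bullet> w) - w \<bullet> N pt = - (M pt \<bullet> w)" for w
    unfolding Mv by (simp add: inner_diff_left inner_diff_right inner_commute)
  let ?g = "\<lambda>x. V x \<bullet> V x" and ?k = "\<lambda>x. V x \<bullet> N x"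
  have sg: "Ck_on m ?g S" and sk: "Ck_on m ?k S" for m by (intro Ck_on_inner sV smooth_N)+
  define u where "u x = \<phi> x * ?g x - 2 * ?k x" for x
  have su: "Ck_on 2 u S" unfolding u_def[abs_def] by (intro Ck_on_diff Ck_on_mult Ck_on_const \<phi> sg sk)
  have u0: "u pt = 0" using vN by (simp add: u_def V0 f_def dd_def)
  have "0 \<le> u (\<xi>, t)" if "(\<xi>, t) \<in> S" "t \<le> t0" for \<xi> t using nonneg[OF that] by (simp add: u_def V_def)
  note test = back_in_time[OF this su u0]
  have d\<phi>: "\<phi> differentiable (at pt)" by (rule differentiable_of_C2[OF \<phi> S(2)])
  have Du: "D w u pt = D w \<phi> pt * dd + f * (2 * (v \<bullet> D w V pt)) - 2 * (D w V pt \<bullet> N pt + v \<bullet> D w N pt)" for w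
  proof -
    have "D w u pt = D w (\<lambda>x. \<phi> x * ?g x) pt - D w (\<lambda>x. 2 * ?k x) pt"
      unfolding u_def[abs_def] using d\<phi> diffI[OF sg S(2)] diffI[OF Ck_on_mult[OF Ck_on_const sk] S(2)]
      by (intro D_diff) (auto intro: differentiable_mult)
    then show ?thesis using d\<phi> diffI[OF sg S(2)] diffI[OF sk S(2)] diffI[OF sV S(2)] diffI[OF smooth_N S(2)]
      by (simp add: D_mult D_inner V0 f_def dd_def inner_commute)
  qed
  \<comment> \<open>First order condition in the mirrored directions, solved for the gradient of
    \<phi>.\<close>
  have \<phi>i: "D (\<xi>dir i) \<phi> pt = 2 * (a $ i - f) * \<alpha> i / dd" for i
  proof -
    have vN': "v \<bullet> N pt = f * dd / 2" using vN by simp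
    have \<alpha>': "v \<bullet> D (\<xi>dir i) p pt = \<alpha> i" by (simp add: \<alpha>_def inner_commute)
    have "D (\<xi>dir i) \<phi> pt * dd + f * (2 * (2 * \<alpha> i)) - (2 * \<alpha> i / dd) * (f * dd) - 2 * (a $ i * \<alpha> i) = 0"
      using test(2)[of i] dd unfolding Du Vi N_i
      by (simp add: \<alpha>' vN' dd_def[symmetric] algebra_simps)
    then show ?thesis using dd by (simp add: field_simps)
  qed
  have step: "0 \<le> D (\<xi>dir i) (D (\<xi>dir i) \<phi>) pt * dd + 2 * a $ i * (M pt \<bullet> N pt) - 2 * b i
      - 2 * (v \<bullet> D (\<xi>dir i) (D (\<xi>dir i) N) pt)" for i
  proof -
    have g1: "D (\<xi>dir i) ?g pt = 4 * \<alpha> i"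
      using diffI[OF sV S(2)] dd by (simp add: D_inner V0 Vi dd_def[symmetric])
    have g2: "D (\<xi>dir i) (D (\<xi>dir i) ?g) pt = 2 * (v \<bullet> D (\<xi>dir i) (D (\<xi>dir i) V) pt) + 8 * (\<alpha> i)\<^sup>2 / dd"
      unfolding D2_inner[OF S sV sV] V0 using dd
      by (simp add: Vi dd_def[symmetric] inner_commute power2_eq_square)
    have k2: "D (\<xi>dir i) (D (\<xi>dir i) ?k) pt = D (\<xi>dir i) (D (\<xi>dir i) V) pt \<bullet> N pt + 4 * a $ i * (\<alpha> i)\<^sup>2 / dd
        + v \<bullet> D (\<xi>dir i) (D (\<xi>dir i) N) pt"
      unfolding D2_inner[OF S sV smooth_N] V0
      by (simp add: Vi N_i \<alpha>_def inner_commute power2_eq_square)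
    have "D (\<xi>dir i) (D (\<xi>dir i) u) pt = D (\<xi>dir i) (D (\<xi>dir i) (\<lambda>x. \<phi> x * ?g x)) pt - 2 * D (\<xi>dir i) (D (\<xi>dir i) ?k) pt"
      unfolding u_def[abs_def] D2_diff[OF S Ck_on_mult[OF \<phi> sg] Ck_on_mult[OF Ck_on_const sk]]
      by (simp add: D2_cmult[OF S sk])
    also have "\<dots> = D (\<xi>dir i) (D (\<xi>dir i) \<phi>) pt * dd + 8 * \<alpha> i * D (\<xi>dir i) \<phi> pt + 8 * f * (\<alpha> i)\<^sup>2 / dd
        + 2 * (f * (v \<bullet> D (\<xi>dir i) (D (\<xi>dir i) V) pt) - D (\<xi>dir i) (D (\<xi>dir i) V) pt \<bullet> N pt)
        - 8 * a $ i * (\<alpha> i)\<^sup>2 / dd - 2 * (v \<bullet> D (\<xi>dir i) (D (\<xi>dir i) N) pt)"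
      unfolding D2_mult[OF S \<phi> sg] g1 g2 k2
      by (simp add: V0 f_def dd_def algebra_simps)
    also have "\<dots> = D (\<xi>dir i) (D (\<xi>dir i) \<phi>) pt * dd + 8 * (a $ i - f) * (\<alpha> i)\<^sup>2 / dd
        + 2 * a $ i * (M pt \<bullet> N pt) - 2 * b i - 2 * (v \<bullet> D (\<xi>dir i) (D (\<xi>dir i) N) pt)"
      unfolding MV \<phi>i Vii using q.unit[OF S(2)] dd
      by (simp add: inner_diff_right field_simps power2_eq_square)
    also have "\<dots> \<le> D (\<xi>dir i) (D (\<xi>dir i) \<phi>) pt * dd
        + 2 * a $ i * (M pt \<bullet> N pt) - 2 * b i - 2 * (v \<bullet> D (\<xi>dir i) (D (\<xi>dir i) N) pt)"
    proof -
      have "8 * (a $ i - f) \<le> 0" using a_le[of i] by (simp add: f_def)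
      then have "8 * (a $ i - f) * (\<alpha> i)\<^sup>2 \<le> 0" by (rule mult_nonpos_nonneg) simp
      then have "8 * (a $ i - f) * (\<alpha> i)\<^sup>2 / dd \<le> 0" using dd by (rule divide_nonpos_pos)
      then show ?thesis by linarith
    qed
    finally show ?thesis using test(3)[of i] by linarith
  qed
  have "0 \<le> (\<Sum>i\<in>UNIV. c $ i * (D (\<xi>dir i) (D (\<xi>dir i) \<phi>) pt * dd + 2 * a $ i * (M pt \<bullet> N pt) - 2 * b i
      - 2 * (v \<bullet> D (\<xi>dir i) (D (\<xi>dir i) N) pt)))"
    by (intro sum_nonneg mult_nonneg_nonneg c_nonneg step)
  also have "\<dots> = dd * (\<Sum>i\<in>UNIV. c $ i * D (\<xi>dir i) (D (\<xi>dir i) \<phi>) pt) + 2 * F pt * (M pt \<bullet> N pt)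
      - 2 * (\<Sum>i\<in>UNIV. c $ i * b i) - 2 * (\<Sum>i\<in>UNIV. c $ i * (v \<bullet> D (\<xi>dir i) (D (\<xi>dir i) N) pt))"
    unfolding F_pt sum_distrib_left sum_distrib_right sum.distrib[symmetric] sum_subtractf[symmetric]
    by (intro sum.cong refl) (simp add: algebra_simps)
  finally have s: "0 \<le> dd * (\<Sum>i\<in>UNIV. c $ i * D (\<xi>dir i) (D (\<xi>dir i) \<phi>) pt) + 2 * F pt * (M pt \<bullet> N pt)
      - 2 * (\<Sum>i\<in>UNIV. c $ i * b i) - 2 * (\<Sum>i\<in>UNIV. c $ i * (v \<bullet> D (\<xi>dir i) (D (\<xi>dir i) N) pt))" .
  have Nt: "v \<bullet> D tdir N pt = (\<Sum>i\<in>UNIV. c $ i * (v \<bullet> D (\<xi>dir i) (D (\<xi>dir i) N) pt)) + (\<Sum>i\<in>UNIV. c $ i * (a $ i)\<^sup>2) * (v \<bullet> N pt)"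
    unfolding normal_evolution by (simp add: inner_add_right inner_sum_right)
  have "D tdir \<phi> pt * dd + 2 * (f * (v \<bullet> D tdir V pt) - D tdir V pt \<bullet> N pt) - 2 * (v \<bullet> D tdir N pt) \<le> 0"
    using test(1) unfolding Du by (simp add: algebra_simps)
  then have t: "D tdir \<phi> pt * dd \<le> 2 * F' pt - 2 * F pt * (M pt \<bullet> N pt) + 2 * (v \<bullet> D tdir N pt)"
    unfolding MV Vt using q.unit[OF S(2)] by (simp add: inner_diff_right)
  have "(\<Sum>i\<in>UNIV. c $ i * (a $ i)\<^sup>2) * (v \<bullet> N pt) * 2 = (\<Sum>i\<in>UNIV. c $ i * (a $ i)\<^sup>2) * (f * dd)"
    using vN by simp
  \<comment> \<open>The terms with \<open>F pt * (M pt \<bullet> N pt)\<close> cancel between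
    \<open>s\<close> and \<open>t\<close>, the second derivatives of \<open>N\<close> are replaced
    through \<open>normal_evolution\<close>, and the speed at the second point is bounded by the
    weighted sum of the \<open>b i\<close>.\<close>
  then have "D tdir \<phi> pt * dd \<le> dd * (\<Sum>i\<in>UNIV. c $ i * D (\<xi>dir i) (D (\<xi>dir i) \<phi>) pt) + (\<Sum>i\<in>UNIV. c $ i * (a $ i)\<^sup>2) * (f * dd)"
    using t s Nt F' unfolding b_def by linarith
  also have "\<dots> = (\<Sum>k\<in>UNIV. c $ k * (D (\<xi>dir k) (D (\<xi>dir k) \<phi>) pt + (a $ k)\<^sup>2 * f)) * dd"
    unfolding sum_distrib_left sum_distrib_right sum.distrib[symmetric]
    by (intro sum.cong refl) (simp add: algebra_simps)
  finally show ?thesis using dd by (simp add: f_def)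
qed

end

section \<open>Families of embedded hypersurfaces\<close>

lemma continuous_on_locally:
  fixes f :: "'a::t2_space \<Rightarrow> 'b::topological_space"
  assumes "\<And>x. x \<in> S \<Longrightarrow> \<exists>V. open V \<and> x \<in> V \<and> continuous_on (S \<inter> V) f"
  shows "continuous_on S f"
  unfolding continuous_on_eq_continuous_within
proof
  fix x assume x: "x \<in> S"
  then obtain V where V: "open V" "x \<in> V" "continuous_on (S \<inter> V) f" using assms by blast
  then have "continuous (at x within S \<inter> V) f" using x by (simp add: continuous_on_eq_continuous_within)
  moreover have "at x within S \<inter> V = at x within S" by (rule at_within_nhd[OF V(2,1)]) auto
  ultimately show "continuous (at x within S) f" by simp
qed

locale hypersurface_family =
  fixes \<A> :: "('p::t2_space, 'n::finite) chart set" and X :: "'p \<Rightarrow> real \<Rightarrow> real^'m::finite" and T :: real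
  assumes card_m: "CARD('m) = CARD('n) + 1"
    and compact_M: "compact (UNIV :: 'p set)" and atlas: "smooth_atlas \<A>" and T: "0 < T"
    and emb: "smooth_family_of_embeddings \<A> T X"
begin

abbreviation "I \<equiv> {0..<T}"
definition U :: "('p, 'n) chart \<Rightarrow> (real^'n) set" where "U C = snd C ` fst C"
definition Y :: "('p, 'n) chart \<Rightarrow> (real^'n) \<times> real \<Rightarrow> real^'m" where "Y C = (\<lambda>(z, t). X (chart_inv C z) t)"

lemma chart_cover: "\<exists>C\<in>\<A>. x \<in> fst C"
proof -
  have "(\<Union>C\<in>\<A>. fst C) = UNIV" using atlas by (simp add: smooth_atlas_def)
  then show ?thesis by (metis UNIV_I UN_E)
qed

lemma chart_facts:
  assumes "C \<in> \<A>"
  shows "open (fst C)" "open (U C)" "x \<in> fst C \<Longrightarrow> chart_inv C (snd C x) = x"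
    "x \<in> fst C \<Longrightarrow> snd C x \<in> U C"
    "z \<in> U C \<Longrightarrow> snd C (chart_inv C z) = z" "z \<in> U C \<Longrightarrow> chart_inv C z \<in> fst C"
    "continuous_on (U C) (chart_inv C)" "continuous_on (fst C) (snd C)"
proof -
  have a: "open (fst C)" "open (U C)" and h: "homeomorphism (fst C) (U C) (snd C) (chart_inv C)"
    using atlas assms unfolding smooth_atlas_def U_def by auto
  show "open (fst C)" "open (U C)" by fact+
  show "x \<in> fst C \<Longrightarrow> chart_inv C (snd C x) = x" "x \<in> fst C \<Longrightarrow> snd C x \<in> U C"
    "z \<in> U C \<Longrightarrow> snd C (chart_inv C z) = z" "z \<in> U C \<Longrightarrow> chart_inv C z \<in> fst C"
    "continuous_on (U C) (chart_inv C)" "continuous_on (fst C) (snd C)"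
    using h by (auto simp: homeomorphism_def)
qed

lemma smooth_Y: "C \<in> \<A> \<Longrightarrow> Ck_on k (Y C) (U C \<times> I)"
  using emb unfolding smooth_family_of_embeddings_def smooth_family_def Ck_family_def Y_def U_def by blast

lemma smooth_sd_Y: "C \<in> \<A> \<Longrightarrow> Ck_on k (sd v (Y C)) (U C \<times> I)"
  using Ck_on_sd[OF chart_facts(2) smooth_Y, of C k v] by blast

lemma smooth_sd2_Y: "C \<in> \<A> \<Longrightarrow> Ck_on k (sd v (sd w (Y C))) (U C \<times> I)"
  using Ck_on_sd[OF chart_facts(2) smooth_sd_Y, of C k v w] by blast

lemma Y_eq: "C \<in> \<A> \<Longrightarrow> x \<in> fst C \<Longrightarrow> Y C (snd C x, t) = X x t"
  by (simp add: Y_def chart_facts)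

lemma pd_eq_sd: "pd i (\<lambda>w. f (w, t)) z = sd (axis i 1) f (z, t)"
  by (simp add: pd_def sd_def D_def)

lemma sd_linear:
  assumes "C \<in> \<A>" "z \<in> U C" "t \<in> I" "\<And>k. Ck_on k f (U C \<times> I)"
  shows "sd v f (z, t) = (\<Sum>i\<in>UNIV. v $ i *\<^sub>R sd (axis i 1) f (z, t))"
proof -
  have "((\<lambda>w. f (w, t)) has_derivative (\<lambda>v. sd v f (z, t))) (at z)"
    by (rule sd_has_derivative[OF chart_facts(2)[OF assms(1)] assms(4) assms(2,3)])
  then have d: "(\<lambda>w. f (w, t)) differentiable (at z)" by (auto simp: differentiable_def)
  have "v = (\<Sum>i\<in>UNIV. v $ i *\<^sub>R axis i 1)"
    by (simp add: vec_eq_iff axis_def if_distrib cong: if_cong)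
  then have "D v (\<lambda>w. f (w, t)) z = D (\<Sum>i\<in>UNIV. v $ i *\<^sub>R axis i 1) (\<lambda>w. f (w, t)) z" by simp
  then show ?thesis unfolding sd_def by (simp add: D_linear[OF d])
qed

lemma sd_Y_inj:
  assumes C: "C \<in> \<A>" "z \<in> U C" "t \<in> I" and "sd v (Y C) (z, t) = 0"
  shows "v = 0"
proof -
  have "immersion \<A> (\<lambda>x. X x t)" using emb C by (simp add: smooth_family_of_embeddings_def)
  then have "inj (frechet_derivative ((\<lambda>x. X x t) \<circ> chart_inv C) (at z))"
    using C by (auto simp: immersion_def U_def)
  moreover have e: "frechet_derivative ((\<lambda>x. X x t) \<circ> chart_inv C) (at z) w = sd w (Y C) (z, t)" for w
    by (simp add: sd_def D_def Y_def o_def)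
  moreover have "sd 0 (Y C) (z, t) = 0" by (subst sd_linear[OF C smooth_Y[OF C(1)]]) simp
  ultimately show ?thesis using assms(4) by (metis injD)
qed

lemma continuous_X: "continuous_on (UNIV \<times> I) (\<lambda>(x, t). X x t)"
proof (rule continuous_on_locally)
  fix a :: "'p \<times> real" assume "a \<in> UNIV \<times> I"
  obtain C where C: "C \<in> \<A>" "fst a \<in> fst C" using chart_cover by blast
  have "continuous_on (fst C \<times> I) (\<lambda>(x, t). X x t)"
  proof -
    have "continuous_on (fst C \<times> I) (\<lambda>x. Y C (snd C (fst x), snd x))"
    proof (rule continuous_on_compose2[OF Ck_on_imp_continuous_on[OF smooth_Y[OF C(1)]]])
      show "continuous_on (fst C \<times> I) (\<lambda>x. (snd C (fst x), snd x))"
        by (intro continuous_intros continuous_on_compose2[OF chart_facts(8)[OF C(1)]]) auto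
    qed (use chart_facts(4)[OF C(1)] in auto)
    then show ?thesis by (rule continuous_on_eq) (auto simp: Y_eq C)
  qed
  then have "continuous_on (UNIV \<times> I \<inter> fst C \<times> UNIV) (\<lambda>(x, t). X x t)"
    by (rule continuous_on_subset) auto
  then show "\<exists>V. open V \<and> a \<in> V \<and> continuous_on (UNIV \<times> I \<inter> V) (\<lambda>(x, t). X x t)"
    using C chart_facts(1)[OF C(1)] by (intro exI[of _ "fst C \<times> UNIV"]) (auto simp: open_Times mem_Times_iff)
qed

lemma X_tendsto:
  assumes "xs \<longlonglongrightarrow> x" "ts \<longlonglongrightarrow> t" "\<And>n. ts n \<in> I" "t \<in> I"
  shows "(\<lambda>n. X (xs n) (ts n)) \<longlonglongrightarrow> X x t"
proof -
  have "(\<lambda>n. (xs n, ts n)) \<longlonglongrightarrow> (x, t)" using assms by (intro tendsto_Pair)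
  from continuous_on_tendsto_compose[OF continuous_X this] show ?thesis using assms by auto
qed

lemma embedding_t: "t \<in> I \<Longrightarrow> \<exists>Yi. homeomorphism UNIV (range (\<lambda>x. X x t)) (\<lambda>x. X x t) Yi"
  using emb by (simp add: smooth_family_of_embeddings_def)

lemma X_inj: "t \<in> I \<Longrightarrow> X x t = X y t \<longleftrightarrow> x = y"
  using embedding_t unfolding homeomorphism_def by (metis UNIV_I)

lemma compact_X: assumes "t \<in> I" shows "compact (range (\<lambda>x. X x t))"
proof -
  have "continuous_on UNIV (\<lambda>x. X x t)" using embedding_t[OF assms] by (auto simp: homeomorphism_def)
  then show ?thesis using compact_continuous_image compact_M by blast
qed

lemma tendsto_iff_X:
  assumes "t \<in> I" "(\<lambda>n. X (xs n) t) \<longlonglongrightarrow> X x t"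
  shows "xs \<longlonglongrightarrow> x"
proof -
  obtain Yi where h: "homeomorphism UNIV (range (\<lambda>x. X x t)) (\<lambda>x. X x t) Yi" using embedding_t[OF assms(1)] by blast
  then have "continuous_on (range (\<lambda>x. X x t)) Yi" "\<And>x. Yi (X x t) = x" by (auto simp: homeomorphism_def)
  from continuous_on_tendsto_compose[OF this(1) assms(2)] this(2) show ?thesis by auto
qed

text \<open>The manifold is given as a compact Hausdorff space. Convergent subsequences are found in
  the image of the initial embedding, a compact set in Euclidean space, and carried back by the
  continuous inverse.\<close>

lemma sequence_compact:
  fixes xs :: "nat \<Rightarrow> 'p"
  obtains r x where "strict_mono r" "(\<lambda>n. xs (r n)) \<longlonglongrightarrow> x"
proof -
  have 0: "0 \<in> I" using T by simp
  have "\<forall>n. X (xs n) 0 \<in> range (\<lambda>x. X x 0)" by simp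
  then obtain l r where l: "l \<in> range (\<lambda>x. X x 0)" "strict_mono r" "((\<lambda>n. X (xs n) 0) \<circ> r) \<longlonglongrightarrow> l"
    using compact_X[OF 0] unfolding compact_def by metis
  then obtain x where "l = X x 0" by auto
  then have "(\<lambda>n. xs (r n)) \<longlonglongrightarrow> x" using l(3) by (intro tendsto_iff_X[OF 0]) (simp add: o_def)
  then show ?thesis using that l(2) by blast
qed

text \<open>Sequences suffice because the initial embedding identifies
  \<open>UNIV \<times> I\<close> with a subset of a metric space; the function is transported there,
  tested sequentially and composed back.\<close>

lemma continuous_on_sequentiallyI:
  fixes u :: "'p \<Rightarrow> real \<Rightarrow> 'b::topological_space"
  assumes "\<And>xs ts x t. xs \<longlonglongrightarrow> x \<Longrightarrow> ts \<longlonglongrightarrow> t \<Longrightarrow> (\<And>n. ts n \<in> I) \<Longrightarrow> t \<in> I \<Longrightarrow> (\<lambda>n. u (xs n) (ts n)) \<longlonglongrightarrow> u x t"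
  shows "continuous_on (UNIV \<times> I) (\<lambda>(x, t). u x t)"
proof -
  have 0: "0 \<in> I" using T by simp
  obtain Yi where h: "homeomorphism UNIV (range (\<lambda>x. X x 0)) (\<lambda>x. X x 0) Yi" using embedding_t[OF 0] by blast
  then have Yi: "\<And>x. Yi (X x 0) = x" by (auto simp: homeomorphism_def)
  have A: "continuous_on (range (\<lambda>x. X x 0) \<times> I) (\<lambda>x. u (Yi (fst x)) (snd x))"
    unfolding continuous_on_sequentially o_def
  proof (intro allI ballI impI, elim conjE)
    fix s :: "nat \<Rightarrow> (real^'m) \<times> real" and a
    assume a: "a \<in> range (\<lambda>x. X x 0) \<times> I" "\<forall>n. s n \<in> range (\<lambda>x. X x 0) \<times> I" and lim: "s \<longlonglongrightarrow> a"
    have "fst (s n) \<in> range (\<lambda>x. X x 0)" for n using a(2) by (simp add: mem_Times_iff)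
    then have "\<exists>x. fst (s n) = X x 0" for n by (simp add: image_iff)
    then obtain xs where xs: "\<And>n. fst (s n) = X (xs n) 0" by metis
    obtain x where x: "fst a = X x 0" using a(1) by auto
    have "(\<lambda>n. X (xs n) 0) \<longlonglongrightarrow> X x 0" using tendsto_fst[OF lim] by (simp add: xs x)
    then have "xs \<longlonglongrightarrow> x" by (rule tendsto_iff_X[OF 0])
    then have "(\<lambda>n. u (xs n) (snd (s n))) \<longlonglongrightarrow> u x (snd a)"
      by (rule assms) (use tendsto_snd[OF lim] a in \<open>auto simp: mem_Times_iff\<close>)
    then show "(\<lambda>n. u (Yi (fst (s n))) (snd (s n))) \<longlonglongrightarrow> u (Yi (fst a)) (snd a)" by (simp add: xs x Yi)
  qed
  have "continuous_on UNIV (\<lambda>x. X x 0)" using h by (simp add: homeomorphism_def)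
  then have "continuous_on (UNIV \<times> I) (\<lambda>x. X (fst x) 0)"
    by (rule continuous_on_compose2[OF _ continuous_on_fst[OF continuous_on_id]]) auto
  then have B: "continuous_on (UNIV \<times> I) (\<lambda>x. (X (fst x) 0, snd x))"
    by (rule continuous_on_Pair[OF _ continuous_on_snd[OF continuous_on_id]])
  have "(\<lambda>x. (X (fst x) 0, snd x)) ` (UNIV \<times> I) \<subseteq> range (\<lambda>x. X x 0) \<times> I" by auto
  from continuous_on_compose2[OF A B this] have "continuous_on (UNIV \<times> I) (\<lambda>x. u (Yi (X (fst x) 0)) (snd x))" by simp
  then show ?thesis by (simp add: Yi case_prod_unfold)
qed

lemma snd_chart_tendsto:
  assumes C: "C \<in> \<A>" "x \<in> fst C" and xs: "xs \<longlonglongrightarrow> x"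
  shows "(\<lambda>n. snd C (xs n)) \<longlonglongrightarrow> snd C x" "\<forall>\<^sub>F n in sequentially. xs n \<in> fst C"
proof -
  show ev: "\<forall>\<^sub>F n in sequentially. xs n \<in> fst C"
    using topological_tendstoD[OF xs chart_facts(1)[OF C(1)] C(2)] .
  show "(\<lambda>n. snd C (xs n)) \<longlonglongrightarrow> snd C x"
    by (rule continuous_on_tendsto_compose[OF chart_facts(8)[OF C(1)] xs C(2) ev])
qed

lemma chart_inv_tendsto:
  assumes C: "C \<in> \<A>" "z \<in> U C" and zs: "zs \<longlonglongrightarrow> z"
  shows "(\<lambda>n. chart_inv C (zs n)) \<longlonglongrightarrow> chart_inv C z" "\<forall>\<^sub>F n in sequentially. zs n \<in> U C"
proof -
  show ev: "\<forall>\<^sub>F n in sequentially. zs n \<in> U C"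
    using topological_tendstoD[OF zs chart_facts(2)[OF C(1)] C(2)] .
  show "(\<lambda>n. chart_inv C (zs n)) \<longlonglongrightarrow> chart_inv C z"
    by (rule continuous_on_tendsto_compose[OF chart_facts(7)[OF C(1)] zs C(2) ev])
qed

lemma C_tendsto:
  assumes C: "C \<in> \<A>" "z \<in> U C" "t \<in> I" and f: "Ck_on k f (U C \<times> I)"
    and lim: "zs \<longlonglongrightarrow> z" "ts \<longlonglongrightarrow> t" and ts: "\<And>n. ts n \<in> I"
  shows "(\<lambda>n. f (zs n, ts n)) \<longlonglongrightarrow> f (z, t)"
proof (rule continuous_on_tendsto_compose[OF Ck_on_imp_continuous_on[OF f]])
  show "(\<lambda>n. (zs n, ts n)) \<longlonglongrightarrow> (z, t)" by (intro tendsto_Pair lim)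
  show "\<forall>\<^sub>F n in sequentially. (zs n, ts n) \<in> U C \<times> I"
    using chart_inv_tendsto(2)[OF C(1,2) lim(1)] ts by (auto elim: eventually_mono)
qed (use C in auto)

lemma sd2_bilinear:
  assumes C: "C \<in> \<A>" "z \<in> U C" "t \<in> I"
  shows "sd v (sd w (Y C)) (z, t) = (\<Sum>i\<in>UNIV. \<Sum>j\<in>UNIV. (v $ i * w $ j) *\<^sub>R sd (axis i 1) (sd (axis j 1) (Y C)) (z, t))"
proof -
  have dif: "(\<lambda>x. sd (axis j 1) (Y C) (x, t)) differentiable (at z)" for j
    using sd_has_derivative[OF chart_facts(2)[OF C(1)] smooth_sd_Y[OF C(1), of _ "axis j 1"] C(2,3)]
    by (auto simp: differentiable_def)
  have "sd v (sd w (Y C)) (z, t) = D v (\<lambda>x. \<Sum>j\<in>UNIV. w $ j *\<^sub>R sd (axis j 1) (Y C) (x, t)) z"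
    unfolding sd_def[of v] fst_conv snd_conv
    by (rule D_cong[OF chart_facts(2)[OF C(1)] C(2)]) (rule sd_linear[OF C(1) _ C(3) smooth_Y[OF C(1)]])
  also have "\<dots> = (\<Sum>j\<in>UNIV. D v (\<lambda>x. w $ j *\<^sub>R sd (axis j 1) (Y C) (x, t)) z)"
    by (rule D_sum) (intro differentiable_scaleR dif differentiable_const)
  also have "\<dots> = (\<Sum>j\<in>UNIV. w $ j *\<^sub>R sd v (sd (axis j 1) (Y C)) (z, t))"
    by (simp only: D_scaleR[OF differentiable_const dif] sd_def[of v] fst_conv snd_conv) simp
  also have "\<dots> = (\<Sum>j\<in>UNIV. \<Sum>i\<in>UNIV. (v $ i * w $ j) *\<^sub>R sd (axis i 1) (sd (axis j 1) (Y C)) (z, t))"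
    by (subst sd_linear[OF C smooth_sd_Y[OF C(1)], of v]) (simp add: scaleR_sum_right mult.commute)
  finally show ?thesis by (subst sum.swap)
qed

section \<open>Taylor expansion for two points merging in a chart\<close>

lemma line_derivative:
  assumes C: "C \<in> \<A>" "z + s *\<^sub>R w \<in> U C" "t \<in> I" and f: "\<And>k. Ck_on k f (U C \<times> I)"
  shows "((\<lambda>s. f (z + s *\<^sub>R w, t)) has_vector_derivative sd w f (z + s *\<^sub>R w, t)) (at s)"
proof -
  have "(\<lambda>x. f (x, t)) differentiable (at (z + s *\<^sub>R w))"
    using sd_has_derivative[OF chart_facts(2)[OF C(1)] f C(2,3)] by (auto simp: differentiable_def)
  from D_along_line[OF this] show ?thesis by (simp add: sd_def)
qed

text \<open>Taylor's formula along the segment between the two points, whose intermediate points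
  converge to \<open>z\<close>; continuity of the derivatives in space and time then gives the
  limits although base point and time move. In the second quotient the linear term is killed by
  orthogonality to the tangent space.\<close>

lemma difference_quotients:
  assumes C: "C \<in> \<A>" "z \<in> U C" "t \<in> I"
    and lim: "zs \<longlonglongrightarrow> z" "ws \<longlonglongrightarrow> z" "ts \<longlonglongrightarrow> t" and ts: "\<And>n. ts n \<in> I" and ne: "\<And>n. zs n \<noteq> ws n"
    and dir: "(\<lambda>n. (ws n - zs n) /\<^sub>R norm (ws n - zs n)) \<longlonglongrightarrow> d"
  shows "(\<lambda>n. (Y C (ws n, ts n) - Y C (zs n, ts n)) /\<^sub>R norm (ws n - zs n)) \<longlonglongrightarrow> sd d (Y C) (z, t)"
    and "Ns \<longlonglongrightarrow> N \<Longrightarrow> (\<And>n v. zs n \<in> U C \<Longrightarrow> sd v (Y C) (zs n, ts n) \<bullet> Ns n = 0) \<Longrightarrow>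
      (\<lambda>n. ((Y C (ws n, ts n) - Y C (zs n, ts n)) \<bullet> Ns n) / (norm (ws n - zs n))\<^sup>2) \<longlonglongrightarrow> (sd d (sd d (Y C)) (z, t) \<bullet> N) / 2"
proof -
  define l where "l n = norm (ws n - zs n)" for n
  define e where "e n = (ws n - zs n) /\<^sub>R l n" for n
  have l: "l n > 0" "ws n - zs n = l n *\<^sub>R e n" for n using ne[of n] by (auto simp: l_def e_def)
  have ej: "(ws n - zs n) $ j = l n * e n $ j" for n j by (subst l(2)) simp
  have el: "e \<longlonglongrightarrow> d" using dir by (simp add: e_def[abs_def] l_def)
  obtain \<epsilon> where \<epsilon>: "\<epsilon> > 0" "ball z \<epsilon> \<subseteq> U C" using chart_facts(2)[OF C(1)] C(2) open_contains_ball by blast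
  have ev: "\<forall>\<^sub>F n in sequentially. zs n \<in> ball z \<epsilon> \<and> ws n \<in> ball z \<epsilon>"
    using tendstoD[OF lim(1) \<epsilon>(1)] tendstoD[OF lim(2) \<epsilon>(1)] by eventually_elim (auto simp: dist_commute)
  have seg: "zs n + s *\<^sub>R (ws n - zs n) \<in> U C" if "zs n \<in> ball z \<epsilon> \<and> ws n \<in> ball z \<epsilon>" "0 \<le> s" "s \<le> 1" for n s
  proof -
    have "(1 - s) *\<^sub>R zs n + s *\<^sub>R ws n \<in> ball z \<epsilon>" using that by (intro convexD[OF convex_ball]) auto
    then show ?thesis using \<epsilon>(2) by (auto simp: algebra_simps)
  qed
  have \<zeta>: "(\<lambda>n. zs n + \<sigma> n *\<^sub>R (ws n - zs n)) \<longlonglongrightarrow> z" if "\<And>n. 0 \<le> \<sigma> n \<and> \<sigma> n \<le> 1" for \<sigma> :: "nat \<Rightarrow> real"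
  proof -
    have "(\<lambda>n. \<sigma> n *\<^sub>R (ws n - zs n)) \<longlonglongrightarrow> 0"
    proof (rule Lim_null_comparison)
      show "\<forall>\<^sub>F n in sequentially. norm (\<sigma> n *\<^sub>R (ws n - zs n)) \<le> norm (ws n - zs n)"
        using that by (simp add: mult_left_le_one_le)
      show "(\<lambda>n. norm (ws n - zs n)) \<longlonglongrightarrow> 0" using tendsto_norm[OF tendsto_diff[OF lim(2,1)]] by simp
    qed
    then show ?thesis using tendsto_add[OF lim(1)] by fastforce
  qed
  show "(\<lambda>n. (Y C (ws n, ts n) - Y C (zs n, ts n)) /\<^sub>R norm (ws n - zs n)) \<longlonglongrightarrow> sd d (Y C) (z, t)"
  proof (rule vec_tendstoI)
    fix i
    \<comment> \<open>The mean value theorem holds for each component separately, so \<sigma>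
      depends on the fixed index \<open>i\<close>. For the finitely many \<open>n\<close> with a
      point outside the ball the value 0 is a placeholder.\<close>
    have "\<exists>\<sigma>. 0 \<le> \<sigma> \<and> \<sigma> \<le> 1 \<and> (zs n \<in> ball z \<epsilon> \<and> ws n \<in> ball z \<epsilon> \<longrightarrow>
       (Y C (ws n, ts n) - Y C (zs n, ts n)) $ i = sd (ws n - zs n) (Y C) (zs n + \<sigma> *\<^sub>R (ws n - zs n), ts n) $ i)" for n
    proof (cases "zs n \<in> ball z \<epsilon> \<and> ws n \<in> ball z \<epsilon>")
      case True
      have "((\<lambda>s. Y C (zs n + s *\<^sub>R (ws n - zs n), ts n) $ i) has_real_derivative
          sd (ws n - zs n) (Y C) (zs n + s *\<^sub>R (ws n - zs n), ts n) $ i) (at s)" if "0 \<le> s" "s \<le> 1" for s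
        using bounded_linear.has_vector_derivative[OF bounded_linear_vec_nth line_derivative[OF C(1) seg[OF True that] ts smooth_Y[OF C(1)]]]
        by (simp add: has_real_derivative_iff_has_vector_derivative)
      from MVT2[of 0 1, OF _ this] obtain \<sigma> where "0 < \<sigma>" "\<sigma> < 1"
        "Y C (zs n + 1 *\<^sub>R (ws n - zs n), ts n) $ i - Y C (zs n + 0 *\<^sub>R (ws n - zs n), ts n) $ i = (1 - 0) * sd (ws n - zs n) (Y C) (zs n + \<sigma> *\<^sub>R (ws n - zs n), ts n) $ i"
        by auto
      then show ?thesis by (intro exI[of _ \<sigma>]) auto
    qed (auto intro: exI[of _ 0])
    then obtain \<sigma> where \<sigma>: "\<And>n. 0 \<le> \<sigma> n \<and> \<sigma> n \<le> 1" "\<And>n. zs n \<in> ball z \<epsilon> \<and> ws n \<in> ball z \<epsilon> \<Longrightarrow>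
       (Y C (ws n, ts n) - Y C (zs n, ts n)) $ i = sd (ws n - zs n) (Y C) (zs n + \<sigma> n *\<^sub>R (ws n - zs n), ts n) $ i" by metis
    let ?\<zeta> = "\<lambda>n. zs n + \<sigma> n *\<^sub>R (ws n - zs n)"
    have "(\<lambda>n. (\<Sum>j\<in>UNIV. e n $ j *\<^sub>R sd (axis j 1) (Y C) (?\<zeta> n, ts n)) $ i) \<longlonglongrightarrow> (\<Sum>j\<in>UNIV. d $ j *\<^sub>R sd (axis j 1) (Y C) (z, t)) $ i"
      by (intro tendsto_vec_nth tendsto_sum tendsto_scaleR el C_tendsto[OF C smooth_sd_Y[OF C(1)] \<zeta>[OF \<sigma>(1)] lim(3) ts])
    then have lim1: "(\<lambda>n. (\<Sum>j\<in>UNIV. e n $ j *\<^sub>R sd (axis j 1) (Y C) (?\<zeta> n, ts n)) $ i) \<longlonglongrightarrow> sd d (Y C) (z, t) $ i"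
      using sd_linear[OF C smooth_Y[OF C(1)], of d] by simp
    show "(\<lambda>n. ((Y C (ws n, ts n) - Y C (zs n, ts n)) /\<^sub>R norm (ws n - zs n)) $ i) \<longlonglongrightarrow> sd d (Y C) (z, t) $ i"
    proof (rule Lim_transform_eventually[OF lim1])
      show "\<forall>\<^sub>F n in sequentially. (\<Sum>j\<in>UNIV. e n $ j *\<^sub>R sd (axis j 1) (Y C) (?\<zeta> n, ts n)) $ i =
        ((Y C (ws n, ts n) - Y C (zs n, ts n)) /\<^sub>R norm (ws n - zs n)) $ i"
        using ev
      proof eventually_elim
        case (elim n)
        have "?\<zeta> n \<in> U C" using seg[OF elim] \<sigma>(1) by blast
        have "((Y C (ws n, ts n) - Y C (zs n, ts n)) /\<^sub>R norm (ws n - zs n)) $ i = sd (ws n - zs n) (Y C) (?\<zeta> n, ts n) $ i / l n"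
          using \<sigma>(2)[OF elim] by (simp add: l_def divide_inverse mult.commute)
        also have "\<dots> = (\<Sum>j\<in>UNIV. e n $ j *\<^sub>R sd (axis j 1) (Y C) (?\<zeta> n, ts n)) $ i"
          using l(1)[of n] unfolding sd_linear[OF C(1) \<open>?\<zeta> n \<in> U C\<close> ts smooth_Y[OF C(1)], of "ws n - zs n"] ej
          by (simp add: sum_divide_distrib)
        finally show ?case by simp
      qed
    qed
  qed
  assume Ns: "Ns \<longlonglongrightarrow> N" and orth: "\<And>n v. zs n \<in> U C \<Longrightarrow> sd v (Y C) (zs n, ts n) \<bullet> Ns n = 0"
  have "\<exists>\<sigma>. 0 \<le> \<sigma> \<and> \<sigma> \<le> 1 \<and> (zs n \<in> ball z \<epsilon> \<and> ws n \<in> ball z \<epsilon> \<longrightarrow>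
     (Y C (ws n, ts n) - Y C (zs n, ts n)) \<bullet> Ns n = sd (ws n - zs n) (sd (ws n - zs n) (Y C)) (zs n + \<sigma> *\<^sub>R (ws n - zs n), ts n) \<bullet> Ns n / 2)" for n
  proof (cases "zs n \<in> ball z \<epsilon> \<and> ws n \<in> ball z \<epsilon>")
    case True
    let ?w = "ws n - zs n"
    \<comment> \<open>The three cases are the function and its first two derivatives along the
      segment, in the indexed form that \<open>Maclaurin\<close> expects.\<close>
    define h where "h m s = (if m = 0 then (Y C (zs n + s *\<^sub>R ?w, ts n) - Y C (zs n, ts n)) \<bullet> Ns n
       else if m = 1 then sd ?w (Y C) (zs n + s *\<^sub>R ?w, ts n) \<bullet> Ns n
       else sd ?w (sd ?w (Y C)) (zs n + s *\<^sub>R ?w, ts n) \<bullet> Ns n)" for m :: nat and s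
    have "(h m has_real_derivative h (Suc m) s) (at s)" if m: "m < 2" and s: "0 \<le> s" "s \<le> 1" for m s
    proof -
      have bl: "bounded_linear (\<lambda>x. x \<bullet> Ns n)" by (rule bounded_linear_inner_left)
      have 0: "((\<lambda>s. (Y C (zs n + s *\<^sub>R ?w, ts n) - Y C (zs n, ts n)) \<bullet> Ns n) has_real_derivative sd ?w (Y C) (zs n + s *\<^sub>R ?w, ts n) \<bullet> Ns n) (at s)"
        using bounded_linear.has_vector_derivative[OF bl has_vector_derivative_diff[OF line_derivative[OF C(1) seg[OF True s] ts smooth_Y[OF C(1)]] has_vector_derivative_const]]
        by (simp add: has_real_derivative_iff_has_vector_derivative)
      have 1: "((\<lambda>s. sd ?w (Y C) (zs n + s *\<^sub>R ?w, ts n) \<bullet> Ns n) has_real_derivative sd ?w (sd ?w (Y C)) (zs n + s *\<^sub>R ?w, ts n) \<bullet> Ns n) (at s)"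
        using bounded_linear.has_vector_derivative[OF bl line_derivative[OF C(1) seg[OF True s] ts smooth_sd_Y[OF C(1)]]]
        by (simp add: has_real_derivative_iff_has_vector_derivative)
      consider "m = 0" | "m = 1" using m by linarith
      then show ?thesis using 0 1 by cases (simp_all add: h_def[abs_def])
    qed
    then have "\<exists>t>0. t < 1 \<and> h 0 1 = (\<Sum>m<2. h m 0 / fact m * 1 ^ m) + h 2 t / fact 2 * 1 ^ 2"
      by (intro Maclaurin) auto
    then obtain \<sigma> where \<sigma>: "0 < \<sigma>" "\<sigma> < 1" "h 0 1 = (\<Sum>m<2. h m 0 / fact m * 1 ^ m) + h 2 \<sigma> / fact 2 * 1 ^ 2" by blast
    have "zs n \<in> U C" using True \<epsilon> by auto
    then have "(\<Sum>m<2. h m 0 / fact m * 1 ^ m) = 0"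
      using orth[of n ?w] by (simp add: h_def numeral_2_eq_2)
    then show ?thesis using \<sigma> by (intro exI[of _ \<sigma>]) (auto simp: h_def)
  qed (auto intro: exI[of _ 0])
  then obtain \<sigma> where \<sigma>: "\<And>n. 0 \<le> \<sigma> n \<and> \<sigma> n \<le> 1" "\<And>n. zs n \<in> ball z \<epsilon> \<and> ws n \<in> ball z \<epsilon> \<Longrightarrow>
     (Y C (ws n, ts n) - Y C (zs n, ts n)) \<bullet> Ns n = sd (ws n - zs n) (sd (ws n - zs n) (Y C)) (zs n + \<sigma> n *\<^sub>R (ws n - zs n), ts n) \<bullet> Ns n / 2" by metis
  let ?\<zeta> = "\<lambda>n. zs n + \<sigma> n *\<^sub>R (ws n - zs n)"
  let ?Q = "\<lambda>d x t. \<Sum>i\<in>UNIV. \<Sum>j\<in>UNIV. (d $ i * d $ j) *\<^sub>R sd (axis i 1) (sd (axis j 1) (Y C)) (x, t)"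
  have "(\<lambda>n. ?Q (e n) (?\<zeta> n) (ts n) \<bullet> Ns n / 2) \<longlonglongrightarrow> ?Q d z t \<bullet> N / 2"
    by (intro tendsto_intros tendsto_vec_nth el Ns C_tendsto[OF C smooth_sd2_Y[OF C(1)] \<zeta>[OF \<sigma>(1)] lim(3) ts]) auto
  then have lim2: "(\<lambda>n. ?Q (e n) (?\<zeta> n) (ts n) \<bullet> Ns n / 2) \<longlonglongrightarrow> sd d (sd d (Y C)) (z, t) \<bullet> N / 2"
    unfolding sd2_bilinear[OF C, of d d] .
  show "(\<lambda>n. ((Y C (ws n, ts n) - Y C (zs n, ts n)) \<bullet> Ns n) / (norm (ws n - zs n))\<^sup>2) \<longlonglongrightarrow> (sd d (sd d (Y C)) (z, t) \<bullet> N) / 2"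
  proof (rule Lim_transform_eventually[OF lim2])
    show "\<forall>\<^sub>F n in sequentially. ?Q (e n) (?\<zeta> n) (ts n) \<bullet> Ns n / 2 = ((Y C (ws n, ts n) - Y C (zs n, ts n)) \<bullet> Ns n) / (norm (ws n - zs n))\<^sup>2"
      using ev
    proof eventually_elim
      case (elim n)
      have "?\<zeta> n \<in> U C" using seg[OF elim] \<sigma>(1) by blast
      have "sd (ws n - zs n) (sd (ws n - zs n) (Y C)) (?\<zeta> n, ts n) = (l n)\<^sup>2 *\<^sub>R ?Q (e n) (?\<zeta> n) (ts n)"
        unfolding sd2_bilinear[OF C(1) \<open>?\<zeta> n \<in> U C\<close> ts, of "ws n - zs n" "ws n - zs n"] scaleR_sum_right ej
        by (intro sum.cong refl) (simp add: power2_eq_square)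
      then show ?case using \<sigma>(2)[OF elim] l(1)[of n] by (simp add: l_def)
    qed
  qed
qed

end

section \<open>The normal field\<close>

lemma inner_det_row:
  fixes x :: "real^'m" and r :: "'m \<Rightarrow> real^'m"
  shows "x \<bullet> (\<chi> k. det (\<chi> i. if i = k0 then axis k 1 else r i)) = det (\<chi> i. if i = k0 then x else r i)"
proof -
  have "det (\<chi> i. if i = k0 then \<Sum>k\<in>UNIV. x $ k *s axis k 1 else r i) = (\<Sum>k\<in>UNIV. det (\<chi> i. if i = k0 then x $ k *s axis k 1 else r i))"
    by (rule det_linear_row_sum) simp
  also have "\<dots> = (\<Sum>k\<in>UNIV. x $ k * det (\<chi> i. if i = k0 then axis k 1 else r i))"
    by (simp add: det_row_mul)
  finally show ?thesis unfolding basis_expansion by (simp add: inner_vec_def)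
qed

text \<open>At this stage the sign of \<nu> may jump from point to point and from time to
  time.\<close>

locale unit_normal_family = hypersurface_family \<A> X T
  for \<A> :: "('p::t2_space, 'n::finite) chart set" and X :: "'p \<Rightarrow> real \<Rightarrow> real^'m::finite" and T +
  fixes \<nu> :: "'p \<Rightarrow> real \<Rightarrow> real^'m"
  assumes normal_family: "\<And>x t. t \<in> I \<Longrightarrow> norm (\<nu> x t) = 1 \<and>
    (\<forall>C\<in>\<A>. x \<in> fst C \<longrightarrow> (\<forall>i. pd i ((\<lambda>x. X x t) \<circ> chart_inv C) (snd C x) \<bullet> \<nu> x t = 0))"
begin

lemma \<nu>_unit: "t \<in> I \<Longrightarrow> \<nu> x t \<bullet> \<nu> x t = 1"
  using normal_family by (simp add: norm_eq_1)

lemma \<nu>_orth: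
  assumes "C \<in> \<A>" "z \<in> U C" "t \<in> I"
  shows "sd v (Y C) (z, t) \<bullet> \<nu> (chart_inv C z) t = 0"
proof -
  have "sd (axis i 1) (Y C) (z, t) \<bullet> \<nu> (chart_inv C z) t = 0" for i
  proof -
    have "pd i (\<lambda>x. X (chart_inv C x) t) z = sd (axis i 1) (Y C) (z, t)"
      using pd_eq_sd[of i "Y C" t z] by (simp add: Y_def)
    moreover have "pd i ((\<lambda>x. X x t) \<circ> chart_inv C) (snd C (chart_inv C z)) \<bullet> \<nu> (chart_inv C z) t = 0"
      using normal_family[OF assms(3)] assms(1) chart_facts(6)[OF assms(1,2)] by blast
    ultimately show ?thesis by (simp add: o_def chart_facts(5)[OF assms(1,2)])
  qed
  then show ?thesis by (subst sd_linear[OF assms smooth_Y[OF assms(1)]]) (simp add: inner_sum_left)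
qed

definition k0 :: 'm where "k0 = undefined"
definition \<tau> :: "'m \<Rightarrow> 'n" where "\<tau> = (SOME \<tau>. bij_betw \<tau> (UNIV - {k0}) UNIV)"

lemma \<tau>: "bij_betw \<tau> (UNIV - {k0}) UNIV"
proof -
  have "card (UNIV - {k0}) = card (UNIV :: 'n set)" using card_m by simp
  then have "\<exists>\<tau>. bij_betw \<tau> (UNIV - {k0}) (UNIV :: 'n set)" by (intro finite_same_card_bij) auto
  then show ?thesis unfolding \<tau>_def by (rule someI_ex)
qed

text \<open>A square matrix with one free row \<open>k0\<close>; the bijection \<tau> distributes
  the coordinate vectors over the other rows. Expanding its determinant in the free row produces the
  cross product.\<close>

definition frame_rows :: "('p, 'n) chart \<Rightarrow> real^'m \<Rightarrow> (real^'n) \<times> real \<Rightarrow> real^'m^'m" where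
  "frame_rows C x p = (\<chi> i. if i = k0 then x else sd (axis (\<tau> i) 1) (Y C) p)"

text \<open>The generalized cross product of the coordinate vector fields.\<close>

definition cross_normal :: "('p, 'n) chart \<Rightarrow> (real^'n) \<times> real \<Rightarrow> real^'m" where
  "cross_normal C p = (\<chi> k. det (frame_rows C (axis k 1) p))"

lemma inner_cross_normal: "x \<bullet> cross_normal C p = det (frame_rows C x p)"
  unfolding cross_normal_def frame_rows_def by (rule inner_det_row)

text \<open>A linear relation between the rows has zero coefficient at the normal, by orthogonality;
  what remains is a relation between coordinate vectors, excluded by the immersion property.\<close>

lemma frame_rows_det:
  assumes C: "C \<in> \<A>" "z \<in> U C" "t \<in> I"
  shows "det (frame_rows C (\<nu> (chart_inv C z) t) (z, t)) \<noteq> 0"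
proof -
  let ?A = "frame_rows C (\<nu> (chart_inv C z) t) (z, t)"
  have "y = 0" if y: "transpose ?A *v y = 0" for y
  proof -
    have "(\<Sum>i\<in>UNIV. y $ i *\<^sub>R ?A $ i) = transpose ?A *v y"
      by (simp add: vec_eq_iff matrix_vector_mult_def transpose_def mult.commute)
    then have s: "(\<Sum>i\<in>UNIV. y $ i *\<^sub>R ?A $ i) = 0" using y by simp
    have "(\<Sum>i\<in>UNIV. y $ i *\<^sub>R ?A $ i) = y $ k0 *\<^sub>R ?A $ k0 + (\<Sum>i\<in>UNIV - {k0}. y $ i *\<^sub>R ?A $ i)"
      by (rule sum.remove) auto
    also have "(\<Sum>i\<in>UNIV - {k0}. y $ i *\<^sub>R ?A $ i) = (\<Sum>i\<in>UNIV - {k0}. y $ i *\<^sub>R sd (axis (\<tau> i) 1) (Y C) (z, t))"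
      by (intro sum.cong) (auto simp: frame_rows_def)
    also have "\<dots> = (\<Sum>i\<in>UNIV - {k0}. (\<lambda>j. y $ (inv_into (UNIV - {k0}) \<tau> j) *\<^sub>R sd (axis j 1) (Y C) (z, t)) (\<tau> i))"
      by (intro sum.cong) (simp_all add: bij_betw_inv_into_left[OF \<tau>])
    also have "\<dots> = (\<Sum>j\<in>UNIV. y $ (inv_into (UNIV - {k0}) \<tau> j) *\<^sub>R sd (axis j 1) (Y C) (z, t))"
      by (rule sum.reindex_bij_betw[OF \<tau>])
    also have "\<dots> = sd (\<chi> j. y $ (inv_into (UNIV - {k0}) \<tau> j)) (Y C) (z, t)"
      by (subst (2) sd_linear[OF C smooth_Y[OF C(1)]]) simp
    finally have e: "y $ k0 *\<^sub>R \<nu> (chart_inv C z) t + sd (\<chi> j. y $ (inv_into (UNIV - {k0}) \<tau> j)) (Y C) (z, t) = 0"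
      using s by (simp add: frame_rows_def)
    then have "(y $ k0 *\<^sub>R \<nu> (chart_inv C z) t + sd (\<chi> j. y $ (inv_into (UNIV - {k0}) \<tau> j)) (Y C) (z, t)) \<bullet> \<nu> (chart_inv C z) t = 0"
      by simp
    then have y0: "y $ k0 = 0" using \<nu>_orth[OF C] \<nu>_unit[OF C(3)] by (simp add: inner_add_left)
    then have "(\<chi> j. y $ (inv_into (UNIV - {k0}) \<tau> j)) = 0" using e sd_Y_inj[OF C] by simp
    then have "y $ (inv_into (UNIV - {k0}) \<tau> j) = 0" for j by (simp add: vec_eq_iff)
    then have "y $ i = 0" if "i \<noteq> k0" for i
      using \<tau> that by (metis DiffI UNIV_I bij_betw_inv_into_left singletonD)
    then show "y = 0" using y0 by (metis vec_eq_iff zero_index)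
  qed
  then have "inj ((*v) (transpose ?A))"
    by (metis (no_types, lifting) matrix_left_invertible_ker matrix_left_invertible_injective)
  then have "det (transpose ?A) \<noteq> 0" by (metis matrix_left_invertible_injective invertible_det_nz invertible_left_inverse)
  then show ?thesis by simp
qed

lemma orthogonal_zero:
  assumes C: "C \<in> \<A>" "z \<in> U C" "t \<in> I" and w: "\<And>i. w \<bullet> sd (axis i 1) (Y C) (z, t) = 0" "w \<bullet> \<nu> (chart_inv C z) t = 0"
  shows "w = 0"
proof -
  let ?A = "frame_rows C (\<nu> (chart_inv C z) t) (z, t)"
  have "?A *v w = 0"
    using w by (auto simp: matrix_mult_dot frame_rows_def vec_eq_iff inner_commute)
  moreover have "invertible ?A" using frame_rows_det[OF C] by (simp add: invertible_det_nz)
  ultimately show ?thesis by (metis invertible_left_inverse matrix_left_invertible_ker)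
qed

text \<open>The product of the cross product with a coordinate vector is a determinant with two
  equal rows, so the cross product is normal; its component along \<nu> is the stated
  determinant.\<close>

lemma cross_normal_eq:
  assumes C: "C \<in> \<A>" "z \<in> U C" "t \<in> I"
  shows "cross_normal C (z, t) = det (frame_rows C (\<nu> (chart_inv C z) t) (z, t)) *\<^sub>R \<nu> (chart_inv C z) t"
proof -
  let ?d = "det (frame_rows C (\<nu> (chart_inv C z) t) (z, t))"
  let ?w = "cross_normal C (z, t) - ?d *\<^sub>R \<nu> (chart_inv C z) t"
  have "?w = 0"
  proof (rule orthogonal_zero[OF C])
    fix j
    obtain i where i: "i \<noteq> k0" "\<tau> i = j" using \<tau> unfolding bij_betw_def by (metis DiffD2 UNIV_I image_iff singletonI)
    have "det (frame_rows C (sd (axis j 1) (Y C) (z, t)) (z, t)) = 0"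
      by (rule det_identical_rows[OF i(1)]) (simp add: row_def frame_rows_def i vec_eq_iff)
    then show "?w \<bullet> sd (axis j 1) (Y C) (z, t) = 0"
      using inner_cross_normal[of "sd (axis j 1) (Y C) (z, t)" C "(z, t)"] \<nu>_orth[OF C, of "axis j 1"]
      by (simp add: inner_diff_left inner_diff_right inner_commute)
  next
    show "?w \<bullet> \<nu> (chart_inv C z) t = 0"
      using inner_cross_normal[of "\<nu> (chart_inv C z) t" C "(z, t)"] \<nu>_unit[OF C(3)]
      by (simp add: inner_diff_left inner_diff_right inner_commute)
  qed
  then show ?thesis by simp
qed

text \<open>A unit normal of the chart that is smooth in space and time by construction. It is the
  reference against which the sign of \<nu> is measured.\<close>

definition Vhat :: "('p, 'n) chart \<Rightarrow> (real^'n) \<times> real \<Rightarrow> real^'m" where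
  "Vhat C p = (cross_normal C p \<bullet> cross_normal C p) powr (- 1/2) *\<^sub>R cross_normal C p"

lemma smooth_cross_normal:
  assumes C: "C \<in> \<A>" shows "Ck_on k (cross_normal C) (U C \<times> I)"
proof -
  have "Ck_on k (\<lambda>p. frame_rows C (axis l 1) p $ i $ j) (U C \<times> I)" for i j l
  proof (cases "i = k0")
    case False
    have "Ck_on k (\<lambda>p. sd (axis (\<tau> i) 1) (Y C) p \<bullet> axis j 1) (U C \<times> I)"
      by (intro Ck_on_inner smooth_sd_Y[OF C] Ck_on_const)
    then show ?thesis using False by (simp add: frame_rows_def inner_axis del: Ck_on.simps)
  qed (simp add: frame_rows_def)
  then have "Ck_on k (\<lambda>p. \<chi> l. det (frame_rows C (axis l 1) p)) (U C \<times> I)"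
    unfolding det_def by (intro Ck_on_vec Ck_on_sum Ck_on_mult Ck_on_const Ck_on_prod)
  then show ?thesis by (simp add: cross_normal_def[abs_def])
qed

lemma Vhat_sign:
  assumes C: "C \<in> \<A>" "z \<in> U C" "t \<in> I"
  shows "\<exists>s\<in>{1, -1}. Vhat C (z, t) = s *\<^sub>R \<nu> (chart_inv C z) t"
proof -
  let ?d = "det (frame_rows C (\<nu> (chart_inv C z) t) (z, t))"
  have d: "?d \<noteq> 0" by (rule frame_rows_det[OF C])
  have "(?d * ?d) powr (- 1/2) = 1 / \<bar>?d\<bar>"
    using d by (simp add: powr_minus_divide powr_half_sqrt)
  then have "Vhat C (z, t) = (?d / \<bar>?d\<bar>) *\<^sub>R \<nu> (chart_inv C z) t"
    unfolding Vhat_def cross_normal_eq[OF C] using \<nu>_unit[OF C(3)] by simp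
  moreover have "?d / \<bar>?d\<bar> \<in> {1, -1}" using d by (auto simp: abs_if)
  ultimately show ?thesis by blast
qed

lemma Vhat_unit:
  assumes "C \<in> \<A>" "z \<in> U C" "t \<in> I" shows "Vhat C (z, t) \<bullet> Vhat C (z, t) = 1"
  using Vhat_sign[OF assms] \<nu>_unit[OF assms(3)] by auto

lemma Vhat_orth:
  assumes "C \<in> \<A>" "z \<in> U C" "t \<in> I" shows "sd v (Y C) (z, t) \<bullet> Vhat C (z, t) = 0"
  using Vhat_sign[OF assms] \<nu>_orth[OF assms] by auto

lemma smooth_Vhat:
  assumes C: "C \<in> \<A>" shows "Ck_on k (Vhat C) (U C \<times> I)"
proof -
  have "cross_normal C p \<bullet> cross_normal C p > 0" if "p \<in> U C \<times> I" for p
    using that cross_normal_eq[OF C, of "fst p" "snd p"] frame_rows_det[OF C, of "fst p" "snd p"] \<nu>_unit[of "snd p" "chart_inv C (fst p)"]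
    by (auto simp: mem_Times_iff zero_less_mult_iff linorder_neq_iff)
  then have "Ck_on k (\<lambda>p. (cross_normal C p \<bullet> cross_normal C p) powr (- 1/2)) (U C \<times> I)"
    by (intro Ck_on_compose[OF Ck_on_inner[OF smooth_cross_normal[OF C] smooth_cross_normal[OF C]] Ck_on_powr]) auto
  then have "Ck_on k (\<lambda>p. (cross_normal C p \<bullet> cross_normal C p) powr (- 1/2) *\<^sub>R cross_normal C p) (U C \<times> I)"
    by (intro Ck_on_scaleR smooth_cross_normal[OF C])
  then show ?thesis by (simp add: Vhat_def[abs_def] del: Ck_on.simps)
qed

end

section \<open>Compactness arguments for slices, charts and normal segments\<close>

context hypersurface_family
begin

text \<open>Unit directions between the two points in the chart have a convergent subsequence, to
  which \<open>difference_quotients\<close> applies; \<open>l\<close> is the coordinate distance.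
  The normals \<open>Ns\<close> are left open in the second order statement.\<close>

lemma merging_points:
  assumes C: "C \<in> \<A>" "x \<in> fst C" "t \<in> I"
    and lim: "xs \<longlonglongrightarrow> x" "ys \<longlonglongrightarrow> x" "ts \<longlonglongrightarrow> t" and ts: "\<And>n. ts n \<in> I" and ne: "\<And>n. xs n \<noteq> ys n"
  obtains r d l where "strict_mono r" "norm d = 1" "\<And>n. xs (r n) \<in> fst C" "\<And>n. l n > 0"
    "(\<lambda>n. (X (ys (r n)) (ts (r n)) - X (xs (r n)) (ts (r n))) /\<^sub>R l n) \<longlonglongrightarrow> sd d (Y C) (snd C x, t)"
    "\<And>Ns N. Ns \<longlonglongrightarrow> N \<Longrightarrow> (\<And>n v. sd v (Y C) (snd C (xs (r n)), ts (r n)) \<bullet> Ns n = 0) \<Longrightarrow>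
      (\<lambda>n. ((X (ys (r n)) (ts (r n)) - X (xs (r n)) (ts (r n))) \<bullet> Ns n) / (l n)\<^sup>2) \<longlonglongrightarrow> (sd d (sd d (Y C)) (snd C x, t) \<bullet> N) / 2"
proof -
  have "\<forall>\<^sub>F n in sequentially. xs n \<in> fst C \<and> ys n \<in> fst C"
    using snd_chart_tendsto(2)[OF C(1,2) lim(1)] snd_chart_tendsto(2)[OF C(1,2) lim(2)] by (rule eventually_conj)
  then obtain N0 where N0: "\<And>n. n \<ge> N0 \<Longrightarrow> xs n \<in> fst C \<and> ys n \<in> fst C" by (auto simp: eventually_sequentially)
  define e where "e n = (snd C (ys (n + N0)) - snd C (xs (n + N0))) /\<^sub>R norm (snd C (ys (n + N0)) - snd C (xs (n + N0)))" for n
  have in_C: "xs (n + N0) \<in> fst C" "ys (n + N0) \<in> fst C" for n using N0 by auto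
  have ne': "snd C (xs (n + N0)) \<noteq> snd C (ys (n + N0))" for n
    using ne[of "n + N0"] in_C[of n] chart_facts(3)[OF C(1)] by metis
  have "e n \<in> sphere 0 1" for n using ne'[of n] by (simp add: e_def)
  moreover have "compact (sphere 0 1 :: (real^'n) set)" by simp
  ultimately obtain d r1 where d: "d \<in> sphere 0 1" "strict_mono r1" "(e \<circ> r1) \<longlonglongrightarrow> d"
    unfolding compact_def by metis
  \<comment> \<open>The directions \<open>e\<close> were indexed from \<open>N0\<close> on, where
    both sequences have entered the chart, so the index is shifted back.\<close>
  define r where "r n = r1 n + N0" for n
  have r: "strict_mono r" using d(2) by (simp add: strict_mono_def r_def)
  have C': "snd C x \<in> U C" by (rule chart_facts(4)[OF C(1,2)])
  have sub: "(\<lambda>n. f (r n)) \<longlonglongrightarrow> L" if "f \<longlonglongrightarrow> L" for f :: "nat \<Rightarrow> 'z::topological_space" and L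
    using LIMSEQ_subseq_LIMSEQ[OF that r] by (simp add: o_def)
  define l where "l n = norm (snd C (ys (r n)) - snd C (xs (r n)))" for n
  have XY: "X (xs (r n)) s = Y C (snd C (xs (r n)), s)" "X (ys (r n)) s = Y C (snd C (ys (r n)), s)" for n s
    using in_C[of "r1 n"] by (simp_all add: Y_eq[OF C(1)] r_def)
  note dq = difference_quotients[OF C(1) C' C(3), of "\<lambda>n. snd C (xs (r n))" "\<lambda>n. snd C (ys (r n))" "\<lambda>n. ts (r n)" d,
      OF sub[OF snd_chart_tendsto(1)[OF C(1,2) lim(1)]] sub[OF snd_chart_tendsto(1)[OF C(1,2) lim(2)]] sub[OF lim(3)] ts]
  have ne'': "snd C (xs (r n)) \<noteq> snd C (ys (r n))" for n using ne'[of "r1 n"] by (simp add: r_def)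
  have dir: "(\<lambda>n. (snd C (ys (r n)) - snd C (xs (r n))) /\<^sub>R norm (snd C (ys (r n)) - snd C (xs (r n)))) \<longlonglongrightarrow> d"
    using d(3) by (simp add: e_def[abs_def] r_def o_def)
  show ?thesis
  proof (rule that[OF r, of d l])
    show "norm d = 1" using d(1) by simp
    show "xs (r n) \<in> fst C" for n using in_C by (simp add: r_def)
    show "l n > 0" for n using ne''[of n] by (simp add: l_def)
    show "(\<lambda>n. (X (ys (r n)) (ts (r n)) - X (xs (r n)) (ts (r n))) /\<^sub>R l n) \<longlonglongrightarrow> sd d (Y C) (snd C x, t)"
      unfolding XY l_def by (rule dq(1)[OF ne'' dir])
    show "(\<lambda>n. ((X (ys (r n)) (ts (r n)) - X (xs (r n)) (ts (r n))) \<bullet> Ns n) / (l n)\<^sup>2) \<longlonglongrightarrow> (sd d (sd d (Y C)) (snd C x, t) \<bullet> N) / 2"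
      if "Ns \<longlonglongrightarrow> N" "\<And>n v. sd v (Y C) (snd C (xs (r n)), ts (r n)) \<bullet> Ns n = 0" for Ns N
      unfolding XY l_def by (rule dq(2)[OF ne'' dir that])
  qed
qed

text \<open>Otherwise there are points of the hypersurface at times tending to \<open>t0\<close>
  that converge to \<open>q\<close>; by compactness of the manifold the limit is a point of the
  slice at \<open>t0\<close>.\<close>

lemma avoid_slices:
  assumes "t0 \<in> I" "q \<notin> range (\<lambda>x. X x t0)"
  shows "\<exists>\<delta>>0. \<forall>t\<in>I. \<bar>t - t0\<bar> < \<delta> \<longrightarrow> ball q \<delta> \<inter> range (\<lambda>x. X x t) = {}"
proof (rule ccontr)
  assume no: "\<not> ?thesis"
  have "\<exists>t y. t \<in> I \<and> \<bar>t - t0\<bar> < inverse (real (Suc n)) \<and> dist q (X y t) < inverse (real (Suc n))" for n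
  proof -
    have "inverse (real (Suc n)) > 0" by simp
    then obtain t where "t \<in> I" "\<bar>t - t0\<bar> < inverse (real (Suc n))" "ball q (inverse (real (Suc n))) \<inter> range (\<lambda>x. X x t) \<noteq> {}"
      using no by blast
    then show ?thesis by (auto simp: disjoint_iff)
  qed
  then obtain ts ys where ty: "\<And>n. ts n \<in> I" "\<And>n. \<bar>ts n - t0\<bar> < inverse (real (Suc n))" "\<And>n. dist q (X (ys n) (ts n)) < inverse (real (Suc n))"
    by metis
  have tl: "ts \<longlonglongrightarrow> t0"
    by (rule LIM_zero_cancel, rule Lim_null_comparison[OF _ LIMSEQ_inverse_real_of_nat]) (use ty(2) in \<open>auto intro!: always_eventually less_imp_le\<close>)
  have ql: "(\<lambda>n. X (ys n) (ts n)) \<longlonglongrightarrow> q"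
    by (rule LIM_zero_cancel, rule Lim_null_comparison[OF _ LIMSEQ_inverse_real_of_nat])
       (use ty(3) in \<open>auto intro!: always_eventually less_imp_le simp: dist_norm norm_minus_commute\<close>)
  obtain r y where r: "strict_mono r" "(\<lambda>n. ys (r n)) \<longlonglongrightarrow> y" by (rule sequence_compact)
  have "(\<lambda>n. X (ys (r n)) (ts (r n))) \<longlonglongrightarrow> X y t0"
    by (rule X_tendsto[OF r(2) _ ty(1) assms(1)]) (use LIMSEQ_subseq_LIMSEQ[OF tl r(1)] in \<open>simp add: o_def\<close>)
  moreover have "(\<lambda>n. X (ys (r n)) (ts (r n))) \<longlonglongrightarrow> q" using LIMSEQ_subseq_LIMSEQ[OF ql r(1)] by (simp add: o_def)
  ultimately have "q = X y t0" by (rule LIMSEQ_unique[rotated])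
  then show False using assms(2) by blast
qed

lemma slices_bounded:
  assumes "t0 \<in> I"
  shows "\<exists>R t1. t0 < t1 \<and> (\<forall>t x. t \<in> I \<longrightarrow> t \<le> t1 \<longrightarrow> norm (X x t) \<le> R)"
proof -
  \<comment> \<open>Any time strictly between \<open>t0\<close> and \<open>T\<close> would do: the
    flow is bounded on compact subintervals of the half-open time interval.\<close>
  define t1 where "t1 = (t0 + T) / 2"
  have t1: "t0 < t1" "t1 < T" using assms by (auto simp: t1_def)
  have "compact ((\<lambda>(x, t). X x t) ` (UNIV \<times> {0..t1}))"
  proof (rule compact_continuous_image)
    show "continuous_on (UNIV \<times> {0..t1}) (\<lambda>(x, t). X x t)"
      by (rule continuous_on_subset[OF continuous_X]) (use t1 in auto)
    show "compact (UNIV \<times> {0..t1} :: ('p \<times> real) set)" by (intro compact_Times compact_M) simp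
  qed
  then obtain R where "\<And>v. v \<in> (\<lambda>(x, t). X x t) ` (UNIV \<times> {0..t1}) \<Longrightarrow> norm v \<le> R"
    using compact_imp_bounded bounded_iff by metis
  then have "\<forall>t x. t \<in> I \<longrightarrow> t \<le> t1 \<longrightarrow> norm (X x t) \<le> R" by fastforce
  then show ?thesis using t1(1) by blast
qed

text \<open>The inverse of the embedding is continuous, so no distant part of the manifold can come
  close to \<open>Y C (z0, t)\<close> at time \<open>t\<close>.\<close>

lemma near_in_chart:
  assumes C: "C \<in> \<A>" "z0 \<in> U C" "t \<in> I" and \<epsilon>: "\<epsilon> > 0"
  shows "\<exists>\<rho>>0. \<forall>x. dist (X x t) (Y C (z0, t)) < \<rho> \<longrightarrow> x \<in> fst C \<and> snd C x \<in> ball z0 \<epsilon>"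
proof (rule ccontr)
  assume "\<not> ?thesis"
  then have "\<exists>x. dist (X x t) (Y C (z0, t)) < inverse (real (Suc n)) \<and> \<not> (x \<in> fst C \<and> snd C x \<in> ball z0 \<epsilon>)" for n
    by (metis inverse_positive_iff_positive of_nat_0_less_iff zero_less_Suc)
  then obtain xs where xs: "\<And>n. dist (X (xs n) t) (Y C (z0, t)) < inverse (real (Suc n))" "\<And>n. \<not> (xs n \<in> fst C \<and> snd C (xs n) \<in> ball z0 \<epsilon>)"
    by metis
  have x0: "chart_inv C z0 \<in> fst C" "snd C (chart_inv C z0) = z0" using chart_facts(5,6)[OF C(1,2)] by auto
  have "(\<lambda>n. X (xs n) t) \<longlonglongrightarrow> X (chart_inv C z0) t"
    by (rule LIM_zero_cancel, rule Lim_null_comparison[OF _ LIMSEQ_inverse_real_of_nat])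
       (use xs(1) in \<open>auto intro!: always_eventually less_imp_le simp: dist_norm Y_def\<close>)
  then have l: "xs \<longlonglongrightarrow> chart_inv C z0" by (rule tendsto_iff_X[OF C(3)])
  have "(\<lambda>n. snd C (xs n)) \<longlonglongrightarrow> z0" using snd_chart_tendsto(1)[OF C(1) x0(1) l] x0(2) by simp
  from tendstoD[OF this \<epsilon>] snd_chart_tendsto(2)[OF C(1) x0(1) l]
  have "\<forall>\<^sub>F n in sequentially. xs n \<in> fst C \<and> snd C (xs n) \<in> ball z0 \<epsilon>"
    by eventually_elim (simp add: dist_commute)
  from eventually_happens'[OF sequentially_bot this] show False using xs(2) by blast
qed

end

context unit_normal_family
begin

text \<open>A tubular neighbourhood that is uniform in space and time. If ever shorter normal
  segments met the hypersurface again, the two points would merge; their difference quotients are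
  normal, but converge to a nonzero tangent vector.\<close>

lemma normal_segment_clear:
  assumes C: "C \<in> \<A>" "z0 \<in> U C" "t0 \<in> I"
  shows "\<exists>\<epsilon>>0. ball z0 \<epsilon> \<subseteq> U C \<and> (\<forall>z t s. z \<in> ball z0 \<epsilon> \<and> t \<in> I \<and> \<bar>t - t0\<bar> < \<epsilon> \<and> s \<noteq> 0 \<and> \<bar>s\<bar> \<le> \<epsilon> \<longrightarrow>
    Y C (z, t) + s *\<^sub>R Vhat C (z, t) \<notin> range (\<lambda>x. X x t))"
proof (rule ccontr)
  assume no: "\<not> ?thesis"
  obtain \<epsilon>0 where \<epsilon>0: "\<epsilon>0 > 0" "ball z0 \<epsilon>0 \<subseteq> U C" using chart_facts(2)[OF C(1)] C(2) open_contains_ball by blast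
  have "\<exists>z t s y. z \<in> U C \<and> dist z0 z < inverse (real (Suc n)) \<and> t \<in> I \<and> \<bar>t - t0\<bar> < inverse (real (Suc n)) \<and> s \<noteq> 0 \<and> \<bar>s\<bar> \<le> inverse (real (Suc n)) \<and>
    Y C (z, t) + s *\<^sub>R Vhat C (z, t) = X y t" for n
  proof -
    let ?e = "min \<epsilon>0 (inverse (real (Suc n)))"
    have "?e > 0" using \<epsilon>0 by simp
    moreover have sub: "ball z0 ?e \<subseteq> U C" using \<epsilon>0 by auto
    ultimately obtain z t s where "z \<in> ball z0 ?e" "t \<in> I" "\<bar>t - t0\<bar> < ?e" "s \<noteq> 0" "\<bar>s\<bar> \<le> ?e"
      "Y C (z, t) + s *\<^sub>R Vhat C (z, t) \<in> range (\<lambda>x. X x t)" using no by blast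
    then show ?thesis using sub by (intro exI[of _ z] exI[of _ t] exI[of _ s]) auto
  qed
  then obtain zs ts s ys where *: "\<And>n. zs n \<in> U C" "\<And>n. dist z0 (zs n) < inverse (real (Suc n))" "\<And>n. ts n \<in> I"
    "\<And>n. \<bar>ts n - t0\<bar> < inverse (real (Suc n))" "\<And>n. s n \<noteq> 0" "\<And>n. \<bar>s n\<bar> \<le> inverse (real (Suc n))"
    "\<And>n. Y C (zs n, ts n) + s n *\<^sub>R Vhat C (zs n, ts n) = X (ys n) (ts n)" by metis
  have tl: "ts \<longlonglongrightarrow> t0"
    by (rule LIM_zero_cancel, rule Lim_null_comparison[OF _ LIMSEQ_inverse_real_of_nat]) (use *(4) in \<open>auto intro!: always_eventually less_imp_le\<close>)
  have zl: "zs \<longlonglongrightarrow> z0"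
    by (rule LIM_zero_cancel, rule Lim_null_comparison[OF _ LIMSEQ_inverse_real_of_nat])
       (use *(2) in \<open>auto intro!: always_eventually less_imp_le simp: dist_norm norm_minus_commute\<close>)
  have sl: "s \<longlonglongrightarrow> 0"
    by (rule Lim_null_comparison[OF _ LIMSEQ_inverse_real_of_nat]) (use *(6) in auto)
  obtain r y where r: "strict_mono r" "(\<lambda>n. ys (r n)) \<longlonglongrightarrow> y" by (rule sequence_compact)
  have sub: "(\<lambda>n. f (r n)) \<longlonglongrightarrow> L" if "f \<longlonglongrightarrow> L" for f :: "nat \<Rightarrow> 'z::topological_space" and L
    using LIMSEQ_subseq_LIMSEQ[OF that r(1)] by (simp add: o_def)
  let ?x = "chart_inv C z0"
  have x: "?x \<in> fst C" "snd C ?x = z0" using chart_facts(5,6)[OF C(1,2)] by auto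
  have xl: "(\<lambda>n. chart_inv C (zs (r n))) \<longlonglongrightarrow> ?x" by (rule sub[OF chart_inv_tendsto(1)[OF C(1,2) zl]])
  have Vl: "(\<lambda>n. Vhat C (zs n, ts n)) \<longlonglongrightarrow> Vhat C (z0, t0)"
    by (rule C_tendsto[OF C smooth_Vhat[OF C(1), of 0] zl tl *(3)])
  have Yl: "(\<lambda>n. Y C (zs n, ts n)) \<longlonglongrightarrow> Y C (z0, t0)" by (rule C_tendsto[OF C smooth_Y[OF C(1), of 0] zl tl *(3)])
  have "(\<lambda>n. Y C (zs n, ts n) + s n *\<^sub>R Vhat C (zs n, ts n)) \<longlonglongrightarrow> Y C (z0, t0) + 0 *\<^sub>R Vhat C (z0, t0)"
    by (intro tendsto_intros Yl sl Vl)
  then have "(\<lambda>n. X (ys n) (ts n)) \<longlonglongrightarrow> Y C (z0, t0)" unfolding *(7) by simp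
  moreover have "Y C (z0, t0) = X ?x t0" by (simp add: Y_def)
  ultimately have "(\<lambda>n. X (ys n) (ts n)) \<longlonglongrightarrow> X ?x t0" by simp
  then have "(\<lambda>n. X (ys (r n)) (ts (r n))) \<longlonglongrightarrow> X ?x t0" by (rule sub)
  moreover have "(\<lambda>n. X (ys (r n)) (ts (r n))) \<longlonglongrightarrow> X y t0"
    by (rule X_tendsto[OF r(2) sub[OF tl] *(3) C(3)])
  ultimately have "y = ?x" using X_inj[OF C(3)] LIMSEQ_unique by metis
  then have yl: "(\<lambda>n. ys (r n)) \<longlonglongrightarrow> ?x" using r(2) by simp
  have Xx: "X (chart_inv C (zs n)) (ts n) = Y C (zs n, ts n)" for n by (simp add: Y_def)
  have ne: "chart_inv C (zs (r n)) \<noteq> ys (r n)" for n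
  proof
    assume "chart_inv C (zs (r n)) = ys (r n)"
    then have "s (r n) *\<^sub>R Vhat C (zs (r n), ts (r n)) = 0" using *(7)[of "r n"] Xx[of "r n"] by simp
    then show False using *(5)[of "r n"] Vhat_unit[OF C(1) *(1)[of "r n"] *(3)[of "r n"]] by simp
  qed
  obtain r' d l where r': "strict_mono r'" "norm d = 1" "\<And>n. l n > 0"
    "(\<lambda>n. (X (ys (r (r' n))) (ts (r (r' n))) - X (chart_inv C (zs (r (r' n)))) (ts (r (r' n)))) /\<^sub>R l n) \<longlonglongrightarrow> sd d (Y C) (snd C ?x, t0)"
    by (rule merging_points[OF C(1) x(1) C(3) xl yl sub[OF tl] *(3) ne]) (rule that; assumption)
  let ?k = "\<lambda>n. r (r' n)"
  have q: "(\<lambda>n. (s (?k n) / l n) *\<^sub>R Vhat C (zs (?k n), ts (?k n))) \<longlonglongrightarrow> sd d (Y C) (z0, t0)"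
    using r'(4) unfolding Xx x(2) by (simp add: divide_inverse mult.commute flip: *(7))
  have Vk: "(\<lambda>n. Vhat C (zs (?k n), ts (?k n))) \<longlonglongrightarrow> Vhat C (z0, t0)"
    using LIMSEQ_subseq_LIMSEQ[OF sub[OF Vl] r'(1)] by (simp add: o_def)
  have "(\<lambda>n. ((s (?k n) / l n) *\<^sub>R Vhat C (zs (?k n), ts (?k n))) \<bullet> Vhat C (zs (?k n), ts (?k n))) \<longlonglongrightarrow> sd d (Y C) (z0, t0) \<bullet> Vhat C (z0, t0)"
    by (rule tendsto_inner[OF q Vk])
  then have "(\<lambda>n. s (?k n) / l n) \<longlonglongrightarrow> 0"
    using Vhat_orth[OF C] by (simp add: Vhat_unit[OF C(1) *(1) *(3)])
  from tendsto_scaleR[OF this Vk] have "(\<lambda>n. (s (?k n) / l n) *\<^sub>R Vhat C (zs (?k n), ts (?k n))) \<longlonglongrightarrow> 0" by simp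
  then have "sd d (Y C) (z0, t0) = 0" using q LIMSEQ_unique by blast
  from sd_Y_inj[OF C this] show False using r'(2) by simp
qed

text \<open>The sign of \<nu> relative to the smooth reference normal. Smoothness of \<nu> amounts
  to local constancy of this sign.\<close>

definition sg :: "('p, 'n) chart \<Rightarrow> (real^'n) \<Rightarrow> real \<Rightarrow> real" where
  "sg C z t = Vhat C (z, t) \<bullet> \<nu> (chart_inv C z) t"

lemma sg:
  assumes "C \<in> \<A>" "z \<in> U C" "t \<in> I"
  shows "sg C z t = 1 \<or> sg C z t = -1" "\<nu> (chart_inv C z) t = sg C z t *\<^sub>R Vhat C (z, t)"
  using Vhat_sign[OF assms] \<nu>_unit[OF assms(3), of "chart_inv C z"] by (auto simp: sg_def)

lemma normal_multiple:
  assumes C: "C \<in> \<A>" "z \<in> U C" "t \<in> I" and w: "\<And>v. sd v (Y C) (z, t) \<bullet> w = 0"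
  shows "w = (w \<bullet> Vhat C (z, t)) *\<^sub>R Vhat C (z, t)"
proof -
  have "w - (w \<bullet> Vhat C (z, t)) *\<^sub>R Vhat C (z, t) = 0"
  proof (rule orthogonal_zero[OF C])
    show "(w - (w \<bullet> Vhat C (z, t)) *\<^sub>R Vhat C (z, t)) \<bullet> sd (axis i 1) (Y C) (z, t) = 0" for i
      using w Vhat_orth[OF C] by (simp add: inner_diff_left inner_diff_right inner_commute)
    show "(w - (w \<bullet> Vhat C (z, t)) *\<^sub>R Vhat C (z, t)) \<bullet> \<nu> (chart_inv C z) t = 0"
      unfolding sg(2)[OF C] using Vhat_unit[OF C] by (simp add: inner_diff_left)
  qed
  then show ?thesis by simp
qed

end

section \<open>Continuity of the outward normal\<close>

locale oriented_family = unit_normal_family \<A> X T \<nu>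
  for \<A> :: "('p::t2_space, 'n::finite) chart set" and X :: "'p \<Rightarrow> real \<Rightarrow> real^'m::finite" and T \<nu> +
  fixes \<Omega> :: "real \<Rightarrow> (real^'m) set"
  assumes region: "\<And>t. t \<in> I \<Longrightarrow> bounds_region (range (\<lambda>x. X x t)) (\<Omega> t)"
    and outward: "\<And>t x. t \<in> I \<Longrightarrow> \<forall>\<^sub>F s in at_right 0. X x t + s *\<^sub>R \<nu> x t \<notin> \<Omega> t \<and> X x t - s *\<^sub>R \<nu> x t \<in> \<Omega> t"
begin

lemma connected_side:
  assumes "t \<in> I" "connected A" "A \<inter> range (\<lambda>x. X x t) = {}" "a \<in> A" "b \<in> A"
  shows "a \<in> \<Omega> t \<longleftrightarrow> b \<in> \<Omega> t"
proof (rule ccontr)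
  assume "\<not> ?thesis"
  then have "A \<inter> \<Omega> t \<noteq> {}" "A - \<Omega> t \<noteq> {}" using assms by auto
  then have "A \<inter> frontier (\<Omega> t) \<noteq> {}" by (rule connected_Int_frontier[OF assms(2)])
  then show False using region[OF assms(1)] assms(3) by (simp add: bounds_region_def)
qed

lemma connected_open_ray: "connected ((\<lambda>s. (q::real^'m) + s *\<^sub>R v) ` {0<..\<epsilon>})"
  by (intro connected_continuous_image continuous_intros) (simp add: convex_connected)

text \<open>The outward condition holds for small \<open>s\<close> without any uniformity; since the
  segment up to \<epsilon> avoids the hypersurface, it lies on one side, and the condition extends
  to its end point.\<close>

lemma side_of_normal:
  assumes t: "t \<in> I" and e: "e \<in> {1, -1}" and \<epsilon>: "\<epsilon> > 0"
    and clear: "\<And>s. 0 < s \<Longrightarrow> s \<le> \<epsilon> \<Longrightarrow> X x t + s *\<^sub>R (e *\<^sub>R \<nu> x t) \<notin> range (\<lambda>x. X x t)"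
  shows "X x t + \<epsilon> *\<^sub>R (e *\<^sub>R \<nu> x t) \<in> \<Omega> t \<longleftrightarrow> e = -1"
proof -
  obtain b where b: "b > 0" "\<And>s. 0 < s \<Longrightarrow> s < b \<Longrightarrow> X x t + s *\<^sub>R \<nu> x t \<notin> \<Omega> t \<and> X x t - s *\<^sub>R \<nu> x t \<in> \<Omega> t"
    using outward[OF t, of x] unfolding eventually_at_right_field by blast
  define s where "s = min \<epsilon> (b / 2)"
  have s: "0 < s" "s \<le> \<epsilon>" "s < b" using b \<epsilon> by (auto simp: s_def)
  let ?A = "(\<lambda>s. X x t + s *\<^sub>R (e *\<^sub>R \<nu> x t)) ` {0<..\<epsilon>}"
  have dis: "?A \<inter> range (\<lambda>x. X x t) = {}" using clear by (fastforce simp del: scaleR_scaleR)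
  have "X x t + \<epsilon> *\<^sub>R (e *\<^sub>R \<nu> x t) \<in> \<Omega> t \<longleftrightarrow> X x t + s *\<^sub>R (e *\<^sub>R \<nu> x t) \<in> \<Omega> t"
    by (rule connected_side[OF t connected_open_ray dis]) (use s \<epsilon> in auto)
  also have "\<dots> \<longleftrightarrow> e = -1" using b(2)[OF s(1,3)] e by auto
  finally show ?thesis .
qed

lemma chart_side:
  assumes C: "C \<in> \<A>" "z \<in> U C" "t \<in> I" and s: "s \<noteq> 0" "\<bar>s\<bar> \<le> \<epsilon>"
    and clear: "\<And>s. s \<noteq> 0 \<Longrightarrow> \<bar>s\<bar> \<le> \<epsilon> \<Longrightarrow> Y C (z, t) + s *\<^sub>R Vhat C (z, t) \<notin> range (\<lambda>x. X x t)"
  shows "Y C (z, t) + s *\<^sub>R Vhat C (z, t) \<in> \<Omega> t \<longleftrightarrow> s * sg C z t < 0"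
proof -
  let ?x = "chart_inv C z"
  define e where "e = sgn s * sg C z t"
  have e: "e \<in> {1, -1}" using sg(1)[OF C] s(1) by (auto simp: e_def sgn_if)
  have V: "Vhat C (z, t) = sg C z t *\<^sub>R \<nu> ?x t" using sg[OF C] by auto
  have Vs: "(sgn s * r) *\<^sub>R Vhat C (z, t) = r *\<^sub>R (e *\<^sub>R \<nu> ?x t)" for r
    unfolding V e_def by (simp add: mult.commute mult.left_commute)
  have "X ?x t + \<bar>s\<bar> *\<^sub>R (e *\<^sub>R \<nu> ?x t) \<in> \<Omega> t \<longleftrightarrow> e = -1"
  proof (rule side_of_normal[OF C(3) e])
    show "0 < \<bar>s\<bar>" using s by simp
    fix r assume r: "0 < r" "r \<le> \<bar>s\<bar>"
    have "Y C (z, t) + (sgn s * r) *\<^sub>R Vhat C (z, t) \<notin> range (\<lambda>x. X x t)"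
      by (rule clear) (use r s in \<open>auto simp: sgn_if\<close>)
    then show "X ?x t + r *\<^sub>R (e *\<^sub>R \<nu> ?x t) \<notin> range (\<lambda>x. X x t)" unfolding Vs by (simp add: Y_def)
  qed
  moreover have "X ?x t + \<bar>s\<bar> *\<^sub>R (e *\<^sub>R \<nu> ?x t) = Y C (z, t) + s *\<^sub>R Vhat C (z, t)"
    unfolding Vs[symmetric] by (simp add: Y_def sgn_mult_abs)
  moreover have "e = -1 \<longleftrightarrow> s * sg C z t < 0" using sg(1)[OF C] s(1) by (auto simp: e_def sgn_if)
  ultimately show ?thesis by simp
qed

text \<open>Two points are compared at the same time \<open>t\<close>. Whether the side of
  \<open>q\<close> itself changes with \<open>t\<close> is a different question, to which
  \<open>sign_constant_in_time\<close> is devoted.\<close>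

lemma stable_side:
  assumes "t0 \<in> I" "q \<notin> range (\<lambda>x. X x t0)"
  obtains \<delta> where "\<delta> > 0" "ball q \<delta> \<inter> range (\<lambda>x. X x t0) = {}"
    "\<And>q' t. q' \<in> ball q \<delta> \<Longrightarrow> t \<in> I \<Longrightarrow> \<bar>t - t0\<bar> < \<delta> \<Longrightarrow> q' \<in> \<Omega> t \<longleftrightarrow> q \<in> \<Omega> t"
proof -
  obtain \<delta> where \<delta>: "\<delta> > 0" "\<And>t. t \<in> I \<Longrightarrow> \<bar>t - t0\<bar> < \<delta> \<Longrightarrow> ball q \<delta> \<inter> range (\<lambda>x. X x t) = {}"
    using avoid_slices[OF assms] by blast
  show ?thesis
  proof (rule that[OF \<delta>(1)])
    show "ball q \<delta> \<inter> range (\<lambda>x. X x t0) = {}" using \<delta> assms(1) by simp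
    show "q' \<in> \<Omega> t \<longleftrightarrow> q \<in> \<Omega> t" if "q' \<in> ball q \<delta>" "t \<in> I" "\<bar>t - t0\<bar> < \<delta>" for q' t
      by (rule connected_side[OF that(2) connected_ball \<delta>(2)[OF that(2,3)] that(1)]) (use \<delta> in simp)
  qed
qed

lemma near_points:
  assumes C: "C \<in> \<A>" "z0 \<in> U C" "t0 \<in> I" and \<delta>: "\<delta> > 0"
  shows "\<exists>\<epsilon>>0. \<forall>z t. z \<in> ball z0 \<epsilon> \<and> t \<in> I \<and> \<bar>t - t0\<bar> < \<epsilon> \<longrightarrow> z \<in> U C \<and>
     Y C (z, t) + s *\<^sub>R Vhat C (z, t) \<in> ball (Y C (z0, t0) + s *\<^sub>R Vhat C (z0, t0)) \<delta>"
proof -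
  obtain \<epsilon>0 where \<epsilon>0: "\<epsilon>0 > 0" "ball z0 \<epsilon>0 \<subseteq> U C" using chart_facts(2)[OF C(1)] C(2) open_contains_ball by blast
  have "Ck_on 0 (\<lambda>p. Y C p + s *\<^sub>R Vhat C p) (U C \<times> I)"
    by (intro Ck_on_add Ck_on_scaleR Ck_on_const smooth_Y smooth_Vhat C)
  then have "continuous_on (U C \<times> I) (\<lambda>p. Y C p + s *\<^sub>R Vhat C p)" by simp
  then obtain d where d: "d > 0" "\<And>p. p \<in> U C \<times> I \<Longrightarrow> dist p (z0, t0) < d \<Longrightarrow>
      dist (Y C p + s *\<^sub>R Vhat C p) (Y C (z0, t0) + s *\<^sub>R Vhat C (z0, t0)) < \<delta>"
    using C \<delta> unfolding continuous_on_iff by (metis mem_Sigma_iff)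
  have "z \<in> U C \<and> Y C (z, t) + s *\<^sub>R Vhat C (z, t) \<in> ball (Y C (z0, t0) + s *\<^sub>R Vhat C (z0, t0)) \<delta>"
    if "z \<in> ball z0 (min \<epsilon>0 (d / 2))" "t \<in> I" "\<bar>t - t0\<bar> < min \<epsilon>0 (d / 2)" for z t
  proof -
    have z: "z \<in> U C" using that \<epsilon>0 by auto
    have "dist (z, t) (z0, t0) \<le> dist z z0 + dist t t0"
      unfolding dist_prod_def by (simp add: sqrt_sum_squares_le_sum)
    also have "\<dots> < d"
    proof -
      have "dist z z0 < d / 2" using that(1) by (simp add: dist_commute)
      moreover have "dist t t0 < d / 2" using that(3) by (simp add: dist_real_def)
      ultimately show ?thesis by linarith
    qed
    finally show ?thesis using d(2)[of "(z, t)"] z that by (simp add: dist_commute)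
  qed
  then show ?thesis using \<epsilon>0 d by (intro exI[of _ "min \<epsilon>0 (d / 2)"]) auto
qed

text \<open>The tips of normal segments of fixed length issuing from nearby points stay close to one
  tip off the slices, so at each time they lie on the same side of the hypersurface. The side of the
  tip determines the sign.\<close>

lemma sign_constant_in_space:
  assumes C: "C \<in> \<A>" "z0 \<in> U C" "t0 \<in> I"
  shows "\<exists>\<epsilon>>0. ball z0 \<epsilon> \<subseteq> U C \<and> (\<forall>z t. z \<in> ball z0 \<epsilon> \<and> t \<in> I \<and> \<bar>t - t0\<bar> < \<epsilon> \<longrightarrow> sg C z t = sg C z0 t)"
proof -
  obtain \<epsilon>1 where \<epsilon>1: "\<epsilon>1 > 0" "ball z0 \<epsilon>1 \<subseteq> U C" "\<And>z t s. z \<in> ball z0 \<epsilon>1 \<Longrightarrow> t \<in> I \<Longrightarrow> \<bar>t - t0\<bar> < \<epsilon>1 \<Longrightarrow> s \<noteq> 0 \<Longrightarrow> \<bar>s\<bar> \<le> \<epsilon>1 \<Longrightarrow>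
    Y C (z, t) + s *\<^sub>R Vhat C (z, t) \<notin> range (\<lambda>x. X x t)" using normal_segment_clear[OF C] by blast
  let ?q = "\<lambda>z t. Y C (z, t) + \<epsilon>1 *\<^sub>R Vhat C (z, t)"
  have "?q z0 t0 \<notin> range (\<lambda>x. X x t0)" using \<epsilon>1 C by simp
  from stable_side[OF C(3) this] obtain \<delta> where \<delta>: "\<delta> > 0"
    "\<And>q' t. q' \<in> ball (?q z0 t0) \<delta> \<Longrightarrow> t \<in> I \<Longrightarrow> \<bar>t - t0\<bar> < \<delta> \<Longrightarrow> q' \<in> \<Omega> t \<longleftrightarrow> ?q z0 t0 \<in> \<Omega> t" by metis
  obtain \<epsilon>2 where \<epsilon>2: "\<epsilon>2 > 0" "\<And>z t. z \<in> ball z0 \<epsilon>2 \<Longrightarrow> t \<in> I \<Longrightarrow> \<bar>t - t0\<bar> < \<epsilon>2 \<Longrightarrow> ?q z t \<in> ball (?q z0 t0) \<delta>"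
    using near_points[OF C \<delta>(1), of \<epsilon>1] by blast
  define \<epsilon> where "\<epsilon> = min \<delta> (min \<epsilon>1 \<epsilon>2)"
  have \<epsilon>: "\<epsilon> > 0" "\<epsilon> \<le> \<delta>" "\<epsilon> \<le> \<epsilon>1" "\<epsilon> \<le> \<epsilon>2" using \<delta> \<epsilon>1 \<epsilon>2 by (auto simp: \<epsilon>_def)
  have side: "?q z0 t0 \<in> \<Omega> t \<longleftrightarrow> sg C z t < 0" if "z \<in> ball z0 \<epsilon>" "t \<in> I" "\<bar>t - t0\<bar> < \<epsilon>" for z t
  proof -
    have z: "z \<in> U C" using \<epsilon>1(2) \<epsilon> that by auto
    have "?q z t \<in> \<Omega> t \<longleftrightarrow> \<epsilon>1 * sg C z t < 0"
      by (rule chart_side[OF C(1) z that(2), of \<epsilon>1 \<epsilon>1]) (use \<epsilon>1 \<epsilon> that in auto)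
    moreover have "?q z t \<in> \<Omega> t \<longleftrightarrow> ?q z0 t0 \<in> \<Omega> t" by (rule \<delta>(2)[OF \<epsilon>2(2)]) (use that \<epsilon> in auto)
    ultimately show ?thesis using \<epsilon>1(1) by (simp add: mult_less_0_iff)
  qed
  have "sg C z t = sg C z0 t" if "z \<in> ball z0 \<epsilon>" "t \<in> I" "\<bar>t - t0\<bar> < \<epsilon>" for z t
  proof -
    have "z \<in> U C" using \<epsilon>1(2) \<epsilon> that by auto
    moreover have "sg C z t < 0 \<longleftrightarrow> sg C z0 t < 0" using side[OF that] side[of z0 t] that \<epsilon> by simp
    ultimately show ?thesis using sg(1)[OF C(1) _ that(2), of z] sg(1)[OF C(1,2) that(2)] by auto
  qed
  moreover have "ball z0 \<epsilon> \<subseteq> U C" using \<epsilon>1(2) \<epsilon> by auto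
  ultimately show ?thesis using \<epsilon>(1) by blast
qed

text \<open>A point of largest norm in the region cannot be interior, since moving outward would
  increase the norm; hence it lies on the hypersurface.\<close>

lemma region_in_ball:
  assumes "t \<in> I" "\<And>x. norm (X x t) \<le> R" "q \<in> \<Omega> t"
  shows "norm q \<le> R"
proof -
  have c: "compact (\<Omega> t)" and f: "frontier (\<Omega> t) = range (\<lambda>x. X x t)"
    using region[OF assms(1)] by (auto simp: bounds_region_def)
  have "\<exists>p\<in>\<Omega> t. \<forall>q\<in>\<Omega> t. norm q \<le> norm p"
    by (rule continuous_attains_sup[OF c]) (use assms(3) in \<open>auto intro: continuous_intros\<close>)
  then obtain p where p: "p \<in> \<Omega> t" "\<And>q. q \<in> \<Omega> t \<Longrightarrow> norm q \<le> norm p" by blast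
  have "p \<notin> interior (\<Omega> t)"
  proof
    assume "p \<in> interior (\<Omega> t)"
    then obtain e where e: "e > 0" "ball p e \<subseteq> \<Omega> t" by (auto simp: mem_interior)
    obtain u :: "real^'m" where u: "norm u = 1" "p = norm p *\<^sub>R u"
    proof (cases "p = 0")
      case True
      then show ?thesis using that[of "axis undefined 1"] by (simp add: norm_axis_1)
    next
      case False
      then show ?thesis using that[of "p /\<^sub>R norm p"] by simp
    qed
    have "p + (e / 2) *\<^sub>R u \<in> \<Omega> t" using e u(1) by (auto simp: subset_iff dist_norm)
    then have "norm (p + (e / 2) *\<^sub>R u) \<le> norm p" by (rule p(2))
    moreover have "p + (e / 2) *\<^sub>R u = (norm p + e / 2) *\<^sub>R u" by (subst u(2)) (simp add: scaleR_left_distrib)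
    ultimately show False using u(1) e(1) norm_ge_zero[of p] by simp
  qed
  then have "p \<in> frontier (\<Omega> t)" using p(1) closure_subset by (auto simp: frontier_def)
  then have "norm p \<le> R" using f assms(2) by auto
  then show ?thesis using p(2)[OF assms(3)] by simp
qed

lemma eventually_near:
  assumes "\<delta> > 0" "\<And>t. t \<in> I \<Longrightarrow> \<bar>t - t0\<bar> < \<delta> \<Longrightarrow> P t"
  shows "\<forall>\<^sub>F t in at t0 within I. P t"
  using assms unfolding eventually_at by (metis dist_real_def)

text \<open>Short normal segments leave the slice, which therefore has empty interior.\<close>

lemma off_slice_dense:
  assumes "t0 \<in> I" "r > 0"
  shows "\<exists>q'\<in>ball q r. q' \<notin> range (\<lambda>x. X x t0)"
proof (cases "q \<in> range (\<lambda>x. X x t0)")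
  case True
  then obtain x where q: "q = X x t0" by blast
  obtain C where C: "C \<in> \<A>" "x \<in> fst C" using chart_cover by blast
  have z: "snd C x \<in> U C" by (rule chart_facts(4)[OF C])
  obtain \<epsilon> where \<epsilon>: "\<epsilon> > 0" "\<And>s. s \<noteq> 0 \<Longrightarrow> \<bar>s\<bar> \<le> \<epsilon> \<Longrightarrow> Y C (snd C x, t0) + s *\<^sub>R Vhat C (snd C x, t0) \<notin> range (\<lambda>x. X x t0)"
    using normal_segment_clear[OF C(1) z assms(1)] assms(1) by (metis centre_in_ball diff_self abs_zero)
  define s where "s = min \<epsilon> (r / 2)"
  have s: "s > 0" "s \<le> \<epsilon>" "s < r" using \<epsilon> assms by (auto simp: s_def)
  have "norm (Vhat C (snd C x, t0)) = 1" using Vhat_unit[OF C(1) z assms(1)] by (simp add: norm_eq_1)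
  then have "q + s *\<^sub>R Vhat C (snd C x, t0) \<in> ball q r" using s by (simp add: dist_norm)
  then show ?thesis using \<epsilon>(2)[of s] s unfolding q Y_eq[OF C] by (intro bexI) auto
qed (use assms in auto)

text \<open>A point \<open>q\<close> near the slice is reached from a nearest point of the slice by
  a short normal segment with parameter \<open>s\<close>. At times near \<open>t0\<close> its side
  is the sign of \<open>s\<close> times \<open>sg\<close>, which does not depend on the point in
  space. So whether \<open>q\<close> has changed sides depends only on whether the sign at
  \<open>z0\<close> has flipped.\<close>

lemma nearby_sides:
  assumes C: "C \<in> \<A>" "z0 \<in> U C" "t0 \<in> I"
  shows "\<exists>r>0. \<forall>q\<in>ball (Y C (z0, t0)) r. q \<notin> range (\<lambda>x. X x t0) \<longrightarrow>
    (\<forall>\<^sub>F t in at t0 within I. (q \<in> \<Omega> t \<longleftrightarrow> q \<in> \<Omega> t0) \<longleftrightarrow> sg C z0 t = sg C z0 t0)"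
proof -
  obtain \<epsilon>1 where \<epsilon>1: "\<epsilon>1 > 0" "ball z0 \<epsilon>1 \<subseteq> U C" "\<And>z t s. z \<in> ball z0 \<epsilon>1 \<Longrightarrow> t \<in> I \<Longrightarrow> \<bar>t - t0\<bar> < \<epsilon>1 \<Longrightarrow> s \<noteq> 0 \<Longrightarrow> \<bar>s\<bar> \<le> \<epsilon>1 \<Longrightarrow>
    Y C (z, t) + s *\<^sub>R Vhat C (z, t) \<notin> range (\<lambda>x. X x t)" using normal_segment_clear[OF C] by blast
  obtain \<epsilon>2 where \<epsilon>2: "\<epsilon>2 > 0" "\<And>z t. z \<in> ball z0 \<epsilon>2 \<Longrightarrow> t \<in> I \<Longrightarrow> \<bar>t - t0\<bar> < \<epsilon>2 \<Longrightarrow> sg C z t = sg C z0 t"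
    using sign_constant_in_space[OF C] by blast
  have "min \<epsilon>1 \<epsilon>2 > 0" using \<epsilon>1 \<epsilon>2 by simp
  from near_in_chart[OF C this] obtain \<rho> where \<rho>: "\<rho> > 0"
    "\<And>x. dist (X x t0) (Y C (z0, t0)) < \<rho> \<Longrightarrow> x \<in> fst C \<and> snd C x \<in> ball z0 (min \<epsilon>1 \<epsilon>2)" by blast
  define r where "r = min (\<rho> / 2) \<epsilon>1"
  have r: "r > 0" "2 * r \<le> \<rho>" "r \<le> \<epsilon>1" using \<rho> \<epsilon>1 by (auto simp: r_def)
  have "\<forall>\<^sub>F t in at t0 within I. (q \<in> \<Omega> t \<longleftrightarrow> q \<in> \<Omega> t0) \<longleftrightarrow> sg C z0 t = sg C z0 t0"
    if q: "q \<in> ball (Y C (z0, t0)) r" "q \<notin> range (\<lambda>x. X x t0)" for q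
  proof -
    obtain p where p: "p \<in> range (\<lambda>x. X x t0)" "\<And>p'. p' \<in> range (\<lambda>x. X x t0) \<Longrightarrow> dist q p \<le> dist q p'"
      using distance_attains_inf[OF compact_imp_closed[OF compact_X[OF C(3)]], of q] by auto
    then obtain x where x: "p = X x t0" by blast
    have "Y C (z0, t0) \<in> range (\<lambda>x. X x t0)" by (simp add: Y_def)
    then have qp: "dist q p < r" using p(2) q(1) by (metis dist_commute le_less_trans mem_ball)
    have "dist (X x t0) (Y C (z0, t0)) < \<rho>"
      using dist_triangle[of "X x t0" "Y C (z0, t0)" q] qp q(1) r(2) unfolding x by (simp add: dist_commute)
    then have xC: "x \<in> fst C" "snd C x \<in> ball z0 (min \<epsilon>1 \<epsilon>2)" using \<rho>(2) by auto
    define z where "z = snd C x"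
    have z: "z \<in> U C" "z \<in> ball z0 \<epsilon>1" "z \<in> ball z0 \<epsilon>2" using xC chart_facts(4)[OF C(1)] by (auto simp: z_def)
    have pY: "p = Y C (z, t0)" unfolding x z_def by (rule Y_eq[OF C(1) xC(1), symmetric])
    \<comment> \<open>First variation of the distance from \<open>q\<close> at the nearest
      point.\<close>
    have orth: "sd v (Y C) (z, t0) \<bullet> (q - p) = 0" for v
    proof -
      have d: "((\<lambda>s. Y C (z + s *\<^sub>R v, t0)) has_vector_derivative sd v (Y C) (z, t0)) (at 0)"
        using line_derivative[OF C(1) _ C(3) smooth_Y[OF C(1)], of z 0 v] z(1) by simp
      have "((\<lambda>s. (Y C (z + s *\<^sub>R v, t0) - q) \<bullet> (Y C (z + s *\<^sub>R v, t0) - q)) has_vector_derivative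
          (p - q) \<bullet> sd v (Y C) (z, t0) + sd v (Y C) (z, t0) \<bullet> (p - q)) (at 0)"
        using bounded_bilinear.has_vector_derivative[OF bounded_bilinear_inner has_vector_derivative_diff[OF d has_vector_derivative_const[of q]] has_vector_derivative_diff[OF d has_vector_derivative_const[of q]]]
        by (simp add: pY)
      then have "((\<lambda>s. (Y C (z + s *\<^sub>R v, t0) - q) \<bullet> (Y C (z + s *\<^sub>R v, t0) - q)) has_real_derivative 2 * (sd v (Y C) (z, t0) \<bullet> (p - q))) (at 0)"
        by (simp add: has_real_derivative_iff_has_vector_derivative inner_commute)
      moreover have "(Y C (z + 0 *\<^sub>R v, t0) - q) \<bullet> (Y C (z + 0 *\<^sub>R v, t0) - q) \<le> (Y C (z + s *\<^sub>R v, t0) - q) \<bullet> (Y C (z + s *\<^sub>R v, t0) - q)" for s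
      proof -
        have "dist q p \<le> dist q (Y C (z + s *\<^sub>R v, t0))" by (rule p(2)) (simp add: Y_def)
        then have "norm (Y C (z, t0) - q) \<le> norm (Y C (z + s *\<^sub>R v, t0) - q)" by (simp add: pY dist_norm norm_minus_commute)
        then have "(norm (Y C (z, t0) - q))\<^sup>2 \<le> (norm (Y C (z + s *\<^sub>R v, t0) - q))\<^sup>2" by (intro power_mono) auto
        then show ?thesis by (simp add: power2_norm_eq_inner)
      qed
      ultimately have "2 * (sd v (Y C) (z, t0) \<bullet> (p - q)) = 0"
        by (intro DERIV_local_min[where d=1 and x=0 and f="\<lambda>s. (Y C (z + s *\<^sub>R v, t0) - q) \<bullet> (Y C (z + s *\<^sub>R v, t0) - q)"]) auto
      then show ?thesis by (simp add: inner_diff_right)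
    qed
    define s where "s = (q - p) \<bullet> Vhat C (z, t0)"
    have qs: "q = Y C (z, t0) + s *\<^sub>R Vhat C (z, t0)"
      using normal_multiple[OF C(1) z(1) C(3) orth] unfolding s_def pY by (simp add: algebra_simps)
    have "q \<noteq> p" using p(1) q(2) by blast
    then have s0: "s \<noteq> 0" using qs pY by auto
    have "norm (Vhat C (z, t0)) = 1" using Vhat_unit[OF C(1) z(1) C(3)] by (simp add: norm_eq_1)
    then have "dist q p = \<bar>s\<bar>" unfolding pY by (subst qs) (simp add: dist_norm)
    then have s1: "\<bar>s\<bar> \<le> \<epsilon>1" using qp r by simp
    obtain \<delta> where \<delta>: "\<delta> > 0"
      "\<And>q' t. q' \<in> ball q \<delta> \<Longrightarrow> t \<in> I \<Longrightarrow> \<bar>t - t0\<bar> < \<delta> \<Longrightarrow> q' \<in> \<Omega> t \<longleftrightarrow> q \<in> \<Omega> t"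
      using stable_side[OF C(3) q(2)] by metis
    obtain \<epsilon>3 where \<epsilon>3: "\<epsilon>3 > 0" "\<And>t. t \<in> I \<Longrightarrow> \<bar>t - t0\<bar> < \<epsilon>3 \<Longrightarrow> Y C (z, t) + s *\<^sub>R Vhat C (z, t) \<in> ball q \<delta>"
      using near_points[OF C(1) z(1) C(3) \<delta>(1), of s] unfolding qs[symmetric] by (metis centre_in_ball)
    have side: "q \<in> \<Omega> t \<longleftrightarrow> s * sg C z0 t < 0" if t: "t \<in> I" "\<bar>t - t0\<bar> < \<delta>" "\<bar>t - t0\<bar> < \<epsilon>1" "\<bar>t - t0\<bar> < \<epsilon>2" "\<bar>t - t0\<bar> < \<epsilon>3" for t
    proof -
      have "Y C (z, t) + s *\<^sub>R Vhat C (z, t) \<in> \<Omega> t \<longleftrightarrow> s * sg C z t < 0"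
        by (rule chart_side[OF C(1) z(1) t(1) s0 s1]) (use \<epsilon>1(3)[OF z(2) t(1,3)] in blast)
      moreover have "Y C (z, t) + s *\<^sub>R Vhat C (z, t) \<in> \<Omega> t \<longleftrightarrow> q \<in> \<Omega> t" by (rule \<delta>(2)[OF \<epsilon>3(2)[OF t(1,5)] t(1,2)])
      moreover have "sg C z t = sg C z0 t" by (rule \<epsilon>2(2)[OF z(3) t(1,4)])
      ultimately show ?thesis by simp
    qed
    have iff: "(q \<in> \<Omega> t \<longleftrightarrow> q \<in> \<Omega> t0) \<longleftrightarrow> sg C z0 t = sg C z0 t0"
      if t: "t \<in> I" "\<bar>t - t0\<bar> < min (min \<delta> \<epsilon>1) (min \<epsilon>2 \<epsilon>3)" for t
    proof -
      have "q \<in> \<Omega> t \<longleftrightarrow> s * sg C z0 t < 0" "q \<in> \<Omega> t0 \<longleftrightarrow> s * sg C z0 t0 < 0"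
        using side[of t] side[of t0] t C(3) \<delta>(1) \<epsilon>1(1) \<epsilon>2(1) \<epsilon>3(1) by auto
      moreover have "s < 0 \<or> s > 0" using s0 by linarith
      ultimately show ?thesis using sg(1)[OF C(1,2) t(1)] sg(1)[OF C] by (elim disjE) simp_all
    qed
    show ?thesis by (rule eventually_near[where \<delta>="min (min \<delta> \<epsilon>1) (min \<epsilon>2 \<epsilon>3)", OF _ iff]) (use \<delta>(1) \<epsilon>1(1) \<epsilon>2(1) \<epsilon>3(1) in auto)
  qed
  then show ?thesis using r(1) by blast
qed

text \<open>
  The set of points on whose side \<open>\<Omega> t\<close> and \<open>\<Omega> t0\<close> eventually agree is open and closed,
  and contains all points far away.
\<close>

lemma sign_constant_in_time:
  assumes C: "C \<in> \<A>" "z0 \<in> U C" "t0 \<in> I"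
  shows "\<forall>\<^sub>F t in at t0 within I. sg C z0 t = sg C z0 t0"
proof -
  let ?F = "at t0 within I"
  let ?S = "range (\<lambda>x. X x t0)"
  define agree where "agree q t \<longleftrightarrow> (q \<in> \<Omega> t \<longleftrightarrow> q \<in> \<Omega> t0)" for q t
  define G where "G = {q. \<exists>r>0. \<forall>q'\<in>ball q r. q' \<notin> ?S \<longrightarrow> (\<forall>\<^sub>F t in ?F. agree q' t)}"
  \<comment> \<open>The sign might oscillate as \<open>t\<close> tends to \<open>t0\<close>, hence
    the negation of "eventually" is used here and not "eventually not".\<close>
  define H where "H = {q. \<exists>r>0. \<forall>q'\<in>ball q r. q' \<notin> ?S \<longrightarrow> (\<exists>\<^sub>F t in ?F. \<not> agree q' t)}"
  have op: "open {q. \<exists>r>0. \<forall>q'\<in>ball q r. P q'}" for P :: "real^'m \<Rightarrow> bool"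
    unfolding open_contains_ball
  proof
    fix q assume "q \<in> {q. \<exists>r>0. \<forall>q'\<in>ball q r. P q'}"
    then obtain r where r: "r > 0" "\<And>q'. q' \<in> ball q r \<Longrightarrow> P q'" by blast
    have "P q'" if "q1 \<in> ball q (r / 2)" "q' \<in> ball q1 (r / 2)" for q1 q'
      using r(2)[of q'] dist_triangle[of q q' q1] that by simp
    then have "ball q (r / 2) \<subseteq> {q. \<exists>r>0. \<forall>q'\<in>ball q r. P q'}" using r(1) by (intro subsetI CollectI exI[of _ "r / 2"]) auto
    then show "\<exists>e>0. ball q e \<subseteq> {q. \<exists>r>0. \<forall>q'\<in>ball q r. P q'}" using r(1) by (intro exI[of _ "r / 2"]) auto
  qed
  have "open G" "open H" unfolding G_def H_def by (rule op)+
  \<comment> \<open>Around each point agreement is, for all nearby points off the slice, equivalent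
    to one and the same condition on \<open>t\<close>. That condition either holds eventually, or
    fails frequently for all these points simultaneously.\<close>
  have dichotomy: "q \<in> G \<or> q \<in> H" if r: "r > 0" and iff: "\<And>q'. q' \<in> ball q r \<Longrightarrow> q' \<notin> ?S \<Longrightarrow> \<forall>\<^sub>F t in ?F. agree q' t \<longleftrightarrow> P t" for q r P
  proof (cases "\<forall>\<^sub>F t in ?F. P t")
    case True
    have "\<forall>\<^sub>F t in ?F. agree q' t" if "q' \<in> ball q r" "q' \<notin> ?S" for q'
      using iff[OF that] True by eventually_elim simp
    then show ?thesis using r unfolding G_def by blast
  next
    case False
    have "\<exists>\<^sub>F t in ?F. \<not> agree q' t" if "q' \<in> ball q r" "q' \<notin> ?S" for q'
      unfolding frequently_def
    proof
      assume "\<forall>\<^sub>F t in ?F. \<not> \<not> agree q' t"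
      then have "\<forall>\<^sub>F t in ?F. P t" using iff[OF that] by eventually_elim simp
      then show False using False by simp
    qed
    then show ?thesis using r unfolding H_def by blast
  qed
  have cover: "q \<in> G \<or> q \<in> H" for q
  proof (cases "q \<in> ?S")
    case True
    then obtain x where x: "q = X x t0" by blast
    obtain C where C': "C \<in> \<A>" "x \<in> fst C" using chart_cover by blast
    have "q = Y C (snd C x, t0)" unfolding x by (rule Y_eq[OF C', symmetric])
    then obtain r where "r > 0" "\<And>q'. q' \<in> ball q r \<Longrightarrow> q' \<notin> ?S \<Longrightarrow> \<forall>\<^sub>F t in ?F. agree q' t \<longleftrightarrow> sg C (snd C x) t = sg C (snd C x) t0"
      using nearby_sides[OF C'(1) chart_facts(4)[OF C'] C(3)] unfolding agree_def by blast
    then show ?thesis by (rule dichotomy)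
  next
    case False
    from stable_side[OF C(3) this] obtain \<delta> where \<delta>: "\<delta> > 0"
      "\<And>q' t. q' \<in> ball q \<delta> \<Longrightarrow> t \<in> I \<Longrightarrow> \<bar>t - t0\<bar> < \<delta> \<Longrightarrow> q' \<in> \<Omega> t \<longleftrightarrow> q \<in> \<Omega> t" by metis
    have "\<forall>\<^sub>F t in ?F. agree q' t \<longleftrightarrow> agree q t" if "q' \<in> ball q \<delta>" for q'
      by (rule eventually_near[OF \<delta>(1)]) (use \<delta>(2)[OF that] \<delta>(1) C(3) in \<open>auto simp: agree_def\<close>)
    then show ?thesis by (intro dichotomy[OF \<delta>(1)])
  qed
  have disjoint: "G \<inter> H = {}"
  proof (rule equals0I, elim IntE)
    fix q assume "q \<in> G" "q \<in> H"
    then obtain r r' where r: "r > 0" "\<And>q'. q' \<in> ball q r \<Longrightarrow> q' \<notin> ?S \<Longrightarrow> \<forall>\<^sub>F t in ?F. agree q' t"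
      and r': "r' > 0" "\<And>q'. q' \<in> ball q r' \<Longrightarrow> q' \<notin> ?S \<Longrightarrow> \<exists>\<^sub>F t in ?F. \<not> agree q' t" unfolding G_def H_def by blast
    have "min r r' > 0" using r(1) r'(1) by simp
    then obtain q' where "q' \<in> ball q (min r r')" "q' \<notin> ?S" using off_slice_dense[OF C(3)] by blast
    then show False using r(2)[of q'] r'(2)[of q'] by (simp add: frequently_def)
  qed
  have "G \<noteq> {}"
  proof -
    obtain R t1 where R: "t0 < t1" "\<And>t x. t \<in> I \<Longrightarrow> t \<le> t1 \<Longrightarrow> norm (X x t) \<le> R" using slices_bounded[OF C(3)] by blast
    \<comment> \<open>The unit ball around \<open>q\<close> stays outside the ball of radius
      \<open>R\<close> that contains all the regions for times near \<open>t0\<close>.\<close>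
    define q :: "real^'m" where "q = (\<bar>R\<bar> + 2) *\<^sub>R axis undefined 1"
    have nq: "norm q = \<bar>R\<bar> + 2" by (simp add: q_def norm_axis_1)
    have "\<forall>\<^sub>F t in ?F. agree q' t" if "q' \<in> ball q 1" for q'
    proof (rule eventually_near)
      show "t1 - t0 > 0" using R(1) by simp
      fix t assume t: "t \<in> I" "\<bar>t - t0\<bar> < t1 - t0"
      have "norm q' > R" using that nq norm_triangle_sub[of q q'] by (simp add: dist_norm)
      moreover have "t \<le> t1" using t by linarith
      ultimately have "q' \<notin> \<Omega> t" "q' \<notin> \<Omega> t0"
        using region_in_ball[OF t(1) R(2)[OF t(1)], of q'] region_in_ball[OF C(3) R(2)[OF C(3)], of q'] R(1) by fastforce+
      then show "agree q' t" by (simp add: agree_def)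
    qed
    then have "q \<in> G" unfolding G_def by (intro CollectI exI[of _ 1]) auto
    then show ?thesis by blast
  qed
  moreover have "G \<inter> UNIV = {} \<or> H \<inter> UNIV = {}"
    by (rule connectedD[OF connected_UNIV \<open>open G\<close> \<open>open H\<close>]) (use disjoint cover in auto)
  \<comment> \<open>Connectedness of the ambient space leaves no room for \<open>H\<close>. At a
    point of the slice, eventual agreement means by \<open>nearby_sides\<close> that the sign is
    eventually constant.\<close>
  ultimately have "Y C (z0, t0) \<in> G" using cover by auto
  then obtain r where r: "r > 0" "\<And>q'. q' \<in> ball (Y C (z0, t0)) r \<Longrightarrow> q' \<notin> ?S \<Longrightarrow> \<forall>\<^sub>F t in ?F. agree q' t"
    unfolding G_def by blast
  obtain r' where r': "r' > 0" "\<And>q'. q' \<in> ball (Y C (z0, t0)) r' \<Longrightarrow> q' \<notin> ?S \<Longrightarrow> \<forall>\<^sub>F t in ?F. agree q' t \<longleftrightarrow> sg C z0 t = sg C z0 t0"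
    using nearby_sides[OF C] unfolding agree_def by blast
  have "min r r' > 0" using r(1) r'(1) by simp
  then obtain q' where q': "q' \<in> ball (Y C (z0, t0)) (min r r')" "q' \<notin> ?S"
    using off_slice_dense[OF C(3)] by blast
  have "\<forall>\<^sub>F t in ?F. agree q' t" "\<forall>\<^sub>F t in ?F. agree q' t \<longleftrightarrow> sg C z0 t = sg C z0 t0"
    using r(2)[of q'] r'(2)[of q'] q' by auto
  then show ?thesis by eventually_elim simp
qed

lemma normal_locally_smooth:
  assumes C: "C \<in> \<A>" "z0 \<in> U C" "t0 \<in> I"
  shows "\<exists>\<epsilon>>0. ball z0 \<epsilon> \<subseteq> U C \<and> (\<forall>k. Ck_on k (\<lambda>(z, t). \<nu> (chart_inv C z) t) (ball z0 \<epsilon> \<times> (I \<inter> ball t0 \<epsilon>)))"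
proof -
  obtain \<epsilon>1 where \<epsilon>1: "\<epsilon>1 > 0" "ball z0 \<epsilon>1 \<subseteq> U C" "\<And>z t. z \<in> ball z0 \<epsilon>1 \<Longrightarrow> t \<in> I \<Longrightarrow> \<bar>t - t0\<bar> < \<epsilon>1 \<Longrightarrow> sg C z t = sg C z0 t"
    using sign_constant_in_space[OF C] by blast
  obtain \<epsilon>2 where \<epsilon>2: "\<epsilon>2 > 0" "\<And>t. t \<in> I \<Longrightarrow> t \<noteq> t0 \<Longrightarrow> \<bar>t - t0\<bar> < \<epsilon>2 \<Longrightarrow> sg C z0 t = sg C z0 t0"
    using sign_constant_in_time[OF C] unfolding eventually_at by (auto simp: dist_real_def)
  define \<epsilon> where "\<epsilon> = min \<epsilon>1 \<epsilon>2"
  have \<epsilon>: "\<epsilon> > 0" "\<epsilon> \<le> \<epsilon>1" "\<epsilon> \<le> \<epsilon>2" using \<epsilon>1 \<epsilon>2 by (auto simp: \<epsilon>_def)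
  have sub: "ball z0 \<epsilon> \<subseteq> U C" using \<epsilon>1 \<epsilon> by auto
  have "Ck_on k (\<lambda>(z, t). \<nu> (chart_inv C z) t) (ball z0 \<epsilon> \<times> (I \<inter> ball t0 \<epsilon>))" for k
  proof (rule Ck_on_cong)
    show "Ck_on k (\<lambda>p. sg C z0 t0 *\<^sub>R Vhat C p) (ball z0 \<epsilon> \<times> (I \<inter> ball t0 \<epsilon>))"
      by (intro Ck_on_scaleR Ck_on_const Ck_on_subset[OF smooth_Vhat[OF C(1)]]) (use sub in auto)
    fix p assume p: "p \<in> ball z0 \<epsilon> \<times> (I \<inter> ball t0 \<epsilon>)"
    obtain z t where zt: "p = (z, t)" by (cases p)
    have z: "z \<in> ball z0 \<epsilon>" "z \<in> U C" "t \<in> I" "\<bar>t - t0\<bar> < \<epsilon>" using p sub by (auto simp: zt dist_real_def abs_minus_commute)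
    have "sg C z t = sg C z0 t" by (rule \<epsilon>1(3)) (use z \<epsilon> in auto)
    moreover have "sg C z0 t = sg C z0 t0" using \<epsilon>2(2)[of t] z \<epsilon> by (cases "t = t0") auto
    ultimately show "sg C z0 t0 *\<^sub>R Vhat C p = (case p of (z, t) \<Rightarrow> \<nu> (chart_inv C z) t)"
      using sg(2)[OF C(1) z(2,3)] by (simp add: zt)
  qed
  then show ?thesis using \<epsilon>(1) sub by blast
qed

end

section \<open>Sphere curvatures\<close>

text \<open>The regions are abstracted away: what remains of the orientation is that the unit normal
  is smooth, so \<nu> and its negative are both instances.\<close>

locale normal_flow = unit_normal_family \<A> X T \<nu>
  for \<A> :: "('p::t2_space, 'n::finite) chart set" and X :: "'p \<Rightarrow> real \<Rightarrow> real^'m::finite" and T \<nu> +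
  assumes locally_smooth: "\<And>C z0 t0. C \<in> \<A> \<Longrightarrow> z0 \<in> U C \<Longrightarrow> t0 \<in> I \<Longrightarrow>
    \<exists>\<epsilon>>0. ball z0 \<epsilon> \<subseteq> U C \<and> (\<forall>k. Ck_on k (\<lambda>(z, t). \<nu> (chart_inv C z) t) (ball z0 \<epsilon> \<times> (I \<inter> ball t0 \<epsilon>)))"
begin

lemma \<nu>_tendsto:
  assumes lim: "xs \<longlonglongrightarrow> x" "ts \<longlonglongrightarrow> t" and ts: "\<And>n. ts n \<in> I" and t: "t \<in> I"
  shows "(\<lambda>n. \<nu> (xs n) (ts n)) \<longlonglongrightarrow> \<nu> x t"
proof -
  obtain C where C: "C \<in> \<A>" "x \<in> fst C" using chart_cover by blast
  note sc = snd_chart_tendsto[OF C lim(1)]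
  obtain \<epsilon> where \<epsilon>: "\<epsilon> > 0" "Ck_on 0 (\<lambda>(z, t). \<nu> (chart_inv C z) t) (ball (snd C x) \<epsilon> \<times> (I \<inter> ball t \<epsilon>))"
    using locally_smooth[OF C(1) chart_facts(4)[OF C] t] by blast
  have l: "(\<lambda>n. (snd C (xs n), ts n)) \<longlonglongrightarrow> (snd C x, t)" by (intro tendsto_Pair sc lim)
  have "\<forall>\<^sub>F n in sequentially. (snd C (xs n), ts n) \<in> ball (snd C x) \<epsilon> \<times> (I \<inter> ball t \<epsilon>)"
    using tendstoD[OF sc(1) \<epsilon>(1)] tendstoD[OF lim(2) \<epsilon>(1)] by eventually_elim (use ts in \<open>auto simp: dist_commute\<close>)
  from continuous_on_tendsto_compose[OF _ l _ this, of "\<lambda>(z, t). \<nu> (chart_inv C z) t"]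
  have "(\<lambda>n. \<nu> (chart_inv C (snd C (xs n))) (ts n)) \<longlonglongrightarrow> \<nu> (chart_inv C (snd C x)) t" using \<epsilon> t by simp
  then have "(\<lambda>n. \<nu> (chart_inv C (snd C (xs n))) (ts n)) \<longlonglongrightarrow> \<nu> x t" using C by (simp add: chart_facts)
  then show ?thesis
    by (rule Lim_transform_eventually) (use sc(2) in \<open>auto elim!: eventually_mono simp: chart_facts(3)[OF C(1)]\<close>)
qed

text \<open>This is the limit of \<open>Z X \<nu> x y t\<close> when \<open>y\<close> tends to \<open>x\<close> along \<open>d\<close>.\<close>

definition normal_curvature :: "('p, 'n) chart \<Rightarrow> 'p \<Rightarrow> real \<Rightarrow> real^'n \<Rightarrow> real" where
  "normal_curvature C x t d = - (sd d (sd d (Y C)) (snd C x, t) \<bullet> \<nu> x t) / (norm (sd d (Y C) (snd C x, t)))\<^sup>2"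

text \<open>Numerator and denominator of \<open>Z\<close> degenerate at the same rate; dividing both
  by the square of the scale \<open>l n\<close> leaves two convergent quantities.\<close>

lemma Z_merge:
  assumes l: "\<And>n. l n > 0"
    and q: "(\<lambda>n. (X (ys n) (ts n) - X (xs n) (ts n)) /\<^sub>R l n) \<longlonglongrightarrow> a" "a \<noteq> 0"
    and b: "(\<lambda>n. ((X (ys n) (ts n) - X (xs n) (ts n)) \<bullet> \<nu> (xs n) (ts n)) / (l n)\<^sup>2) \<longlonglongrightarrow> b / 2"
  shows "(\<lambda>n. Z X \<nu> (xs n) (ys n) (ts n)) \<longlonglongrightarrow> - b / (norm a)\<^sup>2"
proof -
  have "(\<lambda>n. - 2 * (((X (ys n) (ts n) - X (xs n) (ts n)) \<bullet> \<nu> (xs n) (ts n)) / (l n)\<^sup>2) /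
      (norm ((X (ys n) (ts n) - X (xs n) (ts n)) /\<^sub>R l n))\<^sup>2) \<longlonglongrightarrow> - 2 * (b / 2) / (norm a)\<^sup>2"
    using q(2) by (intro tendsto_intros b q(1)) auto
  moreover have "- 2 * (((X (ys n) (ts n) - X (xs n) (ts n)) \<bullet> \<nu> (xs n) (ts n)) / (l n)\<^sup>2) /
      (norm ((X (ys n) (ts n) - X (xs n) (ts n)) /\<^sub>R l n))\<^sup>2 = Z X \<nu> (xs n) (ys n) (ts n)" for n
  proof -
    define w where "w = X (ys n) (ts n) - X (xs n) (ts n)"
    have 1: "X (xs n) (ts n) - X (ys n) (ts n) = - w" by (simp add: w_def)
    have "(norm (w /\<^sub>R l n))\<^sup>2 = (norm w)\<^sup>2 / (l n)\<^sup>2"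
      using l[of n] by (simp add: power_divide divide_inverse power_mult_distrib power_inverse mult.commute)
    then show ?thesis using l[of n] unfolding Z_def 1 w_def[symmetric] by simp
  qed
  ultimately show ?thesis by simp
qed

text \<open>By compactness the second points have a limit. If it differs from \<open>x\<close>, then
  \<open>Z\<close> is continuous there; if it equals \<open>x\<close>, the points merge and the
  quotient tends to a normal curvature. This is the compactification of the punctured manifold that
  makes the extremum attained.\<close>

lemma Z_limit:
  assumes C: "C \<in> \<A>" "x \<in> fst C" "t \<in> I"
    and lim: "xs \<longlonglongrightarrow> x" "ts \<longlonglongrightarrow> t" and ts: "\<And>n. ts n \<in> I" and ne: "\<And>n. ys n \<noteq> xs n"
  obtains r L where "strict_mono r" "(\<lambda>n. Z X \<nu> (xs (r n)) (ys (r n)) (ts (r n))) \<longlonglongrightarrow> L"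
    "(\<exists>y. y \<noteq> x \<and> L = Z X \<nu> x y t) \<or> (\<exists>d. norm d = 1 \<and> L = normal_curvature C x t d)"
proof -
  obtain r y where r: "strict_mono r" "(\<lambda>n. ys (r n)) \<longlonglongrightarrow> y" by (rule sequence_compact)
  have sub: "(\<lambda>n. f (r n)) \<longlonglongrightarrow> L" if "f \<longlonglongrightarrow> L" for f :: "nat \<Rightarrow> 'z::topological_space" and L
    using LIMSEQ_subseq_LIMSEQ[OF that r(1)] by (simp add: o_def)
  show ?thesis
  proof (cases "y = x")
    case False
    have "X x t - X y t \<noteq> 0" using X_inj[OF C(3)] False by simp
    note lx = sub[OF lim(1)] and lt = sub[OF lim(2)]
    have "(\<lambda>n. Z X \<nu> (xs (r n)) (ys (r n)) (ts (r n))) \<longlonglongrightarrow> Z X \<nu> x y t"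
      unfolding Z_def
      by (intro tendsto_intros X_tendsto[OF lx lt ts C(3)] X_tendsto[OF r(2) lt ts C(3)] \<nu>_tendsto[OF lx lt ts C(3)])
         (use \<open>X x t - X y t \<noteq> 0\<close> in auto)
    then show ?thesis using that[OF r(1)] False by blast
  next
    case True
    then have yl: "(\<lambda>n. ys (r n)) \<longlonglongrightarrow> x" using r(2) by simp
    have ne': "xs (r n) \<noteq> ys (r n)" for n using ne[of "r n"] by metis
    show ?thesis
    proof (rule merging_points[OF C sub[OF lim(1)] yl sub[OF lim(2)] ts ne'])
      fix r' d l
      assume r': "strict_mono r'" and d: "norm d = 1" and xC: "\<And>n. xs (r (r' n)) \<in> fst C" and l: "\<And>n. 0 < l n"
        and q: "(\<lambda>n. (X (ys (r (r' n))) (ts (r (r' n))) - X (xs (r (r' n))) (ts (r (r' n)))) /\<^sub>R l n) \<longlonglongrightarrow> sd d (Y C) (snd C x, t)"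
        and b: "\<And>Ns N. Ns \<longlonglongrightarrow> N \<Longrightarrow> (\<And>n v. sd v (Y C) (snd C (xs (r (r' n))), ts (r (r' n))) \<bullet> Ns n = 0) \<Longrightarrow>
          (\<lambda>n. ((X (ys (r (r' n))) (ts (r (r' n))) - X (xs (r (r' n))) (ts (r (r' n)))) \<bullet> Ns n) / (l n)\<^sup>2) \<longlonglongrightarrow> (sd d (sd d (Y C)) (snd C x, t) \<bullet> N) / 2"
      have "(\<lambda>n. \<nu> (xs (r n)) (ts (r n))) \<longlonglongrightarrow> \<nu> x t" by (rule \<nu>_tendsto[OF sub[OF lim(1)] sub[OF lim(2)] ts C(3)])
      then have nl: "(\<lambda>n. \<nu> (xs (r (r' n))) (ts (r (r' n)))) \<longlonglongrightarrow> \<nu> x t"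
        using LIMSEQ_subseq_LIMSEQ[OF _ r'] by (fastforce simp: o_def)
      have orth: "sd v (Y C) (snd C (xs (r (r' n))), ts (r (r' n))) \<bullet> \<nu> (xs (r (r' n))) (ts (r (r' n))) = 0" for n v
        using \<nu>_orth[OF C(1) chart_facts(4)[OF C(1) xC] ts] chart_facts(3)[OF C(1) xC] by metis
      have ne0: "sd d (Y C) (snd C x, t) \<noteq> 0" using sd_Y_inj[OF C(1) chart_facts(4)[OF C(1,2)] C(3)] d by (metis norm_zero zero_neq_one)
      have "(\<lambda>n. Z X \<nu> (xs (r (r' n))) (ys (r (r' n))) (ts (r (r' n)))) \<longlonglongrightarrow> normal_curvature C x t d"
        unfolding normal_curvature_def by (rule Z_merge[OF l q ne0 b[OF nl orth]])
      moreover have "strict_mono (\<lambda>n. r (r' n))" using strict_mono_o[OF r(1) r'] by (simp add: o_def)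
      ultimately show thesis using that d by blast
    qed
  qed
qed

text \<open>The points approach \<open>x\<close> along the coordinate line in direction
  \<open>d\<close>, where the directions of the chords are constantly \<open>d\<close>.\<close>

lemma normal_curvature_limit:
  assumes C: "C \<in> \<A>" "x \<in> fst C" "t \<in> I" and d: "norm d = 1"
  obtains ys where "\<And>n. ys n \<noteq> x" "(\<lambda>n. Z X \<nu> x (ys n) t) \<longlonglongrightarrow> normal_curvature C x t d"
proof -
  let ?z = "snd C x"
  have z: "?z \<in> U C" by (rule chart_facts(4)[OF C(1,2)])
  obtain \<epsilon> where \<epsilon>: "\<epsilon> > 0" "ball ?z \<epsilon> \<subseteq> U C" using chart_facts(2)[OF C(1)] z open_contains_ball by blast
  define s where "s n = \<epsilon> / 2 * inverse (real (Suc n))" for n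
  have s: "s n > 0" "s n < \<epsilon>" for n
  proof -
    show "s n > 0" using \<epsilon> by (simp add: s_def)
    have "s n \<le> \<epsilon> / 2 * 1" unfolding s_def using \<epsilon> by (intro mult_left_mono) (auto simp: inverse_le_1_iff)
    then show "s n < \<epsilon>" using \<epsilon> by simp
  qed
  have sl: "s \<longlonglongrightarrow> 0" unfolding s_def[abs_def] using tendsto_mult_right_zero[OF LIMSEQ_inverse_real_of_nat] .
  define ws where "ws n = ?z + s n *\<^sub>R d" for n
  have wU: "ws n \<in> U C" for n using s[of n] d \<epsilon>(2) by (auto simp: ws_def dist_norm subset_iff)
  have wl: "ws \<longlonglongrightarrow> ?z" unfolding ws_def[abs_def] using tendsto_add[OF tendsto_const tendsto_scaleR[OF sl tendsto_const]] by fastforce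
  define ys where "ys n = chart_inv C (ws n)" for n
  have l: "norm (ws n - ?z) = s n" for n using s[of n] d by (simp add: ws_def)
  have ne: "?z \<noteq> ws n" for n using l[of n] s[of n] by auto
  have dir: "(\<lambda>n. (ws n - ?z) /\<^sub>R norm (ws n - ?z)) \<longlonglongrightarrow> d"
  proof -
    have "(ws n - ?z) /\<^sub>R norm (ws n - ?z) = d" for n using s[of n] unfolding l by (simp add: ws_def)
    then show ?thesis by simp
  qed
  note dq = difference_quotients[OF C(1) z C(3) tendsto_const wl tendsto_const C(3) ne dir]
  have XY: "X (ys n) t = Y C (ws n, t)" "X x t = Y C (?z, t)" for n by (simp_all add: Y_def ys_def chart_facts(3)[OF C(1,2)])
  have orth: "sd v (Y C) (?z, t) \<bullet> \<nu> x t = 0" for v using \<nu>_orth[OF C(1) z C(3)] chart_facts(3)[OF C(1,2)] by simp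
  have ne0: "sd d (Y C) (?z, t) \<noteq> 0" using sd_Y_inj[OF C(1) z C(3)] d by (metis norm_zero zero_neq_one)
  have "(\<lambda>n. Z X \<nu> x (ys n) t) \<longlonglongrightarrow> normal_curvature C x t d"
    unfolding normal_curvature_def
    by (rule Z_merge[where l=s and xs="\<lambda>_. x" and ts="\<lambda>_. t", OF s(1) _ ne0])
       (use dq(1) dq(2)[OF tendsto_const orth] in \<open>simp_all add: l XY\<close>)
  moreover have "ys n \<noteq> x" for n using ne[of n] chart_facts(5)[OF C(1) wU] by (metis ys_def)
  ultimately show ?thesis using that by blast
qed

abbreviation "Zbar \<equiv> interior_sphere_curvature X \<nu>"

text \<open>Ensures that the supremum is over a nonempty set.\<close>

lemma other_point: "\<exists>y. y \<noteq> (x::'p)"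
proof -
  obtain C where C: "C \<in> \<A>" "x \<in> fst C" using chart_cover by blast
  have "0 \<in> I" using T by simp
  from normal_curvature_limit[OF C this, of "axis undefined 1"] show ?thesis by (metis norm_axis_1)
qed

text \<open>An unbounded sequence of values would contradict the convergent subsequence supplied by
  \<open>Z_limit\<close>.\<close>

lemma Z_bounded:
  assumes t: "t \<in> I" shows "bdd_above ((\<lambda>y. Z X \<nu> x y t) ` {y. y \<noteq> x})"
proof (rule ccontr)
  assume no: "\<not> ?thesis"
  have "\<exists>y. y \<noteq> x \<and> Z X \<nu> x y t > real n" for n
    using no unfolding bdd_above_def by (auto simp: not_le)
  then obtain ys where ys: "\<And>n. ys n \<noteq> x" "\<And>n. Z X \<nu> x (ys n) t > real n" by metis
  obtain C where C: "C \<in> \<A>" "x \<in> fst C" using chart_cover by blast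
  obtain r L where r: "strict_mono r" "(\<lambda>n. Z X \<nu> x (ys (r n)) t) \<longlonglongrightarrow> L"
    by (rule Z_limit[OF C t tendsto_const tendsto_const t ys(1)]) (rule that; assumption)
  have "\<forall>\<^sub>F n in sequentially. Z X \<nu> x (ys (r n)) t < L + 1" by (rule order_tendstoD(2)[OF r(2)]) simp
  moreover have "\<forall>\<^sub>F n in sequentially. n \<ge> nat \<lceil>L + 1\<rceil>" by (rule eventually_ge_at_top)
  ultimately have "\<forall>\<^sub>F n in sequentially. False"
  proof eventually_elim
    case (elim n)
    have "L + 1 \<le> real n" using elim(2) by linarith
    also have "\<dots> \<le> real (r n)" using seq_suble[OF r(1), of n] by simp
    also have "\<dots> < Z X \<nu> x (ys (r n)) t" by (rule ys)
    finally show ?case using elim(1) by simp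
  qed
  then show False by simp
qed

lemma Z_le_Zbar: "t \<in> I \<Longrightarrow> y \<noteq> x \<Longrightarrow> Z X \<nu> x y t \<le> Zbar x t"
  unfolding interior_sphere_curvature_def by (rule cSUP_upper[OF _ Z_bounded]) auto

lemma normal_curvature_le_Zbar:
  assumes "C \<in> \<A>" "x \<in> fst C" "t \<in> I" "norm d = 1"
  shows "normal_curvature C x t d \<le> Zbar x t"
proof -
  obtain ys where "\<And>n. ys n \<noteq> x" "(\<lambda>n. Z X \<nu> x (ys n) t) \<longlonglongrightarrow> normal_curvature C x t d"
    by (rule normal_curvature_limit[OF assms]) (rule that; assumption)
  then show ?thesis using Z_le_Zbar[OF assms(3)] by (intro tendsto_upperbound[OF _ always_eventually]) auto
qed

lemma near_Zbar:
  assumes "a < Zbar x t" shows "\<exists>y. y \<noteq> x \<and> a < Z X \<nu> x y t"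
proof (rule ccontr)
  assume "\<not> ?thesis"
  then have "\<And>y. y \<in> {y. y \<noteq> x} \<Longrightarrow> Z X \<nu> x y t \<le> a" by (auto simp: not_less)
  then have "Zbar x t \<le> a" unfolding interior_sphere_curvature_def
    by (intro cSUP_least) (use other_point[of x] in auto)
  then show False using assms by simp
qed

text \<open>\<open>Z_limit\<close> is applied to a maximizing sequence with fixed \<open>x\<close>
  and \<open>t\<close>.\<close>

lemma Zbar_attained:
  assumes C: "C \<in> \<A>" "x \<in> fst C" "t \<in> I"
  shows "(\<exists>y. y \<noteq> x \<and> Zbar x t = Z X \<nu> x y t) \<or> (\<exists>d. norm d = 1 \<and> Zbar x t = normal_curvature C x t d)"
proof -
  have "\<exists>y. y \<noteq> x \<and> Zbar x t - inverse (real (Suc n)) < Z X \<nu> x y t" for n by (rule near_Zbar) simp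
  then obtain ys where ys: "\<And>n. ys n \<noteq> x" "\<And>n. Zbar x t - inverse (real (Suc n)) < Z X \<nu> x (ys n) t" by metis
  obtain r L where r: "strict_mono r" "(\<lambda>n. Z X \<nu> x (ys (r n)) t) \<longlonglongrightarrow> L"
    "(\<exists>y. y \<noteq> x \<and> L = Z X \<nu> x y t) \<or> (\<exists>d. norm d = 1 \<and> L = normal_curvature C x t d)"
    by (rule Z_limit[OF C tendsto_const tendsto_const C(3) ys(1)])
  have "(\<lambda>n. Z X \<nu> x (ys n) t) \<longlonglongrightarrow> Zbar x t"
  proof (rule tendsto_sandwich[OF _ _ _ tendsto_const])
    have "(\<lambda>n. Zbar x t - inverse (real (Suc n))) \<longlonglongrightarrow> Zbar x t - 0"
      by (intro tendsto_intros LIMSEQ_inverse_real_of_nat)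
    then show "(\<lambda>n. Zbar x t - inverse (real (Suc n))) \<longlonglongrightarrow> Zbar x t" by simp
    show "\<forall>\<^sub>F n in sequentially. Zbar x t - inverse (real (Suc n)) \<le> Z X \<nu> x (ys n) t"
      by (intro always_eventually allI less_imp_le ys(2))
    show "\<forall>\<^sub>F n in sequentially. Z X \<nu> x (ys n) t \<le> Zbar x t"
      by (intro always_eventually allI Z_le_Zbar C ys(1))
  qed
  then have "(\<lambda>n. Z X \<nu> x (ys (r n)) t) \<longlonglongrightarrow> Zbar x t" using LIMSEQ_subseq_LIMSEQ[OF _ r(1)] by (fastforce simp: o_def)
  then have "L = Zbar x t" using r(2) LIMSEQ_unique by blast
  then show ?thesis using r(3) by metis
qed

text \<open>From below, a nearly optimal \<open>y\<close> for the limit point remains a competitor.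
  From above, nearly optimal points along a subsequence have by \<open>Z_limit\<close> a limiting
  value that is itself bounded by the supremum at the limit point.\<close>

lemma Zbar_continuous: "continuous_on (UNIV \<times> I) (\<lambda>(x, t). Zbar x t)"
proof (rule continuous_on_sequentiallyI)
  fix xs :: "nat \<Rightarrow> 'p" and ts x t
  assume lim: "xs \<longlonglongrightarrow> x" "ts \<longlonglongrightarrow> t" and ts: "\<And>n. ts n \<in> I" and t: "t \<in> I"
  show "(\<lambda>n. Zbar (xs n) (ts n)) \<longlonglongrightarrow> Zbar x t"
  proof (rule order_tendstoI)
    fix a assume "a < Zbar x t"
    then obtain y where y: "y \<noteq> x" "a < Z X \<nu> x y t" using near_Zbar by blast
    have "X x t - X y t \<noteq> 0" using X_inj[OF t, of x y] y(1) by auto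
    then have "(\<lambda>n. Z X \<nu> (xs n) y (ts n)) \<longlonglongrightarrow> Z X \<nu> x y t"
      unfolding Z_def by (intro tendsto_intros X_tendsto \<nu>_tendsto lim ts t) auto
    then have 1: "\<forall>\<^sub>F n in sequentially. a < Z X \<nu> (xs n) y (ts n)" using y(2) by (rule order_tendstoD(1))
    have 2: "\<forall>\<^sub>F n in sequentially. xs n \<in> - {y}" by (rule topological_tendstoD[OF lim(1)]) (use y(1) in auto)
    show "\<forall>\<^sub>F n in sequentially. a < Zbar (xs n) (ts n)"
      using 1 2
    proof eventually_elim
      case (elim n)
      then show ?case using Z_le_Zbar[OF ts, of y "xs n" n] by auto
    qed
  next
    fix a assume a: "Zbar x t < a"
    show "\<forall>\<^sub>F n in sequentially. Zbar (xs n) (ts n) < a"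
    proof (rule ccontr)
      assume "\<not> ?thesis"
      then have "infinite {n. \<not> Zbar (xs n) (ts n) < a}" by (simp add: eventually_cofinite flip: cofinite_eq_sequentially)
      from infinite_enumerate[OF this] obtain r :: "nat \<Rightarrow> nat" where r: "strict_mono r" and "\<forall>n. r n \<in> {n. \<not> Zbar (xs n) (ts n) < a}"
        by blast
      then have ra: "\<not> Zbar (xs (r n)) (ts (r n)) < a" for n by simp
      have "\<exists>y. y \<noteq> xs (r n) \<and> a - inverse (real (Suc n)) < Z X \<nu> (xs (r n)) y (ts (r n))" for n
      proof (rule near_Zbar)
        have "inverse (real (Suc n)) > 0" by simp
        then show "a - inverse (real (Suc n)) < Zbar (xs (r n)) (ts (r n))" using ra[of n] by linarith
      qed
      then obtain ys where ys: "\<And>n. ys n \<noteq> xs (r n)" "\<And>n. a - inverse (real (Suc n)) < Z X \<nu> (xs (r n)) (ys n) (ts (r n))" by metis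
      obtain C where C: "C \<in> \<A>" "x \<in> fst C" using chart_cover by blast
      have l: "(\<lambda>n. xs (r n)) \<longlonglongrightarrow> x" "(\<lambda>n. ts (r n)) \<longlonglongrightarrow> t"
        using LIMSEQ_subseq_LIMSEQ[OF lim(1) r] LIMSEQ_subseq_LIMSEQ[OF lim(2) r] by (simp_all add: o_def)
      obtain r' L where r': "strict_mono r'" "(\<lambda>n. Z X \<nu> (xs (r (r' n))) (ys (r' n)) (ts (r (r' n)))) \<longlonglongrightarrow> L"
        "(\<exists>y. y \<noteq> x \<and> L = Z X \<nu> x y t) \<or> (\<exists>d. norm d = 1 \<and> L = normal_curvature C x t d)"
        by (rule Z_limit[OF C t l ts ys(1)])
      have "(\<lambda>n. a - inverse (real (Suc n))) \<longlonglongrightarrow> a - 0" by (intro tendsto_intros LIMSEQ_inverse_real_of_nat)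
      from LIMSEQ_subseq_LIMSEQ[OF this r'(1)] have "(\<lambda>n. a - inverse (real (Suc (r' n)))) \<longlonglongrightarrow> a" by (simp add: o_def)
      then have "a \<le> L" by (rule LIMSEQ_le[OF _ r'(2)]) (use ys(2) less_imp_le in blast)
      moreover have "L \<le> Zbar x t" using r'(3) Z_le_Zbar[OF t] normal_curvature_le_Zbar[OF C t] by auto
      ultimately show False using a by simp
    qed
  qed
qed

end

section \<open>Normal coordinates\<close>

text \<open>The change of variables \<xi> to \<open>z0 + E \<xi> - K(\<xi>, \<xi>) / 2\<close>, with
  Jacobian \<open>J\<close>. When \<open>E\<close> is an orthonormal frame and \<open>K\<close>
  consists of the Christoffel symbols contracted with \<open>E\<close>, it yields normal coordinates
  to second order.\<close>

locale quadratic_chart =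
  fixes z0 :: "real^'n" and E :: "real^'n^'n" and K :: "'n \<Rightarrow> 'n \<Rightarrow> 'n \<Rightarrow> real"
  assumes K_sym: "K m a b = K m b a"
begin

definition \<Psi> :: "real^'n \<Rightarrow> real^'n" where
  "\<Psi> \<xi> = (\<chi> m. z0 $ m + (\<Sum>a\<in>UNIV. E $ m $ a * \<xi> $ a) - 1/2 * (\<Sum>a\<in>UNIV. \<Sum>b\<in>UNIV. K m a b * (\<xi> $ a * \<xi> $ b)))"

definition J :: "real^'n \<Rightarrow> real^'n^'n" where
  "J \<xi> = (\<chi> m b. E $ m $ b - (\<Sum>a\<in>UNIV. K m a b * \<xi> $ a))"

lemma \<Psi>_0 [simp]: "\<Psi> 0 = z0" and J_0 [simp]: "J 0 = E"
  by (simp_all add: \<Psi>_def J_def vec_eq_iff)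

lemma Ck_on_nth: "Ck_on k (\<lambda>\<xi>::real^'n. \<xi> $ a) S"
  by (rule Ck_on_bounded_linear[OF bounded_linear_vec_nth])

lemma smooth_\<Psi>: "Ck_on k \<Psi> S"
  unfolding \<Psi>_def[abs_def] by (intro Ck_on_vec Ck_on_diff Ck_on_add Ck_on_sum Ck_on_mult Ck_on_const Ck_on_nth)

lemma \<Psi>_has_derivative: "(\<Psi> has_derivative (\<lambda>w. J \<xi> *v w)) (at \<xi>)"
proof -
  have nth: "((\<lambda>\<xi>::real^'n. \<xi> $ a) has_derivative (\<lambda>w. w $ a)) (at \<xi>)" for a
    by (rule bounded_linear_imp_has_derivative[OF bounded_linear_vec_nth])
  have "((\<lambda>\<xi>. z0 $ m + (\<Sum>a\<in>UNIV. E $ m $ a * \<xi> $ a) - 1/2 * (\<Sum>a\<in>UNIV. \<Sum>b\<in>UNIV. K m a b * (\<xi> $ a * \<xi> $ b)))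
     has_derivative (\<lambda>w. (J \<xi> *v w) $ m)) (at \<xi>)" for m
  proof -
    have "((\<lambda>\<xi>. z0 $ m + (\<Sum>a\<in>UNIV. E $ m $ a * \<xi> $ a) - 1/2 * (\<Sum>a\<in>UNIV. \<Sum>b\<in>UNIV. K m a b * (\<xi> $ a * \<xi> $ b)))
       has_derivative (\<lambda>w. (0 + (\<Sum>a\<in>UNIV. E $ m $ a * w $ a)) - 1/2 * (\<Sum>a\<in>UNIV. \<Sum>b\<in>UNIV. K m a b * (\<xi> $ a * w $ b + w $ a * \<xi> $ b)))) (at \<xi>)"
      by (intro has_derivative_diff has_derivative_add has_derivative_const has_derivative_sum
          has_derivative_mult_right has_derivative_mult nth)
    moreover have "(\<Sum>a\<in>UNIV. \<Sum>b\<in>UNIV. K m a b * (\<xi> $ a * w $ b + w $ a * \<xi> $ b)) = 2 * (\<Sum>b\<in>UNIV. \<Sum>a\<in>UNIV. K m a b * \<xi> $ a * w $ b)" for w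
    proof -
      have "(\<Sum>a\<in>UNIV. \<Sum>b\<in>UNIV. K m a b * (\<xi> $ a * w $ b + w $ a * \<xi> $ b)) =
          (\<Sum>a\<in>UNIV. \<Sum>b\<in>UNIV. K m a b * \<xi> $ a * w $ b) + (\<Sum>a\<in>UNIV. \<Sum>b\<in>UNIV. K m a b * \<xi> $ b * w $ a)"
        by (simp add: sum.distrib algebra_simps)
      also have "(\<Sum>a\<in>UNIV. \<Sum>b\<in>UNIV. K m a b * \<xi> $ a * w $ b) = (\<Sum>b\<in>UNIV. \<Sum>a\<in>UNIV. K m a b * \<xi> $ a * w $ b)"
        by (rule sum.swap)
      also have "(\<Sum>a\<in>UNIV. \<Sum>b\<in>UNIV. K m a b * \<xi> $ b * w $ a) = (\<Sum>b\<in>UNIV. \<Sum>a\<in>UNIV. K m a b * \<xi> $ a * w $ b)"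
        by (subst K_sym) (rule refl)
      finally show ?thesis by simp
    qed
    ultimately show ?thesis
      by (simp add: J_def matrix_vector_mult_def left_diff_distrib sum_subtractf sum_distrib_right)
  qed
  then have "((\<lambda>\<xi>. \<Psi> \<xi> $ m) has_derivative (\<lambda>w. (J \<xi> *v w) $ m)) (at \<xi>)" for m by (simp add: \<Psi>_def)
  then show ?thesis by (subst has_derivative_componentwise_within) (auto simp: Basis_vec_def inner_axis)
qed

lemma axis_expansion: "v = (\<Sum>m\<in>UNIV. v $ m *\<^sub>R axis m (1::real))"
  by (simp add: vec_eq_iff axis_def if_distrib cong: if_cong)

definition pull :: "((real^'n) \<times> real \<Rightarrow> 'b) \<Rightarrow> (real^'n) \<times> real \<Rightarrow> 'b" where
  "pull f = (\<lambda>(\<xi>, t). f (\<Psi> \<xi>, t))"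

lemma pull_has_derivative:
  assumes "f differentiable (at (\<Psi> \<xi>, t))"
  shows "(pull f has_derivative (\<lambda>w. D (J \<xi> *v fst w, snd w) f (\<Psi> \<xi>, t))) (at (\<xi>, t))"
proof -
  have "((\<lambda>p. (\<Psi> (fst p), snd p)) has_derivative (\<lambda>w. (J \<xi> *v fst w, snd w))) (at (\<xi>, t))"
  proof (rule has_derivative_Pair)
    show "((\<lambda>p. \<Psi> (fst p)) has_derivative (\<lambda>w. J \<xi> *v fst w)) (at (\<xi>, t))"
      using diff_chain_at[of fst fst "(\<xi>, t)" \<Psi> "\<lambda>w. J \<xi> *v w"] \<Psi>_has_derivative
      by (simp add: o_def bounded_linear_imp_has_derivative bounded_linear_fst)
    show "(snd has_derivative snd) (at (\<xi>, t))" by (rule bounded_linear_imp_has_derivative[OF bounded_linear_snd])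
  qed
  from diff_chain_at[OF this, of f "\<lambda>v. D v f (\<Psi> \<xi>, t)"] has_derivative_D[OF assms]
  show ?thesis by (simp add: o_def pull_def case_prod_unfold)
qed

lemma D_pull_space:
  fixes f :: "(real^'n) \<times> real \<Rightarrow> 'b::real_normed_vector"
  assumes "f differentiable (at (\<Psi> \<xi>, t))"
  shows "D (\<xi>dir i) (pull f) (\<xi>, t) = (\<Sum>m\<in>UNIV. J \<xi> $ m $ i *\<^sub>R D (\<xi>dir m) f (\<Psi> \<xi>, t))"
proof -
  have "(J \<xi> *v axis i 1, 0 :: real) = (\<Sum>m\<in>UNIV. J \<xi> $ m $ i *\<^sub>R \<xi>dir m)"
    by (subst axis_expansion[of "J \<xi> *v axis i 1"])
       (simp add: prod_eq_iff fst_sum snd_sum matrix_vector_mult_basis column_def)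
  moreover have "D (\<xi>dir i) (pull f) (\<xi>, t) = D (J \<xi> *v axis i 1, 0) f (\<Psi> \<xi>, t)"
    using D_eq[OF pull_has_derivative[OF assms], of "\<xi>dir i"] by simp
  ultimately show ?thesis by (simp only: D_linear(2,3)[OF assms])
qed

lemma D_pull_time:
  assumes "f differentiable (at (\<Psi> \<xi>, t))"
  shows "D tdir (pull f) (\<xi>, t) = D tdir f (\<Psi> \<xi>, t)"
  using D_eq[OF pull_has_derivative[OF assms], of tdir] by simp

lemma smooth_pull:
  assumes "Ck_on k f W" "\<And>\<xi> t. (\<xi>, t) \<in> S \<Longrightarrow> (\<Psi> \<xi>, t) \<in> W"
  shows "Ck_on k (pull f) S"
proof -
  have "Ck_on k (\<lambda>p. f (\<Psi> (fst p), snd p)) S"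
  proof (rule Ck_on_compose[OF _ assms(1)])
    show "Ck_on k (\<lambda>p. (\<Psi> (fst p), snd p)) S"
      by (intro Ck_on_pair Ck_on_compose[OF _ smooth_\<Psi>, of _ _ _ UNIV] Ck_on_bounded_linear bounded_linear_fst bounded_linear_snd) auto
  qed (use assms(2) in auto)
  then show ?thesis by (simp add: pull_def case_prod_unfold del: Ck_on.simps)
qed

lemma D2_pull:
  fixes f :: "(real^'n) \<times> real \<Rightarrow> 'b::real_normed_vector"
  assumes S: "open S" "(\<xi>, t) \<in> S" "\<And>\<xi> t. (\<xi>, t) \<in> S \<Longrightarrow> (\<Psi> \<xi>, t) \<in> W" and W: "open W" and f: "Ck_on 2 f W"
  shows "D (\<xi>dir i) (D (\<xi>dir j) (pull f)) (\<xi>, t) =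
    (\<Sum>k\<in>UNIV. J \<xi> $ k $ j *\<^sub>R (\<Sum>l\<in>UNIV. J \<xi> $ l $ i *\<^sub>R D (\<xi>dir l) (D (\<xi>dir k) f) (\<Psi> \<xi>, t)) - K k i j *\<^sub>R D (\<xi>dir k) f (\<Psi> \<xi>, t))"
proof -
  have f1: "Ck_on (Suc 0) f W" "\<And>v. Ck_on (Suc 0) (D v f) W"
    using Ck_on_D[OF W, of "Suc 0" f] f by (auto simp: numeral_2_eq_2 dest: Ck_on_SucD simp del: Ck_on.simps)
  note df = f1[THEN Ck_on_differentiable[OF W]]
  have "D (\<xi>dir i) (D (\<xi>dir j) (pull f)) (\<xi>, t) = D (\<xi>dir i) (\<lambda>p. \<Sum>k\<in>UNIV. J (fst p) $ k $ j *\<^sub>R pull (D (\<xi>dir k) f) p) (\<xi>, t)"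
  proof (rule D_cong[OF S(1,2)])
    fix p assume "p \<in> S"
    then show "D (\<xi>dir j) (pull f) p = (\<Sum>k\<in>UNIV. J (fst p) $ k $ j *\<^sub>R pull (D (\<xi>dir k) f) p)"
      using D_pull_space[OF df(1)[OF S(3)], of "fst p" "snd p" j] by (simp add: pull_def case_prod_unfold)
  qed
  also have "\<dots> = (\<Sum>k\<in>UNIV. D (\<xi>dir i) (\<lambda>p. J (fst p) $ k $ j *\<^sub>R pull (D (\<xi>dir k) f) p) (\<xi>, t))"
  proof (rule D_sum)
    fix k
    have "Ck_on (Suc 0) (\<lambda>p. J (fst p) $ k $ j *\<^sub>R pull (D (\<xi>dir k) f) p) S"
    proof (rule Ck_on_scaleR[OF _ smooth_pull[OF f1(2) S(3)]])
      show "Ck_on (Suc 0) (\<lambda>p. J (fst p) $ k $ j) S"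
        unfolding J_def vec_lambda_beta
        by (intro Ck_on_diff Ck_on_const Ck_on_sum Ck_on_mult 
            Ck_on_bounded_linear[OF bounded_linear_compose[OF bounded_linear_vec_nth bounded_linear_fst]])
    qed
    then show "(\<lambda>p. J (fst p) $ k $ j *\<^sub>R pull (D (\<xi>dir k) f) p) differentiable (at (\<xi>, t))"
      by (rule Ck_on_differentiable[OF S(1) _ S(2)])
  qed
  also have "\<dots> = (\<Sum>k\<in>UNIV. J \<xi> $ k $ j *\<^sub>R (\<Sum>l\<in>UNIV. J \<xi> $ l $ i *\<^sub>R D (\<xi>dir l) (D (\<xi>dir k) f) (\<Psi> \<xi>, t)) - K k i j *\<^sub>R D (\<xi>dir k) f (\<Psi> \<xi>, t))"
  proof (rule sum.cong[OF refl])
    fix k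
    have J: "((\<lambda>p. J (fst p) $ k $ j) has_derivative (\<lambda>w. 0 - (\<Sum>a\<in>UNIV. K k a j * fst w $ a))) (at (\<xi>, t))"
      unfolding J_def vec_lambda_beta
      by (intro has_derivative_diff has_derivative_const has_derivative_sum has_derivative_mult_right
          bounded_linear_imp_has_derivative bounded_linear_compose[OF bounded_linear_vec_nth bounded_linear_fst])
    have "(\<Sum>a\<in>UNIV. K k a j * axis i 1 $ a) = K k i j" by (simp add: axis_def if_distrib cong: if_cong)
    then have DJ: "D (\<xi>dir i) (\<lambda>p. J (fst p) $ k $ j) (\<xi>, t) = - K k i j" using D_eq[OF J, of "\<xi>dir i"] by simp
    have pv: "pull (D (\<xi>dir k) f) (\<xi>, t) = D (\<xi>dir k) f (\<Psi> \<xi>, t)" by (simp add: pull_def)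
    have "(\<lambda>p. J (fst p) $ k $ j) differentiable (at (\<xi>, t))" using J differentiable_def by blast
    moreover have "pull (D (\<xi>dir k) f) differentiable (at (\<xi>, t))"
      using pull_has_derivative[OF df(2)[OF S(3)[OF S(2)]]] differentiable_def by blast
    ultimately show "D (\<xi>dir i) (\<lambda>p. J (fst p) $ k $ j *\<^sub>R pull (D (\<xi>dir k) f) p) (\<xi>, t) =
        J \<xi> $ k $ j *\<^sub>R (\<Sum>l\<in>UNIV. J \<xi> $ l $ i *\<^sub>R D (\<xi>dir l) (D (\<xi>dir k) f) (\<Psi> \<xi>, t)) - K k i j *\<^sub>R D (\<xi>dir k) f (\<Psi> \<xi>, t)"
      by (subst D_scaleR) (simp_all add: DJ D_pull_space[OF df(2)[OF S(3)[OF S(2)]]] pv)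
  qed
  finally show ?thesis .
qed

end

section \<open>Local expressions for the metric, the connection and the Hessian\<close>

context hypersurface_family
begin

abbreviation local_rep :: "('p, 'n) chart \<Rightarrow> ('p \<Rightarrow> real \<Rightarrow> 'b) \<Rightarrow> (real^'n) \<times> real \<Rightarrow> 'b" where
  "local_rep C \<phi> \<equiv> (\<lambda>(z, t). \<phi> (chart_inv C z) t)"

lemma pd_fun_eq_sd: "pd j (\<lambda>w. f (w, t)) = (\<lambda>w. sd (axis j 1) f (w, t))"
  using pd_eq_sd by blast

lemma metric_entry: "metric X C t z $ i $ j = sd (axis i 1) (Y C) (z, t) \<bullet> sd (axis j 1) (Y C) (z, t)"
proof -
  have "(\<lambda>w. X (chart_inv C w) t) = (\<lambda>w. Y C (w, t))" by (simp add: Y_def)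
  then show ?thesis by (simp add: metric_def Let_def pd_eq_sd)
qed

lemma second_fundamental_form_entry:
  "second_fundamental_form X \<nu> C t z $ i $ j = - (sd (axis i 1) (sd (axis j 1) (Y C)) (z, t) \<bullet> \<nu> (chart_inv C z) t)"
proof -
  have "(\<lambda>w. X (chart_inv C w) t) = (\<lambda>w. Y C (w, t))" by (simp add: Y_def)
  then show ?thesis by (simp add: second_fundamental_form_def Let_def pd_fun_eq_sd pd_eq_sd)
qed

lemma hessian_entry:
  "hessian X C t (\<lambda>y. \<phi> y t) z $ i $ j = sd (axis i 1) (sd (axis j 1) (local_rep C \<phi>)) (z, t) -
     (\<Sum>m\<in>UNIV. christoffel X C t z m i j * sd (axis m 1) (local_rep C \<phi>) (z, t))"
proof -
  have "(\<lambda>y. \<phi> y t) \<circ> chart_inv C = (\<lambda>w. local_rep C \<phi> (w, t))" by (simp add: o_def)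
  then show ?thesis by (simp only: hessian_def Let_def pd_fun_eq_sd pd_eq_sd vec_lambda_beta)
qed

lemma slice_differentiable:
  assumes "C \<in> \<A>" "z \<in> U C" "t \<in> I" "\<And>k. Ck_on k f (U C \<times> I)"
  shows "(\<lambda>x. f (x, t)) differentiable (at z)"
  using sd_has_derivative[OF chart_facts(2)[OF assms(1)] assms(4,2,3)] by (auto simp: differentiable_def)

lemma sd_commute:
  assumes C: "C \<in> \<A>" "z \<in> U C" "t \<in> I"
  shows "sd v (sd w (Y C)) (z, t) = sd w (sd v (Y C)) (z, t)"
proof -
  have "Ck_on 2 (\<lambda>x. Y C (x, t)) (U C)"
    by (rule Ck_on_compose[OF Ck_on_pair[OF Ck_on_bounded_linear[OF bounded_linear_ident] Ck_on_const] smooth_Y[OF C(1)]])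
       (use C in auto)
  from D_commute[OF chart_facts(2)[OF C(1)] C(2) this, of v w] show ?thesis
    by (simp add: sd_def[abs_def])
qed

lemma metric_derivative:
  assumes C: "C \<in> \<A>" "z \<in> U C" "t \<in> I"
  shows "pd k (\<lambda>w. metric X C t w $ i $ j) z =
    sd (axis i 1) (Y C) (z, t) \<bullet> sd (axis k 1) (sd (axis j 1) (Y C)) (z, t) + sd (axis k 1) (sd (axis i 1) (Y C)) (z, t) \<bullet> sd (axis j 1) (Y C) (z, t)"
proof -
  have "pd k (\<lambda>w. metric X C t w $ i $ j) z = D (axis k 1) (\<lambda>w. sd (axis i 1) (Y C) (w, t) \<bullet> sd (axis j 1) (Y C) (w, t)) z"
    by (simp add: metric_entry pd_def D_def)
  then show ?thesis
    using D_inner[OF slice_differentiable[OF C smooth_sd_Y[OF C(1)]] slice_differentiable[OF C smooth_sd_Y[OF C(1)]]]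
    by (simp add: sd_def[of "axis k 1"])
qed

lemma christoffel_sym:
  fixes C :: "('p, 'n) chart"
  shows "christoffel X C t z m i j = christoffel X C t z m j i"
proof -
  have s: "(\<lambda>w. metric X C t w $ i $ j) = (\<lambda>w. metric X C t w $ j $ i)"
    by (rule ext) (simp add: metric_entry inner_commute)
  show ?thesis unfolding christoffel_def Let_def s by (simp add: add.commute)
qed

text \<open>For an induced metric the combination of derivatives of \<open>g\<close> in the
  Christoffel symbol collapses, since second derivatives commute, to twice the product of a second
  derivative of X with a coordinate vector. The symbols thus record the tangential part of the
  second derivatives.\<close>

lemma christoffel_lowered:
  assumes C: "C \<in> \<A>" "z \<in> U C" "t \<in> I" and inv: "invertible (metric X C t z)"
  shows "(\<Sum>q\<in>UNIV. christoffel X C t z q i j * metric X C t z $ q $ a) = sd (axis i 1) (sd (axis j 1) (Y C)) (z, t) \<bullet> sd (axis a 1) (Y C) (z, t)"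
proof -
  let ?g = "metric X C t z"
  have invm: "?g ** matrix_inv ?g = mat 1"
    using inv unfolding invertible_def matrix_inv_def by (rule someI2_ex) blast
  define B where "B l = pd i (\<lambda>w. metric X C t w $ j $ l) z + pd j (\<lambda>w. metric X C t w $ i $ l) z - pd l (\<lambda>w. metric X C t w $ i $ j) z" for l
  have gsym: "?g $ q $ a = ?g $ a $ q" for q by (simp add: metric_entry inner_commute)
  have "(\<Sum>q\<in>UNIV. christoffel X C t z q i j * ?g $ q $ a) = (\<Sum>q\<in>UNIV. \<Sum>l\<in>UNIV. 1/2 * (?g $ a $ q * matrix_inv ?g $ q $ l) * B l)"
    unfolding christoffel_def Let_def B_def[symmetric] gsym sum_distrib_left sum_distrib_right
    by (intro sum.cong refl) (simp add: ac_simps)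
  also have "\<dots> = (\<Sum>l\<in>UNIV. \<Sum>q\<in>UNIV. 1/2 * (?g $ a $ q * matrix_inv ?g $ q $ l) * B l)" by (rule sum.swap)
  also have "\<dots> = (\<Sum>l\<in>UNIV. 1/2 * (?g ** matrix_inv ?g) $ a $ l * B l)"
    by (simp add: matrix_matrix_mult_def sum_distrib_left sum_distrib_right)
  also have "\<dots> = 1/2 * B a" unfolding invm by (simp add: mat_def if_distrib if_distribR cong: if_cong)
  also have "\<dots> = sd (axis i 1) (sd (axis j 1) (Y C)) (z, t) \<bullet> sd (axis a 1) (Y C) (z, t)"
    unfolding B_def metric_derivative[OF C]
    using sd_commute[OF C, of "axis i 1" "axis j 1"] sd_commute[OF C, of "axis a 1" "axis j 1"] sd_commute[OF C, of "axis a 1" "axis i 1"]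
    by (simp add: inner_commute)
  finally show ?thesis .
qed

lemma D_time:
  assumes "f differentiable (at (z, t))"
  shows "((\<lambda>s. f (z, s)) has_vector_derivative D tdir f (z, t)) (at t)"
  using D_along_line[of f "(z, 0)" t tdir] assms by simp

end

section \<open>Patches of the flow in normal coordinates\<close>

locale curvature_flow = normal_flow \<A> X T \<nu>
  for \<A> :: "('p::t2_space, 'n::finite) chart set" and X :: "'p \<Rightarrow> real \<Rightarrow> real^'m::finite" and T \<nu> +
  fixes Fs :: "'p \<Rightarrow> real \<Rightarrow> real"
  assumes flow_eq: "\<And>x t. t \<in> I \<Longrightarrow> ((\<lambda>s. X x s) has_vector_derivative - (Fs x t *\<^sub>R \<nu> x t)) (at t within I)"
begin

text \<open>The chart is precomposed with the quadratic map built from the Christoffel symbols at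
  \<open>t0\<close>. At the centre, second derivatives of X become normal and those of \<phi> become
  the Hessian in the frame \<open>E\<close>. The Jacobian \<open>M \<xi>\<close> relates components
  at nearby points to those in the chart \<open>C\<close>, so that bounds valid in all orthonormal
  frames can be read in the patch.\<close>

lemma normal_patch:
  assumes t0: "0 < t0" "t0 < T" and C: "C \<in> \<A>" "x \<in> fst C"
    and E: "orthonormal_frame (metric X C t0 (snd C x)) E"
  obtains \<rho> cm M where "\<rho> > 0" "cm 0 = x" "\<And>\<xi>. \<xi> \<in> ball 0 \<rho> \<Longrightarrow> cm \<xi> \<in> fst C" "continuous_on (ball 0 \<rho>) cm"
    "ball t0 \<rho> \<subseteq> {0<..<T}"
    "flow_patch (ball 0 \<rho> \<times> ball t0 \<rho>) t0 (\<lambda>(\<xi>, t). X (cm \<xi>) t) (\<lambda>(\<xi>, t). \<nu> (cm \<xi>) t) (\<lambda>(\<xi>, t). Fs (cm \<xi>) t)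
       (in_frame E (second_fundamental_form X \<nu> C t0 (snd C x)))"
    "\<And>i. D (\<xi>dir i) (\<lambda>(\<xi>, t). X (cm \<xi>) t) (0, t0) = (\<Sum>m\<in>UNIV. E $ m $ i *\<^sub>R sd (axis m 1) (Y C) (snd C x, t0))"
    "\<And>\<xi> t. \<xi> \<in> ball 0 \<rho> \<Longrightarrow> t \<in> ball t0 \<rho> \<Longrightarrow> first_form (\<lambda>(\<xi>, t). X (cm \<xi>) t) (\<xi>, t) = in_frame (M \<xi>) (metric X C t (snd C (cm \<xi>)))"
    "\<And>\<xi> t. \<xi> \<in> ball 0 \<rho> \<Longrightarrow> t \<in> ball t0 \<rho> \<Longrightarrow> second_form (\<lambda>(\<xi>, t). X (cm \<xi>) t) (\<lambda>(\<xi>, t). \<nu> (cm \<xi>) t) (\<xi>, t) =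
       in_frame (M \<xi>) (second_fundamental_form X \<nu> C t (snd C (cm \<xi>)))"
    "\<And>\<phi> :: 'p \<Rightarrow> real \<Rightarrow> real. Ck_family 2 \<A> T \<phi> \<Longrightarrow> Ck_on 2 (\<lambda>(\<xi>, t). \<phi> (cm \<xi>) t) (ball 0 \<rho> \<times> ball t0 \<rho>) \<and>
       D tdir (\<lambda>(\<xi>, t). \<phi> (cm \<xi>) t) (0, t0) = deriv (\<lambda>t. \<phi> x t) t0 \<and>
       (\<forall>i. D (\<xi>dir i) (D (\<xi>dir i) (\<lambda>(\<xi>, t). \<phi> (cm \<xi>) t)) (0, t0) = in_frame E (hessian X C t0 (\<lambda>y. \<phi> y t0) (snd C x)) $ i $ i)"
proof -
  define z0 where "z0 = snd C x"
  have z0: "z0 \<in> U C" "chart_inv C z0 = x" using chart_facts(3,4)[OF C] by (auto simp: z0_def)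
  have t0I: "t0 \<in> I" using t0 by simp
  let ?g = "metric X C t0 z0"
  define K where "K m a b = (\<Sum>i\<in>UNIV. \<Sum>j\<in>UNIV. christoffel X C t0 z0 m i j * (E $ i $ a * E $ j $ b))" for m a b
  interpret quadratic_chart z0 E K
  proof
    fix m a b
    have "K m a b = (\<Sum>j\<in>UNIV. \<Sum>i\<in>UNIV. christoffel X C t0 z0 m i j * (E $ i $ a * E $ j $ b))"
      unfolding K_def by (rule sum.swap)
    also have "\<dots> = K m b a" unfolding K_def by (intro sum.cong refl) (simp add: christoffel_sym[of C t0 z0 m] mult.commute)
    finally show "K m a b = K m b a" .
  qed
  obtain \<epsilon> where \<epsilon>: "\<epsilon> > 0" "ball z0 \<epsilon> \<subseteq> U C" "\<And>k. Ck_on k (local_rep C \<nu>) (ball z0 \<epsilon> \<times> (I \<inter> ball t0 \<epsilon>))"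
    using locally_smooth[OF C(1) z0(1) t0I] by blast
  have "isCont \<Psi> 0" using has_derivative_continuous[OF \<Psi>_has_derivative] by blast
  then obtain \<rho>1 where \<rho>1: "\<rho>1 > 0" "\<And>\<xi>. dist \<xi> 0 < \<rho>1 \<Longrightarrow> dist (\<Psi> \<xi>) (\<Psi> 0) < \<epsilon>"
    using \<epsilon>(1) unfolding continuous_at_eps_delta by blast
  \<comment> \<open>The radius keeps the patch where \<nu> is known to be smooth and keeps all times
    inside the open interval, so that time derivatives are two-sided.\<close>
  define \<rho> where "\<rho> = min (min \<rho>1 \<epsilon>) (min t0 (T - t0))"
  have \<rho>: "\<rho> > 0" "\<rho> \<le> \<rho>1" "\<rho> \<le> \<epsilon>" "\<rho> \<le> t0" "\<rho> \<le> T - t0" using \<rho>1(1) \<epsilon>(1) t0 by (auto simp: \<rho>_def)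
  let ?S = "ball (0::real^'n) \<rho> \<times> ball t0 \<rho>"
  define W where "W = U C \<times> {0<..<T}"
  have W: "open W" using chart_facts(2)[OF C(1)] by (simp add: W_def open_Times)
  have \<Psi>U: "\<Psi> \<xi> \<in> ball z0 \<epsilon>" "\<Psi> \<xi> \<in> U C" if "\<xi> \<in> ball 0 \<rho>" for \<xi>
  proof -
    show "\<Psi> \<xi> \<in> ball z0 \<epsilon>" using \<rho>1(2)[of \<xi>] that \<rho>(2) by (simp add: dist_commute)
    then show "\<Psi> \<xi> \<in> U C" using \<epsilon>(2) by blast
  qed
  have tT: "t \<in> {0<..<T}" "t \<in> I" "t \<in> ball t0 \<epsilon>" if "t \<in> ball t0 \<rho>" for t
    using that \<rho> by (auto simp: dist_real_def)
  have SW: "(\<Psi> \<xi>, t) \<in> W" if "(\<xi>, t) \<in> ?S" for \<xi> t using that \<Psi>U tT by (auto simp: W_def)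
  have S: "open ?S" "(0, t0) \<in> ?S" using \<rho>(1) by (auto simp: open_Times)
  have WI: "W \<subseteq> U C \<times> I" by (auto simp: W_def)
  have smY: "Ck_on k (Y C) W" for k by (rule Ck_on_subset[OF smooth_Y[OF C(1)] WI])
  have dY: "Y C differentiable (at q)" if "q \<in> W" for q by (rule Ck_on_differentiable[OF W smY that])
  have sd1: "D (v, 0) (Y C) q = sd v (Y C) q" if "q \<in> W" for q v
    using sd_eq_D[of "Y C" "fst q" "snd q" v] dY[OF that] by simp
  have sd2: "D (v, 0) (D (w, 0) (Y C)) q = sd v (sd w (Y C)) q" if "q \<in> W" for q v w
  proof -
    have "D (v, 0) (D (w, 0) (Y C)) q = D (v, 0) (sd w (Y C)) q" by (rule D_cong[OF W that sd1])
    moreover have "sd w (Y C) differentiable (at q)"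
      by (rule Ck_on_differentiable[OF W Ck_on_subset[OF smooth_sd_Y[OF C(1)] WI] that])
    ultimately show ?thesis using sd_eq_D[of "sd w (Y C)" "fst q" "snd q" v] by simp
  qed
  define cm where "cm \<xi> = chart_inv C (\<Psi> \<xi>)" for \<xi>
  have pullX: "(\<lambda>(\<xi>, t). X (cm \<xi>) t) = pull (Y C)" by (simp add: pull_def Y_def cm_def fun_eq_iff)
  have pulll: "(\<lambda>(\<xi>, t). h (cm \<xi>) t) = pull (local_rep C h)" for h :: "'p \<Rightarrow> real \<Rightarrow> 'z::real_normed_vector"
    by (simp add: pull_def cm_def fun_eq_iff)
  have snd_cm: "snd C (cm \<xi>) = \<Psi> \<xi>" if "\<xi> \<in> ball 0 \<rho>" for \<xi> using \<Psi>U(2)[OF that] by (simp add: cm_def chart_facts(5)[OF C(1)])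
  have D1: "D (\<xi>dir i) (pull (Y C)) (\<xi>, t) = (\<Sum>m\<in>UNIV. J \<xi> $ m $ i *\<^sub>R sd (axis m 1) (Y C) (\<Psi> \<xi>, t))" if "(\<xi>, t) \<in> ?S" for \<xi> t i
    using D_pull_space[OF dY[OF SW[OF that]]] sd1[OF SW[OF that]] by simp
  have D2: "D (\<xi>dir i) (D (\<xi>dir j) (pull (Y C))) (\<xi>, t) =
    (\<Sum>k\<in>UNIV. J \<xi> $ k $ j *\<^sub>R (\<Sum>l\<in>UNIV. J \<xi> $ l $ i *\<^sub>R sd (axis l 1) (sd (axis k 1) (Y C)) (\<Psi> \<xi>, t)) - K k i j *\<^sub>R sd (axis k 1) (Y C) (\<Psi> \<xi>, t))"
    if "(\<xi>, t) \<in> ?S" for \<xi> t i j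
    using D2_pull[OF S(1) that SW W smY] by (simp add: sd1[OF SW[OF that]] sd2[OF SW[OF that]])
  have orthN: "sd v (Y C) (\<Psi> \<xi>, t) \<bullet> \<nu> (cm \<xi>) t = 0" if "(\<xi>, t) \<in> ?S" for \<xi> t v
    using \<nu>_orth[OF C(1) \<Psi>U(2) tT(2)] that unfolding cm_def by auto
  have first: "first_form (pull (Y C)) (\<xi>, t) = in_frame (J \<xi>) (metric X C t (\<Psi> \<xi>))" if "(\<xi>, t) \<in> ?S" for \<xi> t
    unfolding first_form_def D1[OF that]
    by (simp add: vec_eq_iff in_frame_def matrix_matrix_mult_def transpose_def metric_entry inner_sum_left inner_sum_right sum_distrib_right sum_distrib_left ac_simps)
  have second: "second_form (pull (Y C)) (pull (local_rep C \<nu>)) (\<xi>, t) = in_frame (J \<xi>) (second_fundamental_form X \<nu> C t (\<Psi> \<xi>))" if "(\<xi>, t) \<in> ?S" for \<xi> t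
  proof -
    have N: "pull (local_rep C \<nu>) (\<xi>, t) = \<nu> (cm \<xi>) t" by (simp add: pull_def cm_def)
    show ?thesis
      unfolding second_form_def D2[OF that] N
      by (simp add: vec_eq_iff in_frame_def matrix_matrix_mult_def transpose_def second_fundamental_form_entry inner_sum_left
          inner_diff_left orthN[OF that] sum_distrib_right sum_distrib_left sum_negf ac_simps cm_def[symmetric])
  qed
  have gE: "in_frame E ?g = mat 1" using E by (simp add: orthonormal_frame_def in_frame_def z0_def)
  then have "transpose E ** (?g ** E) = mat 1" by (simp add: in_frame_def matrix_mul_assoc)
  then have "det (transpose E) * (det ?g * det E) = 1" by (metis det_I det_mul)
  then have "det ?g \<noteq> 0" by auto
  then have ginv: "invertible ?g" by (simp add: invertible_det_nz)
  have orth0: "D (\<xi>dir i) (pull (Y C)) (0, t0) \<bullet> D (\<xi>dir j) (pull (Y C)) (0, t0) = (if i = j then 1 else 0)" for i j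
    using first[OF S(2)] gE by (simp add: first_form_def vec_eq_iff mat_def)
  have N0: "pull (local_rep C \<nu>) (0, t0) = \<nu> x t0" by (simp add: pull_def z0)
  \<comment> \<open>By \<open>christoffel_lowered\<close> the tangential part of the second
    derivatives in the directions of \<open>E\<close> is exactly what the quadratic term
    \<open>K\<close> subtracts.\<close>
  have lowered: "D (\<xi>dir i) (D (\<xi>dir j) (pull (Y C))) (0, t0) \<bullet> sd (axis a 1) (Y C) (z0, t0) = 0" for i j a
  proof -
    have "D (\<xi>dir i) (D (\<xi>dir j) (pull (Y C))) (0, t0) \<bullet> sd (axis a 1) (Y C) (z0, t0) =
      (\<Sum>k\<in>UNIV. \<Sum>l\<in>UNIV. E $ k $ j * (E $ l $ i * (sd (axis l 1) (sd (axis k 1) (Y C)) (z0, t0) \<bullet> sd (axis a 1) (Y C) (z0, t0))))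
      - (\<Sum>q\<in>UNIV. K q i j * (sd (axis q 1) (Y C) (z0, t0) \<bullet> sd (axis a 1) (Y C) (z0, t0)))"
      unfolding D2[OF S(2)] by (simp add: inner_sum_left inner_diff_left sum_subtractf sum_distrib_left)
    also have "(\<Sum>q\<in>UNIV. K q i j * (sd (axis q 1) (Y C) (z0, t0) \<bullet> sd (axis a 1) (Y C) (z0, t0))) =
      (\<Sum>q\<in>UNIV. \<Sum>l\<in>UNIV. \<Sum>k\<in>UNIV. E $ k $ j * (E $ l $ i * (christoffel X C t0 z0 q l k * ?g $ q $ a)))"
      unfolding K_def metric_entry by (simp add: sum_distrib_right sum_distrib_left ac_simps)
    also have "\<dots> = (\<Sum>l\<in>UNIV. \<Sum>k\<in>UNIV. \<Sum>q\<in>UNIV. E $ k $ j * (E $ l $ i * (christoffel X C t0 z0 q l k * ?g $ q $ a)))"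
      by (rule trans[OF sum.swap]) (intro sum.cong refl sum.swap)
    also have "\<dots> = (\<Sum>l\<in>UNIV. \<Sum>k\<in>UNIV. E $ k $ j * (E $ l $ i * (sd (axis l 1) (sd (axis k 1) (Y C)) (z0, t0) \<bullet> sd (axis a 1) (Y C) (z0, t0))))"
      by (simp only: sum_distrib_left[symmetric] christoffel_lowered[OF C(1) z0(1) t0I ginv])
    also have "\<dots> = (\<Sum>k\<in>UNIV. \<Sum>l\<in>UNIV. E $ k $ j * (E $ l $ i * (sd (axis l 1) (sd (axis k 1) (Y C)) (z0, t0) \<bullet> sd (axis a 1) (Y C) (z0, t0))))"
      by (rule sum.swap)
    finally show ?thesis by simp
  qed
  have patch: "flow_patch ?S t0 (pull (Y C)) (pull (local_rep C \<nu>)) (pull (local_rep C Fs)) (in_frame E (second_fundamental_form X \<nu> C t0 z0))"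
  proof
    show "CARD('m) = CARD('n) + 1" by (rule card_m)
    show "open ?S" "(0, t0) \<in> ?S" by (fact S)+
    show "Ck_on k (pull (Y C)) ?S" for k by (rule smooth_pull[OF smY SW])
    show "Ck_on k (pull (local_rep C \<nu>)) ?S" for k
      by (rule smooth_pull[OF \<epsilon>(3)]) (use \<Psi>U tT in auto)
    fix q assume "q \<in> ?S"
    then obtain \<xi> t where q: "q = (\<xi>, t)" and m: "(\<xi>, t) \<in> ?S" by (cases q) auto
    have N: "pull (local_rep C \<nu>) q = \<nu> (cm \<xi>) t" and F: "pull (local_rep C Fs) q = Fs (cm \<xi>) t" by (simp_all add: q pull_def cm_def)
    show "pull (local_rep C \<nu>) q \<bullet> pull (local_rep C \<nu>) q = 1" unfolding N by (rule \<nu>_unit) (use tT m in auto)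
    show "pull (local_rep C \<nu>) q \<bullet> D (\<xi>dir i) (pull (Y C)) q = 0" for i
      unfolding N unfolding q D1[OF m] using orthN[OF m] by (simp add: inner_sum_right inner_commute)
    have tm: "t \<in> I" "t \<in> {0<..<T}" using m tT by auto
    have "((\<lambda>s. Y C (\<Psi> \<xi>, s)) has_vector_derivative - (Fs (cm \<xi>) t *\<^sub>R \<nu> (cm \<xi>) t)) (at t within {0<..<T})"
      using has_vector_derivative_within_subset[OF flow_eq[OF tm(1), of "cm \<xi>"], of "{0<..<T}"] greaterThanLessThan_subseteq_atLeastLessThan_iff[of 0 T 0 T] by (simp add: Y_def cm_def)
    then have "((\<lambda>s. Y C (\<Psi> \<xi>, s)) has_vector_derivative - (Fs (cm \<xi>) t *\<^sub>R \<nu> (cm \<xi>) t)) (at t)"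
      unfolding at_within_open[OF tm(2) open_greaterThanLessThan] .
    then have "D tdir (Y C) (\<Psi> \<xi>, t) = - (Fs (cm \<xi>) t *\<^sub>R \<nu> (cm \<xi>) t)"
      by (rule vector_derivative_unique_at[OF D_time[OF dY[OF SW[OF m]]]])
    then show "D tdir (pull (Y C)) q = - (pull (local_rep C Fs) q *\<^sub>R pull (local_rep C \<nu>) q)"
      unfolding N F unfolding q D_pull_time[OF dY[OF SW[OF m]]] .
  next
    show "D (\<xi>dir i) (pull (Y C)) (0, t0) \<bullet> D (\<xi>dir j) (pull (Y C)) (0, t0) = (if i = j then 1 else 0)" for i j by (rule orth0)
    fix i j
    let ?H = "in_frame E (second_fundamental_form X \<nu> C t0 z0)"
    have u: "\<nu> x t0 \<bullet> \<nu> x t0 = 1" by (rule \<nu>_unit[OF t0I])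
    have oN: "D (\<xi>dir k) (pull (Y C)) (0, t0) \<bullet> \<nu> x t0 = 0" for k
      unfolding D1[OF S(2)] using orthN[OF S(2)] by (simp add: inner_sum_left cm_def z0)
    show "D (\<xi>dir i) (D (\<xi>dir j) (pull (Y C))) (0, t0) = - (?H $ i $ j *\<^sub>R pull (local_rep C \<nu>) (0, t0))"
      unfolding N0
    proof (rule orthonormal_basis_expansion[OF card_m orth0 u oN])
      fix k
      have "D (\<xi>dir i) (D (\<xi>dir j) (pull (Y C))) (0, t0) \<bullet> D (\<xi>dir k) (pull (Y C)) (0, t0) = 0"
        unfolding D1[OF S(2)] by (simp add: inner_sum_right lowered)
      then show "D (\<xi>dir i) (D (\<xi>dir j) (pull (Y C))) (0, t0) \<bullet> D (\<xi>dir k) (pull (Y C)) (0, t0) =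
          - (?H $ i $ j *\<^sub>R \<nu> x t0) \<bullet> D (\<xi>dir k) (pull (Y C)) (0, t0)" using oN by (simp add: inner_commute)
    next
      have "second_form (pull (Y C)) (pull (local_rep C \<nu>)) (0, t0) $ i $ j = ?H $ i $ j" using second[OF S(2)] by simp
      then show "D (\<xi>dir i) (D (\<xi>dir j) (pull (Y C))) (0, t0) \<bullet> \<nu> x t0 = - (?H $ i $ j *\<^sub>R \<nu> x t0) \<bullet> \<nu> x t0"
        using u by (simp add: second_form_def N0)
    qed
  qed
  have \<phi>: "Ck_on 2 (pull (local_rep C \<phi>)) ?S \<and> D tdir (pull (local_rep C \<phi>)) (0, t0) = deriv (\<lambda>t. \<phi> x t) t0 \<and>
       (\<forall>i. D (\<xi>dir i) (D (\<xi>dir i) (pull (local_rep C \<phi>))) (0, t0) = in_frame E (hessian X C t0 (\<lambda>y. \<phi> y t0) z0) $ i $ i)"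
    if "Ck_family 2 \<A> T \<phi>" for \<phi> :: "'p \<Rightarrow> real \<Rightarrow> real"
  proof (intro conjI allI)
    have "Ck_on 2 (local_rep C \<phi>) (U C \<times> I)" using that C(1) unfolding Ck_family_def U_def by blast
    then have s2: "Ck_on 2 (local_rep C \<phi>) W" by (rule Ck_on_subset[OF _ WI])
    show "Ck_on 2 (pull (local_rep C \<phi>)) ?S" by (rule smooth_pull[OF s2 SW])
    have s1: "Ck_on (Suc 0) (local_rep C \<phi>) W" "\<And>v. Ck_on (Suc 0) (D v (local_rep C \<phi>)) W"
      using Ck_on_D[OF W, of "Suc 0" "local_rep C \<phi>"] s2 by (auto simp: numeral_2_eq_2 dest: Ck_on_SucD simp del: Ck_on.simps)
    note d = s1[THEN Ck_on_differentiable[OF W]]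
    have z0W: "(z0, t0) \<in> W" using SW[OF S(2)] by simp
    have "((\<lambda>s. \<phi> x s) has_vector_derivative D tdir (local_rep C \<phi>) (z0, t0)) (at t0)"
      using D_time[OF d(1)[OF z0W]] by (simp add: z0)
    then have "deriv (\<lambda>t. \<phi> x t) t0 = D tdir (local_rep C \<phi>) (z0, t0)"
      by (intro DERIV_imp_deriv) (simp add: has_real_derivative_iff_has_vector_derivative)
    then show "D tdir (pull (local_rep C \<phi>)) (0, t0) = deriv (\<lambda>t. \<phi> x t) t0"
      using D_pull_time[of "local_rep C \<phi>" 0 t0] d(1)[OF z0W] by simp
    fix i
    have e1: "D (v, 0) (local_rep C \<phi>) q = sd v (local_rep C \<phi>) q" if "q \<in> W" for q v
      using sd_eq_D[of "local_rep C \<phi>" "fst q" "snd q" v] d(1)[OF that] by simp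
    have e2: "D (v, 0) (D (w, 0) (local_rep C \<phi>)) (z0, t0) = sd v (sd w (local_rep C \<phi>)) (z0, t0)" for v w
    proof -
      have "sd v (D (w, 0) (local_rep C \<phi>)) (z0, t0) = D (v, 0) (D (w, 0) (local_rep C \<phi>)) (z0, t0)"
        by (rule sd_eq_D[OF d(2)[OF z0W]])
      moreover have "sd v (D (w, 0) (local_rep C \<phi>)) (z0, t0) = sd v (sd w (local_rep C \<phi>)) (z0, t0)"
        unfolding sd_def[of v] fst_conv snd_conv
        by (rule D_cong[OF chart_facts(2)[OF C(1)] z0(1)]) (rule e1, use t0 in \<open>simp add: W_def\<close>)
      ultimately show ?thesis by simp
    qed
    have "D (\<xi>dir i) (D (\<xi>dir i) (pull (local_rep C \<phi>))) (0, t0) =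
      (\<Sum>k\<in>UNIV. E $ k $ i * (\<Sum>l\<in>UNIV. E $ l $ i * sd (axis l 1) (sd (axis k 1) (local_rep C \<phi>)) (z0, t0)) - K k i i * sd (axis k 1) (local_rep C \<phi>) (z0, t0))"
      using D2_pull[OF S SW W s2] by (simp add: e2 e1[OF z0W])
    also have "\<dots> = (\<Sum>k\<in>UNIV. \<Sum>l\<in>UNIV. E $ l $ i * (E $ k $ i * sd (axis l 1) (sd (axis k 1) (local_rep C \<phi>)) (z0, t0)))
      - (\<Sum>m\<in>UNIV. \<Sum>l\<in>UNIV. \<Sum>k\<in>UNIV. E $ l $ i * (E $ k $ i * (christoffel X C t0 z0 m l k * sd (axis m 1) (local_rep C \<phi>) (z0, t0))))"
      unfolding K_def by (simp add: sum_subtractf sum_distrib_left sum_distrib_right ac_simps)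
    also have "(\<Sum>m\<in>UNIV. \<Sum>l\<in>UNIV. \<Sum>k\<in>UNIV. E $ l $ i * (E $ k $ i * (christoffel X C t0 z0 m l k * sd (axis m 1) (local_rep C \<phi>) (z0, t0)))) =
       (\<Sum>l\<in>UNIV. \<Sum>k\<in>UNIV. \<Sum>m\<in>UNIV. E $ l $ i * (E $ k $ i * (christoffel X C t0 z0 m l k * sd (axis m 1) (local_rep C \<phi>) (z0, t0))))"
      by (rule trans[OF sum.swap]) (intro sum.cong refl sum.swap)
    also have "\<dots> = (\<Sum>k\<in>UNIV. \<Sum>l\<in>UNIV. \<Sum>m\<in>UNIV. E $ l $ i * (E $ k $ i * (christoffel X C t0 z0 m l k * sd (axis m 1) (local_rep C \<phi>) (z0, t0))))"
      by (rule sum.swap)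
    also have "(\<Sum>k\<in>UNIV. \<Sum>l\<in>UNIV. E $ l $ i * (E $ k $ i * sd (axis l 1) (sd (axis k 1) (local_rep C \<phi>)) (z0, t0)))
      - (\<Sum>k\<in>UNIV. \<Sum>l\<in>UNIV. \<Sum>m\<in>UNIV. E $ l $ i * (E $ k $ i * (christoffel X C t0 z0 m l k * sd (axis m 1) (local_rep C \<phi>) (z0, t0))))
      = (\<Sum>k\<in>UNIV. \<Sum>l\<in>UNIV. E $ l $ i * (E $ k $ i * hessian X C t0 (\<lambda>y. \<phi> y t0) z0 $ l $ k))"
      unfolding hessian_entry by (simp add: sum_subtractf[symmetric] right_diff_distrib sum_distrib_left)
    also have "\<dots> = in_frame E (hessian X C t0 (\<lambda>y. \<phi> y t0) z0) $ i $ i"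
      by (simp add: in_frame_def matrix_matrix_mult_def transpose_def sum_distrib_right sum_distrib_left ac_simps)
    finally show "D (\<xi>dir i) (D (\<xi>dir i) (pull (local_rep C \<phi>))) (0, t0) = in_frame E (hessian X C t0 (\<lambda>y. \<phi> y t0) z0) $ i $ i" .
  qed
  show ?thesis
  proof (rule that[of \<rho> cm J, unfolded pullX pulll z0_def[symmetric]])
    show "\<rho> > 0" by (fact \<rho>)
    show "cm 0 = x" by (simp add: cm_def z0)
    show "cm \<xi> \<in> fst C" if "\<xi> \<in> ball 0 \<rho>" for \<xi> using \<Psi>U(2)[OF that] chart_facts(6)[OF C(1)] by (simp add: cm_def)
    show "continuous_on (ball 0 \<rho>) cm"
      unfolding cm_def[abs_def]
      by (rule continuous_on_compose2[OF chart_facts(7)[OF C(1)] Ck_on_imp_continuous_on[OF smooth_\<Psi>[of 0]]]) (use \<Psi>U in auto)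
    show "ball t0 \<rho> \<subseteq> {0<..<T}" using tT by auto
    show "flow_patch ?S t0 (pull (Y C)) (pull (local_rep C \<nu>)) (pull (local_rep C Fs)) (in_frame E (second_fundamental_form X \<nu> C t0 z0))"
      by (fact patch)
    show "D (\<xi>dir i) (pull (Y C)) (0, t0) = (\<Sum>m\<in>UNIV. E $ m $ i *\<^sub>R sd (axis m 1) (Y C) (z0, t0))" for i
      using D1[OF S(2)] by simp
    show "first_form (pull (Y C)) (\<xi>, t) = in_frame (J \<xi>) (metric X C t (snd C (cm \<xi>)))" if "\<xi> \<in> ball 0 \<rho>" "t \<in> ball t0 \<rho>" for \<xi> t
      using first that by (simp add: snd_cm)
    show "second_form (pull (Y C)) (pull (local_rep C \<nu>)) (\<xi>, t) = in_frame (J \<xi>) (second_fundamental_form X \<nu> C t (snd C (cm \<xi>)))"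
      if "\<xi> \<in> ball 0 \<rho>" "t \<in> ball t0 \<rho>" for \<xi> t using second that by (simp add: snd_cm)
  qed (use \<phi> in blast)
qed

end

section \<open>The two-point maximum principle\<close>

lemma flow_patch_subset:
  assumes "flow_patch S t0 p N F H" "open S'" "(0, t0) \<in> S'" "S' \<subseteq> S"
  shows "flow_patch S' t0 p N F H"
proof -
  interpret flow_patch S t0 p N F H by (rule assms(1))
  show ?thesis
  proof
    show "CARD('b) = CARD('a) + 1" by (rule card_m)
    show "Ck_on k p S'" "Ck_on k N S'" for k
      by (rule Ck_on_subset[OF smooth_p assms(4)], rule Ck_on_subset[OF smooth_N assms(4)])
  qed (use assms unit normal flow orthonormal hess_p in blast)+
qed

context flow_patch
begin

text \<open>For fixed first point the two-point function vanishes when the second point coincides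
  with it and is nonnegative along the coordinate line. Half its second derivative there is
  \<open>k\<close> times the metric component minus the second fundamental form.\<close>

lemma touching_second_derivative:
  assumes x: "x \<in> S" and \<delta>: "\<delta> > 0"
    and pos: "\<And>s. \<bar>s\<bar> < \<delta> \<Longrightarrow>
      0 \<le> k * ((p x - p (x + s *\<^sub>R \<xi>dir j)) \<bullet> (p x - p (x + s *\<^sub>R \<xi>dir j))) - 2 * ((p x - p (x + s *\<^sub>R \<xi>dir j)) \<bullet> N x)"
  shows "0 \<le> k * (D (\<xi>dir j) p x \<bullet> D (\<xi>dir j) p x) + D (\<xi>dir j) (D (\<xi>dir j) p) x \<bullet> N x"
proof -
  define v where "v y = p x - p y" for y
  have sv: "Ck_on m v S" for m unfolding v_def[abs_def] by (intro Ck_on_diff Ck_on_const smooth_p)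
  have Dv: "D w v y = - D w p y" if "y \<in> S" for w y
    unfolding v_def[abs_def] using that by (simp add: D_diff diffI smooth_p)
  have DDv: "D w (D w v) x = - D w (D w p) x" for w
  proof -
    have "D w (D w v) x = D w (\<lambda>y. - D w p y) x" by (rule D_cong[OF S(1) x Dv])
    also have "\<dots> = - D w (D w p) x" using x by (simp add: D_uminus diffI smooth_D smooth_p)
    finally show ?thesis .
  qed
  define f where "f y = k * (v y \<bullet> v y) - 2 * (v y \<bullet> N x)" for y
  have f2: "Ck_on 2 f S" unfolding f_def[abs_def] by (intro Ck_on_diff Ck_on_mult Ck_on_inner Ck_on_const sv)
  have "f x = 0" by (simp add: f_def v_def)
  moreover have "- 0 * \<bar>s\<bar>^3 \<le> f (x + s *\<^sub>R \<xi>dir j)" if "\<bar>s\<bar> < \<delta>" for s using pos[OF that] by (simp add: f_def v_def)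
  ultimately have "0 \<le> D (\<xi>dir j) (D (\<xi>dir j) f) x"
    by (rule second_derivative_test(2)[OF S(1) x f2 _ \<delta>])
  also have "\<dots> = D (\<xi>dir j) (D (\<xi>dir j) (\<lambda>y. k * (v y \<bullet> v y))) x - D (\<xi>dir j) (D (\<xi>dir j) (\<lambda>y. 2 * (v y \<bullet> N x))) x"
    unfolding f_def[abs_def] by (intro D2_diff[OF S(1) x] Ck_on_mult Ck_on_inner Ck_on_const sv)
  also have "\<dots> = 2 * (k * (D (\<xi>dir j) p x \<bullet> D (\<xi>dir j) p x) + D (\<xi>dir j) (D (\<xi>dir j) p) x \<bullet> N x)"
  proof -
    have "v x = 0" by (simp add: v_def)
    then have "D (\<xi>dir j) (D (\<xi>dir j) (\<lambda>y. v y \<bullet> v y)) x = 2 * (D (\<xi>dir j) p x \<bullet> D (\<xi>dir j) p x)"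
      using D2_inner[OF S(1) x sv sv] by (simp add: Dv[OF x])
    moreover have "D (\<xi>dir j) (D (\<xi>dir j) (\<lambda>y. v y \<bullet> N x)) x = - (D (\<xi>dir j) (D (\<xi>dir j) p) x \<bullet> N x)"
      using D2_inner[OF S(1) x sv Ck_on_const] by (simp add: DDv)
    ultimately show ?thesis
      by (subst (1 2) D2_cmult[OF S(1) x]) (auto intro!: Ck_on_inner sv Ck_on_const simp: algebra_simps simp del: Ck_on.simps)
  qed
  finally show ?thesis by simp
qed

end

lemma reflection_inner:
  fixes v :: "'a::real_inner"
  assumes "v \<noteq> 0"
  shows "(x - (2 * (x \<bullet> v) / (v \<bullet> v)) *\<^sub>R v) \<bullet> (y - (2 * (y \<bullet> v) / (v \<bullet> v)) *\<^sub>R v) = x \<bullet> y"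
    and "(x - (2 * (x \<bullet> v) / (v \<bullet> v)) *\<^sub>R v) \<bullet> v = - (x \<bullet> v)"
proof -
  have "v \<bullet> v \<noteq> 0" using assms by simp
  then show "(x - (2 * (x \<bullet> v) / (v \<bullet> v)) *\<^sub>R v) \<bullet> v = - (x \<bullet> v)" "(x - (2 * (x \<bullet> v) / (v \<bullet> v)) *\<^sub>R v) \<bullet> (y - (2 * (y \<bullet> v) / (v \<bullet> v)) *\<^sub>R v) = x \<bullet> y"
    by (simp_all add: inner_diff_left inner_diff_right field_simps inner_commute)
qed

section \<open>The fundamental forms as quadratic forms, and coordinates of tangent vectors\<close>

context unit_normal_family
begin

lemma metric_quadratic:
  assumes C: "C \<in> \<A>" "z \<in> U C" "t \<in> I"
  shows "sd v (Y C) (z, t) \<bullet> sd w (Y C) (z, t) = v \<bullet> (metric X C t z *v w)"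
proof -
  have inn: "x \<bullet> y = (\<Sum>i\<in>UNIV. x $ i * y $ i)" for x y :: "real^'n" by (simp add: inner_vec_def)
  show ?thesis
    apply (subst (1 2) sd_linear[OF C smooth_Y[OF C(1)]])
    apply (subst inner_sum_left)
    apply (subst inner_sum_right)
    apply (simp add: inn matrix_vector_mult_def metric_entry sum_distrib_left ac_simps)
    done
qed

lemma second_fundamental_form_quadratic:
  assumes C: "C \<in> \<A>" "z \<in> U C" "t \<in> I"
  shows "- (sd v (sd w (Y C)) (z, t) \<bullet> \<nu> (chart_inv C z) t) = v \<bullet> (second_fundamental_form X \<nu> C t z *v w)"
proof -
  have inn: "x \<bullet> y = (\<Sum>i\<in>UNIV. x $ i * y $ i)" for x y :: "real^'n" by (simp add: inner_vec_def)
  show ?thesis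
    by (subst sd2_bilinear[OF C])
       (simp add: inner_sum_left inn matrix_vector_mult_def second_fundamental_form_entry sum_distrib_left sum_negf ac_simps)
qed

lemma metric_invertible:
  assumes C: "C \<in> \<A>" "z \<in> U C" "t \<in> I"
  shows "invertible (metric X C t z)"
  unfolding invertible_left_inverse matrix_left_invertible_ker
proof (intro allI impI)
  fix v assume "metric X C t z *v v = 0"
  then have "sd v (Y C) (z, t) \<bullet> sd v (Y C) (z, t) = 0" by (simp add: metric_quadratic[OF C])
  then show "v = 0" using sd_Y_inj[OF C] by simp
qed

text \<open>The coordinates solve the linear system whose matrix is the metric. The remaining
  difference is orthogonal to all coordinate vectors and to the normal, hence zero.\<close>

lemma tangent_coordinates:
  assumes C: "C \<in> \<A>" "z \<in> U C" "t \<in> I" and w: "w \<bullet> \<nu> (chart_inv C z) t = 0"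
  shows "\<exists>u. w = sd u (Y C) (z, t)"
proof -
  obtain B where B: "metric X C t z ** B = mat 1" using metric_invertible[OF C] by (auto simp: invertible_def)
  define u where "u = B *v (\<chi> m. w \<bullet> sd (axis m 1) (Y C) (z, t))"
  have "w - sd u (Y C) (z, t) = 0"
  proof (rule orthogonal_zero[OF C])
    fix i
    have "sd (axis i 1) (Y C) (z, t) \<bullet> sd u (Y C) (z, t) = axis i 1 \<bullet> ((metric X C t z ** B) *v (\<chi> m. w \<bullet> sd (axis m 1) (Y C) (z, t)))"
      unfolding metric_quadratic[OF C] u_def by (simp add: matrix_vector_mul_assoc)
    also have "\<dots> = w \<bullet> sd (axis i 1) (Y C) (z, t)" unfolding B by (simp add: inner_axis inner_commute[of "axis i 1"])
    finally show "(w - sd u (Y C) (z, t)) \<bullet> sd (axis i 1) (Y C) (z, t) = 0" by (simp add: inner_diff_left inner_commute)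
  next
    show "(w - sd u (Y C) (z, t)) \<bullet> \<nu> (chart_inv C z) t = 0" using w \<nu>_orth[OF C] by (simp add: inner_diff_left)
  qed
  then show ?thesis by auto
qed

end

context normal_flow
begin

text \<open>A normal curvature is an average of the principal curvatures with weights given by the
  squared components in an eigenframe. If it bounds all of them from above, some weight is positive
  and forces equality.\<close>

lemma normal_curvature_diagonal:
  assumes C: "C \<in> \<A>" "x \<in> fst C" "t \<in> I" and E: "orthonormal_frame (metric X C t (snd C x)) E"
    and diag: "in_frame E (second_fundamental_form X \<nu> C t (snd C x)) = diagm a"
    and d: "norm d = 1" and le: "\<And>i. a $ i \<le> normal_curvature C x t d"
  shows "\<exists>j. a $ j = normal_curvature C x t d"
proof (rule ccontr)
  let ?k = "normal_curvature C x t d" and ?g = "metric X C t (snd C x)" and ?h = "second_fundamental_form X \<nu> C t (snd C x)"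
  assume "\<not> ?thesis"
  then have lt: "a $ i < ?k" for i using le[of i] by (auto simp: less_le)
  note z = C(1) chart_facts(4)[OF C(1,2)] C(3)
  have x: "chart_inv C (snd C x) = x" by (rule chart_facts(3)[OF C(1,2)])
  have gE: "transpose E ** ?g ** E = mat 1" using E by (simp add: orthonormal_frame_def)
  then have "(transpose E ** ?g) ** E = mat 1" .
  then have "E ** (transpose E ** ?g) = mat 1" using matrix_left_right_inverse by blast
  then have dE: "d = E *v ((transpose E ** ?g) *v d)" by (simp add: matrix_vector_mul_assoc)
  define w where "w = (transpose E ** ?g) *v d"
  have conj: "(E *v w) \<bullet> (B *v (E *v w)) = w \<bullet> (in_frame E B *v w)" for B
  proof -
    have "w \<bullet> (in_frame E B *v w) = w \<bullet> (transpose E *v (B *v (E *v w)))"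
      by (simp add: in_frame_def matrix_vector_mul_assoc matrix_mul_assoc)
    also have "\<dots> = (E *v w) \<bullet> (B *v (E *v w))" using dot_lmul_matrix[of w "transpose E"] by simp
    finally show ?thesis by simp
  qed
  have n: "(norm (sd d (Y C) (snd C x, t)))\<^sup>2 = w \<bullet> w"
    unfolding power2_norm_eq_inner metric_quadratic[OF z] using conj[of ?g] gE
    by (simp add: dE[folded w_def, symmetric] in_frame_def)
  have ww: "w \<bullet> w \<noteq> 0"
  proof
    assume "w \<bullet> w = 0"
    then have "d = 0" using dE by (simp add: w_def[symmetric])
    then show False using d by simp
  qed
  have "- (sd d (sd d (Y C)) (snd C x, t) \<bullet> \<nu> x t) = w \<bullet> (diagm a *v w)"
    using second_fundamental_form_quadratic[OF z, of d d] conj[of ?h] unfolding diag x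
    by (simp add: dE[folded w_def, symmetric])
  then have "?k * (w \<bullet> w) = w \<bullet> (diagm a *v w)" unfolding normal_curvature_def n using ww by simp
  also have "\<dots> = (\<Sum>i\<in>UNIV. a $ i * (w $ i)\<^sup>2)"
    by (simp add: inner_vec_def matrix_vector_mult_def diagm_entry if_distrib if_distribR power2_eq_square ac_simps cong: if_cong)
  finally have "(\<Sum>i\<in>UNIV. (?k - a $ i) * (w $ i)\<^sup>2) = 0"
    by (simp add: inner_vec_def left_diff_distrib sum_subtractf sum_distrib_left power2_eq_square)
  moreover have "0 \<le> (?k - a $ i) * (w $ i)\<^sup>2" for i using lt[of i] by simp
  ultimately have "(?k - a $ i) * (w $ i)\<^sup>2 = 0" for i by (simp add: sum_nonneg_eq_0_iff)
  then have "w $ i = 0" for i using lt[of i] by (metis less_irrefl mult_eq_0_iff power_eq_0_iff right_minus_eq)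
  then have "w = 0" by (simp add: vec_eq_iff)
  then show False using ww by simp
qed

end

section \<open>The differential inequality at a contact point\<close>

context curvature_flow
begin

text \<open>\<open>F_le\<close> must hold at every point, time and frame with the fixed weights
  \<open>c\<close>: the diagonal case uses it around \<open>x0\<close>, the other at the second
  point of contact. The global orientation enters through \<open>tangent\<close>, which says that
  the two normals at a contact are related by reflection.\<close>

theorem viscosity_inequality:
  assumes t0: "0 < t0" "t0 < T" and C: "C \<in> \<A>" "x0 \<in> fst C"
    and E: "orthonormal_frame (metric X C t0 (snd C x0)) E"
    and diag: "in_frame E (second_fundamental_form X \<nu> C t0 (snd C x0)) = diagm a"
    and c: "\<And>i. 0 \<le> c $ i" and F_pt: "Fs x0 t0 = (\<Sum>i\<in>UNIV. c $ i * a $ i)"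
    and F_le: "\<And>x t C' E'. t \<in> I \<Longrightarrow> C' \<in> \<A> \<Longrightarrow> x \<in> fst C' \<Longrightarrow> orthonormal_frame (metric X C' t (snd C' x)) E' \<Longrightarrow>
      Fs x t \<le> (\<Sum>i\<in>UNIV. c $ i * in_frame E' (second_fundamental_form X \<nu> C' t (snd C' x)) $ i $ i)"
    and tangent: "\<And>y. y \<noteq> x0 \<Longrightarrow> (\<And>y'. y' \<noteq> x0 \<Longrightarrow> Z X \<nu> x0 y' t0 \<le> Z X \<nu> x0 y t0) \<Longrightarrow>
      \<nu> y t0 = \<nu> x0 t0 - Z X \<nu> x0 y t0 *\<^sub>R (X x0 t0 - X y t0)"
    and \<phi>: "Ck_family 2 \<A> T \<phi>" and touch: "touches_from_above T \<phi> Zbar x0 t0"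
  shows "deriv (\<lambda>t. \<phi> x0 t) t0 \<le>
    (\<Sum>k\<in>UNIV. c $ k * (in_frame E (hessian X C t0 (\<lambda>y. \<phi> y t0) (snd C x0)) $ k $ k + (a $ k)\<^sup>2 * \<phi> x0 t0))"
proof -
  have t0I: "t0 \<in> I" using t0 by simp
  obtain W \<delta> where W: "open W" "x0 \<in> W" "\<delta> > 0" and \<phi>0: "\<phi> x0 t0 = Zbar x0 t0"
    and above: "\<And>x t. x \<in> W \<Longrightarrow> t \<in> I \<Longrightarrow> t0 - \<delta> < t \<Longrightarrow> t \<le> t0 \<Longrightarrow> Zbar x t \<le> \<phi> x t"
    using touch unfolding touches_from_above_def by blast
  obtain \<rho> cm M where \<rho>: "\<rho> > 0" and cm: "cm 0 = x0" "\<And>\<xi>. \<xi> \<in> ball 0 \<rho> \<Longrightarrow> cm \<xi> \<in> fst C" "continuous_on (ball 0 \<rho>) cm"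
    and \<rho>T: "ball t0 \<rho> \<subseteq> {0<..<T}"
    and patch: "flow_patch (ball 0 \<rho> \<times> ball t0 \<rho>) t0 (\<lambda>(\<xi>, t). X (cm \<xi>) t) (\<lambda>(\<xi>, t). \<nu> (cm \<xi>) t) (\<lambda>(\<xi>, t). Fs (cm \<xi>) t)
       (in_frame E (second_fundamental_form X \<nu> C t0 (snd C x0)))"
    and first: "\<And>\<xi> t. \<xi> \<in> ball 0 \<rho> \<Longrightarrow> t \<in> ball t0 \<rho> \<Longrightarrow> first_form (\<lambda>(\<xi>, t). X (cm \<xi>) t) (\<xi>, t) = in_frame (M \<xi>) (metric X C t (snd C (cm \<xi>)))"
    and second: "\<And>\<xi> t. \<xi> \<in> ball 0 \<rho> \<Longrightarrow> t \<in> ball t0 \<rho> \<Longrightarrow> second_form (\<lambda>(\<xi>, t). X (cm \<xi>) t) (\<lambda>(\<xi>, t). \<nu> (cm \<xi>) t) (\<xi>, t) =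
       in_frame (M \<xi>) (second_fundamental_form X \<nu> C t (snd C (cm \<xi>)))"
    and \<phi>s: "Ck_on 2 (\<lambda>(\<xi>, t). \<phi> (cm \<xi>) t) (ball 0 \<rho> \<times> ball t0 \<rho>)"
       "D tdir (\<lambda>(\<xi>, t). \<phi> (cm \<xi>) t) (0, t0) = deriv (\<lambda>t. \<phi> x0 t) t0"
       "\<And>i. D (\<xi>dir i) (D (\<xi>dir i) (\<lambda>(\<xi>, t). \<phi> (cm \<xi>) t)) (0, t0) = in_frame E (hessian X C t0 (\<lambda>y. \<phi> y t0) (snd C x0)) $ i $ i"
  proof (rule normal_patch[OF t0 C E], goal_cases)
    case (1 \<rho> cm M)
    show ?case by (rule 1(1)[of \<rho> cm M]) (use 1(2-) \<phi> in blast)+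
  qed
  obtain \<rho>1 where \<rho>1: "\<rho>1 > 0" "\<rho>1 \<le> \<rho>" "\<And>\<xi>. \<xi> \<in> ball 0 \<rho>1 \<Longrightarrow> cm \<xi> \<in> W"
  proof -
    have "open (ball 0 \<rho> \<inter> cm -` W)" by (rule continuous_open_preimage[OF cm(3) open_ball W(1)])
    moreover have "0 \<in> ball 0 \<rho> \<inter> cm -` W" using \<rho> cm(1) W(2) by simp
    ultimately obtain e where "e > 0" "ball 0 e \<subseteq> ball 0 \<rho> \<inter> cm -` W" using open_contains_ball by blast
    then show ?thesis by (intro that[of "min e \<rho>"]) (use \<rho> in auto)
  qed
  \<comment> \<open>The bound of \<open>Z\<close> by \<phi> is multiplied by the squared distance,
    which makes it valid, as 0, also for coinciding points.\<close>
  have key: "0 \<le> \<phi> (cm \<xi>) t * ((X (cm \<xi>) t - X y t) \<bullet> (X (cm \<xi>) t - X y t)) - 2 * ((X (cm \<xi>) t - X y t) \<bullet> \<nu> (cm \<xi>) t)"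
    if "\<xi> \<in> ball 0 \<rho>1" "t \<in> ball t0 (min \<rho>1 \<delta>)" "t \<le> t0" for \<xi> t y
  proof (cases "y = cm \<xi>")
    case False
    have "t \<in> ball t0 \<rho>" using that(2) \<rho>1(2) by simp
    then have t: "t \<in> I" "t0 - \<delta> < t" using that(2) \<rho>T by (force, auto simp: dist_real_def)
    have "Z X \<nu> (cm \<xi>) y t \<le> \<phi> (cm \<xi>) t"
      using Z_le_Zbar[OF t(1) False] above[OF \<rho>1(3)[OF that(1)] t that(3)] by linarith
    moreover have "0 < (X (cm \<xi>) t - X y t) \<bullet> (X (cm \<xi>) t - X y t)" using False X_inj[OF t(1)] by force
    ultimately show ?thesis unfolding Z_def power2_norm_eq_inner by (simp add: divide_le_eq)
  qed simp
  define p where "p = (\<lambda>(\<xi>, t). X (cm \<xi>) t)"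
  define N where "N = (\<lambda>(\<xi>, t). \<nu> (cm \<xi>) t)"
  define F where "F = (\<lambda>(\<xi>, t). Fs (cm \<xi>) t)"
  define f where "f = (\<lambda>(\<xi>, t). \<phi> (cm \<xi>) t)"
  have pt: "p (0, t0) = X x0 t0" "N (0, t0) = \<nu> x0 t0" "F (0, t0) = Fs x0 t0" "f (0, t0) = \<phi> x0 t0"
    by (simp_all add: p_def N_def F_def f_def cm(1))
  note patch = patch[folded p_def N_def F_def] and first = first[folded p_def]
    and second = second[folded p_def N_def] and \<phi>s = \<phi>s[folded f_def]
  \<comment> \<open>Kept for every smaller radius, because the patch around a distant contact point
    has to share its domain with the one around \<open>x0\<close>.\<close>
  have eigen: "eigen_flow_patch (ball 0 r \<times> ball t0 r) t0 p N F (diagm a) a c" if r: "0 < r" "r \<le> \<rho>" for r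
  proof -
    interpret flow_patch "ball 0 r \<times> ball t0 r" t0 p N F "diagm a"
      by (rule flow_patch_subset[OF patch[unfolded diag]]) (use r in \<open>auto simp: open_Times\<close>)
    show ?thesis
    proof
      show "F (0, t0) = (\<Sum>i\<in>UNIV. c $ i * a $ i)" using F_pt by (simp add: pt)
      fix x and E' :: "real^'n^'n" assume x: "x \<in> ball 0 r \<times> ball t0 r" and E': "transpose E' ** first_form p x ** E' = mat 1"
      obtain \<xi> t where xt: "x = (\<xi>, t)" by (cases x)
      have m: "\<xi> \<in> ball 0 \<rho>" "t \<in> ball t0 \<rho>" using x r(2) by (auto simp: xt)
      have comp: "transpose E' ** in_frame (M \<xi>) B ** E' = in_frame (M \<xi> ** E') B" for B :: "real^'n^'n"
        by (simp add: in_frame_def matrix_transpose_mul matrix_mul_assoc)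
      have "Fs (cm \<xi>) t \<le> (\<Sum>i\<in>UNIV. c $ i * in_frame (M \<xi> ** E') (second_fundamental_form X \<nu> C t (snd C (cm \<xi>))) $ i $ i)"
      proof (rule F_le[OF _ C(1) cm(2)[OF m(1)]])
        show "t \<in> I" using \<rho>T m(2) by force
        show "orthonormal_frame (metric X C t (snd C (cm \<xi>))) (M \<xi> ** E')"
          using E' comp[of "metric X C t (snd C (cm \<xi>))"] unfolding xt first[OF m] by (simp add: orthonormal_frame_def in_frame_def)
      qed
      then show "F x \<le> (\<Sum>i\<in>UNIV. c $ i * (transpose E' ** second_form p N x ** E') $ i $ i)"
        unfolding xt second[OF m] comp by (simp add: F_def)
    qed (auto simp: c)
  qed
  define r where "r = min \<rho>1 \<delta>"
  have r: "0 < r" "r \<le> \<rho>1" "r \<le> \<delta>" "r \<le> \<rho>" using \<rho>1 W(3) by (auto simp: r_def)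
  interpret A: eigen_flow_patch "ball 0 r \<times> ball t0 r" t0 p N F "diagm a" a c by (rule eigen[OF r(1,4)])
  \<comment> \<open>\<open>key\<close> is applied with the second point on a coordinate line through
    the first. The result is the hypothesis of the diagonal case and, at the centre, bounds every
    principal curvature by \<phi>.\<close>
  have nonneg: "0 \<le> f (\<xi>, t) * (D (\<xi>dir j) p (\<xi>, t) \<bullet> D (\<xi>dir j) p (\<xi>, t)) + D (\<xi>dir j) (D (\<xi>dir j) p) (\<xi>, t) \<bullet> N (\<xi>, t)"
    if m: "(\<xi>, t) \<in> ball 0 r \<times> ball t0 r" "t \<le> t0" for \<xi> t j
  proof (rule A.touching_second_derivative[OF m(1) zero_less_one])
    fix s :: real
    have "0 \<le> \<phi> (cm \<xi>) t * ((X (cm \<xi>) t - X y t) \<bullet> (X (cm \<xi>) t - X y t)) - 2 * ((X (cm \<xi>) t - X y t) \<bullet> \<nu> (cm \<xi>) t)" for y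
      by (rule key) (use m r in auto)
    then show "0 \<le> f (\<xi>, t) * ((p (\<xi>, t) - p ((\<xi>, t) + s *\<^sub>R \<xi>dir j)) \<bullet> (p (\<xi>, t) - p ((\<xi>, t) + s *\<^sub>R \<xi>dir j)))
        - 2 * ((p (\<xi>, t) - p ((\<xi>, t) + s *\<^sub>R \<xi>dir j)) \<bullet> N (\<xi>, t))"
      by (simp add: f_def p_def N_def)
  qed
  have a_le: "a $ j \<le> f (0, t0)" for j
    using nonneg[of 0 t0 j] r(1) A.unit[OF A.S(2)] by (simp add: A.orthonormal A.p_ij)
  have fr: "Ck_on 2 f (ball 0 r' \<times> ball t0 r')" if "r' \<le> \<rho>" for r'
    by (rule Ck_on_subset[OF \<phi>s(1)]) (use that in auto)
  have "D tdir f (0, t0) \<le> (\<Sum>k\<in>UNIV. c $ k * (D (\<xi>dir k) (D (\<xi>dir k) f) (0, t0) + (a $ k)\<^sup>2 * f (0, t0)))"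
    using Zbar_attained[OF C t0I]
  proof (elim disjE exE conjE)
    fix d :: "real^'n" assume d: "norm d = 1" "Zbar x0 t0 = normal_curvature C x0 t0 d"
    then obtain j where "a $ j = f (0, t0)"
      using normal_curvature_diagonal[OF C t0I E diag d(1)] a_le unfolding pt \<phi>0 by metis
    then show ?thesis by (rule A.diagonal_inequality[OF fr[OF r(4)]]) (rule nonneg)
  next
    fix y assume y: "y \<noteq> x0" "Zbar x0 t0 = Z X \<nu> x0 y t0"
    define v where "v = X x0 t0 - X y t0"
    have v: "v \<noteq> 0" using y(1) X_inj[OF t0I] by (auto simp: v_def)
    have \<nu>y: "\<nu> y t0 = \<nu> x0 t0 - \<phi> x0 t0 *\<^sub>R v"
      unfolding v_def \<phi>0 y(2) by (rule tangent[OF y(1)]) (rule Z_le_Zbar[OF t0I, of _ x0, unfolded y(2)])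
    have zero: "\<phi> x0 t0 * (v \<bullet> v) = 2 * (v \<bullet> \<nu> x0 t0)"
    proof -
      have "Z X \<nu> x0 y t0 = 2 * (v \<bullet> \<nu> x0 t0) / (v \<bullet> v)" unfolding Z_def power2_norm_eq_inner v_def ..
      then show ?thesis using v unfolding \<phi>0 y(2) by simp
    qed
    obtain C' where C': "C' \<in> \<A>" "y \<in> fst C'" using chart_cover by blast
    note z' = C'(1) chart_facts(4)[OF C'] t0I
    \<comment> \<open>The same reflection carries \<open>\<nu> x0 t0\<close> to
      \<open>\<nu> y t0\<close>, because
      \<open>2 * (v \<bullet> \<nu> x0 t0) / (v \<bullet> v)\<close> equals \<phi> at the contact;
      so the reflected frame is tangent at \<open>y\<close>.\<close>
    define u where "u i = D (\<xi>dir i) p (0, t0) - (2 * (D (\<xi>dir i) p (0, t0) \<bullet> v) / (v \<bullet> v)) *\<^sub>R v" for i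
    have u\<nu>: "u i \<bullet> \<nu> y t0 = 0" for i
    proof -
      have "u i \<bullet> v = - (D (\<xi>dir i) p (0, t0) \<bullet> v)" unfolding u_def by (rule reflection_inner(2)[OF v])
      moreover have "u i \<bullet> \<nu> x0 t0 = - ((2 * (D (\<xi>dir i) p (0, t0) \<bullet> v) / (v \<bullet> v)) * (\<phi> x0 t0 * (v \<bullet> v) / 2))"
        using A.normal'[OF A.S(2), of i] unfolding u_def zero pt by (simp add: inner_diff_left)
      ultimately show ?thesis unfolding \<nu>y using v by (simp add: inner_diff_right)
    qed
    have "\<exists>w. u i = sd w (Y C') (snd C' y, t0)" for i
      by (rule tangent_coordinates[OF z']) (simp add: u\<nu> chart_facts(3)[OF C'])
    then obtain w where w: "\<And>i. u i = sd (w i) (Y C') (snd C' y, t0)" by metis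
    define E' where "E' = (\<chi> m i. w i $ m)"
    have col: "u i = (\<Sum>m\<in>UNIV. E' $ m $ i *\<^sub>R sd (axis m 1) (Y C') (snd C' y, t0))" for i
      unfolding w by (subst sd_linear[OF z' smooth_Y[OF C'(1)]]) (simp add: E'_def)
    have "in_frame E' (metric X C' t0 (snd C' y)) $ i $ j = u i \<bullet> u j" for i j
      unfolding col by (simp add: in_frame_def matrix_matrix_mult_def transpose_def metric_entry inner_sum_left inner_sum_right sum_distrib_right sum_distrib_left ac_simps)
    also have "u i \<bullet> u j = (if i = j then 1 else 0)" for i j
      unfolding u_def by (subst reflection_inner(1)[OF v]) (rule A.orthonormal)
    finally have E': "orthonormal_frame (metric X C' t0 (snd C' y)) E'"
      by (simp add: orthonormal_frame_def in_frame_def vec_eq_iff mat_def)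
    obtain \<rho>' cm' where \<rho>': "\<rho>' > 0" and cm': "cm' 0 = y"
      and patch': "flow_patch (ball 0 \<rho>' \<times> ball t0 \<rho>') t0 (\<lambda>(\<xi>, t). X (cm' \<xi>) t) (\<lambda>(\<xi>, t). \<nu> (cm' \<xi>) t) (\<lambda>(\<xi>, t). Fs (cm' \<xi>) t)
         (in_frame E' (second_fundamental_form X \<nu> C' t0 (snd C' y)))"
      and frame': "\<And>i. D (\<xi>dir i) (\<lambda>(\<xi>, t). X (cm' \<xi>) t) (0, t0) = (\<Sum>m\<in>UNIV. E' $ m $ i *\<^sub>R sd (axis m 1) (Y C') (snd C' y, t0))"
    proof (rule normal_patch[OF t0 C' E'], goal_cases)
      case (1 \<rho> cm M)
      show ?case by (rule 1(1)[of \<rho> cm]) (use 1(2-) in blast)+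
    qed
    define r' where "r' = min r \<rho>'"
    have r': "0 < r'" "r' \<le> r" "r' \<le> \<rho>'" "r' \<le> \<rho>" using r \<rho>' by (auto simp: r'_def)
    interpret B: eigen_flow_patch "ball 0 r' \<times> ball t0 r'" t0 p N F "diagm a" a c by (rule eigen[OF r'(1,4)])
    show ?thesis
    proof (rule B.off_diagonal_inequality)
      show "flow_patch (ball 0 r' \<times> ball t0 r') t0 (\<lambda>(\<xi>, t). X (cm' \<xi>) t) (\<lambda>(\<xi>, t). \<nu> (cm' \<xi>) t) (\<lambda>(\<xi>, t). Fs (cm' \<xi>) t)
         (in_frame E' (second_fundamental_form X \<nu> C' t0 (snd C' y)))"
        by (rule flow_patch_subset[OF patch']) (use r' in \<open>auto simp: open_Times\<close>)
      show "Ck_on 2 f (ball 0 r' \<times> ball t0 r')" by (rule fr[OF r'(4)])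
      show "0 \<le> f (\<xi>, t) * ((p (\<xi>, t) - (case (\<xi>, t) of (\<xi>, t) \<Rightarrow> X (cm' \<xi>) t)) \<bullet> (p (\<xi>, t) - (case (\<xi>, t) of (\<xi>, t) \<Rightarrow> X (cm' \<xi>) t)))
          - 2 * ((p (\<xi>, t) - (case (\<xi>, t) of (\<xi>, t) \<Rightarrow> X (cm' \<xi>) t)) \<bullet> N (\<xi>, t))"
        if "(\<xi>, t) \<in> ball 0 r' \<times> ball t0 r'" "t \<le> t0" for \<xi> t
        using key[of \<xi> t "cm' \<xi>"] that r r' by (simp add: f_def p_def N_def)
      show "p (0, t0) \<noteq> (case (0, t0) of (\<xi>, t) \<Rightarrow> X (cm' \<xi>) t)" using v by (simp add: pt cm' v_def)
      show "f (0, t0) * ((p (0, t0) - (case (0, t0) of (\<xi>, t) \<Rightarrow> X (cm' \<xi>) t)) \<bullet> (p (0, t0) - (case (0, t0) of (\<xi>, t) \<Rightarrow> X (cm' \<xi>) t))) =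
          2 * ((p (0, t0) - (case (0, t0) of (\<xi>, t) \<Rightarrow> X (cm' \<xi>) t)) \<bullet> N (0, t0))"
        using zero by (simp add: pt cm' v_def)
      show "(case (0, t0) of (\<xi>, t) \<Rightarrow> \<nu> (cm' \<xi>) t) = N (0, t0) - f (0, t0) *\<^sub>R (p (0, t0) - (case (0, t0) of (\<xi>, t) \<Rightarrow> X (cm' \<xi>) t))"
        using \<nu>y by (simp add: pt cm' v_def)
      show "D (\<xi>dir i) (\<lambda>(\<xi>, t). X (cm' \<xi>) t) (0, t0) = D (\<xi>dir i) p (0, t0) -
          (2 * (D (\<xi>dir i) p (0, t0) \<bullet> (p (0, t0) - (case (0, t0) of (\<xi>, t) \<Rightarrow> X (cm' \<xi>) t))) /
           ((p (0, t0) - (case (0, t0) of (\<xi>, t) \<Rightarrow> X (cm' \<xi>) t)) \<bullet> (p (0, t0) - (case (0, t0) of (\<xi>, t) \<Rightarrow> X (cm' \<xi>) t)))) *\<^sub>R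
          (p (0, t0) - (case (0, t0) of (\<xi>, t) \<Rightarrow> X (cm' \<xi>) t))" for i
        unfolding frame' col[symmetric] by (simp add: u_def pt cm' v_def)
      show "(case (0, t0) of (\<xi>, t) \<Rightarrow> Fs (cm' \<xi>) t) \<le> (\<Sum>i\<in>UNIV. c $ i * in_frame E' (second_fundamental_form X \<nu> C' t0 (snd C' y)) $ i $ i)"
        using F_le[OF t0I C' E'] by (simp add: cm')
      show "a $ i \<le> f (0, t0)" for i by (rule a_le)
    qed
  qed
  then show ?thesis unfolding \<phi>s pt .
qed

end

section \<open>Touching spheres\<close>

text \<open>Completing the square identifies the set: a half-space for \<open>k = 0\<close> and
  nonzero \<open>N\<close>, an open ball of radius \<open>norm N / \<bar>k\<bar>\<close> for
  positive \<open>k\<close>, the complement of a closed ball for negative \<open>k\<close>. The last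
  is connected since the dimension is at least 2.\<close>

lemma connected_sphere_side:
  fixes p N :: "'a::euclidean_space"
  assumes "2 \<le> DIM('a)"
  shows "connected {w. k * ((p - w) \<bullet> (p - w)) - 2 * ((p - w) \<bullet> N) < 0}" (is "connected ?G")
proof (cases "k = 0")
  case True
  have "?G = {w. N \<bullet> w < N \<bullet> p}" using True by (auto simp: inner_diff_left inner_commute[of N])
  then show ?thesis by (simp add: convex_halfspace_lt convex_connected)
next
  case False
  define q where "q = p - (1 / k) *\<^sub>R N"
  define R where "R = norm N / \<bar>k\<bar>"
  have R: "R \<ge> 0" by (simp add: R_def)
  have e: "k * ((p - w) \<bullet> (p - w)) - 2 * ((p - w) \<bullet> N) = k * ((dist q w)\<^sup>2 - R\<^sup>2)" for w
  proof -
    have "(dist q w)\<^sup>2 = (p - w) \<bullet> (p - w) - 2 / k * ((p - w) \<bullet> N) + (N \<bullet> N) / k\<^sup>2"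
    proof -
      have "q - w = (p - w) - (1 / k) *\<^sub>R N" by (simp add: q_def)
      then show ?thesis unfolding dist_norm power2_norm_eq_inner
        by (simp add: inner_diff_left inner_diff_right inner_commute power2_eq_square add_divide_distrib diff_divide_distrib)
    qed
    moreover have "R\<^sup>2 = (N \<bullet> N) / k\<^sup>2" by (simp add: R_def power_divide power2_norm_eq_inner)
    ultimately show ?thesis using False by (simp add: right_diff_distrib)
  qed
  have lt: "(dist q w)\<^sup>2 < R\<^sup>2 \<longleftrightarrow> dist q w < R" "R\<^sup>2 < (dist q w)\<^sup>2 \<longleftrightarrow> R < dist q w" for w
    using R power_strict_mono[of "dist q w" R 2] power_strict_mono[of R "dist q w" 2]
      power2_less_imp_less[of "dist q w" R] power2_less_imp_less[of R "dist q w"] by auto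
  show ?thesis
  proof (cases "k > 0")
    case True
    have "?G = ball q R"
      unfolding e using True by (auto simp: mult_less_0_iff lt)
    then show ?thesis by (simp add: convex_connected)
  next
    case neg: False
    have "?G = - cball q R"
      unfolding e using False neg by (auto simp: mult_less_0_iff not_le lt)
    then show ?thesis by (simp add: connected_complement_bounded_convex assms)
  qed
qed

context oriented_family
begin

lemma signed_normal_flow:
  assumes e: "e \<in> {1, -1::real}"
  shows "normal_flow \<A> X T (\<lambda>x t. e *\<^sub>R \<nu> x t)"
proof
  fix x t assume "t \<in> I"
  then show "norm (e *\<^sub>R \<nu> x t) = 1 \<and>
    (\<forall>C\<in>\<A>. x \<in> fst C \<longrightarrow> (\<forall>i. pd i ((\<lambda>x. X x t) \<circ> chart_inv C) (snd C x) \<bullet> (e *\<^sub>R \<nu> x t) = 0))"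
    using normal_family[of t x] e by auto
next
  fix C z0 t0 assume "C \<in> \<A>" "z0 \<in> U C" "t0 \<in> I"
  then obtain \<epsilon> where \<epsilon>: "\<epsilon> > 0" "ball z0 \<epsilon> \<subseteq> U C" "\<And>k. Ck_on k (\<lambda>(z, t). \<nu> (chart_inv C z) t) (ball z0 \<epsilon> \<times> (I \<inter> ball t0 \<epsilon>))"
    using normal_locally_smooth by blast
  have "Ck_on k (\<lambda>(z, t). e *\<^sub>R \<nu> (chart_inv C z) t) (ball z0 \<epsilon> \<times> (I \<inter> ball t0 \<epsilon>))" for k
    using Ck_on_scaleR[OF Ck_on_const[of k e] \<epsilon>(3)[of k]] by (simp add: case_prod_unfold del: Ck_on.simps)
  then show "\<exists>\<epsilon>>0. ball z0 \<epsilon> \<subseteq> U C \<and> (\<forall>k. Ck_on k (\<lambda>(z, t). e *\<^sub>R \<nu> (chart_inv C z) t) (ball z0 \<epsilon> \<times> (I \<inter> ball t0 \<epsilon>)))"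
    using \<epsilon> by blast
qed

text \<open>
  The open side of the touching sphere (a ball, a half-space or the exterior of a ball) is connected and
  does not meet the hypersurface, so it lies on one side; hence the normals at both points of contact
  point to the same side of the sphere.
\<close>

lemma touching_sphere_normal:
  assumes t: "t \<in> I" and e: "e \<in> {1, -1}"
    and touch: "\<And>w. 0 \<le> k * ((X x t - X w t) \<bullet> (X x t - X w t)) - 2 * ((X x t - X w t) \<bullet> (e *\<^sub>R \<nu> x t))"
    and contact: "k * ((X x t - X y t) \<bullet> (X x t - X y t)) = 2 * ((X x t - X y t) \<bullet> (e *\<^sub>R \<nu> x t))"
  shows "e *\<^sub>R \<nu> y t = e *\<^sub>R \<nu> x t - k *\<^sub>R (X x t - X y t)"
proof -
  define N where "N = e *\<^sub>R \<nu> x t"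
  define v where "v = X x t - X y t"
  define u where "u = N - k *\<^sub>R v"
  define h where "h w = k * ((X x t - w) \<bullet> (X x t - w)) - 2 * ((X x t - w) \<bullet> N)" for w
  have h0: "0 \<le> h (X w t)" for w using touch[of w] by (simp add: h_def N_def)
  have vN: "k * (v \<bullet> v) = 2 * (v \<bullet> N)" using contact by (simp add: v_def N_def)
  have NN: "N \<bullet> N = 1" using \<nu>_unit[OF t, of x] e by (auto simp: N_def)
  have "u \<bullet> u = N \<bullet> N - 2 * k * (v \<bullet> N) + k * (k * (v \<bullet> v))"
    unfolding u_def by (simp add: inner_diff_left inner_diff_right inner_commute algebra_simps)
  \<comment> \<open>By the contact equation the two terms containing \<open>k\<close>
    cancel.\<close>
  then have uu: "u \<bullet> u = 1" unfolding vN NN by simp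
  obtain C where C: "C \<in> \<A>" "y \<in> fst C" using chart_cover by blast
  note z = C(1) chart_facts(4)[OF C] t
  have y: "chart_inv C (snd C y) = y" by (rule chart_facts(3)[OF C])
  \<comment> \<open>On the hypersurface \<open>h\<close> is nonnegative, and it vanishes at
    \<open>X y t\<close>; so it is critical there in tangent directions, and its gradient at that
    point is twice \<open>u\<close>.\<close>
  have uT: "sd w (Y C) (snd C y, t) \<bullet> u = 0" for w
  proof -
    have Yd: "((\<lambda>z. Y C (z, t)) has_derivative (\<lambda>w. sd w (Y C) (snd C y, t))) (at (snd C y))"
      by (rule sd_has_derivative[OF chart_facts(2)[OF C(1)] smooth_Y[OF C(1)] z(2,3)])
    define g where "g w = X x t - Y C (w, t)" for w
    have gd: "(g has_derivative (\<lambda>w. 0 - sd w (Y C) (snd C y, t))) (at (snd C y))"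
      unfolding g_def[abs_def] by (intro has_derivative_diff has_derivative_const Yd)
    have gy: "g (snd C y) = v" by (simp add: g_def v_def Y_eq[OF C])
    have hd: "((\<lambda>z. h (Y C (z, t))) has_derivative
        (\<lambda>w. k * (g (snd C y) \<bullet> (0 - sd w (Y C) (snd C y, t)) + (0 - sd w (Y C) (snd C y, t)) \<bullet> g (snd C y))
          - 2 * ((0 - sd w (Y C) (snd C y, t)) \<bullet> N))) (at (snd C y))"
      unfolding h_def g_def[symmetric]
      by (intro has_derivative_diff has_derivative_mult_right has_derivative_inner gd has_derivative_inner_left)
    have "(\<lambda>w. k * (g (snd C y) \<bullet> (0 - sd w (Y C) (snd C y, t)) + (0 - sd w (Y C) (snd C y, t)) \<bullet> g (snd C y))
          - 2 * ((0 - sd w (Y C) (snd C y, t)) \<bullet> N)) = (\<lambda>w. 0)"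
    proof (rule differential_zero_maxmin[OF z(2) chart_facts(2)[OF C(1)] hd], rule disjI2, rule ballI)
      fix w
      have "h (Y C (snd C y, t)) = 0" using vN by (simp add: Y_eq[OF C] h_def v_def)
      then show "h (Y C (snd C y, t)) \<le> h (Y C (w, t))" using h0[of "chart_inv C w"] by (simp add: Y_def)
    qed
    then have "k * (v \<bullet> (0 - sd w (Y C) (snd C y, t)) + (0 - sd w (Y C) (snd C y, t)) \<bullet> v) - 2 * ((0 - sd w (Y C) (snd C y, t)) \<bullet> N) = 0"
      unfolding gy by (rule fun_cong)
    then show ?thesis by (simp add: u_def inner_diff_right inner_commute[of v])
  qed
  have multiple: "u = (u \<bullet> \<nu> y t) *\<^sub>R \<nu> y t"
  proof -
    have "u - (u \<bullet> \<nu> y t) *\<^sub>R \<nu> y t = 0"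
    proof (rule orthogonal_zero[OF z])
      show "(u - (u \<bullet> \<nu> y t) *\<^sub>R \<nu> y t) \<bullet> sd (axis i 1) (Y C) (snd C y, t) = 0" for i
        using uT[of "axis i 1"] \<nu>_orth[OF z, of "axis i 1"] by (simp add: y inner_diff_left inner_commute)
      show "(u - (u \<bullet> \<nu> y t) *\<^sub>R \<nu> y t) \<bullet> \<nu> (chart_inv C (snd C y)) t = 0"
        using \<nu>_unit[OF t, of y] by (simp add: y inner_diff_left)
    qed
    then show ?thesis by simp
  qed
  define \<sigma> where "\<sigma> = u \<bullet> \<nu> y t"
  have us: "u = \<sigma> *\<^sub>R \<nu> y t" using multiple by (simp add: \<sigma>_def)
  have "\<sigma> * \<sigma> = 1" using uu \<nu>_unit[OF t, of y] by (simp add: us)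
  then have \<sigma>: "\<sigma> = 1 \<or> \<sigma> = -1" by (metis square_eq_1_iff)
  have "\<sigma> \<noteq> - e"
  proof
    assume op: "\<sigma> = - e"
    let ?G = "{w. k * ((X x t - w) \<bullet> (X x t - w)) - 2 * ((X x t - w) \<bullet> N) < 0}"
    have "2 \<le> DIM(real^'m)" using card_m zero_less_card_finite[where 'a='n] by simp
    then have conn: "connected ?G" by (rule connected_sphere_side)
    have disj: "?G \<inter> range (\<lambda>x. X x t) = {}"
    proof -
      have "\<not> h (X w t) < 0" for w using h0[of w] by simp
      then show ?thesis unfolding h_def by auto
    qed
    \<comment> \<open>Small displacements by \<open>- N\<close> at \<open>X x t\<close> and by
      \<open>- u\<close> at \<open>X y t\<close> both enter the open side of the sphere. Under the
      assumption on \<sigma> one of them goes into the region and the other out of it.\<close>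
    have "\<forall>\<^sub>F s in at_right 0. X x t - s *\<^sub>R N \<in> ?G \<and> X y t - s *\<^sub>R u \<in> ?G"
    proof -
      have small: "\<forall>\<^sub>F s in at_right 0. s * \<bar>k\<bar> < (1::real)"
      proof (rule order_tendstoD(2))
        show "((\<lambda>s. s * \<bar>k\<bar>) \<longlongrightarrow> 0) (at_right 0)" by (auto intro!: tendsto_eq_intros)
      qed simp
      have "\<forall>\<^sub>F s in at_right (0::real). s > 0" by (simp add: eventually_at_right_less)
      with small show ?thesis
      proof eventually_elim
        case (elim s)
        have "k * s \<le> \<bar>k\<bar> * s" using elim(2) by (intro mult_right_mono) auto
        then have ks: "k * s < 2" using elim(1) by (simp add: mult.commute)
        then have "s * (k * s) < s * 2" using elim(2) by (rule mult_strict_left_mono)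
        then have neg: "k * (s * s) - 2 * s < 0" by (simp add: ac_simps)
        have "k * ((v + s *\<^sub>R u) \<bullet> (v + s *\<^sub>R u)) - 2 * ((v + s *\<^sub>R u) \<bullet> N) =
            (k * (v \<bullet> v) - 2 * (v \<bullet> N)) - 2 * s * (u \<bullet> (N - k *\<^sub>R v)) + k * (s * s) * (u \<bullet> u)"
          by (simp add: inner_add_left inner_add_right inner_diff_right inner_commute algebra_simps)
        also have "\<dots> = k * (s * s) - 2 * s" using uu vN by (simp add: u_def[symmetric])
        finally have "k * ((v + s *\<^sub>R u) \<bullet> (v + s *\<^sub>R u)) - 2 * ((v + s *\<^sub>R u) \<bullet> N) < 0" using neg by simp
        then have "X y t - s *\<^sub>R u \<in> ?G" by (simp add: v_def algebra_simps)
        moreover have "X x t - s *\<^sub>R N \<in> ?G" using neg by (simp add: NN)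
        ultimately show ?case by blast
      qed
    qed
    then have same: "\<forall>\<^sub>F s in at_right 0. X x t - s *\<^sub>R N \<in> \<Omega> t \<longleftrightarrow> X y t - s *\<^sub>R u \<in> \<Omega> t"
    proof eventually_elim
      case (elim s)
      show ?case by (rule connected_side[OF t conn disj]) (use elim in simp_all)
    qed
    have "\<forall>\<^sub>F s in at_right (0::real). False"
      using same outward[OF t, of x] outward[OF t, of y]
    proof eventually_elim
      case (elim s)
      have "e = 1 \<or> e = -1" using e by simp
      then show ?case using elim unfolding us op N_def by (elim disjE) simp_all
    qed
    then show False by simp
  qed
  then have "\<sigma> = e" using \<sigma> e by auto
  then show ?thesis using us by (simp add: u_def v_def N_def)
qed

lemma touching_normal_of_max:
  assumes t: "t \<in> I" and e: "e \<in> {1, -1}" and y: "y \<noteq> x"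
    and max: "\<And>w. w \<noteq> x \<Longrightarrow> Z X (\<lambda>x t. e *\<^sub>R \<nu> x t) x w t \<le> Z X (\<lambda>x t. e *\<^sub>R \<nu> x t) x y t"
  shows "e *\<^sub>R \<nu> y t = e *\<^sub>R \<nu> x t - Z X (\<lambda>x t. e *\<^sub>R \<nu> x t) x y t *\<^sub>R (X x t - X y t)"
proof (rule touching_sphere_normal[OF t e])
  let ?Z = "\<lambda>w. Z X (\<lambda>x t. e *\<^sub>R \<nu> x t) x w t"
  have Z: "?Z w * ((X x t - X w t) \<bullet> (X x t - X w t)) = 2 * ((X x t - X w t) \<bullet> (e *\<^sub>R \<nu> x t))" if "w \<noteq> x" for w
  proof -
    have "(X x t - X w t) \<bullet> (X x t - X w t) \<noteq> 0" using that X_inj[OF t] by simp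
    then show ?thesis unfolding Z_def power2_norm_eq_inner by simp
  qed
  show "?Z y * ((X x t - X y t) \<bullet> (X x t - X y t)) = 2 * ((X x t - X y t) \<bullet> (e *\<^sub>R \<nu> x t))" by (rule Z[OF y])
  fix w
  show "0 \<le> ?Z y * ((X x t - X w t) \<bullet> (X x t - X w t)) - 2 * ((X x t - X w t) \<bullet> (e *\<^sub>R \<nu> x t))"
  proof (cases "w = x")
    case False
    have "?Z w * ((X x t - X w t) \<bullet> (X x t - X w t)) \<le> ?Z y * ((X x t - X w t) \<bullet> (X x t - X w t))"
      by (rule mult_right_mono[OF max[OF False]]) simp
    then show ?thesis unfolding Z[OF False] by simp
  qed simp
qed

end

section \<open>Passage from an eigenframe to an arbitrary orthonormal frame\<close>

lemma in_frame_comp: "in_frame (E ** V) B = transpose V ** in_frame E B ** V"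
  by (simp add: in_frame_def matrix_transpose_mul matrix_mul_assoc)

lemma eigenvalues_in_frame:
  fixes g B :: "real^'n^'n"
  assumes "eigenvalues_wrt g B k" "orthonormal_frame g E"
  shows "eigenvalues_wrt (mat 1) (in_frame E B) k"
  unfolding eigenvalues_wrt_def
proof
  fix r
  have g: "in_frame E g = mat 1" using assms(2) by (simp add: orthonormal_frame_def in_frame_def)
  have "in_frame E (B - r *\<^sub>R g) = in_frame E B - r *\<^sub>R in_frame E g"
    by (simp add: in_frame_def matrix_mult_diff_left matrix_mult_diff_right matrix_mult_scaleR_left matrix_mult_scaleR_right)
  then have "det (in_frame E B - r *\<^sub>R mat 1) = det (in_frame E (B - r *\<^sub>R g))" using g by simp
  also have "\<dots> = det (in_frame E g) * (\<Prod>i\<in>UNIV. k $ i - r)"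
    using assms(1) by (simp add: in_frame_def det_mul eigenvalues_wrt_def)
  finally show "det (in_frame E B - r *\<^sub>R mat 1) = det (mat 1 :: real^'n^'n) * (\<Prod>i\<in>UNIV. k $ i - r)" unfolding g .
qed

context curvature_flow
begin

lemma in_frame_second_form_sym:
  assumes "C \<in> \<A>" "x \<in> fst C" "t \<in> I"
  shows "transpose (in_frame E (second_fundamental_form X \<nu> C t (snd C x))) = in_frame E (second_fundamental_form X \<nu> C t (snd C x))"
proof -
  have "transpose (second_fundamental_form X \<nu> C t (snd C x)) = second_fundamental_form X \<nu> C t (snd C x)"
    (is "transpose ?h = ?h")
  proof -
    have "?h $ j $ i = ?h $ i $ j" for i j
      unfolding second_fundamental_form_entry
      by (subst sd_commute[OF assms(1) chart_facts(4)[OF assms(1,2)] assms(3)]) (rule refl)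
    then show ?thesis by (simp add: vec_eq_iff[of "transpose _"] vec_eq_iff[of "transpose _ $ _"] transpose_def)
  qed
  then show ?thesis by (simp add: in_frame_def matrix_transpose_mul matrix_mul_assoc)
qed

text \<open>The frame \<open>E\<close> is rotated into an eigenframe, where
  \<open>viscosity_inequality\<close> applies with \<open>c = grad f a\<close>; the weighted sums
  are then contractions with \<open>P\<close> and can be read in \<open>E\<close>. \<open>P\<close>
  is abstract because for a reflected speed it is the derivative of the original function at the
  original second fundamental form.\<close>

theorem concave_viscosity_inequality:
  fixes P :: "real^'n^'n"
  assumes cs: "concave_symmetric \<Gamma> f" and grad_nonneg: "\<And>k i. k \<in> \<Gamma> \<Longrightarrow> 0 \<le> grad f k $ i"
    and \<kappa>: "\<And>x t. t \<in> I \<Longrightarrow> principal_curvatures \<A> X \<nu> x t (\<kappa> x t)" "\<And>x t. t \<in> I \<Longrightarrow> \<kappa> x t \<in> \<Gamma>"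
    and Fs: "\<And>x t. Fs x t = f (\<kappa> x t)"
    and t0: "0 < t0" "t0 < T" and C: "C \<in> \<A>" "x0 \<in> fst C"
    and E: "orthonormal_frame (metric X C t0 (snd C x0)) E"
    and tangent: "\<And>y. y \<noteq> x0 \<Longrightarrow> (\<And>y'. y' \<noteq> x0 \<Longrightarrow> Z X \<nu> x0 y' t0 \<le> Z X \<nu> x0 y t0) \<Longrightarrow>
      \<nu> y t0 = \<nu> x0 t0 - Z X \<nu> x0 y t0 *\<^sub>R (X x0 t0 - X y t0)"
    and \<phi>: "Ck_family 2 \<A> T \<phi>" and touch: "touches_from_above T \<phi> Zbar x0 t0"
    and A: "A = in_frame E (second_fundamental_form X \<nu> C t0 (snd C x0))"
    and P: "\<And>V a. a \<in> \<Gamma> \<Longrightarrow> orthogonal_matrix V \<Longrightarrow> A = V ** diagm a ** transpose V \<Longrightarrow> P = V ** diagm (grad f a) ** transpose V"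
  shows "deriv (\<lambda>t. \<phi> x0 t) t0 \<le>
    (\<Sum>k\<in>UNIV. \<Sum>l\<in>UNIV. P $ k $ l * in_frame E (hessian X C t0 (\<lambda>y. \<phi> y t0) (snd C x0)) $ k $ l) +
    (\<Sum>k\<in>UNIV. \<Sum>l\<in>UNIV. P $ k $ l * (\<Sum>p\<in>UNIV. A $ k $ p * A $ p $ l)) * \<phi> x0 t0"
proof -
  interpret concave_symmetric \<Gamma> f by (rule cs)
  have t0I: "t0 \<in> I" using t0 by simp
  let ?H = "in_frame E (hessian X C t0 (\<lambda>y. \<phi> y t0) (snd C x0))"
  have eig: "eigenvalues_wrt (mat 1) (in_frame E' (second_fundamental_form X \<nu> C' t (snd C' x))) (\<kappa> x t)"
    if "t \<in> I" "C' \<in> \<A>" "x \<in> fst C'" "orthonormal_frame (metric X C' t (snd C' x)) E'" for t x C' E'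
    by (rule eigenvalues_in_frame[OF _ that(4)]) (use \<kappa>(1)[OF that(1)] that(2,3) in \<open>simp add: principal_curvatures_def\<close>)
  have "transpose A = A" unfolding A by (rule in_frame_second_form_sym[OF C t0I])
  then obtain V a where V: "orthogonal_matrix V" "A = V ** diagm a ** transpose V" by (rule symmetric_diagonalization)
  have "eigenvalues_wrt (mat 1) A a" unfolding V(2) by (rule eigenvalues_wrt_conj_diagm[OF V(1)])
  then obtain p where p: "bij p" "a = (\<chi> i. \<kappa> x0 t0 $ p i)"
    using eigenvalues_wrt_unique[OF eig[OF t0I C E, folded A]] by (metis det_I zero_neq_one)
  have a: "a \<in> \<Gamma>" "f a = f (\<kappa> x0 t0)"
    unfolding p(2) using perm_\<Gamma>[OF \<kappa>(2)[OF t0I] p(1)] perm_f[OF \<kappa>(2)[OF t0I] p(1)] by auto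
  define c where "c = grad f a"
  have P': "P = V ** diagm c ** transpose V" unfolding c_def by (rule P[OF a(1) V])
  have frame: "orthonormal_frame (metric X C t0 (snd C x0)) (E ** V)"
    using E V(1) in_frame_comp[of E V "metric X C t0 (snd C x0)"]
    by (simp add: orthonormal_frame_def in_frame_def[symmetric] orthogonal_matrix_def)
  have "deriv (\<lambda>t. \<phi> x0 t) t0 \<le>
    (\<Sum>k\<in>UNIV. c $ k * (in_frame (E ** V) (hessian X C t0 (\<lambda>y. \<phi> y t0) (snd C x0)) $ k $ k + (a $ k)\<^sup>2 * \<phi> x0 t0))"
  proof (rule viscosity_inequality[OF t0 C frame _ _ _ _ tangent \<phi> touch])
    show "in_frame (E ** V) (second_fundamental_form X \<nu> C t0 (snd C x0)) = diagm a"
      unfolding in_frame_comp A[symmetric] V(2) by (rule orthogonal_conj_conj[OF V(1)])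
    show "0 \<le> c $ i" for i using grad_nonneg[OF a(1)] by (simp add: c_def)
    show "Fs x0 t0 = (\<Sum>i\<in>UNIV. c $ i * a $ i)" using euler[OF a(1)] by (simp add: Fs a(2) c_def inner_vec_def)
    fix x t C' and E' :: "real^'n^'n"
    assume m: "t \<in> I" "C' \<in> \<A>" "x \<in> fst C'" "orthonormal_frame (metric X C' t (snd C' x)) E'"
    show "Fs x t \<le> (\<Sum>i\<in>UNIV. c $ i * in_frame E' (second_fundamental_form X \<nu> C' t (snd C' x)) $ i $ i)"
      using support_bound[OF a(1) \<kappa>(2)[OF m(1)] orthogonal_matrix_id in_frame_second_form_sym[OF m(2,3,1)] eig[OF m]]
      by (simp add: Fs c_def)
  qed
  also have "\<dots> = (\<Sum>k\<in>UNIV. c $ k * (transpose V ** ?H ** V) $ k $ k) + (\<Sum>k\<in>UNIV. c $ k * (transpose V ** (A ** A) ** V) $ k $ k) * \<phi> x0 t0"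
  proof -
    have "transpose V ** (A ** A) ** V = (transpose V ** A ** V) ** (transpose V ** A ** V)"
    proof -
      have "(transpose V ** A ** V) ** (transpose V ** A ** V) = transpose V ** A ** (V ** transpose V) ** A ** V"
        by (simp only: matrix_mul_assoc)
      moreover have "V ** transpose V = mat 1" using V(1) by (simp add: orthogonal_matrix_def)
      ultimately show ?thesis by (simp add: matrix_mul_assoc)
    qed
    also have "\<dots> = diagm a ** diagm a" unfolding V(2) by (simp only: orthogonal_conj_conj[OF V(1)])
    finally have eq: "transpose V ** (A ** A) ** V = diagm a ** diagm a" .
    have "(diagm a ** diagm a) $ k $ k = (\<Sum>j\<in>UNIV. if j = k then (a $ k)\<^sup>2 else 0)" for k
      unfolding matrix_matrix_mult_def vec_lambda_beta by (rule sum.cong) (auto simp: diagm_entry power2_eq_square)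
    then have "(transpose V ** (A ** A) ** V) $ k $ k = (a $ k)\<^sup>2" for k unfolding eq by simp
    then show ?thesis by (simp add: in_frame_comp sum.distrib sum_distrib_right distrib_left mult.assoc)
  qed
  also have "\<dots> = P \<bullet> ?H + (P \<bullet> (A ** A)) * \<phi> x0 t0" unfolding P' inner_conj_diagm ..
  finally show ?thesis by (simp add: inner_vec_def matrix_matrix_mult_def)
qed

end

section \<open>Convex and concave speeds\<close>

lemma concave_symmetricI:
  assumes "open \<Gamma>" "\<And>k c. k \<in> \<Gamma> \<Longrightarrow> c > 0 \<Longrightarrow> c *\<^sub>R k \<in> \<Gamma>" "\<And>k p. k \<in> \<Gamma> \<Longrightarrow> bij p \<Longrightarrow> (\<chi> i. k $ p i) \<in> \<Gamma>"
    and "smooth_on f \<Gamma>" "concave_on \<Gamma> f"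
    and "\<And>k p. k \<in> \<Gamma> \<Longrightarrow> bij p \<Longrightarrow> f (\<chi> i. k $ p i) = f k" "\<And>k c. k \<in> \<Gamma> \<Longrightarrow> c > 0 \<Longrightarrow> f (c *\<^sub>R k) = c * f k"
  shows "concave_symmetric \<Gamma> f"
proof
  have s: "Ck_on k f \<Gamma>" for k using assms(4) unfolding smooth_on_def by (rule spec)
  show "f differentiable (at k)" if "k \<in> \<Gamma>" for k by (rule Ck_on_differentiable[OF assms(1) s that])
  have "Ck_on 0 (grad f) \<Gamma>" unfolding grad_def[abs_def] by (rule Ck_on_vec) (rule Ck_on_D[OF assms(1) s])
  then show "continuous_on \<Gamma> (grad f)" by simp
qed (fact assms)+

lemma speed_function_grad_nonneg:
  assumes "symmetric_cone \<Gamma>" "speed_function \<Gamma> f" "k \<in> \<Gamma>"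
  shows "0 \<le> grad f k $ i"
proof (rule ccontr)
  have o: "open \<Gamma>" using assms(1) by (simp add: symmetric_cone_def)
  have "Ck_on (Suc 0) f \<Gamma>" using assms(2) unfolding speed_function_def smooth_on_def by blast
  then have df: "f differentiable (at k)" by (rule Ck_on_differentiable[OF o _ assms(3)])
  have d: "((\<lambda>s. f (k + s *\<^sub>R axis i 1)) has_real_derivative D (axis i 1) f k) (at 0)"
    using D_along_line[of f k 0 "axis i 1"] df by (simp add: has_real_derivative_iff_has_vector_derivative)
  assume "\<not> 0 \<le> grad f k $ i"
  then have "D (axis i 1) f k < 0" by (simp add: grad_def)
  then obtain d where d: "d > 0" "\<And>h. 0 < h \<Longrightarrow> h < d \<Longrightarrow> f (k + h *\<^sub>R axis i 1) < f k"
    using DERIV_neg_dec_right[OF d] by auto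
  obtain \<delta> where \<delta>: "\<delta> > 0" "\<And>s. \<bar>s\<bar> < \<delta> \<Longrightarrow> k + s *\<^sub>R axis i 1 \<in> \<Gamma>" using eventually_on_line[OF o assms(3)] by blast
  define h where "h = min d \<delta> / 2"
  have h: "0 < h" "h < d" "\<bar>h\<bar> < \<delta>" using d \<delta> by (auto simp: h_def)
  have "f k \<le> f (k + h *\<^sub>R axis i 1)" using assms(2,3) h(1) \<delta>(2)[OF h(3)] unfolding speed_function_def by auto
  then show False using d(2)[OF h(1,2)] by simp
qed

lemma concave_symmetric_speed:
  assumes "symmetric_cone \<Gamma>" "speed_function \<Gamma> f" "concave_on \<Gamma> f"
  shows "concave_symmetric \<Gamma> f"
  by (rule concave_symmetricI) (use assms in \<open>auto simp: symmetric_cone_def speed_function_def\<close>)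

lemma concave_symmetric_reflected_speed:
  assumes "symmetric_cone \<Gamma>" "speed_function \<Gamma> f" "convex_on \<Gamma> f"
  shows "concave_symmetric (uminus ` \<Gamma>) (\<lambda>k. - f (- k))"
proof (rule concave_symmetricI)
  show "open (uminus ` \<Gamma>)" using assms(1) by (simp add: symmetric_cone_def open_negations)
  have p: "(\<chi> i. (- k) $ p i) = - (\<chi> i. k $ p i)" for k :: "real^'a" and p by (simp add: vec_eq_iff)
  fix k and c :: real and p :: "'a \<Rightarrow> 'a" assume "k \<in> uminus ` \<Gamma>"
  then obtain l where l: "k = - l" "l \<in> \<Gamma>" by blast
  show "c *\<^sub>R k \<in> uminus ` \<Gamma>" "- f (- (c *\<^sub>R k)) = c * (- f (- k))" if "c > 0"
    using assms(1,2) that l by (auto simp: symmetric_cone_def speed_function_def)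
  show "(\<chi> i. k $ p i) \<in> uminus ` \<Gamma>" "- f (- (\<chi> i. k $ p i)) = - f (- k)" if "bij p"
    unfolding l(1) p using assms(1,2) that l by (auto simp: symmetric_cone_def speed_function_def)
next
  have s: "Ck_on k f \<Gamma>" for k using assms(2) unfolding speed_function_def smooth_on_def by blast
  have "Ck_on k (\<lambda>x. - f (- x)) (uminus ` \<Gamma>)" for k
    by (intro Ck_on_uminus Ck_on_compose[OF _ s] Ck_on_bounded_linear bounded_linear_ident) auto
  then show "smooth_on (\<lambda>k. - f (- k)) (uminus ` \<Gamma>)" by (simp add: smooth_on_def del: Ck_on.simps)
  have cf: "f ((1 - t) *\<^sub>R x + t *\<^sub>R y) \<le> (1 - t) * f x + t * f y" if "0 < t" "t < 1" "x \<in> \<Gamma>" "y \<in> \<Gamma>" for t x y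
    using convex_onD[OF assms(3), of t x y] that by simp
  have "convex_on (uminus ` \<Gamma>) (\<lambda>k. f (- k))"
  proof (rule convex_onI)
    show "convex (uminus ` \<Gamma>)" using assms(1) by (simp add: symmetric_cone_def convex_negations)
    fix t :: real and x y assume "0 < t" "t < 1" "x \<in> uminus ` \<Gamma>" "y \<in> uminus ` \<Gamma>"
    then show "f (- ((1 - t) *\<^sub>R x + t *\<^sub>R y)) \<le> (1 - t) * f (- x) + t * f (- y)"
      using cf[of t "- x" "- y"] by auto
  qed
  then show "concave_on (uminus ` \<Gamma>) (\<lambda>k. - f (- k))" by (simp add: concave_on_def)
qed

section \<open>Reversal of the orientation\<close>

lemma det_uminus: "det (- A) = (- 1) ^ CARD('n) * det (A :: real^'n^'n)"
proof -
  have "- A = (\<chi> i. (- 1) *s A $ i)" by (simp add: vec_eq_iff)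
  then have "det (- A) = det (\<chi> i. (- 1) *s A $ i)" by (rule arg_cong)
  also have "\<dots> = (- 1) ^ CARD('n) * det A" unfolding det_rows_mul by simp
  finally show ?thesis .
qed

lemma eigenvalues_wrt_uminus:
  fixes k :: "real^'n"
  assumes "eigenvalues_wrt g B k" shows "eigenvalues_wrt g (- B) (- k)"
  unfolding eigenvalues_wrt_def
proof
  fix r
  have "det (- B - r *\<^sub>R g) = det (- (B - (- r) *\<^sub>R g))" by (simp add: algebra_simps)
  also have "\<dots> = (- 1) ^ CARD('n) * (det g * (\<Prod>i\<in>UNIV. k $ i - (- r)))"
    using assms unfolding det_uminus eigenvalues_wrt_def by metis
  also have "\<dots> = det g * (\<Prod>i\<in>UNIV. - 1 * (k $ i - (- r)))" unfolding prod.distrib by simp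
  also have "\<dots> = det g * (\<Prod>i\<in>UNIV. (- k) $ i - r)" by simp
  finally show "det (- B - r *\<^sub>R g) = det g * (\<Prod>i\<in>UNIV. (- k) $ i - r)" .
qed

lemma pd_uminus: "f differentiable (at z) \<Longrightarrow> pd i (\<lambda>x. - f x) z = - pd i f z"
  using D_uminus[of f z "axis i 1"] by (simp add: pd_def D_def)

context hypersurface_family
begin

lemma uminus_test_function:
  fixes \<phi> :: "'p \<Rightarrow> real \<Rightarrow> real"
  assumes \<phi>: "Ck_family 2 \<A> T \<phi>" and C: "C \<in> \<A>" "x \<in> fst C" and t: "0 < t" "t < T"
  shows "hessian X C t (\<lambda>y. - \<phi> y t) (snd C x) = - hessian X C t (\<lambda>y. \<phi> y t) (snd C x)"
    and "deriv (\<lambda>t. - \<phi> x t) t = - deriv (\<lambda>t. \<phi> x t) t"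
    and "Ck_family 2 \<A> T (\<lambda>x t. - \<phi> x t)"
proof -
  note z = chart_facts(4)[OF C] and U = chart_facts(2)[OF C(1)]
  have s: "Ck_on 2 (local_rep C \<phi>) (U C \<times> I)" using \<phi> C(1) unfolding Ck_family_def U_def by blast
  define g where "g = (\<lambda>y. \<phi> y t) \<circ> chart_inv C"
  have g2: "Ck_on 2 g (U C)"
  proof -
    have "Ck_on 2 (\<lambda>x. local_rep C \<phi> (x, t)) (U C)"
      by (rule Ck_on_compose[OF Ck_on_pair[OF Ck_on_bounded_linear[OF bounded_linear_ident] Ck_on_const] s]) (use t in auto)
    then show ?thesis by (simp add: g_def o_def del: Ck_on.simps)
  qed
  have g1: "Ck_on (Suc 0) g (U C)" "\<And>v. Ck_on (Suc 0) (D v g) (U C)"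
    using Ck_on_D[OF U, of "Suc 0" g] g2 by (auto simp: numeral_2_eq_2 dest: Ck_on_SucD simp del: Ck_on.simps)
  have pD: "pd i h = D (axis i 1) h" for i and h :: "real^'n \<Rightarrow> real" by (simp add: pd_def D_def fun_eq_iff)
  have d1: "pd i (\<lambda>x. - g x) w = - pd i g w" if "w \<in> U C" for i w
    by (rule pd_uminus[OF Ck_on_differentiable[OF U g1(1) that]])
  have d2: "pd i (pd j (\<lambda>x. - g x)) (snd C x) = - pd i (pd j g) (snd C x)" for i j
  proof -
    have "pd i (pd j (\<lambda>x. - g x)) (snd C x) = pd i (\<lambda>w. - pd j g w) (snd C x)"
      unfolding pD[of i] by (rule D_cong[OF U z d1])
    also have "\<dots> = - pd i (pd j g) (snd C x)"
      unfolding pD[of j] by (rule pd_uminus[OF Ck_on_differentiable[OF U g1(2) z]])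
    finally show ?thesis .
  qed
  have gm: "(\<lambda>y. - \<phi> y t) \<circ> chart_inv C = (\<lambda>x. - g x)" by (simp add: g_def o_def)
  show "hessian X C t (\<lambda>y. - \<phi> y t) (snd C x) = - hessian X C t (\<lambda>y. \<phi> y t) (snd C x)"
    unfolding hessian_def Let_def gm g_def[symmetric] by (simp add: vec_eq_iff d2 d1[OF z] sum_negf)
  show "Ck_family 2 \<A> T (\<lambda>x t. - \<phi> x t)"
    unfolding Ck_family_def
  proof
    fix C' assume "C' \<in> \<A>"
    then have "Ck_on 2 (local_rep C' \<phi>) (snd C' ` fst C' \<times> I)" using \<phi> unfolding Ck_family_def by blast
    from Ck_on_uminus[OF this] show "Ck_on 2 (\<lambda>(z, t). - \<phi> (chart_inv C' z) t) (snd C' ` fst C' \<times> I)"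
      by (simp add: case_prod_unfold del: Ck_on.simps)
  qed
  have "open (U C \<times> {0<..<T})" using U by (simp add: open_Times)
  moreover have "Ck_on (Suc 0) (local_rep C \<phi>) (U C \<times> {0<..<T})"
    by (rule Ck_on_SucD) (rule Ck_on_subset[OF s[unfolded numeral_2_eq_2]], auto)
  ultimately have "local_rep C \<phi> differentiable (at (snd C x, t))"
    by (rule Ck_on_differentiable) (use z t in auto)
  from D_time[OF this] have "((\<lambda>s. \<phi> x s) has_real_derivative D tdir (local_rep C \<phi>) (snd C x, t)) (at t)"
    by (simp add: chart_facts(3)[OF C] has_real_derivative_iff_has_vector_derivative)
  then show "deriv (\<lambda>t. - \<phi> x t) t = - deriv (\<lambda>t. \<phi> x t) t"
    by (metis DERIV_imp_deriv DERIV_minus)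
qed

end

lemma exterior_eq_interior:
  "exterior_sphere_curvature X \<nu> x t = - interior_sphere_curvature X (\<lambda>x t. - \<nu> x t) x t"
proof -
  have "Z X (\<lambda>x t. - \<nu> x t) x y t = - Z X \<nu> x y t" for y by (simp add: Z_def)
  then show ?thesis
    by (simp add: exterior_sphere_curvature_def interior_sphere_curvature_def Inf_real_def image_image)
qed

lemma second_fundamental_form_uminus:
  "second_fundamental_form X (\<lambda>x t. - \<nu> x t) C t z = - second_fundamental_form X \<nu> C t z"
  by (simp add: second_fundamental_form_def Let_def vec_eq_iff)

lemma in_frame_uminus: "in_frame E (- B) = - in_frame E B"
  by (simp add: in_frame_def matrix_mult_uminus_left matrix_mult_uminus_right)

lemma (in oriented_family) signed_curvature_flow:
  assumes e: "e \<in> {1, -1}"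
    and flow: "\<And>x t. t \<in> I \<Longrightarrow> ((\<lambda>s. X x s) has_vector_derivative - (G x t *\<^sub>R \<nu> x t)) (at t within I)"
  shows "curvature_flow \<A> X T (\<lambda>x t. e *\<^sub>R \<nu> x t) (\<lambda>x t. e * G x t)"
proof (intro curvature_flow.intro signed_normal_flow[OF e] curvature_flow_axioms.intro)
  fix x t assume "t \<in> I"
  then show "(X x has_vector_derivative - ((e * G x t) *\<^sub>R e *\<^sub>R \<nu> x t)) (at t within I)"
    using flow[of t x] e by auto
qed

theorem theorem2:
  fixes \<A> :: "('p::t2_space, 'n::finite) chart set"
    and X \<nu> :: "'p \<Rightarrow> real \<Rightarrow> real^'m::finite"
    and \<Omega> :: "real \<Rightarrow> (real^'m) set"
    and \<kappa> :: "'p \<Rightarrow> real \<Rightarrow> real^'n"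
    and \<Gamma> :: "(real^'n) set"
    and f :: "real^'n \<Rightarrow> real"
    and T :: real
  assumes "CARD('m) = CARD('n) + 1"
    and "compact (UNIV :: 'p set)" and "smooth_atlas \<A>"
    and "0 < T"
    and "smooth_family_of_embeddings \<A> T X"
    and "\<And>t. t \<in> {0..<T} \<Longrightarrow> bounds_region (range (\<lambda>x. X x t)) (\<Omega> t)"
    and "\<And>t. t \<in> {0..<T} \<Longrightarrow> outward_unit_normal \<A> (\<lambda>x. X x t) (\<Omega> t) (\<lambda>x. \<nu> x t)"
    and "symmetric_cone \<Gamma>" and "speed_function \<Gamma> f"
    and "\<And>x t. t \<in> {0..<T} \<Longrightarrow> principal_curvatures \<A> X \<nu> x t (\<kappa> x t)"
    and "\<And>x t. t \<in> {0..<T} \<Longrightarrow> \<kappa> x t \<in> \<Gamma>"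
    and "\<And>x t. t \<in> {0..<T} \<Longrightarrow>
           ((\<lambda>s. X x s) has_vector_derivative - (f (\<kappa> x t) *\<^sub>R \<nu> x t)) (at t within {0..<T})"
  shows "(convex_on \<Gamma> f \<longrightarrow>
            viscosity_supersolution \<A> T X (linearized_flow X \<nu> f) (exterior_sphere_curvature X \<nu>)) \<and>
         (concave_on \<Gamma> f \<longrightarrow>
            viscosity_subsolution \<A> T X (linearized_flow X \<nu> f) (interior_sphere_curvature X \<nu>))"
proof -
  interpret oriented_family \<A> X T \<nu> \<Omega>
  proof
    show "CARD('m) = CARD('n) + 1" "compact (UNIV :: 'p set)" "smooth_atlas \<A>" "0 < T" "smooth_family_of_embeddings \<A> T X"
      by (fact assms)+
    fix t assume t: "t \<in> {0..<T}"
    show "bounds_region (range (\<lambda>x. X x t)) (\<Omega> t)" by (fact assms(6)[OF t])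
    fix x
    show "norm (\<nu> x t) = 1 \<and> (\<forall>C\<in>\<A>. x \<in> fst C \<longrightarrow> (\<forall>i. pd i ((\<lambda>x. X x t) \<circ> chart_inv C) (snd C x) \<bullet> \<nu> x t = 0))"
      "\<forall>\<^sub>F s in at_right 0. X x t + s *\<^sub>R \<nu> x t \<notin> \<Omega> t \<and> X x t - s *\<^sub>R \<nu> x t \<in> \<Omega> t"
      using assms(7)[OF t] unfolding outward_unit_normal_def by blast+
  qed
  show ?thesis
  proof (intro conjI impI)
    assume concave: "concave_on \<Gamma> f"
    interpret flow: curvature_flow \<A> X T \<nu> "\<lambda>x t. f (\<kappa> x t)"
      using signed_curvature_flow[of 1 "\<lambda>x t. f (\<kappa> x t)", OF _ assms(12)] by simp
    interpret concave_symmetric \<Gamma> f by (rule concave_symmetric_speed[OF assms(8,9) concave])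
    show "viscosity_subsolution \<A> T X (linearized_flow X \<nu> f) (interior_sphere_curvature X \<nu>)"
      unfolding viscosity_subsolution_def
    proof (intro conjI allI ballI impI, goal_cases)
      case 1 show ?case by (rule flow.Zbar_continuous)
    next
      case (2 x0 t0 \<phi> C E)
      then have m: "0 < t0" "t0 < T" "t0 \<in> I" "x0 \<in> fst C" "orthonormal_frame (metric X C t0 (snd C x0)) E" and mC: "C \<in> \<A>" and
        m': "Ck_family 2 \<A> T \<phi>" "touches_from_above T \<phi> (interior_sphere_curvature X \<nu>) x0 t0" by auto
      note m = m m'
      show ?case
        unfolding apply_operator_def linearized_flow_def Let_def
      proof (rule flow.concave_viscosity_inequality[OF concave_symmetric_axioms speed_function_grad_nonneg[OF assms(8,9)] assms(10,11) refl m(1,2) mC m(4,5) _ m(6,7) refl])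
        fix y assume "y \<noteq> x0" "\<And>y'. y' \<noteq> x0 \<Longrightarrow> Z X \<nu> x0 y' t0 \<le> Z X \<nu> x0 y t0"
        then show "\<nu> y t0 = \<nu> x0 t0 - Z X \<nu> x0 y t0 *\<^sub>R (X x0 t0 - X y t0)"
          using touching_normal_of_max[OF m(3), of 1 y x0] by simp
      next
        fix V :: "real^'n^'n" and a
        assume V: "a \<in> \<Gamma>" "orthogonal_matrix V" "in_frame E (second_fundamental_form X \<nu> C t0 (snd C x0)) = V ** diagm a ** transpose V"
        show "matrix_fun_deriv f (in_frame E (second_fundamental_form X \<nu> C t0 (snd C x0))) = V ** diagm (grad f a) ** transpose V"
          unfolding V(3) by (rule matrix_fun_deriv_eq[OF V(1,2)])
      qed
    qed
  next
    assume convex: "convex_on \<Gamma> f"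
    \<comment> \<open>Speed and normal both change sign, so their product and with it the motion of
      the hypersurface stay the same.\<close>
    define N where "N = (\<lambda>x t. - \<nu> x t)"
    define g where "g = (\<lambda>k. - f (- k))"
    interpret flow: curvature_flow \<A> X T N "\<lambda>x t. - f (\<kappa> x t)"
      using signed_curvature_flow[of "-1" "\<lambda>x t. f (\<kappa> x t)", OF _ assms(12)] by (simp add: N_def)
    have cs: "concave_symmetric (uminus ` \<Gamma>) (\<lambda>k. - f (- k))"
      by (rule concave_symmetric_reflected_speed[OF assms(8,9) convex])
    note deriv_reflected = matrix_fun_deriv_eq_reflected[OF cs, folded g_def]
    have ext: "exterior_sphere_curvature X \<nu> x t = - interior_sphere_curvature X N x t" for x t
      unfolding N_def by (rule exterior_eq_interior)
    have grad: "0 \<le> grad g k $ i" if k: "k \<in> uminus ` \<Gamma>" for k i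
    proof -
      obtain l where l: "k = - l" "l \<in> \<Gamma>" using k by blast
      show ?thesis unfolding l(1) deriv_reflected(2)[OF l(2) orthogonal_matrix_id]
        by (rule speed_function_grad_nonneg[OF assms(8,9) l(2)])
    qed
    have sN: "second_fundamental_form X N C t z = - second_fundamental_form X \<nu> C t z" for C :: "('p, 'n) chart" and t z
      unfolding N_def by (rule second_fundamental_form_uminus)
    have \<kappa>N: "principal_curvatures \<A> X N x t (- \<kappa> x t)" "- \<kappa> x t \<in> uminus ` \<Gamma>" if "t \<in> I" for x t
      using assms(10,11)[OF that, of x] by (auto simp: principal_curvatures_def sN eigenvalues_wrt_uminus)
    show "viscosity_supersolution \<A> T X (linearized_flow X \<nu> f) (exterior_sphere_curvature X \<nu>)"
      unfolding viscosity_supersolution_def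
    proof (intro conjI allI ballI impI, goal_cases)
      case 1
      show ?case unfolding ext using continuous_on_minus[OF flow.Zbar_continuous] by (simp add: case_prod_unfold)
    next
      case (2 x0 t0 \<phi> C E)
      then have m: "0 < t0" "t0 < T" "t0 \<in> I" "x0 \<in> fst C" "orthonormal_frame (metric X C t0 (snd C x0)) E" and mC: "C \<in> \<A>" and
        m': "Ck_family 2 \<A> T \<phi>" "touches_from_above T (exterior_sphere_curvature X \<nu>) \<phi> x0 t0" by auto
      note m = m m'
      note neg = uminus_test_function[OF m(6) mC m(4) m(1,2)]
      define A where "A = in_frame E (second_fundamental_form X \<nu> C t0 (snd C x0))"
      have AN: "- A = in_frame E (second_fundamental_form X N C t0 (snd C x0))" by (simp add: A_def sN in_frame_uminus)
      have touch: "touches_from_above T (\<lambda>x t. - \<phi> x t) (interior_sphere_curvature X N) x0 t0"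
        using m(7) unfolding touches_from_above_def ext by (simp add: minus_le_iff le_minus_iff)
      \<comment> \<open>The quadratic term is even in \<open>A\<close>, and the derivative matrix of
        \<open>f\<close> at \<open>A\<close> coincides with that of \<open>g\<close> at
        \<open>- A\<close>. The signs left are those of the test function and its derivatives, which
        reverse the inequality.\<close>
      have "deriv (\<lambda>t. - \<phi> x0 t) t0 \<le>
        (\<Sum>k\<in>UNIV. \<Sum>l\<in>UNIV. matrix_fun_deriv f A $ k $ l * in_frame E (hessian X C t0 (\<lambda>y. - \<phi> y t0) (snd C x0)) $ k $ l) +
        (\<Sum>k\<in>UNIV. \<Sum>l\<in>UNIV. matrix_fun_deriv f A $ k $ l * (\<Sum>p\<in>UNIV. (- A) $ k $ p * (- A) $ p $ l)) * - \<phi> x0 t0"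
      proof (rule flow.concave_viscosity_inequality[OF cs[folded g_def] grad \<kappa>N _ m(1,2) mC m(4,5) _ neg(3) touch AN])
        show "- f (\<kappa> x t) = g (- \<kappa> x t)" for x t by (simp add: g_def)
        fix y assume "y \<noteq> x0" "\<And>y'. y' \<noteq> x0 \<Longrightarrow> Z X N x0 y' t0 \<le> Z X N x0 y t0"
        then show "N y t0 = N x0 t0 - Z X N x0 y t0 *\<^sub>R (X x0 t0 - X y t0)"
          using touching_normal_of_max[OF m(3), of "-1" y x0] by (simp add: N_def)
      next
        fix V :: "real^'n^'n" and a
        assume V: "a \<in> uminus ` \<Gamma>" "orthogonal_matrix V" "- A = V ** diagm a ** transpose V"
        obtain b where b: "a = - b" "b \<in> \<Gamma>" using V(1) by blast
        have "diagm (- b) = - diagm b" by (simp add: vec_eq_iff diagm_entry)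
        then have "A = V ** diagm b ** transpose V"
          using V(3) by (simp add: b(1) matrix_mult_uminus_left matrix_mult_uminus_right)
        then show "matrix_fun_deriv f A = V ** diagm (grad g a) ** transpose V"
          unfolding b(1) deriv_reflected(2)[OF b(2) V(2)] using deriv_reflected(1)[OF b(2) V(2)] by simp
      qed
      then show ?case
        unfolding apply_operator_def linearized_flow_def Let_def A_def[symmetric]
        by (simp add: neg(1,2) in_frame_uminus sum_negf)
    qed
  qed
qed

end
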